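(* Let $0\ne n\in\mathbb{Z}$ and identify $\mathrm{Mor}(\delta^n,\Delta_P)$ with $\{p\in P:\Delta_P(p)=p\otimes z^n\}$ via $T\mapsto T(1)$. For $t\in\mathbb{Z}$, $k,l\in\mathbb{N}_0$ write $M_{t,k,l}=\alpha^t\gamma^k\gamma^{*l}$ (with $\alpha^{-s}:=\alpha^{*s}$ for $s\in\mathbb N$) and $[m]=\frac{q^{2m}-1}{q^2-1}$. For all $(t,k,l)$ with $t+k-l=n$ put $\hat c(t,k,l)=-q^{-2k}(1+q^4)[k][l]$ and define: - if $t=0$: $\hat e=-\big(q^{-2k}(1+q^2[l])[k]+q^4(1+q^{-2k}[k])[l]\big)$; - if $t\ge1$: $\hat e=-q^{-2t}\big([t][l+1]+q^{-2k}[k][l+1]+q^4[l][t+1]+q^{-2k+4}[l][k]\big)$; - if $t=-s$ with $s\ge1$: $\hat e=-q^{-2k}\big([k][s+1]+q^{2s+2}[k][l]+q^4[s][k+1]+q^{4+2s}[l][k+1]\big)$. Then the right quantum gauge Laplacian $\widehat\square^{\omega^c}_q$ on $\mathrm{Mor}(\delta^n,\Delta_P)$ satisfies $\widehat\square^{\omega^c}_q(M_{t,k,l})=\hat e(t,k,l)M_{t,k,l}+\hat c(t,k,l)M_{t,k-1,l-1}$ for all such $(t,k,l)$ (last term absent if $kl=0$). The elements $$\hat p(M_{t,k,l})=M_{t,k,l}+\sum_{i=1}^{\min(k,l)}\Big(\prod_{j=0}^{i-1}\frac{\hat c(t,k-j,l-j)}{\hat e(t,k,l)-\hat e(t,k-j-1,l-j-1)}\Big)M_{t,k-i,l-i},\qquad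 t+k-l=n,$$ are well defined, satisfy $\widehat\square^{\omega^c}_q(\hat p(M_{t,k,l}))=\hat e(t,k,l)\,\hat p(M_{t,k,l})$, and form a linear basis of $\mathrm{Mor}(\delta^n,\Delta_P)$. The set of eigenvalues of $\widehat\square^{\omega^c}_q$ on $\mathrm{Mor}(\delta^n,\Delta_P)$ is infinite and discrete.
   Context: Fix $q\in(-1,1)\setminus\{0\}$; Sweedler notation is used. **Algebras.** $P=SU_q(1,1)$ is the unital $\ast$-algebra generated by $\alpha,\gamma$ with $\alpha^*\alpha-\gamma^*\gamma=1$, $\alpha\alpha^*-q^2\gamma\gamma^*=1$, $\gamma\gamma^*=\gamma^*\gamma$, $q\gamma\alpha=\alpha\gamma$, $q\gamma^*\alpha=\alpha\gamma^*$; it is a $\ast$-Hopf algebra with $\Delta(\alpha)=\alpha\otimes\alpha+q\gamma^*\otimes\gamma$, $\Delta(\gamma)=\gamma\otimes\alpha+\alpha^*\otimes\gamma$, $\epsilon(\alpha)=1$, $\epsilon(\gamma)=0$, $S(\alpha)=\alpha^*$, $S(\alpha^* )=\alpha$, $S(\gamma)=-q\gamma$, $S(\gamma^* )=-q^{-1}\gamma^*$. A linear basis of $P$ is $\{\alpha^m\gamma^k\gamma^{*l}: m\in\mathbb{Z},k,l\in\mathbb{N}_0\}$. $G=\mathbb{C}[z,z^{-1}]$, $z^*=z^{-1}$, $\Delta'(z)=z\otimes z$, $\epsilon'(z)=1$, $S'(z)=z^*$. $j:P\to G$ is the $\ast$-Hopf morphism with $j(\alpha)=z$, $j(\gamma)=0$;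 $\Delta_P=(\mathrm{id}\otimes j)\Delta$; $\mathbb{H}^2_q=\{b\in P:\Delta_P(b)=b\otimes 1\}$. **Calculus.** $\mathcal R_3\subseteq\ker\epsilon$ is the right ideal generated by $\gamma^2,\gamma^{*2},\gamma\gamma^*,\alpha\gamma-\gamma,\alpha\gamma^*-\gamma^*,\alpha^*\gamma-\gamma,\alpha^*\gamma^*-\gamma^*,q^2\alpha+\alpha^*-(1+q^2)1$. The associated left covariant first order $\ast$-calculus is $\Omega^1(P)=P\otimes(\ker\epsilon/\mathcal R_3)$, with $\pi(p)=[p-\epsilon(p)1]$, $dp=p^{(1)}\pi(p^{(2)})$, $\pi(a)\,p=p^{(1)}\,\pi(ap^{(2)}-\epsilon(a)p^{(2)})$, $\pi(p)^*=-\pi(S(p)^* )$. It is a free left $P$-module on $\eta_3=\pi(\alpha-\alpha^* )$, $\eta_+=\pi(\gamma)$, $\eta_-=q\pi(\gamma^* )$. $(\Omega^\bullet(P),d,\ast)$ is its universal differential envelope: $\bigotimes_P^\bullet\Omega^1(P)$ modulo the two-sided ideal generated by $\sum_i dg_i\otimes_P dh_i$ with $\sum_i g_i\,dh_i=0$; $(\vartheta\vartheta')^*=(-1)^{kl}\vartheta'^*\vartheta^*$ for degrees $k,l$. Similarly $(\Gamma,d')$ is the calculus on $G$ given by the right ideal $\mathcal R'$ generated by $q^2z+z^*-(1+q^2)1$, with germs map $\pi'$ and $\varsigma=\pi'(z-z^* )$ spanning $\mathfrak{u}_q(1)^\#=\ker\epsilon'/\mathcal R'$; $\Gamma^\wedge$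 is its universal differential envelope. $\Delta_P$ extends to a graded differential $\ast$-algebra morphism $\Delta_{\Omega^\bullet(P)}:\Omega^\bullet(P)\to\Omega^\bullet(P)\otimes\Gamma^\wedge$ with $\eta_3\mapsto\eta_3\otimes1+1\otimes\varsigma$, $\eta_+\mapsto\eta_+\otimes z^2$, $\eta_-\mapsto\eta_-\otimes z^{*2}$. $\mathrm{Hor}^\bullet P=\{\varphi:\Delta_{\Omega^\bullet(P)}(\varphi)\in\Omega^\bullet(P)\otimes G\}$, with restricted coaction $\Delta_{\mathrm{Hor}}(\varphi)=\varphi^{(0)}\otimes\varphi^{(1)}$, and $\Omega^\bullet(\mathbb{H}^2_q)=\{\mu:\Delta_{\Omega^\bullet(P)}(\mu)=\mu\otimes1\}$. Here $\Omega^1(\mathbb{H}^2_q)=\{x\eta_-+y\eta_+:\Delta_P(x)=x\otimes z^2,\Delta_P(y)=y\otimes z^{*2}\}$, $\Omega^2(\mathbb{H}^2_q)=\mathbb{H}^2_q\,\mathrm{dvol}$, $\mathrm{dvol}:=\eta_-\eta_+$. **Canonical connection.** $\omega^c:\mathfrak{u}_q(1)^\#\to\Omega^1(P)$, $\omega^c(\varsigma)=\eta_3$. Its covariant derivative is $D:\mathrm{Hor}^\bullet P\to\mathrm{Hor}^\bullet P$, $D(\varphi)=d\varphi-(-1)^k\varphi^{(0)}\omega^c(\pi'(\varphi^{(1)}))$ for $\varphi\in\mathrm{Hor}^kP$; its dual covariant derivative $\ast\circ D\circ\ast$ equals $D$. **Right gauge Laplacian.** $\star_L$ is the antilinear map $\star_L(b)=b^*\mathrm{dvol}$,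 $\star_L(x\eta_-+y\eta_+)=-y^*\eta_-+x^*\eta_+$, $\star_L(b\,\mathrm{dvol})=b^*$ on $\Omega^\bullet(\mathbb{H}^2_q)$, and $\star_R:=\star_L\circ\ast$. $\delta^n:\mathbb{C}\to\mathbb{C}\otimes G$, $w\mapsto w\otimes z^n$. $\mathrm{Mor}(\delta^n,\Delta_P)$ is the space of linear $T:\mathbb{C}\to P$ with $\Delta_P\circ T=(T\otimes\mathrm{id})\circ\delta^n$; similarly $\mathrm{Mor}(\delta^n,\Delta_{\mathrm{Hor}})$. $E^n_R$ is $\mathrm{Mor}(\delta^n,\Delta_P)$ as a right $\mathbb{H}^2_q$-module. The map $T\otimes\mu\mapsto T\mu$ is an isomorphism $E^n_R\otimes_{\mathbb{H}^2_q}\Omega^\bullet(\mathbb{H}^2_q)\to\mathrm{Mor}(\delta^n,\Delta_{\mathrm{Hor}})$ with inverse $\widehat\Upsilon_n$. Put $\widehat\nabla(T)=\widehat\Upsilon_n(D\circ T)$, $d^{\widehat\nabla}(T\otimes\mu)=\widehat\nabla(T)\mu+T\otimes d\mu$, and on degree $k+1$ $d^{\widehat\nabla\star_R}=(-1)^{k+1}(\mathrm{id}\otimes\star_R^{-1})\circ d^{\widehat\nabla}\circ(\mathrm{id}\otimes\star_R)$ ($0$ on degree $0$). Then $\widehat\square^{\omega^c}_q=d^{\widehat\nabla}d^{\widehat\nabla\star_R}+d^{\widehat\nabla\star_R}d^{\widehat\nabla}$, considered in degree $0$ as a linear operator on $\mathrm{Mor}(\delta^n,\Delta_P)$. *)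

theory Defs
  imports
    "HOL-Analysis.Analysis"
    "HOL-Library.Poly_Mapping"
    "HOL-Library.Product_Plus"
begin

text \<open>
  All algebras are given as quotients of monoid algebras \<open>'k \<Rightarrow>\<^sub>0 complex\<close> (with the convolution
  product of \<open>Poly_Mapping\<close>). An element of a quotient is represented by an element of the
  monoid algebra, and equality in the quotient is congruence modulo an ideal or subspace.
  All maps are defined on representatives. Where a map is only determined on the quotient
  (choice of a preimage, inverse of an isomorphism), a representative is selected with \<open>SOME\<close>.
\<close>


section \<open>Free complex vector spaces, tensor products, free algebras, ideals\<close>

definition smul :: "complex \<Rightarrow> ('a \<Rightarrow>\<^sub>0 complex) \<Rightarrow> ('a \<Rightarrow>\<^sub>0 complex)" where
  "smul c x = Poly_Mapping.map ((*) c) x"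

lemma lookup_smul [simp]: "Poly_Mapping.lookup (smul c x) k = c * Poly_Mapping.lookup x k"
  by (simp add: smul_def Poly_Mapping.map.rep_eq when_def)

global_interpretation smul: vector_space smul
  by unfold_locales (auto intro!: poly_mapping_eqI simp: lookup_add algebra_simps)

text \<open>Linear and antilinear extension of a map given on basis elements.\<close>

definition lin :: "('a \<Rightarrow> ('b \<Rightarrow>\<^sub>0 complex)) \<Rightarrow> ('a \<Rightarrow>\<^sub>0 complex) \<Rightarrow> ('b \<Rightarrow>\<^sub>0 complex)" where
  "lin f x = (\<Sum>k\<in>Poly_Mapping.keys x. smul (Poly_Mapping.lookup x k) (f k))"

definition antilin :: "('a \<Rightarrow> ('b \<Rightarrow>\<^sub>0 complex)) \<Rightarrow> ('a \<Rightarrow>\<^sub>0 complex) \<Rightarrow> ('b \<Rightarrow>\<^sub>0 complex)" where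
  "antilin f x = (\<Sum>k\<in>Poly_Mapping.keys x. smul (cnj (Poly_Mapping.lookup x k)) (f k))"

text \<open>
  The tensor product of \<open>'a \<Rightarrow>\<^sub>0 complex\<close> and \<open>'b \<Rightarrow>\<^sub>0 complex\<close> is \<open>'a \<times> 'b \<Rightarrow>\<^sub>0 complex\<close>. For
  monoid algebras its convolution product is the (ungraded) product of the tensor product algebra.
\<close>

definition tens :: "('a \<Rightarrow>\<^sub>0 complex) \<Rightarrow> ('b \<Rightarrow>\<^sub>0 complex) \<Rightarrow> ('a \<times> 'b \<Rightarrow>\<^sub>0 complex)" where
  "tens x y = lin (\<lambda>a. lin (\<lambda>b. Poly_Mapping.single (a, b) 1) y) x"

definition tmap :: "(('a \<Rightarrow>\<^sub>0 complex) \<Rightarrow> ('c \<Rightarrow>\<^sub>0 complex)) \<Rightarrow> (('b \<Rightarrow>\<^sub>0 complex) \<Rightarrow> ('d \<Rightarrow>\<^sub>0 complex))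
    \<Rightarrow> ('a \<times> 'b \<Rightarrow>\<^sub>0 complex) \<Rightarrow> ('c \<times> 'd \<Rightarrow>\<^sub>0 complex)" where
  "tmap f g = lin (\<lambda>(a, b). tens (f (Poly_Mapping.single a 1)) (g (Poly_Mapping.single b 1)))"

text \<open>\<open>(V \<otimes> W) / tnull A B\<close> is \<open>(V / A) \<otimes> (W / B)\<close>.\<close>

definition tnull :: "('a \<Rightarrow>\<^sub>0 complex) set \<Rightarrow> ('b \<Rightarrow>\<^sub>0 complex) set \<Rightarrow> ('a \<times> 'b \<Rightarrow>\<^sub>0 complex) set" where
  "tnull A B = smul.span {tens x y | x y. x \<in> A \<or> y \<in> B}"

inductive_set ideal2 :: "'a::ring_1 set \<Rightarrow> 'a set" for S where
  zero: "0 \<in> ideal2 S"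
| gen: "s \<in> S \<Longrightarrow> a * s * b \<in> ideal2 S"
| add: "x \<in> ideal2 S \<Longrightarrow> y \<in> ideal2 S \<Longrightarrow> x + y \<in> ideal2 S"

inductive_set right_ideal :: "'a::ring_1 set \<Rightarrow> 'a set" for S where
  zero: "0 \<in> right_ideal S"
| gen: "s \<in> S \<Longrightarrow> s * b \<in> right_ideal S"
| add: "x \<in> right_ideal S \<Longrightarrow> y \<in> right_ideal S \<Longrightarrow> x + y \<in> right_ideal S"

datatype 'a wd = Wd (letters: "'a list")

instantiation wd :: (type) monoid_add
begin
definition zero_wd :: "'a wd" where "0 = Wd []"
definition plus_wd :: "'a wd \<Rightarrow> 'a wd \<Rightarrow> 'a wd" where "u + v = Wd (letters u @ letters v)"
instance by standard (auto simp: zero_wd_def plus_wd_def)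
end

type_synonym 'a free = "'a wd \<Rightarrow>\<^sub>0 complex"

definition var :: "'a \<Rightarrow> 'a free" where
  "var a = Poly_Mapping.single (Wd [a]) 1"

text \<open>Extension of a map on generators to an algebra homomorphism on the free algebra.\<close>

definition hom_ext :: "('a \<Rightarrow> ('m::monoid_add \<Rightarrow>\<^sub>0 complex)) \<Rightarrow> 'a free \<Rightarrow> ('m \<Rightarrow>\<^sub>0 complex)" where
  "hom_ext f = lin (\<lambda>w. prod_list (map f (letters w)))"


section \<open>The Hopf algebra of \<open>SU\<^sub>q(1,1)\<close>\<close>

datatype gen = Al | Als | Ga | Gas

abbreviation "\<alpha> \<equiv> var Al"
abbreviation "\<alpha>s \<equiv> var Als"
abbreviation "\<gamma> \<equiv> var Ga"
abbreviation "\<gamma>s \<equiv> var Gas"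

fun gen_star :: "gen \<Rightarrow> gen" where
  "gen_star Al = Als" | "gen_star Als = Al" | "gen_star Ga = Gas" | "gen_star Gas = Ga"

definition pstar :: "gen free \<Rightarrow> gen free" where
  "pstar = antilin (\<lambda>w. Poly_Mapping.single (Wd (rev (map gen_star (letters w)))) 1)"

definition rels :: "real \<Rightarrow> gen free set" where
  "rels q = {\<alpha>s * \<alpha> - \<gamma>s * \<gamma> - 1, \<alpha> * \<alpha>s - smul (of_real (q^2)) (\<gamma> * \<gamma>s) - 1, \<gamma> * \<gamma>s - \<gamma>s * \<gamma>,
     smul (of_real q) (\<gamma> * \<alpha>) - \<alpha> * \<gamma>, smul (of_real q) (\<gamma>s * \<alpha>) - \<alpha> * \<gamma>s}"

text \<open>\<open>P = gen free / PI q\<close>; the relations of a \<open>*\<close>-algebra include their adjoints.\<close>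

definition PI :: "real \<Rightarrow> gen free set" where
  "PI q = ideal2 (rels q \<union> pstar ` rels q)"

definition eqP :: "real \<Rightarrow> gen free \<Rightarrow> gen free \<Rightarrow> bool" where
  "eqP q x y \<longleftrightarrow> x - y \<in> PI q"

fun gen_comult :: "real \<Rightarrow> gen \<Rightarrow> (gen wd \<times> gen wd \<Rightarrow>\<^sub>0 complex)" where
  "gen_comult q Al = tens \<alpha> \<alpha> + smul (of_real q) (tens \<gamma>s \<gamma>)"
| "gen_comult q Als = tens \<alpha>s \<alpha>s + smul (of_real q) (tens \<gamma> \<gamma>s)"
| "gen_comult q Ga = tens \<gamma> \<alpha> + tens \<alpha>s \<gamma>"
| "gen_comult q Gas = tens \<gamma>s \<alpha>s + tens \<alpha> \<gamma>s"

definition comult :: "real \<Rightarrow> gen free \<Rightarrow> (gen wd \<times> gen wd \<Rightarrow>\<^sub>0 complex)" where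
  "comult q = hom_ext (gen_comult q)"

fun gen_counit :: "gen \<Rightarrow> complex" where
  "gen_counit Al = 1" | "gen_counit Als = 1" | "gen_counit Ga = 0" | "gen_counit Gas = 0"

definition counit :: "gen free \<Rightarrow> complex" where
  "counit x = (\<Sum>w\<in>Poly_Mapping.keys x. Poly_Mapping.lookup x w * prod_list (map gen_counit (letters w)))"

fun gen_antipode :: "real \<Rightarrow> gen \<Rightarrow> gen free" where
  "gen_antipode q Al = \<alpha>s"
| "gen_antipode q Als = \<alpha>"
| "gen_antipode q Ga = smul (- of_real q) \<gamma>"
| "gen_antipode q Gas = smul (- of_real (inverse q)) \<gamma>s"

definition antipode :: "real \<Rightarrow> gen free \<Rightarrow> gen free" where
  "antipode q = lin (\<lambda>w. prod_list (map (gen_antipode q) (rev (letters w))))"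

text \<open>\<open>G = \<complex>[z, z\<inverse>]\<close> is the monoid algebra of the integers, \<open>z\<^sup>n = zpow n\<close>.\<close>

definition zpow :: "int \<Rightarrow> (int \<Rightarrow>\<^sub>0 complex)" where
  "zpow n = Poly_Mapping.single n 1"

definition comultG :: "(int \<Rightarrow>\<^sub>0 complex) \<Rightarrow> (int \<times> int \<Rightarrow>\<^sub>0 complex)" where
  "comultG = lin (\<lambda>n. tens (zpow n) (zpow n))"

definition counitG :: "(int \<Rightarrow>\<^sub>0 complex) \<Rightarrow> complex" where
  "counitG x = (\<Sum>n\<in>Poly_Mapping.keys x. Poly_Mapping.lookup x n)"

fun gen_j :: "gen \<Rightarrow> (int \<Rightarrow>\<^sub>0 complex)" where
  "gen_j Al = zpow 1" | "gen_j Als = zpow (-1)" | "gen_j Ga = 0" | "gen_j Gas = 0"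

definition coactP :: "real \<Rightarrow> gen free \<Rightarrow> (gen wd \<times> int \<Rightarrow>\<^sub>0 complex)" where
  "coactP q p = tmap id (hom_ext gen_j) (comult q p)"

text \<open>\<open>Mor(\<delta>\<^sup>n, \<Delta>\<^sub>P)\<close>, identified with a subspace of \<open>P\<close> via \<open>T \<mapsto> T(1)\<close>; for \<open>n = 0\<close> this is
  the quantum hyperbolic plane, as \<open>z\<^sup>0 = 1\<close>.\<close>

definition Mor :: "real \<Rightarrow> int \<Rightarrow> gen free set" where
  "Mor q n = {p. coactP q p - tens p (zpow n) \<in> tnull (PI q) {0}}"

abbreviation Hyp :: "real \<Rightarrow> gen free set" where
  "Hyp q \<equiv> Mor q 0"


section \<open>Left covariant calculi and their universal differential envelopes\<close>

text \<open>
  Data for a left covariant first order calculus on the Hopf algebra \<open>H\<close> presented by a monoid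
  algebra modulo \<open>Rel\<close>; \<open>Rid\<close> is the preimage in the monoid algebra of the right ideal of \<open>H\<close>
  which defines the calculus.
\<close>

record 'k calc =
  Rel :: "('k \<Rightarrow>\<^sub>0 complex) set"
  Cop :: "('k \<Rightarrow>\<^sub>0 complex) \<Rightarrow> ('k \<times> 'k \<Rightarrow>\<^sub>0 complex)"
  Cou :: "('k \<Rightarrow>\<^sub>0 complex) \<Rightarrow> complex"
  Rid :: "('k \<Rightarrow>\<^sub>0 complex) set"

definition R3 :: "real \<Rightarrow> gen free set" where
  "R3 q = {r + i | r i. i \<in> PI q \<and> r \<in> right_ideal
     {\<gamma> * \<gamma>, \<gamma>s * \<gamma>s, \<gamma> * \<gamma>s, \<alpha> * \<gamma> - \<gamma>, \<alpha> * \<gamma>s - \<gamma>s, \<alpha>s * \<gamma> - \<gamma>, \<alpha>s * \<gamma>s - \<gamma>s,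
      smul (of_real (q^2)) \<alpha> + \<alpha>s - smul (of_real (1 + q^2)) 1}}"

definition calcP :: "real \<Rightarrow> gen wd calc" where
  "calcP q = \<lparr>Rel = PI q, Cop = comult q, Cou = counit, Rid = R3 q\<rparr>"

definition calcG :: "real \<Rightarrow> int calc" where
  "calcG q = \<lparr>Rel = {0}, Cop = comultG, Cou = counitG,
     Rid = right_ideal {smul (of_real (q^2)) (zpow 1) + zpow (-1) - smul (of_real (1 + q^2)) 1}\<rparr>"

definition germ :: "'k::monoid_add calc \<Rightarrow> ('k \<Rightarrow>\<^sub>0 complex) \<Rightarrow> ('k \<Rightarrow>\<^sub>0 complex)" where
  "germ X a = a - smul (Cou X a) 1"

text \<open>
  A tensor \<open>\<Sum> p \<otimes> a\<close> represents the one-form \<open>\<Sum> p \<pi>(a)\<close>, i.e. the class of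
  \<open>\<Sum> p \<otimes> (a - \<epsilon>(a)1)\<close> in \<open>H \<otimes> (ker \<epsilon> / R)\<close>; it vanishes iff it lies in \<open>null1 X\<close>.
  With this encoding \<open>dp = p\<^sup>(\<^sup>1\<^sup>) \<pi>(p\<^sup>(\<^sup>2\<^sup>))\<close> is represented by the coproduct of \<open>p\<close>, and
  \<open>\<pi>(a) p = p\<^sup>(\<^sup>1\<^sup>) \<pi>(a p\<^sup>(\<^sup>2\<^sup>) - \<epsilon>(a) p\<^sup>(\<^sup>2\<^sup>))\<close> is represented by \<open>(1 \<otimes> (a - \<epsilon>(a)1)) \<Delta>(p)\<close>.
\<close>

definition null1 :: "'k::monoid_add calc \<Rightarrow> ('k \<times> 'k \<Rightarrow>\<^sub>0 complex) set" where
  "null1 X = {\<omega>. tmap id (germ X) \<omega> \<in> tnull (Rel X) (Rid X)}"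

definition lact :: "('k::monoid_add \<Rightarrow>\<^sub>0 complex) \<Rightarrow> ('k \<times> 'k \<Rightarrow>\<^sub>0 complex) \<Rightarrow> ('k \<times> 'k \<Rightarrow>\<^sub>0 complex)" where
  "lact p \<omega> = tens p 1 * \<omega>"

definition ract :: "'k::monoid_add calc \<Rightarrow> ('k \<times> 'k \<Rightarrow>\<^sub>0 complex) \<Rightarrow> ('k \<Rightarrow>\<^sub>0 complex) \<Rightarrow> ('k \<times> 'k \<Rightarrow>\<^sub>0 complex)" where
  "ract X \<omega> p = tmap id (germ X) \<omega> * Cop X p"

abbreviation dif :: "'k::monoid_add calc \<Rightarrow> ('k \<Rightarrow>\<^sub>0 complex) \<Rightarrow> ('k \<times> 'k \<Rightarrow>\<^sub>0 complex)" where
  "dif X p \<equiv> Cop X p"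

text \<open>
  The tensor algebra over \<open>H\<close> of the bimodule of one-forms is presented by one generator \<open>fn p\<close>
  for each element of \<open>H\<close>, one generator \<open>fm \<omega>\<close> for each one-form, and the relations saying
  that \<open>fn\<close> is an algebra homomorphism and \<open>fm\<close> a bimodule homomorphism.
\<close>

datatype 'k lt = Fn "'k \<Rightarrow>\<^sub>0 complex" | Fm "'k \<times> 'k \<Rightarrow>\<^sub>0 complex"

type_synonym 'k env = "'k lt free"

definition fn :: "('k \<Rightarrow>\<^sub>0 complex) \<Rightarrow> 'k env" where "fn p = var (Fn p)"
definition fm :: "('k \<times> 'k \<Rightarrow>\<^sub>0 complex) \<Rightarrow> 'k env" where "fm \<omega> = var (Fm \<omega>)"

definition tensor_rels :: "'k::monoid_add calc \<Rightarrow> 'k env set" where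
  "tensor_rels X =
     {fn (p + p') - fn p - fn p' | p p'. True} \<union> {fn (smul c p) - smul c (fn p) | c p. True} \<union>
     {fn (p * p') - fn p * fn p' | p p'. True} \<union> {fn 1 - 1} \<union> {fn p | p. p \<in> Rel X} \<union>
     {fm (\<omega> + \<omega>') - fm \<omega> - fm \<omega>' | \<omega> \<omega>'. True} \<union> {fm (smul c \<omega>) - smul c (fm \<omega>) | c \<omega>. True} \<union>
     {fm (lact p \<omega>) - fn p * fm \<omega> | p \<omega>. True} \<union> {fm (ract X \<omega> p) - fm \<omega> * fn p | p \<omega>. True} \<union>
     {fm \<omega> | \<omega>. \<omega> \<in> null1 X}"

definition env_rels :: "'k::monoid_add calc \<Rightarrow> 'k env set" where
  "env_rels X = {\<Sum>(g, h)\<leftarrow>xs. fm (dif X g) * fm (dif X h) | xs.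
                   (\<Sum>(g, h)\<leftarrow>xs. lact g (dif X h)) \<in> null1 X}"

definition env_ideal :: "'k::monoid_add calc \<Rightarrow> 'k env set" where
  "env_ideal X = ideal2 (tensor_rels X \<union> env_rels X)"

fun ldeg :: "'k lt \<Rightarrow> nat" where
  "ldeg (Fn p) = 0" | "ldeg (Fm \<omega>) = 1"

definition wdeg :: "'k lt wd \<Rightarrow> nat" where
  "wdeg w = sum_list (map ldeg (letters w))"

definition homog :: "nat \<Rightarrow> 'k env set" where
  "homog k = {\<phi>. \<forall>w\<in>Poly_Mapping.keys \<phi>. wdeg w = k}"

text \<open>A presentation \<open>\<omega> = \<Sum> g\<^sub>i dh\<^sub>i\<close> of a one-form.\<close>

definition presentation :: "'k::monoid_add calc \<Rightarrow> ('k \<times> 'k \<Rightarrow>\<^sub>0 complex)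
    \<Rightarrow> (('k \<Rightarrow>\<^sub>0 complex) \<times> ('k \<Rightarrow>\<^sub>0 complex)) list" where
  "presentation X \<omega> = (SOME xs. (\<Sum>(g, h)\<leftarrow>xs. lact g (dif X h)) - \<omega> \<in> null1 X)"

text \<open>\<open>d(\<Sum> g\<^sub>i dh\<^sub>i) = \<Sum> dg\<^sub>i dh\<^sub>i\<close>, extended by the graded Leibniz rule.\<close>

fun d_letter :: "'k::monoid_add calc \<Rightarrow> 'k lt \<Rightarrow> 'k env" where
  "d_letter X (Fn p) = fm (dif X p)"
| "d_letter X (Fm \<omega>) = (\<Sum>(g, h)\<leftarrow>presentation X \<omega>. fm (dif X g) * fm (dif X h))"

fun d_word :: "'k::monoid_add calc \<Rightarrow> 'k lt list \<Rightarrow> 'k env" where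
  "d_word X [] = 0"
| "d_word X (l # ls) = d_letter X l * Poly_Mapping.single (Wd ls) 1 + (-1) ^ ldeg l * (var l * d_word X ls)"

definition d_env :: "'k::monoid_add calc \<Rightarrow> 'k env \<Rightarrow> 'k env" where
  "d_env X = lin (\<lambda>w. d_word X (letters w))"


section \<open>The calculus on \<open>P\<close>\<close>

abbreviation \<Omega>null :: "real \<Rightarrow> gen wd env set" where
  "\<Omega>null q \<equiv> env_ideal (calcP q)"

abbreviation dP :: "real \<Rightarrow> gen wd env \<Rightarrow> gen wd env" where
  "dP q \<equiv> d_env (calcP q)"

text \<open>\<open>(x \<pi>(a))\<^sup>* = \<pi>(a)\<^sup>* x\<^sup>* = - \<pi>(S(a)\<^sup>*) x\<^sup>*\<close>\<close>

definition form_star :: "real \<Rightarrow> (gen wd \<times> gen wd \<Rightarrow>\<^sub>0 complex) \<Rightarrow> (gen wd \<times> gen wd \<Rightarrow>\<^sub>0 complex)" where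
  "form_star q = antilin (\<lambda>(u, v).
     - ract (calcP q) (tens 1 (pstar (antipode q (Poly_Mapping.single v 1)))) (pstar (Poly_Mapping.single u 1)))"

fun star_letter :: "real \<Rightarrow> gen wd lt \<Rightarrow> gen wd env" where
  "star_letter q (Fn p) = fn (pstar p)"
| "star_letter q (Fm \<omega>) = fm (form_star q \<omega>)"

fun star_word :: "real \<Rightarrow> gen wd lt list \<Rightarrow> gen wd env" where
  "star_word q [] = 1"
| "star_word q (l # ls) = (-1) ^ (ldeg l * wdeg (Wd ls)) * (star_word q ls * star_letter q l)"

definition env_star :: "real \<Rightarrow> gen wd env \<Rightarrow> gen wd env" where
  "env_star q = antilin (\<lambda>w. star_word q (letters w))"

definition \<eta>3 :: "gen wd env" where "\<eta>3 = fm (tens 1 (\<alpha> - \<alpha>s))"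
definition \<eta>p :: "gen wd env" where "\<eta>p = fm (tens 1 \<gamma>)"
definition \<eta>m :: "real \<Rightarrow> gen wd env" where "\<eta>m q = smul (of_real q) (fm (tens 1 \<gamma>s))"
definition dvol :: "real \<Rightarrow> gen wd env" where "dvol q = \<eta>m q * \<eta>p"


section \<open>The coaction on forms, horizontal and base forms\<close>

text \<open>The graded tensor product of the two envelopes.\<close>

type_synonym envPG = "gen wd lt wd \<times> int lt wd \<Rightarrow>\<^sub>0 complex"

definition gmul :: "envPG \<Rightarrow> envPG \<Rightarrow> envPG" where
  "gmul x y = lin (\<lambda>(u, v). lin (\<lambda>(u', v'). Poly_Mapping.single (u + u', v + v') ((-1) ^ (wdeg v * wdeg u'))) y) x"

definition d_tens :: "real \<Rightarrow> envPG \<Rightarrow> envPG" where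
  "d_tens q = lin (\<lambda>(u, v). tens (dP q (Poly_Mapping.single u 1)) (Poly_Mapping.single v 1)
     + smul ((-1) ^ wdeg u) (tens (Poly_Mapping.single u 1) (d_env (calcG q) (Poly_Mapping.single v 1))))"

definition PGnull :: "real \<Rightarrow> envPG set" where
  "PGnull q = tnull (\<Omega>null q) (env_ideal (calcG q))"

text \<open>\<open>\<Delta>\<^sub>P(p)\<close> as a form of degree 0, and the unique extension of \<open>\<Delta>\<^sub>P\<close> to a morphism of graded
  differential algebras: \<open>\<Sum> g\<^sub>i dh\<^sub>i \<mapsto> \<Sum> \<Delta>\<^sub>P(g\<^sub>i) d(\<Delta>\<^sub>P(h\<^sub>i))\<close> on one-forms.\<close>

definition coact0 :: "real \<Rightarrow> gen free \<Rightarrow> envPG" where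
  "coact0 q p = tmap fn fn (coactP q p)"

fun coact_letter :: "real \<Rightarrow> gen wd lt \<Rightarrow> envPG" where
  "coact_letter q (Fn p) = coact0 q p"
| "coact_letter q (Fm \<omega>) =
     (\<Sum>(g, h)\<leftarrow>presentation (calcP q) \<omega>. gmul (coact0 q g) (d_tens q (coact0 q h)))"

definition coact\<Omega> :: "real \<Rightarrow> gen wd env \<Rightarrow> envPG" where
  "coact\<Omega> q = lin (\<lambda>w. foldr (\<lambda>l x. gmul (coact_letter q l) x) (letters w) (tens 1 1))"

text \<open>Inclusion of \<open>\<Omega> \<otimes> G\<close>, where \<open>G\<close> is the degree 0 part of its envelope.\<close>

definition inclG :: "(gen wd lt wd \<times> int \<Rightarrow>\<^sub>0 complex) \<Rightarrow> envPG" where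
  "inclG = tmap id fn"

definition Hor :: "real \<Rightarrow> nat \<Rightarrow> gen wd env set" where
  "Hor q k = {\<phi> \<in> homog k. \<exists>\<psi>. coact\<Omega> q \<phi> - inclG \<psi> \<in> PGnull q}"

definition coactHor :: "real \<Rightarrow> gen wd env \<Rightarrow> (gen wd lt wd \<times> int \<Rightarrow>\<^sub>0 complex)" where
  "coactHor q \<phi> = (SOME \<psi>. coact\<Omega> q \<phi> - inclG \<psi> \<in> PGnull q)"

definition BaseForms :: "real \<Rightarrow> nat \<Rightarrow> gen wd env set" where
  "BaseForms q k = {\<mu> \<in> homog k. coact\<Omega> q \<mu> - tens \<mu> 1 \<in> PGnull q}"


section \<open>The canonical connection and the right gauge Laplacian\<close>

text \<open>\<open>\<omega>\<^sup>c(\<pi>'(g))\<close>: if \<open>\<pi>'(g) = c \<pi>'(z - z\<^sup>*)\<close> then the value is \<open>c \<eta>\<^sub>3\<close>.\<close>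

definition conn_germ :: "real \<Rightarrow> (int \<Rightarrow>\<^sub>0 complex) \<Rightarrow> gen wd env" where
  "conn_germ q g = smul (SOME c. germ (calcG q) g - smul c (germ (calcG q) (zpow 1 - zpow (-1)))
                                   \<in> Rid (calcG q)) \<eta>3"

definition covD :: "real \<Rightarrow> nat \<Rightarrow> gen wd env \<Rightarrow> gen wd env" where
  "covD q k \<phi> = dP q \<phi> - (-1) ^ k * lin (\<lambda>(u, n). Poly_Mapping.single u 1 * conn_germ q (zpow n)) (coactHor q \<phi>)"

text \<open>The Hodge operators \<open>\<star>\<^sub>L\<close>, \<open>\<star>\<^sub>R\<close> and \<open>\<star>\<^sub>R\<inverse>\<close> on base forms; the second argument is the degree
  of the form to which the operator is applied. Base forms vanish in degrees above 2.\<close>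

definition starL :: "real \<Rightarrow> nat \<Rightarrow> gen wd env \<Rightarrow> gen wd env" where
  "starL q k \<mu> =
    (if k = 0 then
       (let b = SOME b. b \<in> Hyp q \<and> \<mu> - fn b \<in> \<Omega>null q in fn (pstar b) * dvol q)
     else if k = 1 then
       (let (x, y) = SOME (x, y). x \<in> Mor q 2 \<and> y \<in> Mor q (-2) \<and>
                                    \<mu> - (fn x * \<eta>m q + fn y * \<eta>p) \<in> \<Omega>null q
        in - (fn (pstar y) * \<eta>m q) + fn (pstar x) * \<eta>p)
     else if k = 2 then
       (let b = SOME b. b \<in> Hyp q \<and> \<mu> - fn b * dvol q \<in> \<Omega>null q in fn (pstar b))
     else 0)"

definition starR :: "real \<Rightarrow> nat \<Rightarrow> gen wd env \<Rightarrow> gen wd env" where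
  "starR q k \<mu> = starL q k (env_star q \<mu>)"

definition starR_inv :: "real \<Rightarrow> nat \<Rightarrow> gen wd env \<Rightarrow> gen wd env" where
  "starR_inv q k \<nu> = (SOME \<mu>. \<mu> \<in> BaseForms q (2 - k) \<and> starR q (2 - k) \<mu> - \<nu> \<in> \<Omega>null q)"

text \<open>
  The tensor product \<open>E\<^sup>n\<^sub>R \<otimes> \<Omega>\<^sup>k\<close> over the base algebra is \<open>ERep q n k / Enull q n k\<close>: formal linear
  combinations of pairs \<open>(T, \<mu>)\<close>, standing for \<open>T \<otimes> \<mu>\<close>, modulo bilinearity and balancing.
  As \<open>T \<otimes> \<mu> \<mapsto> T\<mu>\<close> is an isomorphism, every \<open>u\<close> with \<open>\<Upsilon> u = \<phi>\<close> represents the image of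
  \<open>\<phi>\<close> under the inverse; \<open>\<Upsilon>hat\<close> selects one.
\<close>

type_synonym etens = "gen free \<times> gen wd env \<Rightarrow>\<^sub>0 complex"

definition ERep :: "real \<Rightarrow> int \<Rightarrow> nat \<Rightarrow> etens set" where
  "ERep q n k = {u. \<forall>(T, \<mu>)\<in>Poly_Mapping.keys u. T \<in> Mor q n \<and> \<mu> \<in> BaseForms q k}"

definition Enull :: "real \<Rightarrow> int \<Rightarrow> nat \<Rightarrow> etens set" where
  "Enull q n k = smul.span (
     let pure = (\<lambda>T \<mu>. Poly_Mapping.single (T, \<mu>) 1 :: etens); E = Mor q n; B = BaseForms q k in
     {pure (T + T') \<mu> - pure T \<mu> - pure T' \<mu> | T T' \<mu>. T \<in> E \<and> T' \<in> E \<and> \<mu> \<in> B} \<union>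
     {pure T (\<mu> + \<mu>') - pure T \<mu> - pure T \<mu>' | T \<mu> \<mu>'. T \<in> E \<and> \<mu> \<in> B \<and> \<mu>' \<in> B} \<union>
     {pure (smul c T) \<mu> - smul c (pure T \<mu>) | c T \<mu>. T \<in> E \<and> \<mu> \<in> B} \<union>
     {pure T (smul c \<mu>) - smul c (pure T \<mu>) | c T \<mu>. T \<in> E \<and> \<mu> \<in> B} \<union>
     {pure (T * b) \<mu> - pure T (fn b * \<mu>) | T b \<mu>. T \<in> E \<and> b \<in> Hyp q \<and> \<mu> \<in> B} \<union>
     {pure T \<mu> | T \<mu>. T \<in> E \<and> \<mu> \<in> B \<and> (T \<in> PI q \<or> \<mu> \<in> \<Omega>null q)})"

definition \<Upsilon> :: "etens \<Rightarrow> gen wd env" where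
  "\<Upsilon> = lin (\<lambda>(T, \<mu>). fn T * \<mu>)"

definition \<Upsilon>hat :: "real \<Rightarrow> int \<Rightarrow> nat \<Rightarrow> gen wd env \<Rightarrow> etens" where
  "\<Upsilon>hat q n k \<phi> = (SOME u. u \<in> ERep q n k \<and> \<Upsilon> u - \<phi> \<in> \<Omega>null q)"

definition nabla :: "real \<Rightarrow> int \<Rightarrow> gen free \<Rightarrow> etens" where
  "nabla q n T = \<Upsilon>hat q n 1 (covD q 0 (fn T))"

definition on_form :: "(gen wd env \<Rightarrow> gen wd env) \<Rightarrow> etens \<Rightarrow> etens" where
  "on_form f = lin (\<lambda>(T, \<mu>). Poly_Mapping.single (T, f \<mu>) 1)"

definition d_nabla :: "real \<Rightarrow> int \<Rightarrow> etens \<Rightarrow> etens" where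
  "d_nabla q n = lin (\<lambda>(T, \<mu>). on_form (\<lambda>\<nu>. \<nu> * \<mu>) (nabla q n T) + Poly_Mapping.single (T, dP q \<mu>) 1)"

text \<open>The degree argument is that of the element to which the operator is applied; for
  an element of degree \<open>k + 1\<close>, \<open>d_nabla\<close> is applied in degree \<open>1 - k\<close>.\<close>

fun d_nabla_star :: "real \<Rightarrow> int \<Rightarrow> nat \<Rightarrow> etens \<Rightarrow> etens" where
  "d_nabla_star q n 0 u = 0"
| "d_nabla_star q n (Suc k) u =
     smul ((-1) ^ (k + 1)) (on_form (starR_inv q (2 - k)) (d_nabla q n (on_form (starR q (Suc k)) u)))"

definition box :: "real \<Rightarrow> int \<Rightarrow> nat \<Rightarrow> etens \<Rightarrow> etens" where
  "box q n k u = d_nabla q n (d_nabla_star q n k u) + d_nabla_star q n (Suc k) (d_nabla q n u)"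

text \<open>The Laplacian in degree 0: \<open>p \<otimes> 1\<close> is mapped to \<open>laplacian q n p \<otimes> 1\<close>.\<close>

definition laplacian :: "real \<Rightarrow> int \<Rightarrow> gen free \<Rightarrow> gen free" where
  "laplacian q n p = (SOME p'. p' \<in> Mor q n \<and>
     box q n 0 (Poly_Mapping.single (p, 1) 1) - Poly_Mapping.single (p', 1) 1 \<in> Enull q n 0)"


section \<open>Eigenvalues and eigenvectors\<close>

definition qbr :: "real \<Rightarrow> nat \<Rightarrow> real" where
  "qbr q m = (q ^ (2 * m) - 1) / (q^2 - 1)"

definition M :: "int \<Rightarrow> nat \<Rightarrow> nat \<Rightarrow> gen free" where
  "M t k l = (if t \<ge> 0 then \<alpha> ^ nat t else \<alpha>s ^ nat (-t)) * \<gamma> ^ k * \<gamma>s ^ l"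

definition chat :: "real \<Rightarrow> int \<Rightarrow> nat \<Rightarrow> nat \<Rightarrow> real" where
  "chat q t k l = - (q powi (-2 * int k)) * (1 + q^4) * qbr q k * qbr q l"

definition ehat :: "real \<Rightarrow> int \<Rightarrow> nat \<Rightarrow> nat \<Rightarrow> real" where
  "ehat q t k l =
    (if t = 0 then
       - (q powi (-2 * int k) * (1 + q^2 * qbr q l) * qbr q k
          + q^4 * (1 + q powi (-2 * int k) * qbr q k) * qbr q l)
     else if t \<ge> 1 then
       - (q powi (-2 * t)) *
         (qbr q (nat t) * qbr q (l + 1) + q powi (-2 * int k) * qbr q k * qbr q (l + 1)
          + q^4 * qbr q l * qbr q (nat t + 1) + q powi (-2 * int k + 4) * qbr q l * qbr q k)
     else (let s = nat (-t) in
       - (q powi (-2 * int k)) *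
         (qbr q k * qbr q (s + 1) + q ^ (2 * s + 2) * qbr q k * qbr q l
          + q^4 * qbr q s * qbr q (k + 1) + q ^ (4 + 2 * s) * qbr q l * qbr q (k + 1))))"

definition phat :: "real \<Rightarrow> int \<Rightarrow> nat \<Rightarrow> nat \<Rightarrow> gen free" where
  "phat q t k l = M t k l + (\<Sum>i = 1..min k l.
     smul (of_real (\<Prod>j<i. chat q t (k - j) (l - j) / (ehat q t k l - ehat q t (k - j - 1) (l - j - 1))))
          (M t (k - i) (l - i)))"

definition J :: "int \<Rightarrow> (int \<times> nat \<times> nat) set" where
  "J n = {(t, k, l). t + int k - int l = n}"

text \<open>\<open>b\<close>, indexed by \<open>I\<close>, is a linear basis of the subspace of \<open>P\<close> represented by \<open>S\<close>.\<close>

definition basis_of :: "real \<Rightarrow> gen free set \<Rightarrow> 'i set \<Rightarrow> ('i \<Rightarrow> gen free) \<Rightarrow> bool" where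
  "basis_of q S I b \<longleftrightarrow> (\<forall>i\<in>I. b i \<in> S) \<and>
     (\<forall>p\<in>S. \<exists>!c :: 'i \<Rightarrow>\<^sub>0 complex. Poly_Mapping.keys c \<subseteq> I \<and> eqP q p (lin b c))"

text \<open>\<open>F\<close> induces a well-defined linear operator on the subspace of \<open>P\<close> represented by \<open>S\<close>.\<close>

definition linear_op :: "real \<Rightarrow> gen free set \<Rightarrow> (gen free \<Rightarrow> gen free) \<Rightarrow> bool" where
  "linear_op q S F \<longleftrightarrow> (\<forall>p\<in>S. F p \<in> S) \<and> (\<forall>p\<in>S. \<forall>p'\<in>S. eqP q p p' \<longrightarrow> eqP q (F p) (F p')) \<and>
     (\<forall>p\<in>S. \<forall>p'\<in>S. eqP q (F (p + p')) (F p + F p')) \<and>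
     (\<forall>c. \<forall>p\<in>S. eqP q (F (smul c p)) (smul c (F p)))"

definition eigenvalues :: "real \<Rightarrow> gen free set \<Rightarrow> (gen free \<Rightarrow> gen free) \<Rightarrow> complex set" where
  "eigenvalues q S F = {ev. \<exists>p\<in>S. \<not> eqP q p 0 \<and> eqP q (F p) (smul ev p)}"

end

theory Submission
  imports Defs
begin

text \<open>
  The monomials \<open>M t k l\<close> span \<open>P\<close> by the commutation relations, and they are independent because
  \<open>P\<close> acts by left multiplication on a space with basis \<open>(t, k, l)\<close>. Hence an equation in \<open>P\<close> is
  decided by normal forms. The differential is \<open>dp = \<Sum>\<^sub>i (d\<^sub>i p) \<eta>\<^sub>i\<close> for twisted derivations
  \<open>d\<^sub>3, d\<^sub>+, d\<^sub>-\<close> of the free algebra, and iterated twisted derivations give functionals which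
  annihilate the relations of the envelope and so detect the coefficients of forms of degree at most 2.
  Horizontally \<open>Dp = (d\<^sub>- p) \<eta>\<^sub>- + (d\<^sub>+ p) \<eta>\<^sub>+\<close>. Since
  \<open>\<star>\<^sub>R (x \<eta>\<^sub>- + y \<eta>\<^sub>+) = - q\<^sup>2 x \<eta>\<^sub>- + q\<^sup>-\<^sup>2 y \<eta>\<^sub>+\<close>, the Laplacian in degree 0 is
  \<open>- (q\<^sup>4 d\<^sub>+ d\<^sub>- + q\<^sup>-\<^sup>2 d\<^sub>- d\<^sub>+)\<close>. It is triangular on the monomials with fixed \<open>t\<close>. Its diagonal
  entries are strictly monotone along \<open>(k, l) \<mapsto> (k + 1, l + 1)\<close> and only finitely many of them lie
  in a bounded set, whence the eigenbasis and the discreteness of the eigenvalues.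
\<close>

section \<open>Linear maps, subspaces and ideals of monoid algebras\<close>

text \<open>The obstacle is that all maps act on representatives and many values are arbitrary
  choices: presentations of one-forms, preimages under the inclusion of horizontal forms, inverses
  of \<open>\<Upsilon>\<close> and of the Hodge operator. A chosen element is known only up to the
  congruence that defines it, and the choices are not additive. Hence chosen elements are compared
  only through functionals that vanish on the ideals: \<open>D0\<close>, \<open>DD i\<close> and
  \<open>D2\<close> on the envelope of P, \<open>D0\<close> and \<open>DG\<close> on that of G. In
  degree two the single coefficient of \<open>dvol\<close> carries what the Laplacian uses; that it
  is well defined rests on the identity d_- d_+ - q^2 d_+ d_- = (1 + q^2) d_3. The explicit lists of
  pairs further on all have one origin: for p in P the form \<pi>(p) equals the sum of S(p1) dp2.
  With p in R_3 this sum is zero, and the envelope then yields relations between products of the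
  basic forms. With p = \<gamma>\<alpha>s or \<gamma>s\<alpha> it presents \<eta>p or \<eta>m, up to
  a factor, by differentials of functions of degree 0, for which the exterior derivative is
  short.\<close>

abbreviation pt :: "'a \<Rightarrow> ('a \<Rightarrow>\<^sub>0 complex)" where
  "pt k \<equiv> Poly_Mapping.single k 1"

lemma smul_conv_mult: "smul c x = Poly_Mapping.single 0 c * x"
  for x :: "'a::monoid_add \<Rightarrow>\<^sub>0 complex"
  unfolding smul_def by (rule mult_map_scale_conv_mult)

lemma smul_mult_left [simp]: "smul c x * y = smul c (x * y)"
  for x y :: "'a::monoid_add \<Rightarrow>\<^sub>0 complex"
  by (simp add: smul_conv_mult mult.assoc)

text \<open>Scalars sit at the neutral element of the monoid and are therefore central, although the
  words themselves do not commute. This makes \<open>smul\<close> pass through both factors of a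
  product.\<close>

lemma single_zero_comm: "Poly_Mapping.single 0 c * x = x * Poly_Mapping.single 0 c"
  for x :: "'a::monoid_add \<Rightarrow>\<^sub>0 complex"
proof (induction x rule: Poly_Mapping.update_induct)
  case const
  then show ?case by simp
next
  case (update f a b)
  have "Poly_Mapping.update a b f = Poly_Mapping.single a b + f"
    using update by (intro poly_mapping_eqI)
      (auto simp: lookup_update lookup_add lookup_single when_def in_keys_iff)
  then show ?case using update by (simp add: algebra_simps mult_single)
qed

lemma smul_mult_right [simp]: "x * smul c y = smul c (x * y)"
  for x y :: "'a::monoid_add \<Rightarrow>\<^sub>0 complex"
  unfolding smul_conv_mult by (metis mult.assoc single_zero_comm)

lemma smul_single [simp]: "smul c (Poly_Mapping.single k d) = Poly_Mapping.single k (c * d)"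
  by (intro poly_mapping_eqI) (simp add: lookup_single when_def)

lemma single_smul_pt: "Poly_Mapping.single k c = smul c (pt k)"
  by simp

lemma smul_zero [simp]: "smul c 0 = 0" "smul 0 x = 0"
  by (auto intro!: poly_mapping_eqI)

lemma smul_add: "smul c (x + y) = smul c x + smul c y"
  by (rule smul.scale_right_distrib)

lemma smul_diff: "smul c (x - y) = smul c x - smul c y"
  by (rule smul.scale_right_diff_distrib)

lemma smul_minus: "smul c (- x) = - smul c x" "smul (- c) x = - smul c x"
  by (auto intro!: poly_mapping_eqI)

lemma smul_add_left: "smul (c + d) x = smul c x + smul d x"
  by (rule smul.scale_left_distrib)

lemma smul_sum: "smul c (sum f A) = (\<Sum>a\<in>A. smul c (f a))"
  by (rule smul.scale_sum_right)

definition clin :: "(('a \<Rightarrow>\<^sub>0 complex) \<Rightarrow> ('b \<Rightarrow>\<^sub>0 complex)) \<Rightarrow> bool" where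
  "clin F \<longleftrightarrow> (\<forall>x y. F (x + y) = F x + F y) \<and> (\<forall>c x. F (smul c x) = smul c (F x))"

lemma clinI: "(\<And>x y. F (x + y) = F x + F y) \<Longrightarrow> (\<And>c x. F (smul c x) = smul c (F x)) \<Longrightarrow> clin F"
  by (simp add: clin_def)

lemma clin_add: "clin F \<Longrightarrow> F (x + y) = F x + F y"
  and clin_smul: "clin F \<Longrightarrow> F (smul c x) = smul c (F x)"
  by (simp_all add: clin_def)

lemma clin_zero: "clin F \<Longrightarrow> F 0 = 0"
  using clin_smul[of F 0 0] by simp

lemma clin_minus: "clin F \<Longrightarrow> F (- x) = - F x"
  using clin_smul[of F "-1" x] by (simp add: smul_minus)

lemma clin_diff: "clin F \<Longrightarrow> F (x - y) = F x - F y"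
  using clin_add[of F x "- y"] by (simp add: clin_minus)

lemma clin_sum: "clin F \<Longrightarrow> F (sum f A) = (\<Sum>a\<in>A. F (f a))"
  by (induction A rule: infinite_finite_induct) (auto simp: clin_zero clin_add)

lemma clin_sum_list: "clin F \<Longrightarrow> F (sum_list (map f xs)) = (\<Sum>a\<leftarrow>xs. F (f a))"
  by (induction xs) (auto simp: clin_zero clin_add)

lemma clin_single: "clin F \<Longrightarrow> F (Poly_Mapping.single k c) = smul c (F (pt k))"
  by (subst single_smul_pt) (rule clin_smul)

lemma pm_decomp: "x = (\<Sum>k\<in>Poly_Mapping.keys x. smul (Poly_Mapping.lookup x k) (pt k))"
proof (rule poly_mapping_eqI)
  fix k
  have "Poly_Mapping.lookup (\<Sum>k\<in>Poly_Mapping.keys x. smul (Poly_Mapping.lookup x k) (pt k)) k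
    = (\<Sum>j\<in>Poly_Mapping.keys x. if j = k then Poly_Mapping.lookup x k else 0)"
    by (auto simp: lookup_sum lookup_single when_def intro!: sum.cong)
  then show "Poly_Mapping.lookup x k =
      Poly_Mapping.lookup (\<Sum>k\<in>Poly_Mapping.keys x. smul (Poly_Mapping.lookup x k) (pt k)) k"
    by (simp add: in_keys_iff)
qed

lemma clin_lin_pt: "clin F \<Longrightarrow> F x = lin (\<lambda>k. F (pt k)) x"
  by (subst pm_decomp) (simp only: clin_sum clin_smul lin_def)

lemma clin_eqI: "clin F \<Longrightarrow> clin G \<Longrightarrow> (\<And>k. F (pt k) = G (pt k)) \<Longrightarrow> F x = G x"
  using clin_lin_pt[of F x] clin_lin_pt[of G x] by simp

text \<open>Coefficients can cancel in \<open>x + y\<close>, so the supports do not add up; summing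
  over any larger finite set allows additivity to be read off termwise.\<close>

lemma lin_superset:
  assumes "finite A" "Poly_Mapping.keys x \<subseteq> A"
  shows "lin f x = (\<Sum>k\<in>A. smul (Poly_Mapping.lookup x k) (f k))"
  unfolding lin_def using assms by (intro sum.mono_neutral_left) (auto simp: in_keys_iff)

lemma clin_lin [simp, intro]: "clin (lin f)"
proof (rule clinI)
  fix x y :: "'a \<Rightarrow>\<^sub>0 complex"
  let ?A = "Poly_Mapping.keys x \<union> Poly_Mapping.keys y"
  have "lin f (x + y) = (\<Sum>k\<in>?A. smul (Poly_Mapping.lookup (x + y) k) (f k))"
    by (rule lin_superset) (use Poly_Mapping.keys_add[of x y] in auto)
  also have "\<dots> = (\<Sum>k\<in>?A. smul (Poly_Mapping.lookup x k) (f k)) + (\<Sum>k\<in>?A. smul (Poly_Mapping.lookup y k) (f k))"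
    by (simp add: lookup_add smul_add_left sum.distrib)
  also have "\<dots> = lin f x + lin f y"
    by (subst (1 2) lin_superset[of ?A]) auto
  finally show "lin f (x + y) = lin f x + lin f y" .
next
  fix c and x :: "'a \<Rightarrow>\<^sub>0 complex"
  have "lin f (smul c x) = (\<Sum>k\<in>Poly_Mapping.keys x. smul (Poly_Mapping.lookup (smul c x) k) (f k))"
    by (rule lin_superset) (auto simp: in_keys_iff)
  then show "lin f (smul c x) = smul c (lin f x)"
    by (simp add: lin_def smul_sum)
qed

lemma lin_pt [simp]: "lin f (pt k) = f k"
  by (simp add: lin_def)

lemma lin_single: "lin f (Poly_Mapping.single k c) = smul c (f k)"
  using clin_single[OF clin_lin, of f k c] by simp

lemma lin_zero [simp]: "lin f 0 = 0"
  by (simp add: lin_def)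

lemmas lin_add = clin_add[OF clin_lin]
  and lin_smul = clin_smul[OF clin_lin]
  and lin_diff = clin_diff[OF clin_lin]
  and lin_minus = clin_minus[OF clin_lin]
  and lin_sum = clin_sum[OF clin_lin]
  and lin_sum_list = clin_sum_list[OF clin_lin]

lemma lin_id: "lin pt x = x"
  using pm_decomp[of x] by (simp add: lin_def)

lemma lin_cong: "(\<And>k. k \<in> Poly_Mapping.keys x \<Longrightarrow> f k = g k) \<Longrightarrow> lin f x = lin g x"
  by (simp add: lin_def cong: sum.cong)

lemma lin_smul_fun: "lin (\<lambda>k. smul c (f k)) x = smul c (lin f x)"
  by (simp add: lin_def smul_sum mult.commute)

lemma lin_add_fun: "lin (\<lambda>k. f k + g k) x = lin f x + lin g x"
  by (simp add: lin_def smul_add sum.distrib)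

lemma clin_id [simp]: "clin (\<lambda>x. x)"
  by (simp add: clin_def)

lemma clin_comp: "clin F \<Longrightarrow> clin G \<Longrightarrow> clin (\<lambda>x. F (G x))"
  by (simp add: clin_def)

lemma clin_plus: "clin F \<Longrightarrow> clin G \<Longrightarrow> clin (\<lambda>x. F x + G x)"
  by (simp add: clin_def smul_add algebra_simps)

lemma clin_minusF: "clin F \<Longrightarrow> clin (\<lambda>x. - F x)"
  by (simp add: clin_def smul_minus)

lemma clin_sub: "clin F \<Longrightarrow> clin G \<Longrightarrow> clin (\<lambda>x. F x - G x)"
  by (simp add: clin_def smul_diff algebra_simps)

lemma clin_smulF: "clin F \<Longrightarrow> clin (\<lambda>x. smul c (F x))"
  by (simp add: clin_def smul_add mult.commute)

lemma clin_sumF: "(\<And>a. a \<in> A \<Longrightarrow> clin (f a)) \<Longrightarrow> clin (\<lambda>x. \<Sum>a\<in>A. f a x)"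
  by (auto simp: clin_def sum.distrib smul_sum)

lemma clin_mult_left: "clin F \<Longrightarrow> clin (\<lambda>x. a * F x)"
  and clin_mult_right: "clin F \<Longrightarrow> clin (\<lambda>x. F x * a)"
  for F :: "_ \<Rightarrow> ('b::monoid_add \<Rightarrow>\<^sub>0 complex)"
  by (simp_all add: clin_def algebra_simps)

lemma clin_linF: "(\<And>k. clin (\<lambda>x. f x k)) \<Longrightarrow> clin (\<lambda>x. lin (f x) y)"
proof -
  assume "\<And>k. clin (\<lambda>x. f x k)"
  then have "f (x + z) = (\<lambda>k. f x k + f z k)" "f (smul c x) = (\<lambda>k. smul c (f x k))" for x z c
    by (auto simp: clin_def)
  then show ?thesis by (simp add: clin_def lin_add_fun lin_smul_fun)
qed

lemma clin_lin': "clin F \<Longrightarrow> clin (\<lambda>x. lin f (F x))"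
  by (rule clin_comp) auto

lemmas clin_intros = clin_id clin_plus clin_minusF clin_sub clin_smulF clin_mult_left clin_mult_right
  clin_lin' clin_lin

lemma clin_lin_comm: "clin F \<Longrightarrow> F (lin g x) = lin (\<lambda>k. F (g k)) x"
  by (simp add: lin_def clin_sum clin_smul)

lemma lin_mult_left: "lin (\<lambda>k. a * f k) x = a * lin f x"
  and lin_mult_right: "lin (\<lambda>k. f k * a) x = lin f x * a"
  for f :: "_ \<Rightarrow> ('b::monoid_add \<Rightarrow>\<^sub>0 complex)"
  by (simp_all add: lin_def sum_distrib_left sum_distrib_right)

lemma clin2_eqI:
  assumes "\<And>y. clin (\<lambda>x. F x y)" "\<And>x. clin (F x)" "\<And>y. clin (\<lambda>x. G x y)" "\<And>x. clin (G x)"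
    and "\<And>j k. F (pt j) (pt k) = G (pt j) (pt k)"
  shows "F x y = G x y"
proof -
  have "F (pt j) y = G (pt j) y" for j
    by (rule clin_eqI[of "F (pt j)" "G (pt j)"]) (use assms in auto)
  then show ?thesis
    by (rule clin_eqI[of "\<lambda>x. F x y" "\<lambda>x. G x y", OF assms(1) assms(3)])
qed

section \<open>Tensor products of monoid algebras\<close>

lemma tens_pt [simp]: "tens (pt a) (pt b) = pt (a, b)"
  by (simp add: tens_def)

lemma clin_tens_left: "clin F \<Longrightarrow> clin (\<lambda>x. tens (F x) y)"
  unfolding tens_def by (rule clin_lin')

lemma clin_tens_right: "clin F \<Longrightarrow> clin (\<lambda>y. tens x (F y))"
  unfolding tens_def by (rule clin_linF) (rule clin_lin')

lemmas tens_add_left = clin_add[OF clin_tens_left[OF clin_id]]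
  and tens_add_right = clin_add[OF clin_tens_right[OF clin_id]]
  and tens_smul_left [simp] = clin_smul[OF clin_tens_left[OF clin_id]]
  and tens_smul_right [simp] = clin_smul[OF clin_tens_right[OF clin_id]]
  and tens_diff_left = clin_diff[OF clin_tens_left[OF clin_id]]
  and tens_diff_right = clin_diff[OF clin_tens_right[OF clin_id]]
  and tens_zero_left [simp] = clin_zero[OF clin_tens_left[OF clin_id]]
  and tens_zero_right [simp] = clin_zero[OF clin_tens_right[OF clin_id]]
  and tens_minus_left = clin_minus[OF clin_tens_left[OF clin_id]]
  and tens_minus_right = clin_minus[OF clin_tens_right[OF clin_id]]
  and tens_sum_left = clin_sum[OF clin_tens_left[OF clin_id]]
  and tens_sum_right = clin_sum[OF clin_tens_right[OF clin_id]]

lemma pt_mult [simp]: "pt a * pt b = pt (a + b)" for a b :: "'a::monoid_add"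
  by (simp add: mult_single)

lemma tens_mult: "tens x y * tens x' y' = tens (x * x') (y * y')"
  for x x' :: "'a::monoid_add \<Rightarrow>\<^sub>0 complex" and y y' :: "'b::monoid_add \<Rightarrow>\<^sub>0 complex"
proof -
  have 1: "tens (pt a) (pt b) * tens x' y' = tens (pt a * x') (pt b * y')" for a b
    by (rule clin2_eqI[of "\<lambda>x' y'. tens (pt a) (pt b) * tens x' y'" "\<lambda>x' y'. tens (pt a * x') (pt b * y')"])
      (intro clin_mult_left clin_tens_left clin_tens_right clin_id | simp)+
  show ?thesis
    by (rule clin2_eqI[of "\<lambda>x y. tens x y * tens x' y'" "\<lambda>x y. tens (x * x') (y * y')", OF _ _ _ _ 1])
      (rule clin_mult_right clin_tens_left clin_tens_right clin_id)+
qed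

lemma one_pt: "1 = pt 0"
  by simp

lemma tens_one [simp]: "tens 1 1 = 1"
  unfolding one_pt tens_pt by (simp add: zero_prod_def)

lemma clin_tmap [simp, intro]: "clin (tmap f g)"
  unfolding tmap_def by simp

lemma tmap_tens: "clin f \<Longrightarrow> clin g \<Longrightarrow> tmap f g (tens x y) = tens (f x) (g y)"
  by (rule clin2_eqI[of "\<lambda>x y. tmap f g (tens x y)" "\<lambda>x y. tens (f x) (g y)"])
    (auto intro!: clin_comp[OF clin_tmap] clin_lin' clin_tens_left clin_tens_right simp: tmap_def)

lemma tmap_pt: "tmap f g (pt (a, b)) = tens (f (pt a)) (g (pt b))"
  by (simp add: tmap_def)

section \<open>Subspaces, ideals and congruences\<close>

definition csub :: "('a \<Rightarrow>\<^sub>0 complex) set \<Rightarrow> bool" where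
  "csub S \<longleftrightarrow> 0 \<in> S \<and> (\<forall>x\<in>S. \<forall>y\<in>S. x + y \<in> S) \<and> (\<forall>c. \<forall>x\<in>S. smul c x \<in> S)"

definition cideal :: "('a::monoid_add \<Rightarrow>\<^sub>0 complex) set \<Rightarrow> bool" where
  "cideal S \<longleftrightarrow> csub S \<and> (\<forall>a. \<forall>x\<in>S. a * x \<in> S) \<and> (\<forall>a. \<forall>x\<in>S. x * a \<in> S)"

text \<open>One notion of congruence serves for P, for both envelopes, for their tensor product, for
  germs modulo \<open>R3 q\<close> and for the balanced tensor product.\<close>

definition md :: "('a \<Rightarrow>\<^sub>0 complex) set \<Rightarrow> ('a \<Rightarrow>\<^sub>0 complex) \<Rightarrow> ('a \<Rightarrow>\<^sub>0 complex) \<Rightarrow> bool" where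
  "md I x y \<longleftrightarrow> x - y \<in> I"

lemma csub_zero: "csub S \<Longrightarrow> 0 \<in> S"
  and csub_add: "csub S \<Longrightarrow> x \<in> S \<Longrightarrow> y \<in> S \<Longrightarrow> x + y \<in> S"
  and csub_smul: "csub S \<Longrightarrow> x \<in> S \<Longrightarrow> smul c x \<in> S"
  by (simp_all add: csub_def)

lemma csub_minus: "csub S \<Longrightarrow> x \<in> S \<Longrightarrow> - x \<in> S"
  using csub_smul[of S x "-1"] by (simp add: smul_minus)

lemma csub_diff: "csub S \<Longrightarrow> x \<in> S \<Longrightarrow> y \<in> S \<Longrightarrow> x - y \<in> S"
  using csub_add[of S x "- y"] csub_minus[of S y] by simp

lemma csub_sum: "csub S \<Longrightarrow> (\<And>a. a \<in> A \<Longrightarrow> f a \<in> S) \<Longrightarrow> sum f A \<in> S"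
  by (induction A rule: infinite_finite_induct) (auto simp: csub_def)

lemma csub_sum_list: "csub S \<Longrightarrow> (\<And>a. a \<in> set xs \<Longrightarrow> f a \<in> S) \<Longrightarrow> sum_list (map f xs) \<in> S"
  by (induction xs) (auto simp: csub_def)

lemma csub_lin: "csub S \<Longrightarrow> (\<And>k. k \<in> Poly_Mapping.keys x \<Longrightarrow> f k \<in> S) \<Longrightarrow> lin f x \<in> S"
  unfolding lin_def by (intro csub_sum csub_smul) auto

lemma clin_into: "csub S \<Longrightarrow> clin F \<Longrightarrow> (\<And>k. F (pt k) \<in> S) \<Longrightarrow> F x \<in> S"
  by (subst clin_lin_pt) (auto intro: csub_lin)

lemma cideal_csub: "cideal S \<Longrightarrow> csub S"
  and cideal_left: "cideal S \<Longrightarrow> x \<in> S \<Longrightarrow> a * x \<in> S"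
  and cideal_right: "cideal S \<Longrightarrow> x \<in> S \<Longrightarrow> x * a \<in> S"
  by (simp_all add: cideal_def)

lemma csub_span: "csub (smul.span A)"
  by (auto simp: csub_def intro: smul.span_zero smul.span_add smul.span_scale)

lemma span_into: "csub S \<Longrightarrow> (\<And>a. a \<in> A \<Longrightarrow> a \<in> S) \<Longrightarrow> x \<in> smul.span A \<Longrightarrow> x \<in> S"
  using smul.span_minimal[of A S] by (auto simp: smul.subspace_def csub_def)

lemma csub_vimage: "clin F \<Longrightarrow> csub S \<Longrightarrow> csub {x. F x \<in> S}"
  by (auto simp: csub_def clin_zero clin_add clin_smul)

lemma cideal_ideal2: "cideal (ideal2 A)" for A :: "('a::monoid_add \<Rightarrow>\<^sub>0 complex) set"
proof -
  have l: "a * x \<in> ideal2 A" if "x \<in> ideal2 A" for a x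
    using that
  proof induction
    case (gen s u v)
    have "a * (u * s * v) = (a * u) * s * v" by (simp add: mult.assoc)
    then show ?case using gen by (metis ideal2.gen)
  qed (auto simp: algebra_simps intro: ideal2.intros)
  have r: "x * a \<in> ideal2 A" if "x \<in> ideal2 A" for a x
    using that
  proof induction
    case (gen s u v)
    have "u * s * v * a = u * s * (v * a)" by (simp add: mult.assoc)
    then show ?case using gen by (metis ideal2.gen)
  qed (auto simp: algebra_simps intro: ideal2.intros)
  show ?thesis
    using l[of _ "Poly_Mapping.single 0 _"] l r
    by (auto simp: cideal_def csub_def smul_conv_mult intro: ideal2.intros)
qed

lemma ideal2_gen: "s \<in> A \<Longrightarrow> s \<in> ideal2 A" for A :: "('a::monoid_add \<Rightarrow>\<^sub>0 complex) set"
  using ideal2.gen[of s A 1 1] by simp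

lemma ideal2_into:
  "csub S \<Longrightarrow> clin F \<Longrightarrow> (\<And>a s b. s \<in> A \<Longrightarrow> F (a * s * b) \<in> S) \<Longrightarrow> x \<in> ideal2 A \<Longrightarrow> F x \<in> S"
  by (rotate_tac 3, induction rule: ideal2.induct) (auto simp: clin_zero clin_add csub_def)

lemma md_refl [simp]: "csub I \<Longrightarrow> md I x x"
  by (simp add: md_def csub_zero)

lemma md_eq: "csub I \<Longrightarrow> x = y \<Longrightarrow> md I x y"
  by simp

lemma md_sym: "csub I \<Longrightarrow> md I x y \<Longrightarrow> md I y x"
  unfolding md_def using csub_minus by fastforce

lemma md_trans: "csub I \<Longrightarrow> md I x y \<Longrightarrow> md I y z \<Longrightarrow> md I x z"
  unfolding md_def using csub_add[of I "x - y" "y - z"] by simp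

lemma md_add: "csub I \<Longrightarrow> md I x x' \<Longrightarrow> md I y y' \<Longrightarrow> md I (x + y) (x' + y')"
  unfolding md_def using csub_add[of I "x - x'" "y - y'"] by (simp add: algebra_simps)

lemma md_diff: "csub I \<Longrightarrow> md I x x' \<Longrightarrow> md I y y' \<Longrightarrow> md I (x - y) (x' - y')"
  unfolding md_def using csub_diff[of I "x - x'" "y - y'"] by (simp add: algebra_simps)

lemma md_minus: "csub I \<Longrightarrow> md I x x' \<Longrightarrow> md I (- x) (- x')"
  unfolding md_def using csub_minus[of I "x - x'"] by (simp add: algebra_simps)

lemma md_smul: "csub I \<Longrightarrow> md I x x' \<Longrightarrow> md I (smul c x) (smul c x')"
  unfolding md_def using csub_smul[of I "x - x'" c] by (simp add: smul_diff)

lemma md_mult: "cideal I \<Longrightarrow> md I x x' \<Longrightarrow> md I y y' \<Longrightarrow> md I (x * y) (x' * y')"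
  for x y :: "'a::monoid_add \<Rightarrow>\<^sub>0 complex"
proof -
  assume I: "cideal I" and "md I x x'" "md I y y'"
  then have "(x - x') * y + x' * (y - y') \<in> I"
    unfolding md_def using csub_add cideal_left cideal_right cideal_csub by blast
  then show ?thesis by (simp add: md_def algebra_simps)
qed

lemma md_sum: "csub I \<Longrightarrow> (\<And>a. a \<in> A \<Longrightarrow> md I (f a) (g a)) \<Longrightarrow> md I (sum f A) (sum g A)"
  by (induction A rule: infinite_finite_induct) (auto intro: md_add)

lemma md_sum_list: "csub I \<Longrightarrow> (\<And>a. a \<in> set xs \<Longrightarrow> md I (f a) (g a)) \<Longrightarrow>
    md I (sum_list (map f xs)) (sum_list (map g xs))"
  by (induction xs) (auto intro: md_add)

lemma md_lin: "csub I \<Longrightarrow> (\<And>k. k \<in> Poly_Mapping.keys x \<Longrightarrow> md I (f k) (g k)) \<Longrightarrow> md I (lin f x) (lin g x)"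
  unfolding lin_def by (intro md_sum md_smul) auto

lemma md_clin: "csub S \<Longrightarrow> clin F \<Longrightarrow> clin G \<Longrightarrow> (\<And>k. md S (F (pt k)) (G (pt k))) \<Longrightarrow> md S (F x) (G x)"
  using clin_into[of S "\<lambda>x. F x - G x" x] clin_sub[of F G] by (simp add: md_def)

lemma md_zero: "md I x 0 \<longleftrightarrow> x \<in> I"
  by (simp add: md_def)

lemma md_map: "clin F \<Longrightarrow> (\<And>x. x \<in> I \<Longrightarrow> F x \<in> I') \<Longrightarrow> md I x y \<Longrightarrow> md I' (F x) (F y)"
  by (simp add: md_def flip: clin_diff)

lemma md_in: "csub I \<Longrightarrow> md I x y \<Longrightarrow> x \<in> I \<longleftrightarrow> y \<in> I"
  using csub_add[of I "x - y" y] csub_diff[of I x "x - y"] by (auto simp: md_def)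

lemma tnull_csub: "csub (tnull A B)"
  unfolding tnull_def by (rule csub_span)

lemma tnullI: "x \<in> A \<or> y \<in> B \<Longrightarrow> tens x y \<in> tnull A B"
  unfolding tnull_def by (rule smul.span_base) auto

text \<open>Pure tensors with one vanishing factor span \<open>tnull\<close>, so only these have to
  be tested. The slice maps below are shown to be well defined in this way.\<close>

lemma tnull_into:
  assumes "clin F" "csub S" "\<And>x y. x \<in> A \<or> y \<in> B \<Longrightarrow> F (tens x y) \<in> S" "z \<in> tnull A B"
  shows "F z \<in> S"
proof -
  have "z \<in> {z. F z \<in> S}"
    using assms(4) unfolding tnull_def
    by (rule span_into[OF csub_vimage[OF assms(1,2)], rotated]) (use assms(3) in auto)
  then show ?thesis by simp
qed

lemma cideal_tnull:
  fixes A :: "('a::monoid_add \<Rightarrow>\<^sub>0 complex) set" and B :: "('b::monoid_add \<Rightarrow>\<^sub>0 complex) set"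
  assumes "cideal A" "cideal B"
  shows "cideal (tnull A B)"
proof -
  have "pt k * z \<in> tnull A B \<and> z * pt k \<in> tnull A B" if "z \<in> tnull A B" for k z
  proof (cases k)
    case (Pair u v)
    have 1: "pt k = tens (pt u) (pt v)" by (simp add: Pair)
    have e: "pt k * tens x y = tens (pt u * x) (pt v * y)" "tens x y * pt k = tens (x * pt u) (y * pt v)" for x y
      unfolding 1 by (simp_all only: tens_mult)
    have "pt k * z \<in> tnull A B"
    proof (rule tnull_into[OF _ tnull_csub _ that, of "\<lambda>z. pt k * z"])
      show "pt k * tens x y \<in> tnull A B" if "x \<in> A \<or> y \<in> B" for x y
        unfolding e using that cideal_left[OF assms(1)] cideal_left[OF assms(2)] by (intro tnullI) auto
    qed (rule clin_mult_left[OF clin_id])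
    moreover have "z * pt k \<in> tnull A B"
    proof (rule tnull_into[OF _ tnull_csub _ that, of "\<lambda>z. z * pt k"])
      show "tens x y * pt k \<in> tnull A B" if "x \<in> A \<or> y \<in> B" for x y
        unfolding e using that cideal_right[OF assms(1)] cideal_right[OF assms(2)] by (intro tnullI) auto
    qed (rule clin_mult_right[OF clin_id])
    ultimately show ?thesis ..
  qed
  then have 1: "pt k * z \<in> tnull A B" "z * pt k \<in> tnull A B" if "z \<in> tnull A B" for k z
    using that by auto
  have 2: "a * z \<in> tnull A B" if z: "z \<in> tnull A B" for a z
    by (rule clin_into[OF tnull_csub, of "\<lambda>a. a * z"]) (rule clin_mult_right[OF clin_id], rule 1[OF z])
  have 3: "z * a \<in> tnull A B" if z: "z \<in> tnull A B" for a z
    by (rule clin_into[OF tnull_csub, of "\<lambda>a. z * a"]) (rule clin_mult_left[OF clin_id], rule 1[OF z])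
  show ?thesis unfolding cideal_def by (intro conjI allI ballI tnull_csub 2 3)
qed

lemma tnull_md: "md A x x' \<Longrightarrow> md B y y' \<Longrightarrow> csub A \<Longrightarrow> csub B \<Longrightarrow> md (tnull A B) (tens x y) (tens x' y')"
proof -
  assume "md A x x'" "md B y y'" "csub A" "csub B"
  then have 1: "x - x' \<in> A" "y - y' \<in> B" by (simp_all add: md_def)
  have "tens (x - x') y + tens x' (y - y') \<in> tnull A B"
    by (rule csub_add[OF tnull_csub]) (rule tnullI, rule disjI1, rule 1, rule tnullI, rule disjI2, rule 1)
  then show ?thesis unfolding md_def tens_diff_left tens_diff_right by simp
qed

section \<open>Free algebras\<close>

lemma wd_plus [simp]: "Wd u + Wd v = Wd (u @ v)" and letters_plus [simp]: "letters (x + y) = letters x @ letters y"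
  and letters_zero [simp]: "letters 0 = []" and wd_zero: "(0::'a wd) = Wd []"
  by (simp_all add: plus_wd_def zero_wd_def)

lemma var_mult_pt: "var a * pt w = pt (Wd (a # letters w))"
  by (cases w) (simp add: var_def)

lemma pt_word: "pt w = prod_list (map var (letters w))"
proof (induction "letters w" arbitrary: w)
  case Nil
  then show ?case by (cases w) (simp add: one_pt wd_zero del: single_one)
next
  case (Cons a v)
  then have "pt (Wd v) = prod_list (map var v)" by simp
  moreover have "w = Wd (a # v)" using Cons(2) by (cases w) simp
  ultimately show ?case using var_mult_pt[of a "Wd v"] by simp
qed

lemma clin_hom_ext [simp, intro]: "clin (hom_ext f)"
  unfolding hom_ext_def by simp

lemma hom_ext_pt [simp]: "hom_ext f (pt w) = prod_list (map f (letters w))"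
  by (simp add: hom_ext_def)

lemma hom_ext_mult: "hom_ext f (x * y) = hom_ext f x * hom_ext f y"
  by (rule clin2_eqI[of "\<lambda>x y. hom_ext f (x * y)" "\<lambda>x y. hom_ext f x * hom_ext f y"])
    (auto intro!: clin_comp[OF clin_hom_ext] clin_intros)

lemma hom_ext_var [simp]: "hom_ext f (var a) = f a"
  by (simp add: var_def)

lemma hom_ext_one [simp]: "hom_ext f 1 = 1"
  unfolding one_pt hom_ext_pt by simp

text \<open>Words grow by a letter on the left. This fits the representation \<open>act\<close> and
  the twisted derivations, whose rules are stated for left multiplication by one generator.\<close>

lemma free_induct [case_names add smul one var]:
  assumes "\<And>x y. Q x \<Longrightarrow> Q y \<Longrightarrow> Q (x + y)" "\<And>c x. Q x \<Longrightarrow> Q (smul c x)" "Q 1" "\<And>a x. Q x \<Longrightarrow> Q (var a * x)"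
  shows "Q (x :: 'a free)"
proof -
  have w: "Q (pt w)" for w :: "'a wd"
  proof -
    have "Q (prod_list (map var v))" for v :: "'a list"
      by (induction v) (auto simp: assms)
    then show ?thesis by (simp only: pt_word)
  qed
  have z: "Q 0" using assms(2)[OF assms(3), of 0] by simp
  have "csub {x. Q x}"
    using z assms(1,2) by (auto simp: csub_def)
  then have "x \<in> {x. Q x}"
    by (rule clin_into[OF _ clin_id]) (rule CollectI, rule w)
  then show ?thesis by (rule CollectD)
qed

section \<open>Antilinear maps and the involution of \<open>P\<close>\<close>

text \<open>Conjugating coefficients turns an antilinear map into a linear one, so that the rules
  for \<open>lin\<close> and \<open>clin\<close> carry over.\<close>

definition cjm :: "('a \<Rightarrow>\<^sub>0 complex) \<Rightarrow> ('a \<Rightarrow>\<^sub>0 complex)" where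
  "cjm x = Poly_Mapping.map cnj x"

lemma lookup_cjm [simp]: "Poly_Mapping.lookup (cjm x) k = cnj (Poly_Mapping.lookup x k)"
  by (simp add: cjm_def Poly_Mapping.map.rep_eq when_def)

lemma cjm_simps [simp]:
  "cjm (x + y) = cjm x + cjm y" "cjm (smul c x) = smul (cnj c) (cjm x)" "cjm (pt k) = pt k"
  "cjm (cjm x) = x" "Poly_Mapping.keys (cjm x) = Poly_Mapping.keys x"
  by (auto intro!: poly_mapping_eqI simp: lookup_add lookup_single when_def in_keys_iff)

lemma antilin_conv: "antilin f x = lin f (cjm x)"
  by (simp add: antilin_def lin_def)

definition alin :: "(('a \<Rightarrow>\<^sub>0 complex) \<Rightarrow> ('b \<Rightarrow>\<^sub>0 complex)) \<Rightarrow> bool" where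
  "alin F \<longleftrightarrow> (\<forall>x y. F (x + y) = F x + F y) \<and> (\<forall>c x. F (smul c x) = smul (cnj c) (F x))"

lemma alin_antilin [simp, intro]: "alin (antilin f)"
  by (simp add: alin_def antilin_conv lin_add lin_smul)

lemma antilin_pt [simp]: "antilin f (pt k) = f k"
  by (simp add: antilin_conv)

lemma alin_cjm: "alin F \<Longrightarrow> clin (\<lambda>x. F (cjm x))"
  by (simp add: clin_def alin_def)

lemma alin_add: "alin F \<Longrightarrow> F (x + y) = F x + F y"
  and alin_smul: "alin F \<Longrightarrow> F (smul c x) = smul (cnj c) (F x)"
  by (simp_all add: alin_def)

lemma alin_eqI:
  assumes "alin F" "alin G" "\<And>k. F (pt k) = G (pt k)"
  shows "F x = G x"
  using clin_eqI[OF alin_cjm[OF assms(1)] alin_cjm[OF assms(2)], of "cjm x"] assms(3) by simp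

lemma alin_diff: "alin F \<Longrightarrow> F (x - y) = F x - F y"
  using clin_diff[OF alin_cjm, of F "cjm x" "cjm y"] alin_add[of F "x - y" y] by simp

lemma alin_minus: "alin F \<Longrightarrow> F (- x) = - F x"
  using alin_smul[of F "-1" x] by (simp add: smul_minus)

lemma alin_zero: "alin F \<Longrightarrow> F 0 = 0"
  using alin_smul[of F 0 0] by simp

lemma alin_clin: "alin F \<Longrightarrow> clin G \<Longrightarrow> alin (\<lambda>x. G (F x))"
  and clin_alin: "clin F \<Longrightarrow> alin G \<Longrightarrow> alin (\<lambda>x. G (F x))"
  and alin_alin: "alin F \<Longrightarrow> alin G \<Longrightarrow> clin (\<lambda>x. G (F x))"
  by (simp_all add: alin_def clin_def)

lemma alin_pstar [simp, intro]: "alin pstar"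
  unfolding pstar_def by simp

lemma pstar_pt: "pstar (pt w) = pt (Wd (rev (map gen_star (letters w))))"
  by (simp add: pstar_def)

lemma pstar_var [simp]: "pstar (var a) = var (gen_star a)"
  by (simp add: var_def pstar_pt)

lemma pstar_one [simp]: "pstar 1 = 1"
  unfolding one_pt pstar_pt by (simp add: wd_zero)

lemmas pstar_add [simp] = alin_add[OF alin_pstar] and pstar_diff [simp] = alin_diff[OF alin_pstar]
  and pstar_smul [simp] = alin_smul[OF alin_pstar] and pstar_zero [simp] = alin_zero[OF alin_pstar]
  and pstar_minus [simp] = alin_minus[OF alin_pstar]

lemma pstar_mult [simp]: "pstar (x * y) = pstar y * pstar x"
proof -
  have 1: "pstar (pt w * y) = pstar y * pstar (pt w)" for w y
    by (rule alin_eqI[of "\<lambda>y. pstar (pt w * y)" "\<lambda>y. pstar y * pstar (pt w)"])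
      (simp_all add: alin_def algebra_simps pstar_pt)
  show ?thesis
    by (rule alin_eqI[of "\<lambda>x. pstar (x * y)" "\<lambda>x. pstar y * pstar x", OF _ _ 1])
      (simp_all add: alin_def algebra_simps)
qed

lemma gen_star_star [simp]: "gen_star (gen_star a) = a"
  by (cases a) auto

lemma pstar_pstar [simp]: "pstar (pstar x) = x"
proof (rule clin_eqI[of "\<lambda>x. pstar (pstar x)" "\<lambda>x. x"])
  show "pstar (pstar (pt w)) = pt w" for w
    by (cases w) (simp add: pstar_pt rev_map o_def)
qed (auto intro: alin_alin)

text \<open>The power of z that the coaction attaches to a generator. Words are homogeneous for it,
  see \<open>coactP_pt\<close>.\<close>

fun gdeg :: "gen \<Rightarrow> int" where
  "gdeg Al = 1" | "gdeg Als = -1" | "gdeg Ga = 1" | "gdeg Gas = -1"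

definition wdg :: "gen wd \<Rightarrow> int" where
  "wdg w = sum_list (map gdeg (letters w))"

lemma wdg_simps [simp]: "wdg (u + v) = wdg u + wdg v" "wdg 0 = 0" "wdg (Wd []) = 0" "wdg (Wd (a # as)) = gdeg a + wdg (Wd as)"
  by (simp_all add: wdg_def)

section \<open>Normal forms in \<open>P\<close>\<close>

locale suq =
  fixes q :: real
  assumes q0 [simp]: "q \<noteq> 0" and q1: "-1 < q" "q < 1"
begin

abbreviation Q :: complex where "Q \<equiv> complex_of_real q"
abbreviation E where "E \<equiv> md (PI q)"

lemma PI_cideal: "cideal (PI q)"
  unfolding PI_def by (rule cideal_ideal2)

lemmas PI_csub = cideal_csub[OF PI_cideal]
lemmas E_refl [simp] = md_refl[OF PI_csub]
  and E_eq = md_eq[OF PI_csub]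
  and E_sym = md_sym[OF PI_csub]
  and E_trans [trans] = md_trans[OF PI_csub]
  and E_add = md_add[OF PI_csub]
  and E_diff = md_diff[OF PI_csub]
  and E_smul = md_smul[OF PI_csub]
  and E_mult = md_mult[OF PI_cideal]

lemma E_rel: "x \<in> rels q \<union> pstar ` rels q \<Longrightarrow> x = y - z \<Longrightarrow> E y z"
  unfolding md_def PI_def by (drule ideal2_gen) (simp only:)

text \<open>The factor that appears when \<open>\<gamma>\<close> or \<open>\<gamma>s\<close> is
  moved to the right past the power \<open>Apow t\<close>; it also serves as the scaling factor of
  the grading automorphisms \<open>sg\<close>.\<close>

definition zf :: "int \<Rightarrow> complex" where
  "zf t = Q powi (- t)"

lemma zf_simps [simp]: "zf (t + 1) = zf t / Q" "zf (t - 1) = zf t * Q" "zf 0 = 1" "zf t \<noteq> 0"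
  by (simp_all add: zf_def power_int_diff power_int_minus power_int_add divide_inverse)

lemma zf_one [simp]: "zf 1 = 1 / Q" "zf (-1) = Q"
  using zf_simps(1)[of 0] zf_simps(2)[of 0] by simp_all

text \<open>The left regular representation on the span of the symbols \<open>(t, k, l)\<close>, which stand
  for \<open>\<alpha>\<^sup>t\<gamma>\<^sup>k\<gamma>\<^sup>*\<^sup>l\<close>.\<close>

fun agb :: "gen \<Rightarrow> int \<times> nat \<times> nat \<Rightarrow> (int \<times> nat \<times> nat \<Rightarrow>\<^sub>0 complex)" where
  "agb Al (t, k, l) = pt (t + 1, k, l) + (if t < 0 then Poly_Mapping.single (t + 1, k + 1, l + 1) (zf t ^ 2) else 0)"
| "agb Als (t, k, l) = pt (t - 1, k, l) + (if t > 0 then Poly_Mapping.single (t - 1, k + 1, l + 1) ((Q * zf t) ^ 2) else 0)"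
| "agb Ga (t, k, l) = Poly_Mapping.single (t, k + 1, l) (zf t)"
| "agb Gas (t, k, l) = Poly_Mapping.single (t, k, l + 1) (zf t)"

definition ag :: "gen \<Rightarrow> (int \<times> nat \<times> nat \<Rightarrow>\<^sub>0 complex) \<Rightarrow> (int \<times> nat \<times> nat \<Rightarrow>\<^sub>0 complex)" where
  "ag a = lin (agb a)"

definition act :: "gen free \<Rightarrow> (int \<times> nat \<times> nat \<Rightarrow>\<^sub>0 complex) \<Rightarrow> (int \<times> nat \<times> nat \<Rightarrow>\<^sub>0 complex)" where
  "act x v = lin (\<lambda>w. foldr ag (letters w) v) x"

definition nf :: "gen free \<Rightarrow> (int \<times> nat \<times> nat \<Rightarrow>\<^sub>0 complex)" where
  "nf x = act x (pt (0, 0, 0))"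

lemma clin_ag [simp, intro]: "clin (ag a)"
  by (simp add: ag_def)

lemma clin_act_left: "clin (\<lambda>x. act x v)"
  by (simp add: act_def)

lemma clin_act_right: "clin (act x)"
proof -
  have "clin (\<lambda>v. foldr ag w v)" for w
  proof (induction w)
    case Nil
    then show ?case by simp
  next
    case (Cons a w)
    then show ?case using clin_comp[OF clin_ag Cons] by simp
  qed
  then have "clin (\<lambda>v. act x v)" unfolding act_def by (rule clin_linF)
  then show ?thesis by simp
qed

lemma act_pt: "act (pt w) v = foldr ag (letters w) v"
  by (simp add: act_def)

lemma act_var [simp]: "act (var a) v = ag a v"
  by (simp add: var_def act_pt)

lemma act_one [simp]: "act 1 v = v"
  unfolding one_pt act_pt by simp

lemma act_mult [simp]: "act (x * y) v = act x (act y v)"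
proof -
  have 1: "act (pt w * y) v = act (pt w) (act y v)" for w y
    by (rule clin_eqI[of "\<lambda>y. act (pt w * y) v" "\<lambda>y. act (pt w) (act y v)"])
      (intro clin_comp[OF clin_act_left] clin_comp[OF clin_act_right] clin_act_left clin_mult_left clin_id
        | simp add: act_pt)+
  show ?thesis
    by (rule clin_eqI[of "\<lambda>x. act (x * y) v" "\<lambda>x. act x (act y v)", OF _ _ 1])
      (rule clin_comp[OF clin_act_left] clin_act_left clin_mult_right clin_id)+
qed

lemmas act_lin [simp] = clin_add[OF clin_act_left] clin_diff[OF clin_act_left] clin_smul[OF clin_act_left]
  clin_minus[OF clin_act_left] clin_zero[OF clin_act_left]
lemmas act_lin_right = clin_add[OF clin_act_right] clin_diff[OF clin_act_right] clin_smul[OF clin_act_right]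
  clin_zero[OF clin_act_right]
lemmas ag_lin [simp] = clin_add[OF clin_ag] clin_diff[OF clin_ag] clin_smul[OF clin_ag]
  clin_minus[OF clin_ag] clin_zero[OF clin_ag]

lemma ag_single [simp]: "ag a (Poly_Mapping.single i c) = smul c (agb a i)"
  by (simp add: ag_def lin_single)

lemma clin_nf [simp, intro]: "clin nf"
  unfolding nf_def by (rule clin_act_left)

text \<open>The first three relations are selfadjoint, so passing to adjoints adds only the
  commutation rules of \<open>\<alpha>s\<close> with \<open>\<gamma>s\<close> and
  \<open>\<gamma>\<close>.\<close>

lemma rels_list: "s \<in> rels q \<union> pstar ` rels q \<longleftrightarrow>
   s \<in> {\<alpha>s * \<alpha> - \<gamma>s * \<gamma> - 1, \<alpha> * \<alpha>s - smul (Q^2) (\<gamma> * \<gamma>s) - 1, \<gamma> * \<gamma>s - \<gamma>s * \<gamma>,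
     smul Q (\<gamma> * \<alpha>) - \<alpha> * \<gamma>, smul Q (\<gamma>s * \<alpha>) - \<alpha> * \<gamma>s,
     smul Q (\<alpha>s * \<gamma>s) - \<gamma>s * \<alpha>s, smul Q (\<alpha>s * \<gamma>) - \<gamma> * \<alpha>s}"
  by (auto simp: rels_def)

text \<open>The operators \<open>ag\<close> satisfy the relations of P. The sign of \<open>t\<close>
  is split because the correction terms of \<open>agb Al\<close> and \<open>agb Als\<close> switch
  on at 0.\<close>

lemma act_rel_pt: "s \<in> rels q \<union> pstar ` rels q \<Longrightarrow> act s (pt i) = 0"
proof -
  obtain t k l where i: "i = (t, k, l)" by (cases i)
  assume s: "s \<in> rels q \<union> pstar ` rels q"
  have 1: "act (\<alpha>s * \<alpha> - \<gamma>s * \<gamma> - 1) (pt i) = 0"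
    by (rule poly_mapping_eqI, cases "t < 0"; cases "t = 0")
      (simp_all add: i lookup_add lookup_single when_def lookup_minus power2_eq_square distrib_left)
  have 2: "act (\<alpha> * \<alpha>s - smul (Q^2) (\<gamma> * \<gamma>s) - 1) (pt i) = 0"
    by (rule poly_mapping_eqI, cases "t < 0"; cases "t = 0")
      (simp_all add: i lookup_add lookup_single when_def lookup_minus power2_eq_square distrib_left)
  have 3: "act (\<gamma> * \<gamma>s - \<gamma>s * \<gamma>) (pt i) = 0"
    by (rule poly_mapping_eqI, cases "t < 0"; cases "t = 0")
      (simp_all add: i lookup_add lookup_single when_def lookup_minus power2_eq_square distrib_left)
  have 4: "act (smul Q (\<gamma> * \<alpha>) - \<alpha> * \<gamma>) (pt i) = 0"
    by (rule poly_mapping_eqI, cases "t < 0"; cases "t = 0")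
      (simp_all add: i lookup_add lookup_single when_def lookup_minus power2_eq_square distrib_left)
  have 5: "act (smul Q (\<gamma>s * \<alpha>) - \<alpha> * \<gamma>s) (pt i) = 0"
    by (rule poly_mapping_eqI, cases "t < 0"; cases "t = 0")
      (simp_all add: i lookup_add lookup_single when_def lookup_minus power2_eq_square distrib_left)
  have 6: "act (smul Q (\<alpha>s * \<gamma>s) - \<gamma>s * \<alpha>s) (pt i) = 0"
    by (rule poly_mapping_eqI, cases "t < 0"; cases "t = 0")
      (simp_all add: i lookup_add lookup_single when_def lookup_minus power2_eq_square distrib_left)
  have 7: "act (smul Q (\<alpha>s * \<gamma>) - \<gamma> * \<alpha>s) (pt i) = 0"
    by (rule poly_mapping_eqI, cases "t < 0"; cases "t = 0")
      (simp_all add: i lookup_add lookup_single when_def lookup_minus power2_eq_square distrib_left)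
  from s show ?thesis
    unfolding rels_list insert_iff empty_iff by (elim disjE FalseE) (simp_all only: 1 2 3 4 5 6 7)
qed

lemma act_PI: "x \<in> PI q \<Longrightarrow> act x v = 0"
proof -
  have 0: "csub {0 :: int \<times> nat \<times> nat \<Rightarrow>\<^sub>0 complex}" by (simp add: csub_def)
  have 1: "act s v = 0" if "s \<in> rels q \<union> pstar ` rels q" for s v
    using clin_into[OF 0 clin_act_right, of s v] act_rel_pt[OF that] by simp
  assume "x \<in> PI q"
  then have "act x v \<in> {0}"
    unfolding PI_def by (rule ideal2_into[OF 0 clin_act_left, rotated]) (simp add: 1 act_lin_right)
  then show ?thesis by simp
qed

lemma E_rels:
  "E (\<alpha>s * \<alpha>) (1 + \<gamma>s * \<gamma>)" "E (\<alpha> * \<alpha>s) (1 + smul (Q^2) (\<gamma> * \<gamma>s))" "E (\<gamma>s * \<gamma>) (\<gamma> * \<gamma>s)"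
  "E (\<gamma> * \<alpha>) (smul (1/Q) (\<alpha> * \<gamma>))" "E (\<gamma>s * \<alpha>) (smul (1/Q) (\<alpha> * \<gamma>s))"
  "E (\<gamma>s * \<alpha>s) (smul Q (\<alpha>s * \<gamma>s))" "E (\<gamma> * \<alpha>s) (smul Q (\<alpha>s * \<gamma>))"
proof -
  note r = E_rel[unfolded rels_list]
  show "E (\<alpha>s * \<alpha>) (1 + \<gamma>s * \<gamma>)" "E (\<alpha> * \<alpha>s) (1 + smul (Q^2) (\<gamma> * \<gamma>s))" 
    by (rule r[OF insertI1]; simp) (rule r[OF insertI2, OF insertI1]; simp)
  show "E (\<gamma>s * \<gamma>) (\<gamma> * \<gamma>s)" by (rule E_sym, rule r[OF insertI2, OF insertI2, OF insertI1]; simp)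
  have "E (smul (1/Q) (smul Q (\<gamma> * \<alpha>))) (smul (1/Q) (\<alpha> * \<gamma>))" "E (smul (1/Q) (smul Q (\<gamma>s * \<alpha>))) (smul (1/Q) (\<alpha> * \<gamma>s))"
    by (rule E_smul, rule r[of "smul Q (\<gamma> * \<alpha>) - \<alpha> * \<gamma>"], blast, simp)
      (rule E_smul, rule r[of "smul Q (\<gamma>s * \<alpha>) - \<alpha> * \<gamma>s"], blast, simp)
  then show "E (\<gamma> * \<alpha>) (smul (1/Q) (\<alpha> * \<gamma>))" "E (\<gamma>s * \<alpha>) (smul (1/Q) (\<alpha> * \<gamma>s))"
    by simp_all
  show "E (\<gamma>s * \<alpha>s) (smul Q (\<alpha>s * \<gamma>s))" by (rule E_sym, rule r[of "smul Q (\<alpha>s * \<gamma>s) - \<gamma>s * \<alpha>s"], blast, simp)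
  show "E (\<gamma> * \<alpha>s) (smul Q (\<alpha>s * \<gamma>))" by (rule E_sym, rule r[of "smul Q (\<alpha>s * \<gamma>) - \<gamma> * \<alpha>s"], blast, simp)
qed

lemma E_mult_cong_left: "E x y \<Longrightarrow> E (z * x) (z * y)"
  and E_mult_cong_right: "E x y \<Longrightarrow> E (x * z) (y * z)"
  by (simp_all add: E_mult)

lemma E_smulD: "E x (smul c y) \<Longrightarrow> E (smul d x) (smul (d * c) y)"
  using E_smul[of x "smul c y" d] by simp

lemma E_commute_power:
  assumes "E (x * y) (smul c (y * x))"
  shows "E (x * y ^ n) (smul (c ^ n) (y ^ n * x))"
proof (induction n)
  case (Suc n)
  have "E (x * y ^ Suc n) (smul c (y * x) * y ^ n)"
    using E_mult_cong_right[OF assms, of "y ^ n"] by (simp add: mult.assoc)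
  also have "smul c (y * x) * y ^ n = smul c (y * (x * y ^ n))" by (simp add: mult.assoc)
  also have "E \<dots> (smul c (y * smul (c ^ n) (y ^ n * x)))"
    by (rule E_smul, rule E_mult_cong_left, rule Suc)
  finally show ?case by (simp add: mult.assoc)
qed simp

definition Mf :: "int \<times> nat \<times> nat \<Rightarrow> gen free" where
  "Mf = (\<lambda>(t, k, l). M t k l)"

definition Apow :: "int \<Rightarrow> gen free" where
  "Apow t = (if t \<ge> 0 then \<alpha> ^ nat t else \<alpha>s ^ nat (- t))"

lemma Mf_Apow: "Mf (t, k, l) = Apow t * \<gamma> ^ k * \<gamma>s ^ l"
  by (simp add: Mf_def M_def Apow_def)

lemma Ga_Apow: "E (\<gamma> * Apow t) (smul (zf t) (Apow t * \<gamma>))"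
  using E_commute_power[OF E_rels(4), of "nat t"] E_commute_power[OF E_rels(7), of "nat (- t)"]
  by (auto simp: Apow_def zf_def power_int_def power_divide inverse_eq_divide)

lemma Gas_Apow: "E (\<gamma>s * Apow t) (smul (zf t) (Apow t * \<gamma>s))"
  using E_commute_power[OF E_rels(5), of "nat t"] E_commute_power[OF E_rels(6), of "nat (- t)"]
  by (auto simp: Apow_def zf_def power_int_def power_divide inverse_eq_divide)

lemma Gas_Ga_pow: "E (\<gamma>s * \<gamma> ^ k) (\<gamma> ^ k * \<gamma>s)"
  using E_commute_power[of \<gamma>s \<gamma> 1 k] E_rels(3) by simp

lemma Ga_Mf: "E (\<gamma> * Mf (t, k, l)) (smul (zf t) (Mf (t, k + 1, l)))"
  using E_mult_cong_right[OF Ga_Apow[of t], of "\<gamma> ^ k * \<gamma>s ^ l"]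
  by (simp add: Mf_Apow mult.assoc)

lemma Gas_Mf: "E (\<gamma>s * Mf (t, k, l)) (smul (zf t) (Mf (t, k, l + 1)))"
proof -
  have "E (\<gamma>s * Mf (t, k, l)) (smul (zf t) (Apow t * \<gamma>s) * (\<gamma> ^ k * \<gamma>s ^ l))"
    using E_mult_cong_right[OF Gas_Apow[of t], of "\<gamma> ^ k * \<gamma>s ^ l"]
    by (simp add: Mf_Apow mult.assoc)
  also have "\<dots> = smul (zf t) (Apow t * ((\<gamma>s * \<gamma> ^ k) * \<gamma>s ^ l))" by (simp add: mult.assoc)
  also have "E \<dots> (smul (zf t) (Apow t * ((\<gamma> ^ k * \<gamma>s) * \<gamma>s ^ l)))"
    by (intro E_smul E_mult_cong_left E_mult_cong_right Gas_Ga_pow)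
  finally show ?thesis by (simp add: Mf_Apow mult.assoc)
qed

lemma GaGas_Mf: "E (\<gamma> * \<gamma>s * Mf (t, k, l)) (smul (zf t ^ 2) (Mf (t, k + 1, l + 1)))"
proof -
  have "E (\<gamma> * (\<gamma>s * Mf (t, k, l))) (\<gamma> * smul (zf t) (Mf (t, k, l + 1)))"
    by (intro E_mult_cong_left Gas_Mf)
  also have "\<dots> = smul (zf t) (\<gamma> * Mf (t, k, l + 1))" by simp
  also have "E \<dots> (smul (zf t * zf t) (Mf (t, k + 1, l + 1)))"
    by (rule E_smulD, rule Ga_Mf)
  also have "zf t * zf t = zf t ^ 2" by (simp add: power2_eq_square)
  finally show ?thesis by (simp add: mult.assoc)
qed

text \<open>For negative \<open>t\<close> the new \<open>\<alpha>\<close> meets a factor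
  \<open>\<alpha>s\<close>. The product relation leaves a term with
  \<open>\<gamma> * \<gamma>s\<close>, which is then moved past the remaining power; this is the
  second term of \<open>agb\<close>.\<close>

lemma Al_Mf: "E (\<alpha> * Mf (t, k, l)) (lin Mf (agb Al (t, k, l)))"
proof (cases "t < 0")
  case False
  then have "nat (t + 1) = Suc (nat t)" by simp
  then show ?thesis using False by (intro E_eq) (simp add: Mf_Apow Apow_def mult.assoc)
next
  case True
  then have "nat (- t) = Suc (nat (- (t + 1)))" by simp
  then have "Apow t = \<alpha>s * Apow (t + 1)" using True by (auto simp: Apow_def)
  then have "\<alpha> * Mf (t, k, l) = (\<alpha> * \<alpha>s) * Mf (t + 1, k, l)" by (simp add: Mf_Apow mult.assoc)
  also have "E \<dots> ((1 + smul (Q^2) (\<gamma> * \<gamma>s)) * Mf (t + 1, k, l))"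
    by (intro E_mult_cong_right E_rels)
  also have "\<dots> = Mf (t + 1, k, l) + smul (Q^2) (\<gamma> * \<gamma>s * Mf (t + 1, k, l))" by (simp add: algebra_simps)
  also have "E \<dots> (Mf (t + 1, k, l) + smul (Q^2 * zf (t + 1) ^ 2) (Mf (t + 1, k + 1, l + 1)))"
    by (intro E_add E_refl E_smulD GaGas_Mf)
  also have "Q^2 * zf (t + 1) ^ 2 = zf t ^ 2" by (simp add: power_divide)
  finally show ?thesis using True by (simp add: lin_add lin_single)
qed

lemma Als_Mf: "E (\<alpha>s * Mf (t, k, l)) (lin Mf (agb Als (t, k, l)))"
proof (cases "t > 0")
  case False
  then have "nat (- (t - 1)) = Suc (nat (- t))" by simp
  then show ?thesis using False by (intro E_eq) (auto simp: Mf_Apow Apow_def mult.assoc)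
next
  case True
  then have "nat t = Suc (nat (t - 1))" by simp
  then have "Apow t = \<alpha> * Apow (t - 1)" using True by (auto simp: Apow_def)
  then have "\<alpha>s * Mf (t, k, l) = (\<alpha>s * \<alpha>) * Mf (t - 1, k, l)" by (simp add: Mf_Apow mult.assoc)
  also have "E \<dots> ((1 + \<gamma> * \<gamma>s) * Mf (t - 1, k, l))"
    by (intro E_mult_cong_right E_trans[OF E_rels(1)] E_add E_refl E_rels(3))
  also have "\<dots> = Mf (t - 1, k, l) + (\<gamma> * \<gamma>s * Mf (t - 1, k, l))" by (simp add: algebra_simps)
  also have "E \<dots> (Mf (t - 1, k, l) + smul (zf (t - 1) ^ 2) (Mf (t - 1, k + 1, l + 1)))"
    by (intro E_add E_refl GaGas_Mf)
  finally show ?thesis using True by (simp add: lin_add lin_single mult.commute)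
qed

lemma var_Mf: "E (var a * Mf i) (lin Mf (agb a i))"
  using Al_Mf Als_Mf Ga_Mf Gas_Mf by (cases i; cases a) (simp_all add: lin_single)

text \<open>The spanning half: by \<open>var_Mf\<close>, left multiplication by a letter keeps the
  span of the monomials, with coefficients given by the representation.\<close>

lemma E_nf: "E x (lin Mf (nf x))"
proof (induction x rule: free_induct)
  case (add x y)
  then show ?case by (simp add: nf_def lin_add E_add)
next
  case (smul c x)
  then show ?case by (simp add: nf_def lin_smul E_smul)
next
  case one
  then show ?case by (simp add: nf_def Mf_def M_def)
next
  case (var a x)
  have "E (var a * x) (var a * lin Mf (nf x))"
    using var by (rule E_mult_cong_left)
  also have "\<dots> = lin (\<lambda>i. var a * Mf i) (nf x)" by (simp add: lin_mult_left)
  also have "E \<dots> (lin (\<lambda>i. lin Mf (agb a i)) (nf x))" by (intro md_lin PI_csub var_Mf)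
  also have "\<dots> = lin Mf (nf (var a * x))"
    by (simp add: nf_def ag_def clin_lin_comm[OF clin_lin])
  finally show ?case .
qed

text \<open>The representation factors through P by \<open>act_PI\<close>, and \<open>E_nf\<close>
  recovers an element from its normal form. Together they make congruence decidable by
  evaluation.\<close>

lemma E_iff_nf: "E x y \<longleftrightarrow> nf x = nf y"
proof
  assume "E x y"
  then show "nf x = nf y"
    using act_PI[of "x - y" "pt (0,0,0)"] by (simp add: md_def nf_def)
next
  assume "nf x = nf y"
  then show "E x y" using E_nf[of x] E_nf[of y] E_trans E_sym by metis
qed

lemma PI_iff_nf: "x \<in> PI q \<longleftrightarrow> nf x = 0"
  using E_iff_nf[of x 0] by (simp add: md_def nf_def)

lemma eqP_E: "eqP q x y \<longleftrightarrow> E x y"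
  by (simp add: eqP_def md_def)

end

section \<open>Twisted derivations and the first order calculus\<close>

datatype ix = I3 | Ip | Im

definition IX :: "ix set" where "IX = {I3, Ip, Im}"

lemma IX_all: "i \<in> IX"
  by (cases i) (auto simp: IX_def)

lemma finite_IX [simp]: "finite IX"
  by (simp add: IX_def)

lemma sum_IX: "sum f IX = f I3 + f Ip + f Im" for f :: "ix \<Rightarrow> 'b::comm_monoid_add"
  by (simp add: IX_def add.assoc)

text \<open>The power of the grading automorphism that is applied to a function when the basic form
  of this index is moved to its right, see \<open>et_fn\<close>.\<close>

fun mw :: "ix \<Rightarrow> int" where
  "mw I3 = 2" | "mw Ip = 1" | "mw Im = 1"

section \<open>Linear functionals and slices of tensors\<close>

definition fl :: "('a \<Rightarrow> complex) \<Rightarrow> ('a \<Rightarrow>\<^sub>0 complex) \<Rightarrow> complex" where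
  "fl f x = (\<Sum>k\<in>Poly_Mapping.keys x. Poly_Mapping.lookup x k * f k)"

text \<open>A functional is viewed as a linear map into the one-dimensional space over the unit
  type, so the rules for \<open>lin\<close> apply to it.\<close>

lemma fl_conv: "Poly_Mapping.single () (fl f x) = lin (\<lambda>k. Poly_Mapping.single () (f k)) x"
  by (rule poly_mapping_eqI) (simp add: fl_def lin_def lookup_sum)

lemma fl_conv': "fl f x = Poly_Mapping.lookup (lin (\<lambda>k. Poly_Mapping.single () (f k)) x) ()"
  by (simp flip: fl_conv)

lemma fl_simps [simp]:
  "fl f (x + y) = fl f x + fl f y" "fl f (smul c x) = c * fl f x" "fl f (x - y) = fl f x - fl f y"
  "fl f (pt k) = f k" "fl f 0 = 0" "fl f (- x) = - fl f x"
  by (simp_all add: fl_conv' lin_add lin_smul lin_diff lookup_add lookup_minus lin_minus)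

lemma fl_single [simp]: "fl f (Poly_Mapping.single k c) = c * f k"
  using fl_simps(2)[of f c "pt k"] by simp

lemma fl_eqI:
  assumes "\<And>x y. F (x + y) = F x + F y" "\<And>c x. F (smul c x) = c * F x"
    "\<And>x y. G (x + y) = G x + G y" "\<And>c x. G (smul c x) = c * G x" "\<And>k. F (pt k) = G (pt k)"
  shows "F x = (G x :: complex)"
proof -
  have "Poly_Mapping.single () (F x) = Poly_Mapping.single () (G x)"
    by (rule clin_eqI[of "\<lambda>x. Poly_Mapping.single () (F x)" "\<lambda>x. Poly_Mapping.single () (G x)"])
      (simp_all add: clin_def assms single_add)
  then show ?thesis by (metis lookup_single_eq)
qed

text \<open>The list \<open>xs\<close> is a coproduct of the functional. It has one entry for a
  character and two for a twisted derivation at the counit.\<close>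

lemma fl_tensor_eqI:
  fixes x y :: "'a::monoid_add \<Rightarrow>\<^sub>0 complex"
  assumes "\<And>u v. \<phi> (u + v) = (\<Sum>a\<leftarrow>xs. fst a u * snd a v)"
  shows "fl \<phi> (x * y) = (\<Sum>a\<leftarrow>xs. fl (fst a) x * fl (snd a) y)"
proof -
  have 1: "fl \<phi> (pt u * y) = (\<Sum>a\<leftarrow>xs. fl (fst a) (pt u) * fl (snd a) y)" for u
    by (rule fl_eqI[of "\<lambda>y. fl \<phi> (pt u * y)" "\<lambda>y. \<Sum>a\<leftarrow>xs. fl (fst a) (pt u) * fl (snd a) y"])
      (simp_all add: distrib_left sum_list_addf assms sum_list_const_mult mult.left_commute)
  show ?thesis
    by (rule fl_eqI[of "\<lambda>x. fl \<phi> (x * y)" "\<lambda>x. \<Sum>a\<leftarrow>xs. fl (fst a) x * fl (snd a) y", OF _ _ _ _ 1])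
      (simp_all add: distrib_right sum_list_addf sum_list_const_mult mult.assoc)
qed

text \<open>The functional is applied to the second leg. Applied to a coproduct this is convolution,
  and applied to a one-form it extracts a coefficient.\<close>

definition slice :: "('b \<Rightarrow> complex) \<Rightarrow> ('a \<times> 'b \<Rightarrow>\<^sub>0 complex) \<Rightarrow> ('a \<Rightarrow>\<^sub>0 complex)" where
  "slice f = lin (\<lambda>(u, v). Poly_Mapping.single u (f v))"

lemma clin_slice [simp, intro]: "clin (slice f)"
  by (simp add: slice_def)

lemma slice_pt [simp]: "slice f (pt (u, v)) = Poly_Mapping.single u (f v)"
  by (simp add: slice_def)

lemma slice_tens [simp]: "slice f (tens x y) = smul (fl f y) x"
  by (rule clin2_eqI[of "\<lambda>x y. slice f (tens x y)" "\<lambda>x y. smul (fl f y) x"])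
    (simp_all add: clin_def tens_add_left tens_add_right clin_add[OF clin_slice] clin_smul[OF clin_slice]
      smul_add smul_add_left mult.commute)

lemma fl_one: "fl f 1 = f 0"
  unfolding one_pt by (rule fl_simps)

lemma slice_one [simp]: "slice f 1 = smul (f 0) 1"
  using slice_tens[of f 1 1] by (simp add: fl_one del: slice_tens)

lemma slice_smul_fun: "slice (\<lambda>v. c * f v) Y = smul c (slice f Y)"
  by (rule clin_eqI[of "\<lambda>Y. slice (\<lambda>v. c * f v) Y"]) (auto intro: clin_smulF)

lemma slice_add_fun: "slice (\<lambda>v. f v + g v) Y = slice f Y + slice g Y"
  by (rule clin_eqI[of "\<lambda>Y. slice (\<lambda>v. f v + g v) Y"]) (auto intro: clin_plus simp: single_add)

lemma tens_mult_pt: "tens x (pt b) * pt (u, v) = tens (x * pt u) (pt (b + v))"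
  by (simp only: tens_pt[symmetric] tens_mult pt_mult)

lemma slice_tens_mult: "slice f (tens x (pt b) * Y) = x * slice (\<lambda>v. f (b + v)) Y"
proof (rule clin_eqI[of "\<lambda>Y. slice f (tens x (pt b) * Y)" "\<lambda>Y. x * slice (\<lambda>v. f (b + v)) Y"])
  show "slice f (tens x (pt b) * pt k) = x * slice (\<lambda>v. f (b + v)) (pt k)" for k
    by (cases k) (simp add: tens_mult_pt single_smul_pt[of _ "f _"] del: smul_single)
qed (auto intro!: clin_comp[OF clin_slice] clin_mult_left clin_mult_right)

lemma slice_var_mult: "slice f (tens x (var b) * Y) = x * slice (\<lambda>v. f (Wd [b] + v)) Y"
  unfolding var_def by (rule slice_tens_mult)

definition ew :: "gen wd \<Rightarrow> complex" where
  "ew w = prod_list (map gen_counit (letters w))"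

lemma counit_fl: "counit = fl ew"
  by (rule ext) (simp add: counit_def fl_def ew_def)

lemma ew_simps [simp]: "ew (u + v) = ew u * ew v" "ew (Wd (a # w)) = gen_counit a * ew (Wd w)" "ew (Wd []) = 1"
  by (simp_all add: ew_def)

lemma counit_mult: "counit (x * y) = counit x * counit y"
  unfolding counit_fl using fl_tensor_eqI[of ew "[(ew, ew)]"] by simp

lemma fl_var: "fl f (var a) = f (Wd [a])"
  by (simp add: var_def)

lemma counit_simps [simp]:
  "counit (x + y) = counit x + counit y" "counit (smul c x) = c * counit x" "counit (x - y) = counit x - counit y"
  "counit (var a) = gen_counit a" "counit 1 = 1" "counit (- x) = - counit x" "counit 0 = 0"
  by (simp_all add: counit_fl fl_var fl_one wd_zero)

context suq
begin

lemma zf_add: "zf (a + b) = zf a * zf b"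
  by (simp add: zf_def power_int_add power_int_diff power_int_minus divide_inverse)

lemma zf_two [simp]: "zf 2 = 1 / Q^2" "zf (-2) = Q^2"
  by (simp_all add: zf_def power_int_minus divide_inverse)

lemma zf_minus: "zf (- a) = 1 / zf a"
  using zf_add[of a "- a"] by (simp add: field_simps)

text \<open>The grading automorphism which multiplies degree n by q to the power -mn. It is the
  twist between left and right multiplication of the basic one-forms by functions.\<close>

definition sg :: "int \<Rightarrow> gen free \<Rightarrow> gen free" where
  "sg m = lin (\<lambda>w. Poly_Mapping.single w (zf (m * wdg w)))"

lemma clin_sg [simp, intro]: "clin (sg m)"
  by (simp add: sg_def)

lemmas sg_lin [simp] = clin_add[OF clin_sg] clin_diff[OF clin_sg] clin_smul[OF clin_sg] clin_minus[OF clin_sg]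
  clin_zero[OF clin_sg]

lemma sg_pt [simp]: "sg m (pt w) = Poly_Mapping.single w (zf (m * wdg w))"
  by (simp add: sg_def)

lemma sg_var [simp]: "sg m (var a) = smul (zf (m * gdeg a)) (var a)"
  by (simp add: var_def)

lemma sg_one [simp]: "sg m 1 = 1"
  unfolding one_pt sg_pt by simp

lemma sg_mult [simp]: "sg m (x * y) = sg m x * sg m y"
proof -
  have 1: "sg m (pt w * pt v) = sg m (pt w) * sg m (pt v)" for w v
    by (simp add: mult_single zf_add distrib_left)
  show ?thesis
    by (rule clin2_eqI[of "\<lambda>x y. sg m (x * y)" "\<lambda>x y. sg m x * sg m y", OF _ _ _ _ 1])
      (simp_all add: clin_def algebra_simps)
qed

lemma sg_sg: "sg m (sg k x) = sg (m + k) x"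
  by (rule clin_eqI[of "\<lambda>x. sg m (sg k x)", OF clin_comp[OF clin_sg clin_sg] clin_sg])
    (simp add: sg_def lin_single zf_add[symmetric] algebra_simps)

text \<open>The coefficients of dp = p1 \<pi>(p2) on generators. Modulo R_3 one has \<pi>(\<alpha>s)
  = -q^2 \<pi>(\<alpha>), hence \<pi>(\<alpha>) = \<eta>3 / (1 + q^2). The factor
  \<open>1 / Q\<close> at \<open>Gas\<close> undoes the q in \<open>\<eta>m\<close>.\<close>

fun dl :: "ix \<Rightarrow> gen \<Rightarrow> gen free" where
  "dl I3 Al = smul (1 / (1 + Q^2)) \<alpha>" | "dl I3 Als = smul (- (Q^2) / (1 + Q^2)) \<alpha>s"
| "dl I3 Ga = smul (1 / (1 + Q^2)) \<gamma>" | "dl I3 Gas = smul (- (Q^2) / (1 + Q^2)) \<gamma>s"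
| "dl Ip Al = smul Q \<gamma>s" | "dl Ip Ga = \<alpha>s" | "dl Ip _ = 0"
| "dl Im Als = \<gamma>" | "dl Im Gas = smul (1 / Q) \<alpha>" | "dl Im _ = 0"

text \<open>The Leibniz rule with coefficients collected on the left: the form produced by the first
  letter has to pass the rest of the word, which picks up the twist.\<close>

fun ddw :: "ix \<Rightarrow> gen list \<Rightarrow> gen free" where
  "ddw i [] = 0"
| "ddw i (a # w) = var a * ddw i w + dl i a * sg (mw i) (pt (Wd w))"

text \<open>\<open>dp = \<Sum>\<^sub>i (dd i p) \<eta>\<^sub>i\<close>\<close>

definition dd :: "ix \<Rightarrow> gen free \<Rightarrow> gen free" where
  "dd i = lin (\<lambda>w. ddw i (letters w))"

lemma clin_dd [simp, intro]: "clin (dd i)"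
  by (simp add: dd_def)

lemmas dd_lin [simp] = clin_add[OF clin_dd] clin_diff[OF clin_dd] clin_smul[OF clin_dd] clin_minus[OF clin_dd]
  clin_zero[OF clin_dd]

lemma dd_var_mult: "dd i (var a * y) = var a * dd i y + dl i a * sg (mw i) y"
proof (rule clin_eqI[of "\<lambda>y. dd i (var a * y)" "\<lambda>y. var a * dd i y + dl i a * sg (mw i) y"])
  show "dd i (var a * pt w) = var a * dd i (pt w) + dl i a * sg (mw i) (pt w)" for w
    unfolding var_mult_pt by (cases w) (simp add: dd_def)
qed (simp_all add: clin_def algebra_simps smul_add)

lemma dd_one [simp]: "dd i 1 = 0"
  unfolding one_pt by (simp add: dd_def del: single_one)

lemma dd_var [simp]: "dd i (var a) = dl i a"
  using dd_var_mult[of i a 1] by simp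

lemma dd_mult: "dd i (x * y) = x * dd i y + dd i x * sg (mw i) y"
proof (induction x rule: free_induct)
  case (var a x)
  then show ?case by (simp add: mult.assoc dd_var_mult algebra_simps)
qed (simp_all add: algebra_simps smul_add)

section \<open>The grading on words and on normal forms\<close>

definition comp :: "int \<Rightarrow> gen free \<Rightarrow> gen free" where
  "comp n = lin (\<lambda>w. if wdg w = n then pt w else 0)"

lemma clin_comp_deg [simp, intro]: "clin (comp n)"
  by (simp add: comp_def)

lemmas comp_lin [simp] = clin_add[OF clin_comp_deg] clin_diff[OF clin_comp_deg] clin_smul[OF clin_comp_deg]
  clin_minus[OF clin_comp_deg] clin_zero[OF clin_comp_deg]

lemma comp_pt [simp]: "comp n (pt w) = (if wdg w = n then pt w else 0)"
  by (simp add: comp_def)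

lemma comp_one [simp]: "comp n 1 = (if n = 0 then 1 else 0)"
  unfolding one_pt comp_pt by (auto simp: wd_zero)

lemma comp_var_mult: "comp n (var a * x) = var a * comp (n - gdeg a) x"
proof (rule clin_eqI[of "\<lambda>x. comp n (var a * x)" "\<lambda>x. var a * comp (n - gdeg a) x"])
  show "comp n (var a * pt w) = var a * comp (n - gdeg a) (pt w)" for w
    by (cases w) (auto simp: var_mult_pt)
qed (simp_all add: clin_def algebra_simps)

definition vdg :: "int \<times> nat \<times> nat \<Rightarrow> int" where
  "vdg = (\<lambda>(t, k, l). t + int k - int l)"

definition vcomp :: "int \<Rightarrow> (int \<times> nat \<times> nat \<Rightarrow>\<^sub>0 complex) \<Rightarrow> (int \<times> nat \<times> nat \<Rightarrow>\<^sub>0 complex)" where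
  "vcomp n = lin (\<lambda>i. if vdg i = n then pt i else 0)"

definition vsg :: "int \<Rightarrow> (int \<times> nat \<times> nat \<Rightarrow>\<^sub>0 complex) \<Rightarrow> (int \<times> nat \<times> nat \<Rightarrow>\<^sub>0 complex)" where
  "vsg m = lin (\<lambda>i. Poly_Mapping.single i (zf (m * vdg i)))"

lemma clin_vcomp [simp, intro]: "clin (vcomp n)" and clin_vsg [simp, intro]: "clin (vsg m)"
  by (simp_all add: vcomp_def vsg_def)

lemma vcomp_pt [simp]: "vcomp n (pt i) = (if vdg i = n then pt i else 0)"
  and vsg_pt [simp]: "vsg m (pt i) = Poly_Mapping.single i (zf (m * vdg i))"
  by (simp_all add: vcomp_def vsg_def)

lemma vcomp_ag: "vcomp n (ag a v) = ag a (vcomp (n - gdeg a) v)"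
proof (rule clin_eqI[of "\<lambda>v. vcomp n (ag a v)" "\<lambda>v. ag a (vcomp (n - gdeg a) v)"])
  show "vcomp n (ag a (pt i)) = ag a (vcomp (n - gdeg a) (pt i))" for i
    by (cases i; cases a) (auto simp: vcomp_def lin_add lin_single vdg_def clin_zero[OF clin_ag])
qed (rule clin_comp[OF clin_vcomp clin_ag] clin_comp[OF clin_ag clin_vcomp])+

lemma vsg_ag: "vsg m (ag a v) = smul (zf (m * gdeg a)) (ag a (vsg m v))"
proof (rule clin_eqI[of "\<lambda>v. vsg m (ag a v)" "\<lambda>v. smul (zf (m * gdeg a)) (ag a (vsg m v))"])
  show "vsg m (ag a (pt i)) = smul (zf (m * gdeg a)) (ag a (vsg m (pt i)))" for i
    by (cases i; cases a) (auto simp: vsg_def lin_add lin_single vdg_def smul_add zf_add[symmetric] algebra_simps)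
qed (rule clin_comp[OF clin_vsg clin_ag] clin_smulF clin_comp[OF clin_ag clin_vsg])+

lemma nf_simps [simp]: "nf (x + y) = nf x + nf y" "nf (x - y) = nf x - nf y" "nf (smul c x) = smul c (nf x)"
  "nf (var a * x) = ag a (nf x)" "nf 0 = 0" "nf (- x) = - nf x" "nf 1 = pt (0, 0, 0)"
  by (simp_all add: nf_def)

text \<open>Every operator \<open>ag a\<close> is homogeneous for \<open>vdg\<close>. Hence
  \<open>comp\<close>, and likewise \<open>sg\<close>, becomes a diagonal map on normal forms and
  therefore preserves \<open>PI q\<close>.\<close>

lemma nf_comp: "nf (comp n x) = vcomp n (nf x)"
proof (induction x arbitrary: n rule: free_induct)
  case (var a x)
  then show ?case by (simp add: comp_var_mult vcomp_ag)
qed (auto simp: clin_add[OF clin_vcomp] clin_smul[OF clin_vcomp] vdg_def)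

lemma nf_sg: "nf (sg m x) = vsg m (nf x)"
proof (induction x rule: free_induct)
  case (var a x)
  then show ?case by (simp add: vsg_ag)
qed (auto simp: clin_add[OF clin_vsg] clin_smul[OF clin_vsg] vdg_def)

lemma comp_PI: "x \<in> PI q \<Longrightarrow> comp n x \<in> PI q"
  by (simp add: PI_iff_nf nf_comp clin_zero[OF clin_vcomp])

lemma sg_PI: "x \<in> PI q \<Longrightarrow> sg m x \<in> PI q"
  by (simp add: PI_iff_nf nf_sg clin_zero[OF clin_vsg])

lemma nf_var [simp]: "nf (var a) = agb a (0, 0, 0)"
  using nf_simps(4)[of a 1] by (simp del: nf_simps(4) add: nf_def)

lemma one_plus_Q2 [simp]: "1 + Q^2 \<noteq> 0"
proof
  assume "1 + Q^2 = 0"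
  then have "complex_of_real (1 + q^2) = 0" by simp
  then show False using sum_power2_gt_zero_iff[of 1 q] by (simp only: of_real_eq_0_iff) simp
qed

text \<open>Together with the twisted Leibniz rule this lets the derivations, which are defined on
  words, descend to P. Each relation is checked by its normal form.\<close>

lemma dd_rel: "s \<in> rels q \<union> pstar ` rels q \<Longrightarrow> dd i s \<in> PI q"
  unfolding rels_list insert_iff empty_iff PI_iff_nf
  by (elim disjE FalseE; hypsubst; cases i; rule poly_mapping_eqI)
    (simp_all add: dd_mult lookup_add lookup_single when_def lookup_minus zf_minus field_simps power2_eq_square)

lemma dd_PI: "x \<in> PI q \<Longrightarrow> dd i x \<in> PI q"
proof -
  have r: "s \<in> rels q \<union> pstar ` rels q \<Longrightarrow> s \<in> PI q" for s
    unfolding PI_def by (rule ideal2_gen)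
  have "dd i (a * s * b) \<in> PI q" if s: "s \<in> rels q \<union> pstar ` rels q" for a s b
    unfolding dd_mult distrib_right
    by (intro csub_add[OF PI_csub] cideal_left[OF PI_cideal] cideal_right[OF PI_cideal] r[OF s] dd_rel[OF s] sg_PI)
  then show "x \<in> PI q \<Longrightarrow> dd i x \<in> PI q"
    using ideal2_into[OF PI_csub clin_dd] unfolding PI_def by blast
qed

lemma E_dd: "E x y \<Longrightarrow> E (dd i x) (dd i y)"
  and E_sg: "E x y \<Longrightarrow> E (sg m x) (sg m y)"
  and E_comp: "E x y \<Longrightarrow> E (comp n x) (comp n y)"
  by (auto intro: md_map dd_PI sg_PI comp_PI)

text \<open>The operator \<open>dd Im (dd Ip h) - Q^2 dd Ip (dd Im h) - (1 + Q^2) dd I3 h\<close> is a twisted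
  derivation which vanishes on the generators.\<close>

lemma sg_dl: "sg m (dl Im a) = smul (zf (2 * m) * zf (m * gdeg a)) (dl Im a)"
  "sg m (dl Ip a) = smul (zf (- 2 * m) * zf (m * gdeg a)) (dl Ip a)"
  "sg m (dl I3 a) = smul (zf (m * gdeg a)) (dl I3 a)"
  by (cases a; simp add: zf_add[symmetric] mult.commute)+

lemma dd_sg: "dd Im (sg m y) = smul (1 / zf (2 * m)) (sg m (dd Im y))"
  "dd Ip (sg m y) = smul (zf (2 * m)) (sg m (dd Ip y))"
  "dd I3 (sg m y) = sg m (dd I3 y)"
  by (induction y rule: free_induct)
    (simp_all add: dd_mult sg_dl smul_add sg_sg add.commute zf_minus mult.commute)

text \<open>The identity holds in the free algebra itself. In the induction the mixed terms match
  because \<open>dd_sg\<close> contributes Q^2 for \<open>Im\<close> and its inverse for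
  \<open>Ip\<close>; what remains is twisted twice with weight 1, which is the weight 2 of
  \<open>I3\<close>.\<close>

lemma dd_comm: "dd Im (dd Ip h) = smul (Q^2) (dd Ip (dd Im h)) + smul (1 + Q^2) (dd I3 h)"
proof (induction h rule: free_induct)
  case (var a h)
  have l: "dd Im (dl Ip a) = smul (Q^2) (dd Ip (dl Im a)) + smul (1 + Q^2) (dl I3 a)"
    by (cases a) (simp_all add: smul_minus)
  show ?case
    by (simp add: dd_mult var dd_sg sg_sg l sg_dl zf_minus algebra_simps smul_add smul_add_left)
qed (simp_all add: smul_add algebra_simps)

subsection \<open>The functionals behind the twisted derivations\<close>

fun fgl :: "int \<Rightarrow> gen \<Rightarrow> complex" where
  "fgl m Al = zf m" | "fgl m Als = zf (- m)" | "fgl m _ = 0"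

definition fw :: "int \<Rightarrow> gen wd \<Rightarrow> complex" where
  "fw m w = prod_list (map (fgl m) (letters w))"

lemma fw_simps [simp]: "fw m (u + v) = fw m u * fw m v" "fw m (Wd (a # w)) = fgl m a * fw m (Wd w)" "fw m (Wd []) = 1"
  by (simp_all add: fw_def)

text \<open>The left invariant tangent functional that belongs to \<open>dd i\<close>. These
  functionals are dual to the representatives \<open>eg\<close>, see \<open>chw_eg\<close>.\<close>

definition chw :: "ix \<Rightarrow> gen wd \<Rightarrow> complex" where
  "chw i w = counit (dd i (pt w))"

lemma counit_sg_pt: "counit (sg m (pt w)) = fw m w"
proof -
  have "counit (sg m (pt (Wd v))) = fw m (Wd v)" for v
  proof (induction v)
    case (Cons a v)
    have "sg m (pt (Wd (a # v))) = sg m (var a) * sg m (pt (Wd v))"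
      unfolding sg_mult[symmetric] by (simp only: var_mult_pt wd.sel)
    then show ?case using Cons by (cases a) (simp_all add: counit_mult del: sg_pt)
  qed (simp add: counit_fl)
  then show ?thesis by (cases w) simp
qed

lemma chw_append [simp]: "chw i (u + v) = ew u * chw i v + chw i u * fw (mw i) v"
proof -
  have "chw i (u + v) = counit (dd i (pt u * pt v))" by (simp add: chw_def)
  also have "\<dots> = counit (pt u) * chw i v + chw i u * fw (mw i) v"
    by (simp only: dd_mult counit_simps counit_mult counit_sg_pt chw_def)
  finally show ?thesis by (simp add: counit_fl)
qed

lemma chw_Cons: "chw i (Wd (a # v)) = gen_counit a * chw i (Wd v) + chw i (Wd [a]) * fw (mw i) (Wd v)"
  using chw_append[of i "Wd [a]" "Wd v"] by simp

lemma chw_Nil [simp]: "chw i (Wd []) = 0"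
  using dd_one[of i] unfolding one_pt chw_def by (simp add: wd_zero)

lemma chw_letter [simp]: "chw i (Wd [a]) = counit (dl i a)"
  using dd_var[of i a] by (simp add: chw_def var_def)

text \<open>The left coefficient of a one-form at the basic form of index i: a tensor of p and a
  contributes p times the tangent functional at a.\<close>

abbreviation cf :: "ix \<Rightarrow> (gen wd \<times> gen wd \<Rightarrow>\<^sub>0 complex) \<Rightarrow> gen free" where
  "cf i \<equiv> slice (chw i)"

lemmas slice_lin = clin_add[OF clin_slice] clin_diff[OF clin_slice] clin_smul[OF clin_slice] clin_zero[OF clin_slice]
lemmas comult_lin = clin_add[OF clin_hom_ext[of "gen_comult q"], folded comult_def]
  clin_smul[OF clin_hom_ext[of "gen_comult q"], folded comult_def]

lemma comult_mult: "comult q (x * y) = comult q x * comult q y"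
  unfolding comult_def by (rule hom_ext_mult)

lemma comult_var [simp]: "comult q (var a) = gen_comult q a"
  by (simp add: comult_def)

lemma comult_one [simp]: "comult q 1 = 1"
  by (simp add: comult_def)

lemma slice_fw_var_mult: "slice (fw m) (tens x (var b) * Y) = smul (fgl m b) (x * slice (fw m) Y)"
  unfolding slice_var_mult by (simp add: slice_smul_fun del: wd_plus)

lemma slice_chw_var_mult: "cf i (tens x (var b) * Y) =
    smul (gen_counit b) (x * cf i Y) + smul (counit (dl i b)) (x * slice (fw (mw i)) Y)"
  unfolding slice_var_mult by (simp add: slice_smul_fun slice_add_fun distrib_left del: wd_plus)

lemma slice_fw_comult: "slice (fw m) (comult q x) = sg m x"
proof (induction x rule: free_induct)
  case (var a x)
  then show ?case
    by (cases a) (simp_all add: comult_mult distrib_right slice_lin slice_fw_var_mult)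
qed (simp_all add: comult_lin slice_lin wd_zero)

text \<open>The coproduct represents dp, so \<open>dd i\<close> is indeed the coefficient of the
  differential. Both sides obey the same Leibniz rule under left multiplication by a letter.\<close>

lemma cf_comult: "cf i (comult q x) = dd i x"
proof (induction x rule: free_induct)
  case (var a x)
  then show ?case
    by (cases a; cases i) (simp_all add: comult_mult distrib_right slice_lin slice_chw_var_mult
        slice_fw_comult dd_mult)
qed (simp_all add: comult_lin slice_lin wd_zero)

lemma cf_lact: "cf i (lact p \<omega>) = p * cf i \<omega>"
proof -
  have "tens p (pt (0 :: gen wd)) * \<omega> = lact p \<omega>"
    unfolding lact_def by simp
  then show ?thesis using slice_tens_mult[of "chw i" p 0 \<omega>] by simp
qed

lemma cf_tens_mult: "cf i (tens x y * Z) = smul (counit y) (x * cf i Z) + smul (fl (chw i) y) (x * slice (fw (mw i)) Z)"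
proof (rule clin_eqI[of "\<lambda>y. cf i (tens x y * Z)"
      "\<lambda>y. smul (counit y) (x * cf i Z) + smul (fl (chw i) y) (x * slice (fw (mw i)) Z)"])
  show "cf i (tens x (pt b) * Z) = smul (counit (pt b)) (x * cf i Z) + smul (fl (chw i) (pt b)) (x * slice (fw (mw i)) Z)" for b
    unfolding slice_tens_mult
    by (simp add: slice_add_fun slice_smul_fun distrib_left counit_fl)
qed (simp_all add: clin_def tens_add_right distrib_right slice_lin smul_add_left smul_add)

lemma counit_germ: "counit (germ (calcP q) x) = 0"
  by (simp add: germ_def calcP_def)

lemma chw_one: "fl (chw i) 1 = 0"
  by (simp add: fl_one wd_zero)

lemma chw_germ: "fl (chw i) (germ (calcP q) x) = fl (chw i) x"
  by (simp add: germ_def calcP_def chw_one)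

lemma Cou_P [simp]: "Cou (calcP q) = counit" and Cop_P [simp]: "Cop (calcP q) = comult q"
  and Rel_P [simp]: "Rel (calcP q) = PI q" and Rid_P [simp]: "Rid (calcP q) = R3 q"
  by (simp_all add: calcP_def)

text \<open>The germ has counit zero, which removes the untwisted term of
  \<open>cf_tens_mult\<close>; only the twist of the right factor is left.\<close>

lemma cf_ract: "cf i (ract (calcP q) \<omega> p) = cf i \<omega> * sg (mw i) p"
proof (rule clin_eqI[of "\<lambda>\<omega>. cf i (ract (calcP q) \<omega> p)" "\<lambda>\<omega>. cf i \<omega> * sg (mw i) p"])
  show "cf i (ract (calcP q) (pt k) p) = cf i (pt k) * sg (mw i) p" for k
    by (cases k) (simp add: ract_def tmap_pt cf_tens_mult counit_germ chw_germ slice_fw_comult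
        single_smul_pt[of _ "chw _ _"] del: smul_single)
qed (auto simp: clin_def ract_def clin_add[OF clin_tmap] clin_smul[OF clin_tmap] distrib_right slice_lin)

lemma counit_PI: "x \<in> PI q \<Longrightarrow> counit x = 0"
  unfolding PI_def
proof (induction rule: ideal2.induct)
  case (gen s a b)
  have "counit s = 0"
    using gen[unfolded rels_list insert_iff empty_iff] by (elim disjE FalseE) (simp_all add: counit_mult)
  then show ?case by (simp add: counit_mult)
qed simp_all

lemma counit_dd: "counit (dd i x) = fl (chw i) x"
  by (rule fl_eqI) (simp_all add: chw_def)

lemma fl_chw_mult: "fl (chw i) (x * y) = counit x * fl (chw i) y + fl (chw i) x * fl (fw (mw i)) y"
  using fl_tensor_eqI[of "chw i" "[(ew, chw i), (chw i, fw (mw i))]" x y] by (simp add: counit_fl)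

definition R3gens :: "gen free set" where
  "R3gens = {\<gamma> * \<gamma>, \<gamma>s * \<gamma>s, \<gamma> * \<gamma>s, \<alpha> * \<gamma> - \<gamma>, \<alpha> * \<gamma>s - \<gamma>s, \<alpha>s * \<gamma> - \<gamma>, \<alpha>s * \<gamma>s - \<gamma>s,
      smul (Q^2) \<alpha> + \<alpha>s - smul (1 + Q^2) 1}"

lemma R3_alt: "R3 q = {r + i | r i. i \<in> PI q \<and> r \<in> right_ideal R3gens}"
  by (simp add: R3_def R3gens_def)

text \<open>On a product s b the functional is a combination of its value and the counit at s. Both
  vanish at the generators of the right ideal, so arbitrary right factors b are harmless.\<close>

lemma chw_R3: "y \<in> R3 q \<Longrightarrow> fl (chw i) y = 0"
proof -
  have 1: "fl (chw i) r = 0" if "r \<in> right_ideal R3gens" for r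
    using that
  proof induction
    case (gen s b)
    then have "counit s = 0 \<and> fl (chw i) s = 0"
      unfolding R3gens_def insert_iff empty_iff
      by (elim disjE FalseE; cases i)
        (simp_all add: counit_mult fl_chw_mult fl_var chw_one divide_simps add_eq_0_iff)
    then show ?case by (simp add: fl_chw_mult)
  qed simp_all
  have 2: "fl (chw i) r = 0" if "r \<in> PI q" for r
    using counit_PI[OF dd_PI[OF that, of i]] by (simp add: counit_dd)
  show "y \<in> R3 q \<Longrightarrow> fl (chw i) y = 0"
    unfolding R3_alt using 1 2 by auto
qed

lemma right_ideal_smul: "x \<in> right_ideal R3gens \<Longrightarrow> smul c x \<in> right_ideal R3gens"
proof (induction rule: right_ideal.induct)
  case (gen s b)
  then show ?case using right_ideal.gen[of s R3gens "smul c b"] by simp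
qed (auto simp: smul_add intro: right_ideal.intros)

lemma right_ideal_mult: "x \<in> right_ideal R3gens \<Longrightarrow> x * b \<in> right_ideal R3gens"
proof (induction rule: right_ideal.induct)
  case (gen s c)
  then show ?case using right_ideal.gen[of s R3gens "c * b"] by (simp add: mult.assoc)
qed (auto simp: distrib_right intro: right_ideal.intros)

lemma R3_csub: "csub (R3 q)"
proof -
  have "x + y \<in> R3 q" if x: "x \<in> R3 q" and y: "y \<in> R3 q" for x y
  proof -
    obtain r i s j where *: "x = r + i" "y = s + j" "i \<in> PI q" "j \<in> PI q" "r \<in> right_ideal R3gens" "s \<in> right_ideal R3gens"
      using x y unfolding R3_alt by blast
    have "x + y = (r + s) + (i + j)" by (simp add: * algebra_simps)
    then show ?thesis unfolding R3_alt using right_ideal.add[OF *(5,6)] csub_add[OF PI_csub *(3,4)] by blast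
  qed
  moreover have "smul c x \<in> R3 q" if "x \<in> R3 q" for c x
    using that right_ideal_smul csub_smul[OF PI_csub] unfolding R3_alt by (force simp: smul_add)
  moreover have "0 \<in> R3 q"
    unfolding R3_alt using csub_zero[OF PI_csub] right_ideal.zero[of R3gens] by force
  ultimately show ?thesis by (simp add: csub_def)
qed

lemma R3_mult: "x \<in> R3 q \<Longrightarrow> x * b \<in> R3 q"
  using right_ideal_mult cideal_right[OF PI_cideal] unfolding R3_alt by (force simp: distrib_right)

lemma PI_R3: "x \<in> PI q \<Longrightarrow> x \<in> R3 q"
  unfolding R3_alt using right_ideal.zero[of R3gens] by force

lemma gen_R3: "x \<in> R3gens \<Longrightarrow> x \<in> R3 q"
proof -
  assume "x \<in> R3gens"
  then have "x * 1 + 0 \<in> R3 q" unfolding R3_alt using right_ideal.gen csub_zero[OF PI_csub] by blast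
  then show ?thesis by simp
qed

fun eg :: "ix \<Rightarrow> gen free" where
  "eg I3 = \<alpha> - \<alpha>s" | "eg Ip = \<gamma>" | "eg Im = smul Q \<gamma>s"

lemma E_R3: "E x y \<Longrightarrow> x - y \<in> R3 q"
  unfolding md_def by (rule PI_R3)

text \<open>Each \<open>eg i\<close> spans a right submodule of germs modulo \<open>R3 q\<close> on
  which letters act by a character. This is the commutation rule of the basic forms with functions,
  before the coproduct enters.\<close>

lemma eg_var: "md (R3 q) (eg i * var a) (smul (fgl (mw i) a) (eg i))"
proof -
  let ?g = "smul (Q^2) \<alpha> + \<alpha>s - smul (1 + Q^2) 1"
  have g: "?g \<in> R3 q" "\<alpha> * \<gamma> - \<gamma> \<in> R3 q" "\<alpha> * \<gamma>s - \<gamma>s \<in> R3 q" "\<alpha>s * \<gamma> - \<gamma> \<in> R3 q" "\<alpha>s * \<gamma>s - \<gamma>s \<in> R3 q"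
    "\<gamma> * \<gamma> \<in> R3 q" "\<gamma>s * \<gamma>s \<in> R3 q" "\<gamma> * \<gamma>s \<in> R3 q"
    by (rule gen_R3, simp add: R3gens_def)+
  note add = csub_add[OF R3_csub] and sm = csub_smul[OF R3_csub]
  have "\<gamma>s * \<gamma> - \<gamma> * \<gamma>s \<in> R3 q" by (rule E_R3, rule E_rels)
  from add[OF this g(8)] have gg: "\<gamma>s * \<gamma> \<in> R3 q" by simp
  have aa: "\<alpha>s * \<alpha> - 1 \<in> R3 q" using add[OF E_R3[OF E_rels(1)] gg] by simp
  have bb: "\<alpha> * \<alpha>s - 1 \<in> R3 q" using add[OF E_R3[OF E_rels(2)] sm[OF g(8), of "Q^2"]] by simp
  have "eg i * var a - smul (fgl (mw i) a) (eg i) \<in> R3 q"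
  proof (cases i; cases a)
    assume [simp]: "i = I3" "a = Al"
    \<comment> \<open>The multiple of \<open>?g * \<alpha>\<close> produces the square of
      \<open>\<alpha>\<close>, then \<open>\<alpha>s * \<alpha>\<close> is replaced by 1, and the
      linear remainder is a multiple of \<open>?g\<close>.\<close>
    have "eg i * var a - smul (fgl (mw i) a) (eg i) =
      smul (1 / Q^2) (?g * \<alpha>) + smul (- (1 + 1 / Q^2)) (\<alpha>s * \<alpha> - 1) + smul (1 / Q^2) ?g"
      by (rule poly_mapping_eqI) (simp add: lookup_add lookup_minus algebra_simps; (simp add: field_simps)?)
    also have "\<dots> \<in> R3 q" by (intro add sm R3_mult g aa)
    finally show ?thesis .
  next
    assume [simp]: "i = I3" "a = Als"
    have "eg i * var a - smul (fgl (mw i) a) (eg i) =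
      smul (-1) (?g * \<alpha>s) + smul (1 + Q^2) (\<alpha> * \<alpha>s - 1) + smul (-1) ?g"
      by (rule poly_mapping_eqI) (simp add: lookup_add lookup_minus algebra_simps zf_minus)
    also have "\<dots> \<in> R3 q" by (intro add sm R3_mult g bb)
    finally show ?thesis .
  next
    assume [simp]: "i = I3" "a = Ga"
    have "eg i * var a - smul (fgl (mw i) a) (eg i) = (\<alpha> * \<gamma> - \<gamma>) + smul (-1) (\<alpha>s * \<gamma> - \<gamma>)"
      by (simp add: algebra_simps smul_minus)
    also have "\<dots> \<in> R3 q" by (intro add sm g)
    finally show ?thesis .
  next
    assume [simp]: "i = I3" "a = Gas"
    have "eg i * var a - smul (fgl (mw i) a) (eg i) = (\<alpha> * \<gamma>s - \<gamma>s) + smul (-1) (\<alpha>s * \<gamma>s - \<gamma>s)"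
      by (simp add: algebra_simps smul_minus)
    also have "\<dots> \<in> R3 q" by (intro add sm g)
    finally show ?thesis .
  next
    assume [simp]: "i = Ip" "a = Al"
    have "eg i * var a - smul (fgl (mw i) a) (eg i) = (\<gamma> * \<alpha> - smul (1 / Q) (\<alpha> * \<gamma>)) + smul (1 / Q) (\<alpha> * \<gamma> - \<gamma>)"
      by (simp add: smul_diff)
    also have "\<dots> \<in> R3 q" by (intro add sm g E_R3 E_rels)
    finally show ?thesis .
  next
    assume [simp]: "i = Ip" "a = Als"
    have "eg i * var a - smul (fgl (mw i) a) (eg i) = (\<gamma> * \<alpha>s - smul Q (\<alpha>s * \<gamma>)) + smul Q (\<alpha>s * \<gamma> - \<gamma>)"
      by (simp add: smul_diff)
    also have "\<dots> \<in> R3 q" by (intro add sm g E_R3 E_rels)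
    finally show ?thesis .
  next
    assume [simp]: "i = Im" "a = Al"
    have "eg i * var a - smul (fgl (mw i) a) (eg i) = smul Q ((\<gamma>s * \<alpha> - smul (1 / Q) (\<alpha> * \<gamma>s)) + smul (1 / Q) (\<alpha> * \<gamma>s - \<gamma>s))"
      by (simp add: smul_diff)
    also have "\<dots> \<in> R3 q" by (intro add sm g E_R3 E_rels)
    finally show ?thesis .
  next
    assume [simp]: "i = Im" "a = Als"
    have "eg i * var a - smul (fgl (mw i) a) (eg i) = smul Q ((\<gamma>s * \<alpha>s - smul Q (\<alpha>s * \<gamma>s)) + smul Q (\<alpha>s * \<gamma>s - \<gamma>s))"
      by (simp add: smul_diff)
    also have "\<dots> \<in> R3 q" by (intro add sm g E_R3 E_rels)
    finally show ?thesis .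
  qed (auto intro!: sm g gg)
  then show ?thesis by (simp add: md_def)
qed

lemmas R3_trans = md_trans[OF R3_csub]

lemma md_R3_mult: "md (R3 q) x y \<Longrightarrow> md (R3 q) (x * b) (y * b)"
  unfolding md_def using R3_mult[of "x - y" b] by (simp add: left_diff_distrib)

lemma eg_pt: "md (R3 q) (eg i * pt w) (smul (fw (mw i) w) (eg i))"
proof -
  have "md (R3 q) (eg i * pt (Wd v)) (smul (fw (mw i) (Wd v)) (eg i))" for v
  proof (induction v)
    case Nil
    show ?case using md_refl[OF R3_csub] one_pt[where ?'a = "gen wd"] by (simp add: wd_zero)
  next
    case (Cons a v)
    have "eg i * pt (Wd (a # v)) = (eg i * var a) * pt (Wd v)"
      by (simp add: mult.assoc var_mult_pt)
    moreover have "md (R3 q) ((eg i * var a) * pt (Wd v)) (smul (fgl (mw i) a) (eg i) * pt (Wd v))"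
      by (rule md_R3_mult, rule eg_var)
    moreover have "md (R3 q) (smul (fgl (mw i) a) (eg i * pt (Wd v))) (smul (fgl (mw i) a) (smul (fw (mw i) (Wd v)) (eg i)))"
      by (rule md_smul[OF R3_csub Cons])
    ultimately show ?case by (simp, rule_tac R3_trans) auto
  qed
  then show ?thesis by (cases w) simp
qed

text \<open>Only \<open>\<alpha>\<close> and \<open>\<alpha>s\<close> leave a remainder, and it is
  the last generator of R_3 divided by 1 + Q^2.\<close>

lemma germ_var: "md (R3 q) (var a - smul (gen_counit a) 1) (\<Sum>i\<in>IX. smul (counit (dl i a)) (eg i))"
proof -
  let ?g = "smul (Q^2) \<alpha> + \<alpha>s - smul (1 + Q^2) 1"
  have g: "?g \<in> R3 q"
    by (rule gen_R3, simp add: R3gens_def)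
  have "var a - smul (gen_counit a) 1 - (\<Sum>i\<in>IX. smul (counit (dl i a)) (eg i)) =
     smul (case a of Al \<Rightarrow> 1 / (1 + Q^2) | Als \<Rightarrow> 1 / (1 + Q^2) | _ \<Rightarrow> 0) ?g"
    by (rule poly_mapping_eqI, cases a)
      (simp_all add: sum_IX lookup_add lookup_minus divide_simps, (simp_all add: algebra_simps)?)
  then show ?thesis using csub_smul[OF R3_csub g] by (simp add: md_def)
qed

text \<open>The three classes \<open>eg i\<close> span the germs modulo \<open>R3 q\<close>, with
  the tangent functionals as coordinates. The step from v to a v combines \<open>germ_var\<close>
  with the right action \<open>eg_pt\<close>.\<close>

lemma germ_pt: "md (R3 q) (germ (calcP q) (pt w)) (\<Sum>i\<in>IX. smul (chw i w) (eg i))"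
proof -
  have "md (R3 q) (pt (Wd v) - smul (ew (Wd v)) 1) (\<Sum>i\<in>IX. smul (chw i (Wd v)) (eg i))" for v
  proof (induction v)
    case Nil
    show ?case using md_refl[OF R3_csub] one_pt[where ?'a = "gen wd"] by (simp add: wd_zero)
  next
    case (Cons a v)
    have 1: "pt (Wd (a # v)) - smul (ew (Wd (a # v))) 1 =
       (var a - smul (gen_counit a) 1) * pt (Wd v) + smul (gen_counit a) (pt (Wd v) - smul (ew (Wd v)) 1)"
      by (simp add: left_diff_distrib smul_diff var_mult_pt)
    have 2: "md (R3 q) ((var a - smul (gen_counit a) 1) * pt (Wd v)) (\<Sum>i\<in>IX. smul (counit (dl i a)) (eg i * pt (Wd v)))"
      using md_R3_mult[OF germ_var[of a], of "pt (Wd v)"] by (simp add: sum_distrib_right)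
    have 3: "md (R3 q) (\<Sum>i\<in>IX. smul (counit (dl i a)) (eg i * pt (Wd v)))
        (\<Sum>i\<in>IX. smul (counit (dl i a)) (smul (fw (mw i) (Wd v)) (eg i)))"
      by (intro md_sum md_smul R3_csub eg_pt)
    have 4: "(\<Sum>i\<in>IX. smul (chw i (Wd (a # v))) (eg i)) =
        (\<Sum>i\<in>IX. smul (counit (dl i a)) (smul (fw (mw i) (Wd v)) (eg i))) +
        smul (gen_counit a) (\<Sum>i\<in>IX. smul (chw i (Wd v)) (eg i))"
      unfolding smul_sum sum.distrib[symmetric]
      by (rule sum.cong[OF refl], subst chw_Cons) (simp add: smul_add_left add.commute)
    show ?case
      unfolding 1 4 by (rule md_add[OF R3_csub R3_trans[OF 2 3] md_smul[OF R3_csub Cons]])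
  qed
  then show ?thesis by (cases w) (simp add: germ_def counit_fl)
qed

text \<open>Freeness of the one-forms on three generators. One direction holds because the
  functionals kill \<open>R3 q\<close>, the other because \<open>germ_pt\<close> rewrites every germ
  by its coordinates.\<close>

lemma null1_iff: "\<omega> \<in> null1 (calcP q) \<longleftrightarrow> (\<forall>i. cf i \<omega> \<in> PI q)"
proof
  assume "\<omega> \<in> null1 (calcP q)"
  then have 1: "tmap id (germ (calcP q)) \<omega> \<in> tnull (PI q) (R3 q)" by (simp add: null1_def)
  have 2: "cf i (tmap id (germ (calcP q)) \<omega>) = cf i \<omega>" for i
    by (rule clin_eqI[of "\<lambda>\<omega>. cf i (tmap id (germ (calcP q)) \<omega>)" "cf i", OF clin_comp[OF clin_slice clin_tmap] clin_slice])
      (auto simp: tmap_pt chw_germ)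
  have "cf i (tmap id (germ (calcP q)) \<omega>) \<in> PI q" for i
    by (rule tnull_into[OF clin_slice PI_csub _ 1])
      (auto simp: chw_R3 csub_zero[OF PI_csub] intro: csub_smul[OF PI_csub])
  then show "\<forall>i. cf i \<omega> \<in> PI q" by (simp add: 2)
next
  assume *: "\<forall>i. cf i \<omega> \<in> PI q"
  let ?T = "tnull (PI q) (R3 q)"
  have c: "clin (\<lambda>\<omega>. \<Sum>i\<in>IX. tens (cf i \<omega>) (eg i))"
    by (intro clin_sumF clin_tens_left clin_slice)
  have "md ?T (tmap id (germ (calcP q)) \<omega>) (\<Sum>i\<in>IX. tens (cf i \<omega>) (eg i))"
  proof (rule md_clin[OF tnull_csub clin_tmap c])
    fix k :: "gen wd \<times> gen wd"
    obtain u v where k: "k = (u, v)" by (cases k)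
    have "md ?T (tens (pt u) (germ (calcP q) (pt v))) (tens (pt u) (\<Sum>i\<in>IX. smul (chw i v) (eg i)))"
      by (rule tnull_md[OF md_refl[OF PI_csub] germ_pt PI_csub R3_csub])
    then show "md ?T (tmap id (germ (calcP q)) (pt k)) (\<Sum>i\<in>IX. tens (cf i (pt k)) (eg i))"
      by (simp add: k tmap_pt tens_sum_right single_smul_pt[of _ "chw _ _"] del: smul_single)
  qed
  moreover have "(\<Sum>i\<in>IX. tens (cf i \<omega>) (eg i)) \<in> ?T"
    by (intro csub_sum[OF tnull_csub] tnullI) (use * in auto)
  ultimately show "\<omega> \<in> null1 (calcP q)"
    by (simp add: null1_def md_in[OF tnull_csub])
qed

lemma chw_eg: "fl (chw i) (eg j) = (if i = j then 1 else 0)"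
  by (cases i; cases j) (simp_all add: fl_var divide_simps)

end

section \<open>The universal differential envelope\<close>

subsection \<open>Coefficient functionals\<close>

definition D0l :: "'k::monoid_add lt \<Rightarrow> ('k \<Rightarrow>\<^sub>0 complex)" where
  "D0l l = (case l of Fn p \<Rightarrow> p | Fm \<omega> \<Rightarrow> 0)"

definition D0 :: "'k::monoid_add env \<Rightarrow> ('k \<Rightarrow>\<^sub>0 complex)" where
  "D0 = hom_ext D0l"

lemma clin_D0 [simp, intro]: "clin D0"
  by (simp add: D0_def)

lemmas D0_lin [simp] = clin_add[OF clin_D0] clin_diff[OF clin_D0] clin_smul[OF clin_D0] clin_minus[OF clin_D0]
  clin_zero[OF clin_D0]

lemma D0_simps [simp]: "D0 (x * y) = D0 x * D0 y" "D0 (fn p) = p" "D0 (fm \<omega>) = 0" "D0 1 = 1"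
  by (simp_all add: D0_def hom_ext_mult fn_def fm_def D0l_def)

lemma var_lt: "var (Fn p) = fn p" "var (Fm \<omega>) = fm \<omega>"
  by (simp_all add: fn_def fm_def)

text \<open>A word of degree one has the shape p \<omega> p', and p' is moved to the left at the
  price of the twist \<open>s\<close>. A second one-form in the word makes \<open>D0\<close> of the
  remainder zero, so higher degrees contribute nothing.\<close>

fun D1w :: "(('k::monoid_add \<times> 'k \<Rightarrow>\<^sub>0 complex) \<Rightarrow> ('k \<Rightarrow>\<^sub>0 complex)) \<Rightarrow> (('k \<Rightarrow>\<^sub>0 complex) \<Rightarrow> ('k \<Rightarrow>\<^sub>0 complex))
    \<Rightarrow> 'k lt list \<Rightarrow> ('k \<Rightarrow>\<^sub>0 complex)" where
  "D1w c s [] = 0"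
| "D1w c s (Fn p # w) = p * D1w c s w"
| "D1w c s (Fm \<omega> # w) = c \<omega> * s (D0 (pt (Wd w)))"

definition D1 where "D1 c s = lin (\<lambda>w. D1w c s (letters w))"

lemma clin_D1 [simp, intro]: "clin (D1 c s)"
  by (simp add: D1_def)

lemmas D1_lin [simp] = clin_add[OF clin_D1] clin_diff[OF clin_D1] clin_smul[OF clin_D1] clin_minus[OF clin_D1]
  clin_zero[OF clin_D1]

lemma D1_one [simp]: "D1 c s 1 = 0"
  unfolding one_pt by (simp add: D1_def del: single_one)

text \<open>A coefficient \<open>c\<close> of one-forms and the twist \<open>s\<close> of its basic
  form. The locale is used for the three coefficients on P and for the single one on G.\<close>

locale env_model =
  fixes c :: "('k::monoid_add \<times> 'k \<Rightarrow>\<^sub>0 complex) \<Rightarrow> ('k \<Rightarrow>\<^sub>0 complex)"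
    and s :: "('k \<Rightarrow>\<^sub>0 complex) \<Rightarrow> ('k \<Rightarrow>\<^sub>0 complex)"
  assumes clin_s: "clin s" and s_mult: "s (x * y) = s x * s y" and s_one: "s 1 = 1"
begin

lemma D1_var_mult: "D1 c s (fn p * y) = p * D1 c s y" "D1 c s (fm \<omega> * y) = c \<omega> * s (D0 y)"
proof -
  show "D1 c s (fn p * y) = p * D1 c s y"
    by (rule clin_eqI[of "\<lambda>y. D1 c s (fn p * y)" "\<lambda>y. p * D1 c s y"])
      (simp_all add: clin_def distrib_left flip: var_lt, simp add: var_mult_pt D1_def)
  show "D1 c s (fm \<omega> * y) = c \<omega> * s (D0 y)"
    by (rule clin_eqI[of "\<lambda>y. D1 c s (fm \<omega> * y)" "\<lambda>y. c \<omega> * s (D0 y)"])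
      (simp_all add: clin_def distrib_left clin_add[OF clin_s] clin_smul[OF clin_s] flip: var_lt, simp add: var_mult_pt D1_def)
qed

lemma D1_mult: "D1 c s (x * y) = D0 x * D1 c s y + D1 c s x * s (D0 y)"
proof (induction x rule: free_induct)
  case (var l x)
  then show ?case
    by (cases l) (simp_all add: var_lt mult.assoc D1_var_mult distrib_left s_mult)
qed (simp_all add: algebra_simps smul_add)

lemma D1_fn [simp]: "D1 c s (fn p) = 0" and D1_fm [simp]: "D1 c s (fm \<omega>) = c \<omega>"
  using D1_var_mult(1)[of p 1] D1_var_mult(2)[of \<omega> 1] s_one by simp_all

end

lemma D0_env_ideal:
  assumes I: "cideal (Rel X)" and x: "x \<in> env_ideal X"
  shows "D0 x \<in> Rel X"
proof -
  have "D0 s \<in> Rel X" if "s \<in> tensor_rels X \<union> env_rels X" for s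
  proof -
    from that consider "s \<in> tensor_rels X" | "s \<in> env_rels X" by blast
    then show ?thesis
    proof cases
      case 1
      then show ?thesis using csub_zero[OF cideal_csub[OF I]] by (auto simp: tensor_rels_def)
    next
      case 2
      then obtain xs where s: "s = (\<Sum>(g, h)\<leftarrow>xs. fm (dif X g) * fm (dif X h))" by (auto simp: env_rels_def)
      have "D0 s = 0" unfolding s by (induction xs) auto
      then show ?thesis using csub_zero[OF cideal_csub[OF I]] by simp
    qed
  qed
  then have "D0 (a * s * b) \<in> Rel X" if "s \<in> tensor_rels X \<union> env_rels X" for a s b
    using that cideal_left[OF I] cideal_right[OF I] by simp
  then show ?thesis
    using ideal2_into[OF cideal_csub[OF I] clin_D0] x unfolding env_ideal_def by blast
qed

text \<open>The conditions on \<open>c\<close> and \<open>s\<close> mirror the bimodule relations.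
  The quadratic relations of the envelope are killed for degree reasons, since \<open>D0\<close>
  vanishes at each factor \<open>fm\<close>.\<close>

lemma (in env_model) D1_env_ideal:
  assumes I: "cideal (Rel X)" and x: "x \<in> env_ideal X"
    and "clin c" "\<And>p \<omega>. c (lact p \<omega>) = p * c \<omega>" "\<And>p \<omega>. c (ract X \<omega> p) = c \<omega> * s p"
    and null: "\<And>\<omega>. \<omega> \<in> null1 X \<Longrightarrow> c \<omega> \<in> Rel X" and sI: "\<And>p. p \<in> Rel X \<Longrightarrow> s p \<in> Rel X"
  shows "D1 c s x \<in> Rel X"
proof -
  note z = csub_zero[OF cideal_csub[OF I]]
  have g: "D1 c s r \<in> Rel X" "D0 r \<in> Rel X" if "r \<in> tensor_rels X \<union> env_rels X" for r
  proof -
    have "r \<in> env_ideal X" using that unfolding env_ideal_def by (rule ideal2_gen)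
    then show "D0 r \<in> Rel X" using D0_env_ideal[OF I] by simp
    from that consider "r \<in> tensor_rels X" | "r \<in> env_rels X" by blast
    then show "D1 c s r \<in> Rel X"
    proof cases
      case 1
      then show ?thesis
        using z assms(3-6) null by (auto simp: tensor_rels_def D1_mult clin_add clin_smul clin_zero[OF clin_s])
    next
      case 2
      then obtain xs where r: "r = (\<Sum>(g, h)\<leftarrow>xs. fm (dif X g) * fm (dif X h))" by (auto simp: env_rels_def)
      have "D1 c s r = 0" unfolding r by (induction xs) (auto simp: D1_mult clin_zero[OF clin_s])
      then show ?thesis using z by simp
    qed
  qed
  have "D1 c s (a * r * b) \<in> Rel X" if r: "r \<in> tensor_rels X \<union> env_rels X" for a r b
    unfolding D1_mult distrib_right D0_simps s_mult
    by (intro csub_add[OF cideal_csub[OF I]] cideal_left[OF I] cideal_right[OF I] g[OF r] sI)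
  then show ?thesis
    using ideal2_into[OF cideal_csub[OF I] clin_D1] x unfolding env_ideal_def by blast
qed

subsection \<open>Computing modulo the ideal of the envelope\<close>

lemma env_cideal: "cideal (env_ideal X)"
  unfolding env_ideal_def by (rule cideal_ideal2)

lemmas env_csub = cideal_csub[OF env_cideal]

lemma env_trels: "r \<in> tensor_rels X \<Longrightarrow> r \<in> env_ideal X"
  unfolding env_ideal_def by (rule ideal2_gen) simp

lemma env_erels: "r \<in> env_rels X \<Longrightarrow> r \<in> env_ideal X"
  unfolding env_ideal_def by (rule ideal2_gen) simp

lemma fn_rel:
  shows fn_add: "md (env_ideal X) (fn (p + p')) (fn p + fn p')"
    and fn_smul: "md (env_ideal X) (fn (smul c p)) (smul c (fn p))"
    and fn_mult: "md (env_ideal X) (fn (p * p')) (fn p * fn p')"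
    and fn_one: "md (env_ideal X) (fn 1) 1"
    and fn_Rel: "p \<in> Rel X \<Longrightarrow> fn p \<in> env_ideal X"
    and fm_add: "md (env_ideal X) (fm (\<omega> + \<omega>')) (fm \<omega> + fm \<omega>')"
    and fm_smul: "md (env_ideal X) (fm (smul c \<omega>)) (smul c (fm \<omega>))"
    and fm_lact: "md (env_ideal X) (fm (lact p \<omega>)) (fn p * fm \<omega>)"
    and fm_ract: "md (env_ideal X) (fm (ract X \<omega> p)) (fm \<omega> * fn p)"
    and fm_null: "\<omega> \<in> null1 X \<Longrightarrow> fm \<omega> \<in> env_ideal X"
  unfolding md_def
  by (rule env_trels, unfold tensor_rels_def, force simp: algebra_simps)+

lemma fn_zero: "fn 0 \<in> env_ideal X"
  using fn_smul[of X 0 0] by (simp add: md_def)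

lemma fm_zero: "fm 0 \<in> env_ideal X"
  using fm_smul[of X 0 0] by (simp add: md_def)

lemma fn_cong: 
  assumes "md (Rel X) p p'"
  shows "md (env_ideal X) (fn p) (fn p')"
proof -
  note t = md_trans[OF env_csub]
  have "md (env_ideal X) (fn (p' + (p - p'))) (fn p' + fn (p - p'))" by (rule fn_add)
  moreover have "md (env_ideal X) (fn p' + fn (p - p')) (fn p' + 0)"
    using fn_Rel[of "p - p'" X] assms by (intro md_add[OF env_csub] md_refl[OF env_csub]) (simp add: md_def)
  ultimately show ?thesis using t by simp
qed

lemma fm_cong:
  assumes "\<omega> - \<omega>' \<in> null1 X"
  shows "md (env_ideal X) (fm \<omega>) (fm \<omega>')"
proof -
  note t = md_trans[OF env_csub]
  have "md (env_ideal X) (fm (\<omega>' + (\<omega> - \<omega>'))) (fm \<omega>' + fm (\<omega> - \<omega>'))" by (rule fm_add)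
  moreover have "md (env_ideal X) (fm \<omega>' + fm (\<omega> - \<omega>')) (fm \<omega>' + 0)"
    using fm_null[OF assms] by (intro md_add[OF env_csub] md_refl[OF env_csub]) (simp add: md_def)
  ultimately show ?thesis using t by simp
qed

lemma fn_sum: "md (env_ideal X) (fn (sum f A)) (\<Sum>a\<in>A. fn (f a))"
proof (induction A rule: infinite_finite_induct)
  case (insert a A)
  then show ?case
    using md_trans[OF env_csub fn_add md_add[OF env_csub md_refl[OF env_csub] insert(3)]] by simp
qed (auto simp: md_def fn_zero)

lemma fn_sum_list: "md (env_ideal X) (fn (sum_list (map f xs))) (\<Sum>a\<leftarrow>xs. fn (f a))"
proof (induction xs)
  case (Cons a xs)
  then show ?case
    using md_trans[OF env_csub fn_add md_add[OF env_csub md_refl[OF env_csub] Cons]] by simp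
qed (auto simp: md_def fn_zero)

lemma fm_sum: "md (env_ideal X) (fm (sum f A)) (\<Sum>a\<in>A. fm (f a))"
proof (induction A rule: infinite_finite_induct)
  case (insert a A)
  then show ?case
    using md_trans[OF env_csub fm_add md_add[OF env_csub md_refl[OF env_csub] insert(3)]] by simp
qed (auto simp: md_def fm_zero)

lemma fn_lin: "md (env_ideal X) (fn (lin g x)) (lin (\<lambda>k. fn (g k)) x)"
  unfolding lin_def
  by (rule md_trans[OF env_csub fn_sum md_sum[OF env_csub fn_smul]])

lemma fn_minus: "md (env_ideal X) (fn (- p)) (- fn p)"
  using fn_smul[of X "-1" p] by (simp add: smul_minus)

context suq
begin

abbreviation W where "W \<equiv> md (\<Omega>null q)"

lemmas W_refl [simp] = md_refl[OF env_csub[of "calcP q"]]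
  and W_eq = md_eq[OF env_csub[of "calcP q"]]
  and W_sym = md_sym[OF env_csub[of "calcP q"]]
  and W_trans [trans] = md_trans[OF env_csub[of "calcP q"]]
  and W_add = md_add[OF env_csub[of "calcP q"]]
  and W_diff = md_diff[OF env_csub[of "calcP q"]]
  and W_minus = md_minus[OF env_csub[of "calcP q"]]
  and W_smul = md_smul[OF env_csub[of "calcP q"]]
  and W_sum = md_sum[OF env_csub[of "calcP q"]]
  and W_mult = md_mult[OF env_cideal[of "calcP q"]]

lemma W_fn: "E p p' \<Longrightarrow> W (fn p) (fn p')"
  by (rule fn_cong) simp

lemma sg_model: "env_model (sg m)"
  by unfold_locales simp_all

abbreviation DD :: "ix \<Rightarrow> gen wd env \<Rightarrow> gen free" where
  "DD i \<equiv> D1 (cf i) (sg (mw i))"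

lemmas DD_mult = env_model.D1_mult[OF sg_model]
lemmas DD_fn [simp] = env_model.D1_fn[OF sg_model]
lemmas DD_fm [simp] = env_model.D1_fm[OF sg_model]

lemma D0_null: "x \<in> \<Omega>null q \<Longrightarrow> D0 x \<in> PI q"
  using D0_env_ideal[of "calcP q" x] PI_cideal by simp

lemma DD_null: "x \<in> \<Omega>null q \<Longrightarrow> DD i x \<in> PI q"
  using env_model.D1_env_ideal[OF sg_model, of "calcP q" x "cf i" "mw i"] PI_cideal
  by (simp add: cf_lact cf_ract null1_iff sg_PI)

fun D2w :: "gen wd lt list \<Rightarrow> gen free" where
  "D2w [] = 0"
| "D2w (Fn p # w) = p * D2w w"
| "D2w (Fm \<omega> # w) = cf Im \<omega> * sg 1 (DD Ip (pt (Wd w))) - smul (Q^2) (cf Ip \<omega> * sg 1 (DD Im (pt (Wd w))))"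

text \<open>The coefficient of \<open>dvol\<close> in a two-form.\<close>

definition D2 :: "gen wd env \<Rightarrow> gen free" where
  "D2 = lin (\<lambda>w. D2w (letters w))"

lemma clin_D2 [simp, intro]: "clin D2"
  by (simp add: D2_def)

lemmas D2_lin [simp] = clin_add[OF clin_D2] clin_diff[OF clin_D2] clin_smul[OF clin_D2] clin_minus[OF clin_D2]
  clin_zero[OF clin_D2]

lemma D2_one [simp]: "D2 1 = 0"
  unfolding one_pt by (simp add: D2_def del: single_one)

lemma D2_var_mult: "D2 (fn p * y) = p * D2 y"
  "D2 (fm \<omega> * y) = cf Im \<omega> * sg 1 (DD Ip y) - smul (Q^2) (cf Ip \<omega> * sg 1 (DD Im y))"
proof -
  show "D2 (fn p * y) = p * D2 y"
    by (rule clin_eqI[of "\<lambda>y. D2 (fn p * y)" "\<lambda>y. p * D2 y"])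
      (simp_all add: clin_def distrib_left flip: var_lt, simp add: var_mult_pt D2_def)
  show "D2 (fm \<omega> * y) = cf Im \<omega> * sg 1 (DD Ip y) - smul (Q^2) (cf Ip \<omega> * sg 1 (DD Im y))"
    by (rule clin_eqI[of "\<lambda>y. D2 (fm \<omega> * y)" "\<lambda>y. cf Im \<omega> * sg 1 (DD Ip y) - smul (Q^2) (cf Ip \<omega> * sg 1 (DD Im y))"])
      (simp_all add: clin_def distrib_left smul_add smul_diff mult.commute flip: var_lt, simp add: var_mult_pt D2_def)
qed

text \<open>The minus sign with Q^2 anticipates \<eta>p \<eta>m = -Q^2 dvol, see
  \<open>et_pm\<close>. The last twist is \<open>sg 2\<close> because both factors of
  \<open>dvol\<close> have weight 1.\<close>

lemma D2_mult: "D2 (x * y) = D0 x * D2 y + DD Im x * sg 1 (DD Ip y) - smul (Q^2) (DD Ip x * sg 1 (DD Im y))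
    + D2 x * sg 2 (D0 y)"
proof (induction x rule: free_induct)
  case (var l x)
  show ?case
    by (cases l) (simp_all only: var_lt mult.assoc D2_var_mult var DD_mult,
        simp_all add: D2_var_mult DD_mult sg_sg smul_add smul_diff algebra_simps)
next
  case (add x z)
  show ?case
    unfolding distrib_right D2_lin(1) add D1_lin(1) D0_lin(1) by (simp add: algebra_simps smul_add)
next
  case (smul c x)
  show ?case
    unfolding smul_mult_left D2_lin(3) smul by (simp add: smul_add smul_diff mult.commute)
qed simp

lemma D2_fn [simp]: "D2 (fn p) = 0" and D2_fm [simp]: "D2 (fm \<omega>) = 0"
  using D2_var_mult(1)[of p 1] D2_var_mult(2)[of \<omega> 1] by simp_all

lemma cf_list: "cf i (\<Sum>(g, h)\<leftarrow>xs. lact g (comult q h)) = (\<Sum>(g, h)\<leftarrow>xs. g * dd i h)"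
  by (induction xs) (auto simp: slice_lin cf_lact cf_comult)

lemma sum_list_leibniz: "(\<Sum>(g, h)\<leftarrow>xs. dd i g * sg (mw i) (dd j h)) =
   dd i (\<Sum>(g, h)\<leftarrow>xs. g * dd j h) - (\<Sum>(g, h)\<leftarrow>xs. g * dd i (dd j h))"
  by (induction xs) (auto simp: dd_mult)

lemma D2_list: "D2 (\<Sum>(g, h)\<leftarrow>xs. fm (comult q g) * fm (comult q h)) =
    (\<Sum>(g, h)\<leftarrow>xs. dd Im g * sg 1 (dd Ip h)) - smul (Q^2) (\<Sum>(g, h)\<leftarrow>xs. dd Ip g * sg 1 (dd Im h))"
  by (induction xs) (auto simp: D2_mult cf_comult smul_add)

lemma sum_list_dd_comm: "(\<Sum>(g, h)\<leftarrow>xs. g * dd Im (dd Ip h)) - smul (Q^2) (\<Sum>(g, h)\<leftarrow>xs. g * dd Ip (dd Im h))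
    = smul (1 + Q^2) (\<Sum>(g, h)\<leftarrow>xs. g * dd I3 h)"
  by (induction xs) (auto simp: dd_comm smul_add distrib_left algebra_simps)

text \<open>For a sum of g dh that vanishes, the Leibniz rule trades products of first derivatives
  for second derivatives of h, modulo \<open>PI q\<close>. In the combination taken by
  \<open>D2\<close> these reduce by \<open>dd_comm\<close> to the \<open>I3\<close> coefficient of
  the same vanishing form.\<close>

lemma D2_null: "x \<in> \<Omega>null q \<Longrightarrow> D2 x \<in> PI q"
proof -
  note z = csub_zero[OF PI_csub]
  have g: "D2 r \<in> PI q" if "r \<in> tensor_rels (calcP q) \<union> env_rels (calcP q)" for r
    using that
  proof
    assume "r \<in> tensor_rels (calcP q)"
    then show ?thesis using z by (auto simp: tensor_rels_def D2_mult)
  next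
    assume "r \<in> env_rels (calcP q)"
    then obtain xs where r: "r = (\<Sum>(g, h)\<leftarrow>xs. fm (comult q g) * fm (comult q h))"
      and n: "(\<Sum>(g, h)\<leftarrow>xs. lact g (comult q h)) \<in> null1 (calcP q)"
      by (auto simp: env_rels_def)
    have n': "(\<Sum>(g, h)\<leftarrow>xs. g * dd i h) \<in> PI q" for i
      using n by (simp add: null1_iff cf_list)
    have "D2 r = dd Im (\<Sum>(g, h)\<leftarrow>xs. g * dd Ip h) - smul (Q^2) (dd Ip (\<Sum>(g, h)\<leftarrow>xs. g * dd Im h))
        - smul (1 + Q^2) (\<Sum>(g, h)\<leftarrow>xs. g * dd I3 h)"
      unfolding r D2_list sum_list_dd_comm[symmetric]
      using sum_list_leibniz[of Im Ip xs] sum_list_leibniz[of Ip Im xs] by (simp add: smul_diff)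
    also have "\<dots> \<in> PI q"
      by (intro csub_diff[OF PI_csub] csub_smul[OF PI_csub] dd_PI n')
    finally show ?thesis .
  qed
  have i: "r \<in> \<Omega>null q" if "r \<in> tensor_rels (calcP q) \<union> env_rels (calcP q)" for r
    using that unfolding env_ideal_def by (rule ideal2_gen)
  have "D2 (a * r * b) \<in> PI q" if r: "r \<in> tensor_rels (calcP q) \<union> env_rels (calcP q)" for a r b
    unfolding D2_mult DD_mult distrib_right D0_simps
    by (intro csub_add[OF PI_csub] csub_diff[OF PI_csub] csub_smul[OF PI_csub] cideal_left[OF PI_cideal] cideal_right[OF PI_cideal]
        g[OF r] D0_null[OF i[OF r]] DD_null[OF i[OF r]] sg_PI)
  then show "x \<in> \<Omega>null q \<Longrightarrow> D2 x \<in> PI q"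
    using ideal2_into[OF PI_csub clin_D2] unfolding env_ideal_def by blast
qed

lemma W_D0: "W x y \<Longrightarrow> E (D0 x) (D0 y)"
  and W_DD: "W x y \<Longrightarrow> E (DD i x) (DD i y)"
  and W_D2: "W x y \<Longrightarrow> E (D2 x) (D2 y)"
  by (auto intro: md_map D0_null DD_null D2_null)

fun et :: "ix \<Rightarrow> gen wd env" where
  "et I3 = \<eta>3" | "et Ip = \<eta>p" | "et Im = \<eta>m q"

lemma W_et: "W (et i) (fm (tens 1 (eg i)))"
  using W_sym[OF fm_smul[of "calcP q" Q "tens 1 \<gamma>s"]] by (cases i) (simp_all add: \<eta>3_def \<eta>p_def \<eta>m_def)

lemma lin_sum_fun: "lin (\<lambda>k. \<Sum>a\<in>A. f a k) x = (\<Sum>a\<in>A. lin (f a) x)"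
  by (simp add: lin_def smul_sum sum.swap[of _ A])

text \<open>The two sides come from one-forms with equal coefficients, and by
  \<open>null1_iff\<close> their difference is null. From here on one-forms are handled through
  coordinates.\<close>

lemma fm_expand: "W (fm \<omega>) (\<Sum>i\<in>IX. fn (cf i \<omega>) * et i)"
proof -
  let ?S = "\<Sum>i\<in>IX. lact (cf i \<omega>) (tens 1 (eg i))"
  have "cf j ?S = cf j \<omega>" for j
    by (cases j) (simp_all add: sum_IX slice_lin cf_lact chw_eg del: eg.simps)
  then have "\<omega> - ?S \<in> null1 (calcP q)"
    by (simp add: null1_iff slice_lin csub_zero[OF PI_csub])
  then have "W (fm \<omega>) (fm ?S)" by (rule fm_cong)
  also have "W \<dots> (\<Sum>i\<in>IX. fm (lact (cf i \<omega>) (tens 1 (eg i))))" by (rule fm_sum)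
  also have "W \<dots> (\<Sum>i\<in>IX. fn (cf i \<omega>) * fm (tens 1 (eg i)))" by (intro W_sum fm_lact)
  also have "W \<dots> (\<Sum>i\<in>IX. fn (cf i \<omega>) * et i)" by (intro W_sum W_mult W_refl W_sym[OF W_et])
  finally show ?thesis .
qed

lemma W_fn_zero: "E p 0 \<Longrightarrow> W (fn p * x) 0"
  using W_mult[OF W_fn, of p 0 x x] W_mult[of "fn 0" 0 x x] fn_zero[of "calcP q"] W_trans
  by (fastforce simp: md_zero)

lemma sum_delta_IX: "(\<Sum>j\<in>IX. if j = i then f j else 0) = f i" for f :: "ix \<Rightarrow> 'b::comm_monoid_add"
  using sum.delta[of IX i f] IX_all by simp

lemma et_fn: "W (et i * fn p) (fn (sg (mw i) p) * et i)"
proof -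
  let ?\<omega> = "tens 1 (eg i)"
  have c: "cf j (ract (calcP q) ?\<omega> p) = (if j = i then sg (mw i) p else 0)" for j
    by (simp add: cf_ract chw_eg del: eg.simps)
  have "W (et i * fn p) (fm ?\<omega> * fn p)" by (intro W_mult W_et W_refl)
  also have "W \<dots> (fm (ract (calcP q) ?\<omega> p))" by (rule W_sym[OF fm_ract])
  also have "W \<dots> (\<Sum>j\<in>IX. fn (cf j (ract (calcP q) ?\<omega> p)) * et j)" by (rule fm_expand)
  also have "W \<dots> (\<Sum>j\<in>IX. if j = i then fn (sg (mw i) p) * et j else 0)"
    by (rule W_sum) (auto simp: c intro: W_fn_zero)
  also have "\<dots> = fn (sg (mw i) p) * et i" by (rule sum_delta_IX)
  finally show ?thesis .
qed

lemma pt_Cons: "pt (Wd (l # w)) = var l * pt (Wd w)"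
  by (simp only: var_mult_pt wd.sel)

lemma wdeg_simps [simp]: "wdeg (Wd []) = 0" "wdeg (Wd (l # w)) = ldeg l + wdeg (Wd w)" "wdeg (u + v) = wdeg u + wdeg v"
  by (simp_all add: wdeg_def)

lemma word0_fn: "wdeg (Wd w) = 0 \<Longrightarrow> W (pt (Wd w)) (fn (D0 (pt (Wd w))))"
proof (induction w)
  case Nil
  have "(1 :: gen wd env) = pt (Wd [])" by (simp only: one_pt wd_zero)
  then show ?case using W_sym[OF fn_one[of "calcP q"]] by (simp only: D0_simps flip: \<open>1 = pt (Wd [])\<close>)
next
  case (Cons l w)
  then obtain p where l: "l = Fn p" by (cases l) auto
  have "W (fn p * pt (Wd w)) (fn p * fn (D0 (pt (Wd w))))" using Cons l by (intro W_mult W_refl) simp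
  also have "W \<dots> (fn (p * D0 (pt (Wd w))))" by (rule W_sym[OF fn_mult])
  finally show ?case by (simp only: pt_Cons l var_lt D0_simps)
qed

lemma word1_et: "wdeg (Wd w) = 1 \<Longrightarrow> W (pt (Wd w)) (\<Sum>i\<in>IX. fn (DD i (pt (Wd w))) * et i)"
proof (induction w)
  case (Cons l w)
  show ?case
  proof (cases l)
    case (Fn p)
    have "W (fn p * pt (Wd w)) (fn p * (\<Sum>i\<in>IX. fn (DD i (pt (Wd w))) * et i))"
      using Cons Fn by (intro W_mult W_refl) simp
    also have "\<dots> = (\<Sum>i\<in>IX. (fn p * fn (DD i (pt (Wd w)))) * et i)" by (simp add: sum_distrib_left mult.assoc)
    also have "W \<dots> (\<Sum>i\<in>IX. fn (p * DD i (pt (Wd w))) * et i)"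
      by (intro W_sum W_mult W_refl W_sym[OF fn_mult])
    finally show ?thesis by (simp add: pt_Cons Fn var_lt DD_mult)
  next
    case (Fm \<omega>)
    let ?p = "D0 (pt (Wd w))"
    have "W (fm \<omega> * pt (Wd w)) ((\<Sum>i\<in>IX. fn (cf i \<omega>) * et i) * fn ?p)"
      using Cons(2) Fm by (intro W_mult fm_expand word0_fn) simp
    also have "\<dots> = (\<Sum>i\<in>IX. fn (cf i \<omega>) * (et i * fn ?p))" by (simp add: sum_distrib_right mult.assoc)
    also have "W \<dots> (\<Sum>i\<in>IX. fn (cf i \<omega>) * (fn (sg (mw i) ?p) * et i))" by (intro W_sum W_mult W_refl et_fn)
    also have "\<dots> = (\<Sum>i\<in>IX. (fn (cf i \<omega>) * fn (sg (mw i) ?p)) * et i)" by (simp add: mult.assoc)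
    also have "W \<dots> (\<Sum>i\<in>IX. fn (cf i \<omega> * sg (mw i) ?p) * et i)"
      by (intro W_sum W_mult W_refl W_sym[OF fn_mult])
    finally show ?thesis by (simp add: pt_Cons Fm var_lt DD_mult)
  qed
qed simp

lemma homog0_fn: "\<phi> \<in> homog 0 \<Longrightarrow> W \<phi> (fn (D0 \<phi>))"
proof -
  assume h: "\<phi> \<in> homog 0"
  have "W (lin pt \<phi>) (lin (\<lambda>w. fn (D0 (pt w))) \<phi>)"
  proof (rule md_lin[OF env_csub])
    show "W (pt w) (fn (D0 (pt w)))" if "w \<in> Poly_Mapping.keys \<phi>" for w
      using that h word0_fn[of "letters w"] by (cases w) (auto simp: homog_def)
  qed
  also have "W \<dots> (fn (lin (\<lambda>w. D0 (pt w)) \<phi>))" by (rule W_sym[OF fn_lin])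
  also have "lin (\<lambda>w. D0 (pt w)) \<phi> = D0 \<phi>" by (rule clin_lin_pt[symmetric]) simp
  finally show ?thesis by (simp add: lin_id)
qed

lemma homog1_et: "\<phi> \<in> homog 1 \<Longrightarrow> W \<phi> (\<Sum>i\<in>IX. fn (DD i \<phi>) * et i)"
proof -
  assume h: "\<phi> \<in> homog 1"
  have "W (lin pt \<phi>) (lin (\<lambda>w. \<Sum>i\<in>IX. fn (DD i (pt w)) * et i) \<phi>)"
  proof (rule md_lin[OF env_csub])
    show "W (pt w) (\<Sum>i\<in>IX. fn (DD i (pt w)) * et i)" if "w \<in> Poly_Mapping.keys \<phi>" for w
      using that h word1_et[of "letters w"] by (cases w) (auto simp: homog_def)
  qed
  also have "lin (\<lambda>w. \<Sum>i\<in>IX. fn (DD i (pt w)) * et i) \<phi> = (\<Sum>i\<in>IX. lin (\<lambda>w. fn (DD i (pt w))) \<phi> * et i)"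
    by (simp add: lin_sum_fun lin_mult_right)
  also have "W \<dots> (\<Sum>i\<in>IX. fn (lin (\<lambda>w. DD i (pt w)) \<phi>) * et i)"
    by (intro W_sum W_mult W_refl W_sym[OF fn_lin])
  also have "\<dots> = (\<Sum>i\<in>IX. fn (DD i \<phi>) * et i)" by (simp flip: clin_lin_pt)
  finally show ?thesis by (simp add: lin_id)
qed

subsection \<open>Relations between two-forms\<close>

abbreviation dsum :: "(gen free \<times> gen free) list \<Rightarrow> gen wd env" where
  "dsum xs \<equiv> \<Sum>(g, h)\<leftarrow>xs. fm (comult q g) * fm (comult q h)"

lemma fm_fm: "W (fm \<omega> * fm \<omega>') (\<Sum>i\<in>IX. \<Sum>j\<in>IX. fn (cf i \<omega> * sg (mw i) (cf j \<omega>')) * (et i * et j))"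
proof -
  have "W (fm \<omega> * fm \<omega>') ((\<Sum>i\<in>IX. fn (cf i \<omega>) * et i) * (\<Sum>j\<in>IX. fn (cf j \<omega>') * et j))"
    by (intro W_mult fm_expand)
  also have "\<dots> = (\<Sum>i\<in>IX. \<Sum>j\<in>IX. fn (cf i \<omega>) * (et i * fn (cf j \<omega>')) * et j)"
    by (simp add: sum_product mult.assoc)
  also have "W \<dots> (\<Sum>i\<in>IX. \<Sum>j\<in>IX. fn (cf i \<omega>) * (fn (sg (mw i) (cf j \<omega>')) * et i) * et j)"
    by (intro W_sum W_mult W_refl et_fn)
  also have "\<dots> = (\<Sum>i\<in>IX. \<Sum>j\<in>IX. (fn (cf i \<omega>) * fn (sg (mw i) (cf j \<omega>'))) * (et i * et j))"
    by (simp add: mult.assoc)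
  also have "W \<dots> (\<Sum>i\<in>IX. \<Sum>j\<in>IX. fn (cf i \<omega> * sg (mw i) (cf j \<omega>')) * (et i * et j))"
    by (intro W_sum W_mult W_refl W_sym[OF fn_mult])
  finally show ?thesis .
qed

lemma dsum_expand: "W (dsum xs) (\<Sum>i\<in>IX. \<Sum>j\<in>IX. fn (\<Sum>(g, h)\<leftarrow>xs. dd i g * sg (mw i) (dd j h)) * (et i * et j))"
proof -
  have "W (dsum xs) (\<Sum>(g, h)\<leftarrow>xs. \<Sum>i\<in>IX. \<Sum>j\<in>IX. fn (dd i g * sg (mw i) (dd j h)) * (et i * et j))"
    by (rule md_sum_list[OF env_csub]) (use fm_fm in \<open>auto simp: split_beta cf_comult[symmetric]\<close>)
  also have "\<dots> = (\<Sum>i\<in>IX. \<Sum>j\<in>IX. (\<Sum>(g, h)\<leftarrow>xs. fn (dd i g * sg (mw i) (dd j h))) * (et i * et j))"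
    by (induction xs) (auto simp: sum.distrib distrib_right)
  also have "W \<dots> (\<Sum>i\<in>IX. \<Sum>j\<in>IX. fn (\<Sum>(g, h)\<leftarrow>xs. dd i g * sg (mw i) (dd j h)) * (et i * et j))"
    unfolding case_prod_unfold by (intro W_sum W_mult W_refl W_sym[OF fn_sum_list])
  finally show ?thesis .
qed

text \<open>Constants have zero derivative, so the Leibniz rule turns the coefficients dg dh into
  minus second derivatives of h. This is the form in which coefficients can be computed.\<close>

lemma dsum_expand_const:
  assumes "\<And>j. E (\<Sum>(g, h)\<leftarrow>xs. g * dd j h) (smul (\<kappa> j) 1)"
  shows "W (dsum xs) (- (\<Sum>i\<in>IX. \<Sum>j\<in>IX. fn (\<Sum>(g, h)\<leftarrow>xs. g * dd i (dd j h)) * (et i * et j)))"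
proof -
  have e: "E (\<Sum>(g, h)\<leftarrow>xs. dd i g * sg (mw i) (dd j h)) (- (\<Sum>(g, h)\<leftarrow>xs. g * dd i (dd j h)))" for i j
    unfolding sum_list_leibniz using E_diff[OF E_dd[OF assms[of j], of i] E_refl] by simp
  have f: "W (fn (\<Sum>(g, h)\<leftarrow>xs. dd i g * sg (mw i) (dd j h))) (- fn (\<Sum>(g, h)\<leftarrow>xs. g * dd i (dd j h)))" for i j
    by (rule W_trans[OF W_fn[OF e] fn_minus])
  have "W (dsum xs) (\<Sum>i\<in>IX. \<Sum>j\<in>IX. - fn (\<Sum>(g, h)\<leftarrow>xs. g * dd i (dd j h)) * (et i * et j))"
    by (rule W_trans[OF dsum_expand]) (intro W_sum W_mult W_refl f)
  then show ?thesis by (simp add: sum_negf)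
qed

text \<open>A machine for relations: a list presenting the zero form gives an element of the
  envelope ideal, and constant second-order coefficients make it a scalar relation between the
  products of basic forms.\<close>

lemma et_relation:
  assumes 1: "\<And>j. E (\<Sum>(g, h)\<leftarrow>xs. g * dd j h) 0"
    and 2: "\<And>i j. E (\<Sum>(g, h)\<leftarrow>xs. g * dd i (dd j h)) (smul (c i j) 1)"
  shows "W (\<Sum>i\<in>IX. \<Sum>j\<in>IX. smul (c i j) (et i * et j)) 0"
proof -
  have f: "W (fn (\<Sum>(g, h)\<leftarrow>xs. g * dd i (dd j h))) (smul (c i j) 1)" for i j
    by (rule W_trans[OF W_fn[OF 2] W_trans[OF fn_smul W_smul[OF fn_one]]])
  have "(\<Sum>(g, h)\<leftarrow>xs. lact g (comult q h)) \<in> null1 (calcP q)"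
    using 1 by (simp add: null1_iff cf_list md_zero)
  then have "dsum xs \<in> \<Omega>null q"
    by (intro env_erels) (auto simp: env_rels_def)
  then have "W 0 (- dsum xs)"
    using csub_minus[OF env_csub] by (simp add: md_def)
  also have "W \<dots> (- (- (\<Sum>i\<in>IX. \<Sum>j\<in>IX. fn (\<Sum>(g, h)\<leftarrow>xs. g * dd i (dd j h)) * (et i * et j))))"
    using 1 by (intro W_minus dsum_expand_const[of xs "\<lambda>j. 0"]) simp
  also have "\<dots> = (\<Sum>i\<in>IX. \<Sum>j\<in>IX. fn (\<Sum>(g, h)\<leftarrow>xs. g * dd i (dd j h)) * (et i * et j))" by simp
  also have "W \<dots> (\<Sum>i\<in>IX. \<Sum>j\<in>IX. smul (c i j) 1 * (et i * et j))"
    by (intro W_sum W_mult W_refl f)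
  finally have "W 0 (\<Sum>i\<in>IX. \<Sum>j\<in>IX. smul (c i j) (et i * et j))" by simp
  then show ?thesis by (rule W_sym)
qed

text \<open>The solution of the cocycle equation \<open>cc_add\<close> with value 1 / (1 + Q^2) at
  1. It is the eigenvalue of \<open>dd I3\<close> in degree n, and also the multiple of the
  generator obtained from z^n in the germs of G. This coincidence makes the connection cancel the
  \<open>\<eta>3\<close> part of dp.\<close>

definition cc :: "int \<Rightarrow> complex" where
  "cc n = Q^2 * (1 - zf (2 * n)) / (Q^4 - 1)"

lemma Q4: "Q^4 - 1 \<noteq> 0"
proof
  assume "Q^4 - 1 = 0"
  then have "complex_of_real (q^4 - 1) = 0" by simp
  then have 1: "q^4 = 1" by (simp only: of_real_eq_0_iff)
  have "\<bar>q\<bar> < 1" using q1 by auto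
  then have "\<bar>q\<bar> ^ 4 < 1" using power_less_one_iff[of "\<bar>q\<bar>" 4] by simp
  then show False using 1 by simp
qed

lemma Q4_factor: "Q^4 - 1 = (1 + Q^2) * (Q^2 - 1)"
  by (simp add: algebra_simps power4_eq_xxxx power2_eq_square)

lemma Q2_minus [simp]: "Q^2 - 1 \<noteq> 0" "1 - Q^2 \<noteq> 0" "Q^2 \<noteq> 1"
  using Q4 unfolding Q4_factor by auto

lemma cc_simps [simp]: "cc 0 = 0" "cc 2 = 1 / Q^2" "cc (- 2) = - (Q^2)"
  "cc 1 = 1 / (1 + Q^2)" "cc (- 1) = - (Q^2) / (1 + Q^2)"
proof -
  have z: "zf 4 = 1 / Q^4" "zf (-4) = Q^4"
    using zf_add[of 2 2] zf_add[of "-2" "-2"] by (simp_all add: power4_eq_xxxx power2_eq_square)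
  show "cc 0 = 0" by (simp add: cc_def)
  show "cc 2 = 1 / Q^2" using Q4 by (simp add: cc_def z) (simp add: field_simps power4_eq_xxxx power2_eq_square)
  show "cc (-2) = - (Q^2)" using Q4 by (simp add: cc_def z) (simp add: field_simps)
  show "cc 1 = 1 / (1 + Q^2)" "cc (- 1) = - (Q^2) / (1 + Q^2)"
    by (simp_all add: cc_def Q4_factor) (simp_all add: divide_simps, simp_all add: algebra_simps)
qed

lemma cc_add: "cc (a + b) = cc b + cc a * zf (2 * b)"
  using zf_add[of "2 * a" "2 * b"] by (simp add: cc_def distrib_left divide_simps) (simp add: algebra_simps)

lemma dd3_pt: "dd I3 (pt w) = smul (cc (wdg w)) (pt w)"
proof -
  have "dd I3 (pt (Wd v)) = smul (cc (wdg (Wd v))) (pt (Wd v))" for v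
  proof (induction v)
    case Nil
    show ?case using dd_one[of I3] unfolding one_pt by (simp add: wd_zero)
  next
    case (Cons a v)
    have 1: "pt (Wd (a # v)) = var a * pt (Wd v)" by (simp only: pt_Cons)
    have 2: "dl I3 a = smul (cc (gdeg a)) (var a)" by (cases a) simp_all
    show ?case
      unfolding 1 dd_var_mult Cons 2
      by (simp add: cc_add var_mult_pt single_smul_pt[of _ "zf _"] smul_add_left[symmetric] del: smul_single)
        (simp add: var_def)?
  qed
  then show ?thesis by (cases w) simp
qed

lemma dd3_comp: "comp n x = x \<Longrightarrow> dd I3 x = smul (cc n) x"
proof -
  have "dd I3 (comp n x) = smul (cc n) (comp n x)"
    by (rule clin_eqI[of "\<lambda>x. dd I3 (comp n x)" "\<lambda>x. smul (cc n) (comp n x)"])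
      (simp_all add: clin_def smul_add mult.commute dd3_pt)
  then show "comp n x = x \<Longrightarrow> dd I3 x = smul (cc n) x" by simp
qed

text \<open>The degree shift caused by \<open>dd i\<close>. The basic form itself carries the
  opposite degree, since d preserves degrees.\<close>

fun dgi :: "ix \<Rightarrow> int" where "dgi I3 = 0" | "dgi Ip = -2" | "dgi Im = 2"

lemma comp_sg: "comp n (sg m x) = sg m (comp n x)"
  by (rule clin_eqI[of "\<lambda>x. comp n (sg m x)" "\<lambda>x. sg m (comp n x)"])
    (simp_all add: clin_def, simp add: comp_def lin_single clin_zero[OF clin_sg])

lemma comp_var [simp]: "comp n (var a) = (if n = gdeg a then var a else 0)"
  using comp_var_mult[of n a 1] by auto

lemma comp_dd: "comp (n + dgi i) (dd i x) = dd i (comp n x)"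
proof (induction x arbitrary: n rule: free_induct)
  case (var a x)
  have 1: "comp (n + dgi i) (dl i a * y) = dl i a * comp (n - gdeg a) y" for y
    by (cases i; cases a) (simp_all add: comp_var_mult algebra_simps)
  have 2: "comp (n + dgi i - gdeg a) (dd i x) = dd i (comp (n - gdeg a) x)"
    using var[of "n - gdeg a"] by (simp add: algebra_simps)
  show ?case by (simp add: dd_mult comp_var_mult 1 2 comp_sg)
qed simp_all

text \<open>Homogeneity as an equality of representatives. It is stricter than membership in
  \<open>Mor q n\<close>, which is homogeneity modulo \<open>PI q\<close>, and makes equations for
  degrees exact.\<close>

definition hdeg :: "int \<Rightarrow> gen free \<Rightarrow> bool" where
  "hdeg n x \<longleftrightarrow> comp n x = x"

lemma hdeg_dd: "hdeg n x \<Longrightarrow> m = n + dgi i \<Longrightarrow> hdeg m (dd i x)"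
  by (simp add: hdeg_def comp_dd)

lemma hdeg_dd3: "hdeg n x \<Longrightarrow> dd I3 x = smul (cc n) x"
  by (simp add: hdeg_def dd3_comp)

lemma hdeg_sg: "hdeg n x \<Longrightarrow> sg m x = smul (zf (m * n)) x"
proof -
  have "sg m (comp n x) = smul (zf (m * n)) (comp n x)"
    by (rule clin_eqI[of "\<lambda>x. sg m (comp n x)" "\<lambda>x. smul (zf (m * n)) (comp n x)"])
      (simp_all add: clin_def smul_add mult.commute)
  then show "hdeg n x \<Longrightarrow> sg m x = smul (zf (m * n)) x" by (simp add: hdeg_def)
qed

lemma lookup_numeral_mult: "Poly_Mapping.lookup (numeral n * x) k = numeral n * Poly_Mapping.lookup x k"
  for x :: "'a::monoid_add \<Rightarrow>\<^sub>0 complex"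
proof -
  have "numeral n * x = smul (numeral n) x" by (simp add: smul_conv_mult)
  then show ?thesis by simp
qed

text \<open>Distributivity is instantiated at \<open>gen free\<close>, so that polynomials are
  expanded while the complex coefficients stay closed until denominators are cleared.\<close>

lemmas nf_eval = lookup_numeral_mult dd_mult mult.assoc distrib_left[of a b c for a b c :: "gen free"]
  distrib_right[of a b c for a b c :: "gen free"] left_diff_distrib[of a b c for a b c :: "gen free"]
  right_diff_distrib[of a b c for a b c :: "gen free"]
  lookup_add lookup_single when_def lookup_minus zf_minus E_iff_nf smul_add

text \<open>The list \<open>?xs\<close> consists of the pairs S(p1), p2 for p = \<gamma>\<gamma>. As
  p lies in R_3, the form \<pi>(p) vanishes, and only the product of \<open>\<eta>p\<close> with
  itself survives in the resulting relation.\<close>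

lemma et_pp: "W (\<eta>p * \<eta>p) 0"
proof -
  let ?xs = "[(smul (Q^2) (\<gamma> * \<gamma>), \<alpha> * \<alpha>), (smul (- Q) (\<alpha> * \<gamma>), \<alpha> * \<gamma>), (smul (- Q) (\<gamma> * \<alpha>), \<gamma> * \<alpha>), (\<alpha> * \<alpha>, \<gamma> * \<gamma>)]"
  let ?c = "\<lambda>i j. if i = Ip \<and> j = Ip then Q + 1 / Q else 0"
  have "W (\<Sum>i\<in>IX. \<Sum>j\<in>IX. smul (?c i j) (et i * et j)) 0"
  proof (rule et_relation[of ?xs])
    show "E (\<Sum>(g, h)\<leftarrow>?xs. g * dd j h) 0" for j
      unfolding E_iff_nf by (rule poly_mapping_eqI, cases j)
        (simp_all add: nf_eval, (simp_all add: divide_simps)?, (simp_all add: algebra_simps eval_nat_numeral)?)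
    show "E (\<Sum>(g, h)\<leftarrow>?xs. g * dd i (dd j h)) (smul (?c i j) 1)" for i j
      unfolding E_iff_nf by (rule poly_mapping_eqI, cases j; cases i)
        (simp_all add: nf_eval, (simp_all add: divide_simps)?, (simp_all add: algebra_simps eval_nat_numeral)?)
  qed
  then have "W (smul (Q + 1 / Q) (\<eta>p * \<eta>p)) 0" by (simp add: sum_IX)
  moreover have "Q + 1 / Q \<noteq> 0" using one_plus_Q2 by (simp add: field_simps power2_eq_square)
  ultimately show ?thesis using W_smul[of "smul (Q + 1 / Q) (\<eta>p * \<eta>p)" 0 "1 / (Q + 1 / Q)"] by simp
qed

text \<open>The same construction with p = \<gamma>s\<gamma>s in R_3.\<close>

lemma et_mm: "W (\<eta>m q * \<eta>m q) 0"
proof -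
  let ?xs = "[(smul (1 / Q^2) (\<gamma>s * \<gamma>s), \<alpha>s * \<alpha>s), (smul (- 1 / Q) (\<alpha>s * \<gamma>s), \<alpha>s * \<gamma>s),
    (smul (- 1 / Q) (\<gamma>s * \<alpha>s), \<gamma>s * \<alpha>s), (\<alpha>s * \<alpha>s, \<gamma>s * \<gamma>s)]"
  let ?c = "\<lambda>i j. if i = Im \<and> j = Im then (Q + 1 / Q) / Q^2 else 0"
  have "W (\<Sum>i\<in>IX. \<Sum>j\<in>IX. smul (?c i j) (et i * et j)) 0"
  proof (rule et_relation[of ?xs])
    show "E (\<Sum>(g, h)\<leftarrow>?xs. g * dd j h) 0" for j
      unfolding E_iff_nf by (rule poly_mapping_eqI, cases j)
        (simp_all add: nf_eval, (simp_all add: divide_simps)?, (simp_all add: algebra_simps eval_nat_numeral)?)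
    show "E (\<Sum>(g, h)\<leftarrow>?xs. g * dd i (dd j h)) (smul (?c i j) 1)" for i j
      unfolding E_iff_nf by (rule poly_mapping_eqI, cases j; cases i)
        (simp_all add: nf_eval, (simp_all add: divide_simps)?, (simp_all add: algebra_simps eval_nat_numeral)?)
  qed
  then have "W (smul ((Q + 1 / Q) / Q^2) (\<eta>m q * \<eta>m q)) 0" by (simp add: sum_IX)
  moreover have "Q + 1 / Q \<noteq> 0" using one_plus_Q2 by (simp add: field_simps power2_eq_square)
  ultimately show ?thesis using W_smul[of "smul ((Q + 1 / Q) / Q^2) (\<eta>m q * \<eta>m q)" 0 "Q^2 / (Q + 1 / Q)"] by simp
qed

text \<open>The same construction with p = \<gamma>\<gamma>s in R_3. Both orders of the two factors
  survive, which gives the commutation factor -Q^2.\<close>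

lemma et_pm: "W (\<eta>p * \<eta>m q) (smul (- (Q^2)) (dvol q))"
proof -
  let ?xs = "[(\<gamma>s * \<gamma>, \<alpha> * \<alpha>s), (smul (- Q) (\<alpha>s * \<gamma>), \<alpha> * \<gamma>s),
    (smul (- 1 / Q) (\<gamma>s * \<alpha>), \<gamma> * \<alpha>s), (\<alpha>s * \<alpha>, \<gamma> * \<gamma>s)]"
  let ?c = "\<lambda>i j. if i = Im \<and> j = Ip then 1 else if i = Ip \<and> j = Im then 1 / Q^2 else 0"
  have "W (\<Sum>i\<in>IX. \<Sum>j\<in>IX. smul (?c i j) (et i * et j)) 0"
  proof (rule et_relation[of ?xs])
    show "E (\<Sum>(g, h)\<leftarrow>?xs. g * dd j h) 0" for j
      unfolding E_iff_nf by (rule poly_mapping_eqI, cases j)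
        (simp_all add: nf_eval, (simp_all add: divide_simps)?, (simp_all add: algebra_simps eval_nat_numeral)?)
    show "E (\<Sum>(g, h)\<leftarrow>?xs. g * dd i (dd j h)) (smul (?c i j) 1)" for i j
      unfolding E_iff_nf by (rule poly_mapping_eqI, cases j; cases i)
        (simp_all add: nf_eval, (simp_all add: divide_simps)?, (simp_all add: algebra_simps eval_nat_numeral)?)
  qed
  then have "W (smul (1 / Q^2) (\<eta>p * \<eta>m q) + dvol q) 0" by (simp add: sum_IX dvol_def)
  from W_smul[OF this, of "Q^2"] have "W (\<eta>p * \<eta>m q + smul (Q^2) (dvol q)) 0" by (simp add: smul_add)
  then show ?thesis by (simp add: md_def smul_minus)
qed

lemma E_sum_list: "(\<And>a. a \<in> set xs \<Longrightarrow> E (f a) (g a)) \<Longrightarrow> E (sum_list (map f xs)) (sum_list (map g xs))"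
  by (rule md_sum_list[OF PI_csub])

text \<open>If all \<open>h\<close> have degree 0, then \<open>dh\<close> has no component along \<open>\<eta>\<^sub>3\<close>, and the terms with
  \<open>\<eta>\<^sub>-\<eta>\<^sub>+\<close> cancel by the commutation relation for \<open>dd Im\<close> and \<open>dd Ip\<close>.\<close>

lemma dsum_degree0:
  assumes h: "\<And>g h. (g, h) \<in> set xs \<Longrightarrow> hdeg 0 h"
    and k: "\<And>j. E (\<Sum>(g, h)\<leftarrow>xs. g * dd j h) (smul (\<kappa> j) 1)"
  shows "W (dsum xs) (smul (- \<kappa> Im / Q^2) (\<eta>3 * \<eta>m q) + smul (Q^2 * \<kappa> Ip) (\<eta>3 * \<eta>p))"
proof -
  let ?F = "\<lambda>i j. fn (\<Sum>(g, h)\<leftarrow>xs. g * dd i (dd j h))"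
  let ?A = "\<Sum>(g, h)\<leftarrow>xs. g * dd Im (dd Ip h)" and ?B = "\<Sum>(g, h)\<leftarrow>xs. g * dd Ip (dd Im h)"
  have 0: "W (?F i I3 * x) 0" for i x
  proof -
    have "(\<Sum>(g, h)\<leftarrow>xs. g * dd i (dd I3 h)) = (\<Sum>a\<leftarrow>xs. 0)"
      by (rule arg_cong[of _ _ sum_list], rule map_cong[OF refl]) (auto dest: h simp: hdeg_dd3)
    then show ?thesis by (intro W_fn_zero) simp
  qed
  have 3: "W (?F I3 j) (smul (cc (dgi j) * \<kappa> j) 1)" if "j \<noteq> I3" for j
  proof -
    have "(\<Sum>(g, h)\<leftarrow>xs. g * dd I3 (dd j h)) = (\<Sum>(g, h)\<leftarrow>xs. smul (cc (dgi j)) (g * dd j h))"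
      by (rule arg_cong[of _ _ sum_list], rule map_cong[OF refl]) (auto dest!: h simp: hdeg_dd3[OF hdeg_dd[OF _ refl]])
    also have "\<dots> = smul (cc (dgi j)) (\<Sum>(g, h)\<leftarrow>xs. g * dd j h)"
      by (induction xs) (auto simp: smul_add)
    finally have "E (\<Sum>(g, h)\<leftarrow>xs. g * dd I3 (dd j h)) (smul (cc (dgi j) * \<kappa> j) 1)"
      using E_smul[OF k[of j], of "cc (dgi j)"] by simp
    then show ?thesis by (rule W_trans[OF W_fn W_trans[OF fn_smul W_smul[OF fn_one]]])
  qed
  have "smul (1 + Q^2) (\<Sum>(g, h)\<leftarrow>xs. g * dd I3 h) = 0"
  proof -
    have "(\<Sum>(g, h)\<leftarrow>xs. g * dd I3 h) = (\<Sum>a\<leftarrow>xs. 0)"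
      by (rule arg_cong[of _ _ sum_list], rule map_cong[OF refl]) (auto dest: h simp: hdeg_dd3)
    then show ?thesis by simp
  qed
  then have AB: "?A = smul (Q^2) ?B" using sum_list_dd_comm[of xs] by simp
  have mp: "W (?F Im Ip * (\<eta>m q * \<eta>p) + ?F Ip Im * (\<eta>p * \<eta>m q)) 0"
  proof -
    have "W (fn ?A * (\<eta>m q * \<eta>p) + fn ?B * (\<eta>p * \<eta>m q))
        (smul (Q^2) (fn ?B) * dvol q + fn ?B * smul (- (Q^2)) (dvol q))"
      unfolding AB dvol_def[symmetric] by (intro W_add W_mult W_refl fn_smul et_pm)
    then show ?thesis by (simp add: smul_minus)
  qed
  have z: "W (?F Im Im * (\<eta>m q * \<eta>m q)) 0" "W (?F Ip Ip * (\<eta>p * \<eta>p)) 0"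
    using W_mult[OF W_refl et_mm] W_mult[OF W_refl et_pp] by simp_all
  have "W (dsum xs) (- (\<Sum>i\<in>IX. \<Sum>j\<in>IX. ?F i j * (et i * et j)))"
    by (rule dsum_expand_const[OF k])
  also have "\<dots> = - ((?F I3 I3 * (\<eta>3 * \<eta>3) + ?F Ip I3 * (\<eta>p * \<eta>3) + ?F Im I3 * (\<eta>m q * \<eta>3))
     + (?F I3 Ip * (\<eta>3 * \<eta>p) + ?F I3 Im * (\<eta>3 * \<eta>m q))
     + (?F Im Ip * (\<eta>m q * \<eta>p) + ?F Ip Im * (\<eta>p * \<eta>m q)) + (?F Im Im * (\<eta>m q * \<eta>m q) + ?F Ip Ip * (\<eta>p * \<eta>p)))"
    by (simp add: sum_IX algebra_simps)
  also have "W \<dots> (- ((0 + 0 + 0) + (smul (cc (dgi Ip) * \<kappa> Ip) 1 * (\<eta>3 * \<eta>p) + smul (cc (dgi Im) * \<kappa> Im) 1 * (\<eta>3 * \<eta>m q)) + 0 + (0 + 0)))"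
    by (intro W_minus W_add 0 W_mult W_refl 3 mp z) simp_all
  finally show ?thesis by (simp add: smul_minus)
qed

subsection \<open>Presentations of one-forms\<close>

text \<open>The pairs S(p1), p2 with p = (1 + q^2) \<alpha>, p = \<gamma>\<alpha>s / q and p = q
  \<gamma>s\<alpha>. They present \<eta>3, \<eta>p and \<eta>m / q. In the last two cases all second
  entries have degree 0, as \<open>dsum_degree0\<close> requires.\<close>

fun gdh :: "ix \<Rightarrow> (gen free \<times> gen free) list" where
  "gdh I3 = [(smul (1 + Q^2) \<alpha>s, \<alpha>), (smul (- (1 + Q^2)) \<gamma>s, \<gamma>)]"
| "gdh Ip = [(smul (-1) (\<alpha> * \<gamma>), \<alpha> * \<alpha>s), (smul (Q^2) (\<gamma> * \<gamma>), \<alpha> * \<gamma>s), (smul (1 / Q) (\<alpha> * \<alpha>), \<gamma> * \<alpha>s),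
     (smul (- Q) (\<gamma> * \<alpha>), \<gamma> * \<gamma>s)]"
| "gdh Im = [(smul (-1) (\<alpha>s * \<gamma>s), \<alpha>s * \<alpha>), (\<gamma>s * \<gamma>s, \<alpha>s * \<gamma>), (smul Q (\<alpha>s * \<alpha>s), \<gamma>s * \<alpha>),
     (smul (- Q) (\<gamma>s * \<alpha>s), \<gamma>s * \<gamma>)]"

lemma gdh_sum: "E (\<Sum>(g, h)\<leftarrow>gdh i. g * dd j h) (smul (if i = j then if i = Im then 1 / Q else 1 else 0) 1)"
  unfolding E_iff_nf by (rule poly_mapping_eqI, cases j; cases i)
    (simp_all add: nf_eval, (simp_all add: divide_simps)?, (simp_all add: algebra_simps eval_nat_numeral)?)

lemma gdh_degree0: "i \<noteq> I3 \<Longrightarrow> (g, h) \<in> set (gdh i) \<Longrightarrow> hdeg 0 h"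
  by (cases i) (auto simp: hdeg_def comp_var_mult)

definition is_pres :: "(gen free \<times> gen free) list \<Rightarrow> (gen wd \<times> gen wd \<Rightarrow>\<^sub>0 complex) \<Rightarrow> bool" where
  "is_pres xs \<omega> \<longleftrightarrow> (\<forall>j. E (\<Sum>(g, h)\<leftarrow>xs. g * dd j h) (cf j \<omega>))"

lemma is_pres_iff: "is_pres xs \<omega> \<longleftrightarrow> (\<Sum>(g, h)\<leftarrow>xs. lact g (dif (calcP q) h)) - \<omega> \<in> null1 (calcP q)"
  by (simp add: is_pres_def null1_iff slice_lin cf_list md_def)

lemma is_pres_append: "is_pres xs \<omega> \<Longrightarrow> is_pres ys \<omega>' \<Longrightarrow> is_pres (xs @ ys) (\<omega> + \<omega>')"
  by (simp add: is_pres_def slice_lin E_add)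

lemma is_pres_lact: "is_pres xs \<omega> \<Longrightarrow> is_pres (map (\<lambda>(g, h). (p * g, h)) xs) (lact p \<omega>)"
proof -
  have "(\<Sum>(g, h)\<leftarrow>map (\<lambda>(g, h). (p * g, h)) xs. g * dd j h) = p * (\<Sum>(g, h)\<leftarrow>xs. g * dd j h)" for j
    by (induction xs) (auto simp: algebra_simps)
  then show "is_pres xs \<omega> \<Longrightarrow> is_pres (map (\<lambda>(g, h). (p * g, h)) xs) (lact p \<omega>)"
    by (simp add: is_pres_def cf_lact E_mult)
qed

lemma gdh_pres: "is_pres (gdh i) (tens 1 (smul (if i = Im then 1 / Q else 1) (eg i)))"
  unfolding is_pres_def
proof
  fix j
  have "cf j (tens 1 (smul (if i = Im then 1 / Q else 1) (eg i))) = smul (if i = j then if i = Im then 1 / Q else 1 else 0) 1"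
    unfolding slice_tens fl_simps chw_eg by auto
  then show "E (\<Sum>(g, h)\<leftarrow>gdh i. g * dd j h) (cf j (tens 1 (smul (if i = Im then 1 / Q else 1) (eg i))))"
    by (simp only: gdh_sum)
qed

text \<open>Presentations of the basic forms are multiplied from the left by the coefficients and
  concatenated; the factor Q at \<open>Im\<close> cancels the 1 / Q of
  \<open>gdh Im\<close>.\<close>

lemma is_pres_ex: "\<exists>xs. is_pres xs \<omega>"
proof -
  have 1: "is_pres (gdh i) (smul (if i = Im then 1 / Q else 1) (tens 1 (eg i)))" for i
    using gdh_pres[of i] unfolding tens_smul_right .
  have 2: "lact p (smul c \<omega>) = lact (smul c p) \<omega>" for p c \<omega>
    unfolding lact_def tens_smul_left by simp
  let ?\<omega> = "\<lambda>i. lact (smul (if i = Im then Q else 1) (cf i \<omega>)) (smul (if i = Im then 1 / Q else 1) (tens 1 (eg i)))"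
  have 3: "?\<omega> i = lact (cf i \<omega>) (tens 1 (eg i))" for i
    unfolding 2 by simp
  have 4: "\<exists>xs. is_pres xs (?\<omega> i)" for i
    using is_pres_lact[OF 1] by blast
  have "\<exists>xs. is_pres xs (?\<omega> I3 + ?\<omega> Ip + ?\<omega> Im)"
    using 4[of I3] 4[of Ip] 4[of Im] is_pres_append by blast
  moreover have "cf j (?\<omega> I3 + ?\<omega> Ip + ?\<omega> Im) = cf j \<omega>" for j
    unfolding 3 by (cases j) (simp_all add: slice_lin cf_lact chw_eg del: eg.simps)
  ultimately show ?thesis by (simp add: is_pres_def)
qed

lemma is_pres_presentation: "is_pres (presentation (calcP q) \<omega>) \<omega>"
  using someI_ex[OF is_pres_ex[of \<omega>, unfolded is_pres_iff]] unfolding presentation_def is_pres_iff by simp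

text \<open>Two presentations of the same form differ by a presentation of zero, whose differential
  is a defining relation of the envelope. So the presentation chosen in \<open>d_letter\<close> may
  be replaced by a convenient one.\<close>

lemma d_letter_dsum: "is_pres xs \<omega> \<Longrightarrow> W (d_letter (calcP q) (Fm \<omega>)) (dsum xs)"
proof -
  assume xs: "is_pres xs \<omega>"
  let ?ys = "map (\<lambda>(g, h). (- 1 * g, h)) xs"
  let ?zs = "presentation (calcP q) \<omega> @ ?ys"
  have "is_pres ?zs (\<omega> + lact (- 1) \<omega>)"
    by (intro is_pres_append is_pres_lact xs is_pres_presentation)
  moreover have "(\<Sum>(g, h)\<leftarrow>zs. lact g (comult q h)) \<in> null1 (calcP q)" if "is_pres zs (\<omega> + lact (- 1) \<omega>)" for zs
    using that by (simp add: is_pres_def null1_iff cf_list slice_lin cf_lact md_zero)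
  ultimately have "(\<Sum>(g, h)\<leftarrow>?zs. lact g (comult q h)) \<in> null1 (calcP q)" by blast
  then have "dsum ?zs \<in> \<Omega>null q"
    by (intro env_erels) (auto simp: env_rels_def simp del: map_append)
  then have 1: "W (d_letter (calcP q) (Fm \<omega>) + dsum ?ys) 0" by (simp add: md_zero del: map_map)
  have 2: "W (dsum ?ys) (- dsum xs)"
  proof (induction xs)
    case (Cons a xs)
    have "W (fm (comult q (- 1 * fst a)) * fm (comult q (snd a))) (- fm (comult q (fst a)) * fm (comult q (snd a)))"
      using fm_smul[of "calcP q" "-1" "comult q (fst a)"]
      by (intro W_mult W_refl) (simp add: clin_minus[OF clin_hom_ext] comult_def smul_minus)
    from W_add[OF this Cons] show ?case by (simp add: case_prod_unfold)
  qed simp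
  from W_diff[OF 1 2] show ?thesis by (simp del: map_map d_letter.simps)
qed

lemma dP_fn_fm: "dP q (fn a * fm \<omega>) = fm (comult q a) * fm \<omega> + fn a * d_letter (calcP q) (Fm \<omega>)"
proof -
  have 1: "fn a * fm \<omega> = pt (Wd [Fn a, Fm \<omega>])" "fm \<omega> = pt (Wd [Fm \<omega>])" "pt (Wd []) = (1 :: gen wd env)"
    unfolding fn_def fm_def one_pt by (simp_all add: var_def wd_zero)
  show ?thesis
    unfolding 1(1) d_env_def lin_pt by (simp add: 1(2,3) var_lt del: d_letter.simps(2) single_one)
qed

lemma clin_dP: "clin (dP q)"
  unfolding d_env_def by simp

lemma dP_one [simp]: "dP q 1 = 0"
  unfolding one_pt d_env_def by (simp add: del: single_one)

lemma dP_fn: "dP q (fn a) = fm (comult q a)"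
proof -
  have 1: "fn a = pt (Wd [Fn a])" "pt (Wd []) = (1 :: gen wd env)"
    unfolding fn_def one_pt by (simp_all add: var_def wd_zero)
  show ?thesis unfolding 1(1) d_env_def lin_pt by (simp add: 1(2) del: single_one)
qed

lemma W_fn_smul: "E p (smul c p') \<Longrightarrow> W (fn p) (smul c (fn p'))"
  by (rule W_trans[OF W_fn fn_smul])

text \<open>The hypothesis says that a behaves as in degree 2. Then the contribution of da along
  \<open>\<eta>3\<close> is cancelled by the derivative of \<open>\<eta>m\<close>, and only the
  \<open>\<eta>p\<close> part of da produces a volume term.\<close>

lemma dP_etm:
  assumes a: "E (dd I3 a) (smul (1 / Q^2) a)"
  shows "W (dP q (fn a * \<eta>m q)) (fn (smul (- (Q^2)) (dd Ip a)) * dvol q)"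
proof -
  let ?\<omega> = "tens 1 \<gamma>s :: gen wd \<times> gen wd \<Rightarrow>\<^sub>0 complex"
  have "is_pres (gdh Im) ?\<omega>" using gdh_pres[of Im] by (simp del: gdh.simps tens_smul_right)
  then have "W (d_letter (calcP q) (Fm ?\<omega>)) (dsum (gdh Im))" by (rule d_letter_dsum)
  also have "W \<dots> (smul (- (1 / Q) / Q^2) (\<eta>3 * \<eta>m q))"
    using dsum_degree0[OF gdh_degree0[of Im] gdh_sum[where i = Im]] by (simp del: gdh.simps)
  finally have "W (smul Q (d_letter (calcP q) (Fm ?\<omega>))) (smul Q (smul (- (1 / Q) / Q^2) (\<eta>3 * \<eta>m q)))"
    by (rule W_smul)
  then have 1: "W (smul Q (d_letter (calcP q) (Fm ?\<omega>))) (smul (- 1 / Q^2) (\<eta>3 * \<eta>m q))" by simp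
  have "dP q (fn a * \<eta>m q) = fm (comult q a) * \<eta>m q + fn a * smul Q (d_letter (calcP q) (Fm ?\<omega>))"
    unfolding \<eta>m_def smul_mult_right clin_smul[OF clin_dP] dP_fn_fm smul_add by simp
  also have "W \<dots> ((\<Sum>i\<in>IX. fn (dd i a) * et i) * \<eta>m q + fn a * smul (- 1 / Q^2) (\<eta>3 * \<eta>m q))"
    using fm_expand[of "comult q a"] by (intro W_add W_mult W_refl 1) (simp add: cf_comult)
  also have "\<dots> = fn (dd I3 a) * (\<eta>3 * \<eta>m q) + fn (dd Ip a) * (\<eta>p * \<eta>m q) + fn (dd Im a) * (\<eta>m q * \<eta>m q)
      - smul (1 / Q^2) (fn a) * (\<eta>3 * \<eta>m q)"
    by (simp add: sum_IX distrib_right mult.assoc smul_minus)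
  also have "W \<dots> (smul (1 / Q^2) (fn a) * (\<eta>3 * \<eta>m q) + fn (dd Ip a) * smul (- (Q^2)) (dvol q) + fn (dd Im a) * 0
      - smul (1 / Q^2) (fn a) * (\<eta>3 * \<eta>m q))"
    by (intro W_diff W_add W_mult W_refl W_fn_smul a et_pm et_mm)
  also have "\<dots> = smul (- (Q^2)) (fn (dd Ip a)) * dvol q" by simp
  also have "W \<dots> (fn (smul (- (Q^2)) (dd Ip a)) * dvol q)" by (intro W_mult W_refl W_sym[OF fn_smul])
  finally show ?thesis .
qed

text \<open>The counterpart in degree -2, where \<open>dd I3\<close> acts by -Q^2 and cancels the
  derivative of \<open>\<eta>p\<close>.\<close>

lemma dP_etp:
  assumes a: "E (dd I3 a) (smul (- (Q^2)) a)"
  shows "W (dP q (fn a * \<eta>p)) (fn (dd Im a) * dvol q)"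
proof -
  let ?\<omega> = "tens 1 \<gamma> :: gen wd \<times> gen wd \<Rightarrow>\<^sub>0 complex"
  have "is_pres (gdh Ip) ?\<omega>" using gdh_pres[of Ip] by (simp del: gdh.simps)
  then have "W (d_letter (calcP q) (Fm ?\<omega>)) (dsum (gdh Ip))" by (rule d_letter_dsum)
  also have "W \<dots> (smul (Q^2) (\<eta>3 * \<eta>p))"
    using dsum_degree0[OF gdh_degree0[of Ip] gdh_sum[where i = Ip]] by (simp del: gdh.simps)
  finally have 1: "W (d_letter (calcP q) (Fm ?\<omega>)) (smul (Q^2) (\<eta>3 * \<eta>p))" .
  have "dP q (fn a * \<eta>p) = fm (comult q a) * \<eta>p + fn a * d_letter (calcP q) (Fm ?\<omega>)"
    unfolding \<eta>p_def dP_fn_fm by simp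
  also have "W \<dots> ((\<Sum>i\<in>IX. fn (dd i a) * et i) * \<eta>p + fn a * smul (Q^2) (\<eta>3 * \<eta>p))"
    using fm_expand[of "comult q a"] by (intro W_add W_mult W_refl 1) (simp add: cf_comult)
  also have "\<dots> = fn (dd I3 a) * (\<eta>3 * \<eta>p) + fn (dd Ip a) * (\<eta>p * \<eta>p) + fn (dd Im a) * dvol q
      + smul (Q^2) (fn a) * (\<eta>3 * \<eta>p)"
    by (simp add: sum_IX distrib_right mult.assoc dvol_def)
  also have "W \<dots> (smul (- (Q^2)) (fn a) * (\<eta>3 * \<eta>p) + fn (dd Ip a) * 0 + fn (dd Im a) * dvol q
      + smul (Q^2) (fn a) * (\<eta>3 * \<eta>p))"
    by (intro W_add W_mult W_refl W_fn_smul a et_pp)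
  also have "\<dots> = fn (dd Im a) * dvol q" by (simp add: smul_minus)
  finally show ?thesis .
qed

section \<open>Coaction and horizontal forms\<close>

lemma clin_id' [simp]: "clin id"
  by (simp add: clin_def)

lemma tmap_id_mult: "(\<And>x y. g (x * y) = g x * g y) \<Longrightarrow> clin g \<Longrightarrow> tmap id g (X * Y) = tmap id g X * tmap id g Y"
  for g :: "('b::monoid_add \<Rightarrow>\<^sub>0 complex) \<Rightarrow> ('c::monoid_add \<Rightarrow>\<^sub>0 complex)" and X :: "'a::monoid_add \<times> 'b \<Rightarrow>\<^sub>0 complex"
proof (rule clin2_eqI[of "\<lambda>X Y. tmap id g (X * Y)" "\<lambda>X Y. tmap id g X * tmap id g Y"])
  assume g: "\<And>x y. g (x * y) = g x * g y" "clin g"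
  show "tmap id g (pt j * pt k) = tmap id g (pt j) * tmap id g (pt k)" for j k
    by (cases j; cases k) (simp add: tmap_pt tens_mult g(1)[symmetric])
qed (simp_all add: clin_def clin_add[OF clin_tmap] clin_smul[OF clin_tmap] algebra_simps)

text \<open>The map j kills \<open>\<gamma>\<close> and \<open>\<gamma>s\<close>, so one summand of
  the coproduct of each generator survives and every word is homogeneous.\<close>

lemma coactP_pt: "coactP q (pt w) = pt (w, wdg w)"
proof -
  have a: "tmap id (hom_ext gen_j) (gen_comult q a) = tens (var a) (zpow (gdeg a))" for a
    by (cases a) (simp_all add: clin_add[OF clin_tmap] clin_smul[OF clin_tmap] tmap_tens)
  have "coactP q (pt (Wd v)) = pt (Wd v, wdg (Wd v))" for v
  proof (induction v)
    case Nil
    have 1: "pt (Wd []) = (1 :: gen free)" "pt (Wd [], 0) = (1 :: gen wd \<times> int \<Rightarrow>\<^sub>0 complex)"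
      by (simp_all only: one_pt wd_zero zero_prod_def)
    have "tmap id (hom_ext gen_j) (tens 1 1) = tens 1 1"
      by (simp only: tmap_tens[OF clin_id' clin_hom_ext] id_apply hom_ext_one)
    then show ?case unfolding 1(1) coactP_def comult_one wdg_simps 1(2) tens_one .
  next
    case (Cons a v)
    have 1: "pt (Wd (a # v)) = var a * pt (Wd v)" by (simp only: pt_Cons)
    show ?case
      unfolding 1 coactP_def comult_mult tmap_id_mult[OF hom_ext_mult clin_hom_ext] comult_var a
      using Cons by (simp add: coactP_def zpow_def tens_mult_pt var_mult_pt)
  qed
  then show ?thesis by (cases w) simp
qed

lemma clin_coactP: "clin (coactP q)"
  by (simp add: clin_def coactP_def comult_lin clin_add[OF clin_tmap] clin_smul[OF clin_tmap])

lemma coactP_lin: "coactP q p = lin (\<lambda>w. pt (w, wdg w)) p"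
  using clin_lin_pt[OF clin_coactP] by (simp add: coactP_pt)

lemma coactP_hdeg: "hdeg n p \<Longrightarrow> coactP q p = tens p (zpow n)"
proof -
  have "coactP q (comp n p) = tens (comp n p) (zpow n)"
    by (rule clin_eqI[of "\<lambda>p. coactP q (comp n p)" "\<lambda>p. tens (comp n p) (zpow n)"])
      (simp_all add: clin_def clin_add[OF clin_coactP] clin_smul[OF clin_coactP] clin_zero[OF clin_coactP]
        tens_add_left coactP_pt zpow_def)
  then show "hdeg n p \<Longrightarrow> coactP q p = tens p (zpow n)" by (simp add: hdeg_def)
qed

lemma coactP_decomp: "coactP q p = (\<Sum>r\<in>wdg ` Poly_Mapping.keys p. tens (comp r p) (zpow r))"
proof -
  let ?R = "wdg ` Poly_Mapping.keys p"
  have "coactP q p = lin (\<lambda>w. \<Sum>r\<in>?R. tens (comp r (pt w)) (zpow r)) p"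
    unfolding coactP_lin
  proof (rule lin_cong)
    fix w assume w: "w \<in> Poly_Mapping.keys p"
    have "(\<Sum>r\<in>?R. tens (comp r (pt w)) (zpow r)) = (\<Sum>r\<in>?R. if r = wdg w then pt (w, wdg w) else 0)"
      by (rule sum.cong) (auto simp: zpow_def)
    then show "pt (w, wdg w) = (\<Sum>r\<in>?R. tens (comp r (pt w)) (zpow r))" using w by simp
  qed
  also have "\<dots> = (\<Sum>r\<in>?R. lin (\<lambda>w. tens (comp r (pt w)) (zpow r)) p)" by (rule lin_sum_fun)
  also have "\<dots> = (\<Sum>r\<in>?R. tens (comp r p) (zpow r))"
    by (intro sum.cong refl clin_lin_pt[symmetric] clin_tens_left clin_comp_deg)
  finally show ?thesis .
qed

lemma coactP_PI: "p \<in> PI q \<Longrightarrow> coactP q p \<in> tnull (PI q) {0}"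
  unfolding coactP_decomp by (intro csub_sum[OF tnull_csub] tnullI disjI1 comp_PI)

lemma slice_degree_coactP: "slice (\<lambda>m. if m = n then 1 else 0) (coactP q p) = comp n p"
  by (rule clin_eqI[of "\<lambda>p. slice (\<lambda>m. if m = n then 1 else 0) (coactP q p)" "comp n", OF clin_comp[OF clin_slice clin_coactP] clin_comp_deg])
    (auto simp: coactP_pt)

text \<open>The coefficient of z^n in the coaction is the component of degree n, which gives one
  direction; the other uses that \<open>PI q\<close> is graded.\<close>

lemma Mor_iff: "p \<in> Mor q n \<longleftrightarrow> E p (comp n p)"
proof
  let ?F = "slice (\<lambda>m. if m = n then 1 else 0) :: (gen wd \<times> int \<Rightarrow>\<^sub>0 complex) \<Rightarrow> gen free"
  assume "p \<in> Mor q n"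
  then have "coactP q p - tens p (zpow n) \<in> tnull (PI q) {0}" by (simp add: Mor_def)
  then have "?F (coactP q p - tens p (zpow n)) \<in> PI q"
    by (rule tnull_into[OF clin_slice PI_csub, rotated]) (auto intro: csub_smul[OF PI_csub] csub_zero[OF PI_csub])
  then have "E (comp n p) p" by (simp add: slice_lin slice_degree_coactP zpow_def md_def)
  then show "E p (comp n p)" by (rule E_sym)
next
  assume e: "E p (comp n p)"
  have c: "hdeg n (comp n p)"
    unfolding hdeg_def
    by (rule clin_eqI[of "\<lambda>p. comp n (comp n p)" "comp n", OF clin_comp[OF clin_comp_deg clin_comp_deg] clin_comp_deg]) auto
  have "coactP q p - tens p (zpow n) = coactP q (p - comp n p) - tens (p - comp n p) (zpow n)"
    using coactP_hdeg[OF c] by (simp add: clin_diff[OF clin_coactP] tens_diff_left)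
  also have "\<dots> \<in> tnull (PI q) {0}"
    using e unfolding md_def by (intro csub_diff[OF tnull_csub] coactP_PI tnullI disjI1)
  finally show "p \<in> Mor q n" by (simp add: Mor_def)
qed

lemma lookup_comp: "Poly_Mapping.lookup (comp r p) w = (if wdg w = r then Poly_Mapping.lookup p w else 0)"
proof -
  have "Poly_Mapping.lookup (comp r p) w = fl (\<lambda>v. if v = w \<and> wdg v = r then 1 else 0) p"
    by (rule fl_eqI[of "\<lambda>p. Poly_Mapping.lookup (comp r p) w"]) (auto simp: lookup_add lookup_single when_def)
  also have "\<dots> = (if wdg w = r then Poly_Mapping.lookup p w else 0)"
    by (rule fl_eqI[of "fl _" "\<lambda>p. if wdg w = r then Poly_Mapping.lookup p w else 0"]) (auto simp: lookup_add lookup_single when_def)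
  finally show ?thesis .
qed

lemma hdeg_iff: "hdeg n p \<longleftrightarrow> (\<forall>w\<in>Poly_Mapping.keys p. wdg w = n)"
proof
  assume "hdeg n p"
  then have "comp n p = p" by (simp add: hdeg_def)
  then show "\<forall>w\<in>Poly_Mapping.keys p. wdg w = n"
    by (intro ballI) (metis in_keys_iff lookup_comp)
next
  assume "\<forall>w\<in>Poly_Mapping.keys p. wdg w = n"
  then show "hdeg n p"
    unfolding hdeg_def by (intro poly_mapping_eqI) (auto simp: lookup_comp in_keys_iff)
qed

lemma hdeg_comp [simp]: "hdeg n (comp n p)"
  by (auto simp: hdeg_iff in_keys_iff lookup_comp split: if_splits)

lemma hdeg_zero [simp]: "hdeg n 0" and hdeg_add: "hdeg n x \<Longrightarrow> hdeg n y \<Longrightarrow> hdeg n (x + y)"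
  and hdeg_smul: "hdeg n x \<Longrightarrow> hdeg n (smul c x)"
  by (simp_all add: hdeg_def)

lemma hdeg_one [simp]: "hdeg 0 1"
  by (simp add: hdeg_def)

lemma hdeg_mult: "hdeg n x \<Longrightarrow> hdeg m y \<Longrightarrow> hdeg (n + m) (x * y)"
  unfolding hdeg_iff using keys_mult[of x y] by fastforce

lemma MorI: "hdeg n x \<Longrightarrow> E p x \<Longrightarrow> p \<in> Mor q n"
  unfolding Mor_iff hdeg_def by (metis E_comp E_sym E_trans)

lemma MorE: "p \<in> Mor q n \<Longrightarrow> (\<And>x. hdeg n x \<Longrightarrow> E p x \<Longrightarrow> thesis) \<Longrightarrow> thesis"
  unfolding Mor_iff using hdeg_comp by blast

lemma hdeg_Mor: "hdeg n x \<Longrightarrow> x \<in> Mor q n"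
  by (rule MorI[OF _ E_refl])

lemma Mor_E: "p \<in> Mor q n \<Longrightarrow> E p' p \<Longrightarrow> p' \<in> Mor q n"
  by (erule MorE) (blast intro: MorI E_trans)

lemma Mor_csub: "csub (Mor q n)"
proof -
  have "x + y \<in> Mor q n" if "x \<in> Mor q n" "y \<in> Mor q n" for x y
    using that by (auto elim!: MorE intro: MorI hdeg_add E_add)
  moreover have "smul c x \<in> Mor q n" if "x \<in> Mor q n" for c x
    using that by (auto elim!: MorE intro: MorI hdeg_smul E_smul)
  ultimately show ?thesis by (simp add: csub_def hdeg_Mor)
qed

lemma Mor_mult: "x \<in> Mor q n \<Longrightarrow> y \<in> Mor q m \<Longrightarrow> x * y \<in> Mor q (n + m)"
  by (auto elim!: MorE intro: MorI hdeg_mult E_mult)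

lemma Mor_dd: "x \<in> Mor q n \<Longrightarrow> m = n + dgi i \<Longrightarrow> dd i x \<in> Mor q m"
  by (erule MorE, rule MorI[OF hdeg_dd E_dd])

lemma Mor_dd3: "x \<in> Mor q n \<Longrightarrow> E (dd I3 x) (smul (cc n) x)"
  by (erule MorE) (metis E_dd E_smul E_sym E_trans hdeg_dd3)

lemma Mor_sg: "x \<in> Mor q n \<Longrightarrow> E (sg m x) (smul (zf (m * n)) x)"
  by (erule MorE) (metis E_sg E_smul E_sym E_trans hdeg_sg)

lemma pstar_PI: "x \<in> PI q \<Longrightarrow> pstar x \<in> PI q"
  unfolding PI_def
proof (induction rule: ideal2.induct)
  case (gen s a b)
  then have "pstar s \<in> rels q \<union> pstar ` rels q" by (auto simp: image_iff)
  then have "pstar b * pstar s * pstar a \<in> ideal2 (rels q \<union> pstar ` rels q)" by (rule ideal2.gen)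
  then show ?case by (simp add: mult.assoc)
qed (auto intro: ideal2.intros)

lemma E_pstar: "E x y \<Longrightarrow> E (pstar x) (pstar y)"
  unfolding md_def using pstar_PI[of "x - y"] by simp

lemma wdg_star: "wdg (Wd (rev (map gen_star (letters w)))) = - wdg w"
proof -
  have g: "gdeg (gen_star a) = - gdeg a" for a by (cases a) auto
  have "sum_list (map gdeg (rev (map gen_star v))) = - sum_list (map gdeg v)" for v
    by (induction v) (auto simp: g)
  then show ?thesis by (simp add: wdg_def)
qed

lemma comp_pstar: "comp n (pstar x) = pstar (comp (- n) x)"
  by (rule alin_eqI[of "\<lambda>x. comp n (pstar x)" "\<lambda>x. pstar (comp (- n) x)"])
    (auto simp: alin_def pstar_pt wdg_star)

lemma Mor_pstar: "x \<in> Mor q n \<Longrightarrow> m = - n \<Longrightarrow> pstar x \<in> Mor q m"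
  unfolding Mor_iff comp_pstar using E_pstar by fastforce

text \<open>The relations \<alpha>\<alpha>s - q^2 \<gamma>\<gamma>s = 1 and \<alpha>s\<alpha> -
  \<gamma>s\<gamma> = 1 split 1 in degrees 1 and -1. The general case is an induction in both
  directions; it supplies the surjectivity of \<open>\<Upsilon>\<close>.\<close>

lemma Mor_unit: "\<exists>xs. (\<forall>(a, b)\<in>set xs. a \<in> Mor q n \<and> b \<in> Mor q (- n)) \<and> E (\<Sum>(a, b)\<leftarrow>xs. a * b) 1"
proof -
  let ?P = "\<lambda>n. \<exists>xs. (\<forall>(a, b)\<in>set xs. a \<in> Mor q n \<and> b \<in> Mor q (- n)) \<and> E (\<Sum>(a, b)\<leftarrow>xs. a * b) 1"
  have step: "?P (n + d)" if n: "?P n" and u: "hdeg d u" "hdeg (- d) u'" "hdeg d v" "hdeg (- d) v'" "E (u * u' + v * v') 1"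
    for n d u u' v v'
  proof -
    obtain xs where xs: "\<And>a b. (a, b) \<in> set xs \<Longrightarrow> a \<in> Mor q n" "\<And>a b. (a, b) \<in> set xs \<Longrightarrow> b \<in> Mor q (- n)"
      "E (\<Sum>(a, b)\<leftarrow>xs. a * b) 1"
      using n by auto
    \<comment> \<open>The splitting of 1 in degree d is inserted between the two factors of the
      splitting in degree n.\<close>
    let ?ys = "map (\<lambda>(a, b). (a * u, u' * b)) xs @ map (\<lambda>(a, b). (a * v, v' * b)) xs"
    have 1: "a \<in> Mor q (n + d) \<and> b \<in> Mor q (- (n + d))" if "(a, b) \<in> set ?ys" for a b
      using that Mor_mult[OF xs(1) hdeg_Mor[OF u(1)]] Mor_mult[OF hdeg_Mor[OF u(2)] xs(2)]
        Mor_mult[OF xs(1) hdeg_Mor[OF u(3)]] Mor_mult[OF hdeg_Mor[OF u(4)] xs(2)]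
      by (auto simp: algebra_simps)
    have 2: "(\<Sum>(a, b)\<leftarrow>?ys. a * b) = (\<Sum>(a, b)\<leftarrow>xs. a * (u * u' + v * v') * b)"
      by (induction xs) (auto simp: algebra_simps)
    have "E (\<Sum>(a, b)\<leftarrow>xs. a * (u * u' + v * v') * b) (\<Sum>(a, b)\<leftarrow>xs. a * 1 * b)"
      unfolding case_prod_unfold by (intro E_sum_list E_mult E_refl u)
    then have 3: "E (\<Sum>(a, b)\<leftarrow>?ys. a * b) 1"
      unfolding 2 by (rule E_trans) (use xs(3) in simp)
    show ?thesis
    proof (rule exI[of _ ?ys], rule conjI)
      show "\<forall>(a, b)\<in>set ?ys. a \<in> Mor q (n + d) \<and> b \<in> Mor q (- (n + d))" using 1 by blast
    qed (rule 3)
  qed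
  have d: "hdeg 1 \<alpha>" "hdeg (- 1) \<alpha>s" "hdeg 1 \<gamma>" "hdeg (- 1) \<gamma>s" by (simp_all add: hdeg_def)
  have r1: "E (\<alpha> * \<alpha>s + \<gamma> * smul (- (Q^2)) \<gamma>s) 1"
    using E_diff[OF E_rels(2) E_refl[of "smul (Q^2) (\<gamma> * \<gamma>s)"]] by (simp add: smul_minus)
  have r2: "E (\<alpha>s * \<alpha> + \<gamma>s * smul (- 1) \<gamma>) 1"
    using E_diff[OF E_rels(1) E_refl[of "\<gamma>s * \<gamma>"]] by (simp add: smul_minus)
  show "?P n"
  proof (induction n rule: int_induct[of _ 0])
    case base
    show ?case by (rule exI[of _ "[(1, 1)]"]) (simp add: hdeg_Mor)
  next
    case (step1 n)
    show ?case by (rule step[OF step1(2) d(1,2,3) hdeg_smul[OF d(4)] r1])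
  next
    case (step2 n)
    have d': "hdeg (- (- 1)) \<alpha>" "hdeg (- (- 1)) \<gamma>" using d by simp_all
    show ?case using step[OF step2(2) d(2) d'(1) d(4) hdeg_smul[OF d'(2)] r2] by simp
  qed
qed

subsection \<open>The calculus on \<open>G\<close>\<close>

lemma G_simps [simp]: "Cou (calcG q) = counitG" "Cop (calcG q) = comultG" "Rel (calcG q) = {0}"
  by (simp_all add: calcG_def)

lemma counitG_fl: "counitG = fl (\<lambda>_. 1)"
  by (rule ext) (simp add: counitG_def fl_def)

lemma comultG_pt [simp]: "comultG (pt m) = pt (m, m)"
  by (simp add: comultG_def zpow_def)

text \<open>Generator of the right ideal that defines the calculus on G, the image under j of the
  last generator of R_3. The element \<open>eG\<close> represents the basic germ of this
  calculus.\<close>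

definition gG :: "int \<Rightarrow>\<^sub>0 complex" where
  "gG = smul (Q^2) (pt 1) + pt (-1) - smul (1 + Q^2) 1"

definition eG :: "int \<Rightarrow>\<^sub>0 complex" where
  "eG = pt 1 - pt (-1)"

definition RG :: "(int \<Rightarrow>\<^sub>0 complex) set" where
  "RG = right_ideal {gG}"

lemma Rid_G: "Rid (calcG q) = RG"
  by (simp add: calcG_def RG_def gG_def zpow_def)

lemma RG_iff: "x \<in> RG \<longleftrightarrow> (\<exists>b. x = gG * b)"
proof
  assume "x \<in> RG"
  then show "\<exists>b. x = gG * b"
    unfolding RG_def
  proof induction
    case zero
    then show ?case by (intro exI[of _ 0]) simp
  next
    case (add x y)
    then show ?case by (metis distrib_left)
  qed auto
qed (auto simp: RG_def intro: right_ideal.gen)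

lemma RG_csub: "csub RG"
proof -
  have "x + y \<in> RG" if xy: "x \<in> RG" "y \<in> RG" for x y
  proof -
    obtain a b where "x = gG * a" "y = gG * b" using xy by (auto simp: RG_iff)
    then have "x + y = gG * (a + b)" by (simp add: distrib_left)
    then show ?thesis by (auto simp: RG_iff)
  qed
  moreover have "smul c x \<in> RG" if x: "x \<in> RG" for c x
  proof -
    obtain a where "x = gG * a" using x by (auto simp: RG_iff)
    then have "smul c x = gG * smul c a" by simp
    then show ?thesis unfolding RG_iff by blast
  qed
  moreover have "0 \<in> RG" unfolding RG_iff by (rule exI[of _ 0]) simp
  ultimately show ?thesis by (simp add: csub_def)
qed

lemma RG_mult: "x \<in> RG \<Longrightarrow> x * b \<in> RG"
  unfolding RG_iff by (metis mult.assoc)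

text \<open>The germ of z^m is \<open>cc m\<close> times the basic germ. The recursion goes up from
  0, and down because multiplication by z is invertible.\<close>

lemma RG_pt: "pt m - 1 - smul (cc m) eG \<in> RG"
proof -
  have c: "cc (m + 1) = 1 / (1 + Q^2) + cc m / Q^2" for m
    using cc_add[of m 1] by simp
  have c': "cc (1 + m) = 1 / (1 + Q^2) + cc m / Q^2" for m
    using c[of m] by (simp only: add.commute)
  \<comment> \<open>The defect of one step of the recursion is the case m = 1 plus the defect of
    commuting \<open>eG\<close> with z; both are multiples of \<open>gG\<close>.\<close>
  have k: "(pt (m + 1) - 1 - smul (cc (m + 1)) eG) - (pt m - 1 - smul (cc m) eG) * pt 1
      = gG * (smul (1 / (1 + Q^2)) 1 + smul (cc m / Q^2) (pt 1 + 1))" for m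
  proof -
    have "(pt (m + 1) - 1 - smul (cc (m + 1)) eG) - (pt m - 1 - smul (cc m) eG) * pt 1
       = (pt 1 - 1 - smul (1 / (1 + Q^2)) eG) + smul (cc m) (eG * pt 1 - smul (1 / Q^2) eG)"
      by (simp add: c c' algebra_simps smul_add_left smul_diff)
    also have "pt 1 - 1 - smul (1 / (1 + Q^2)) eG = smul (1 / (1 + Q^2)) gG"
      unfolding gG_def eG_def one_pt
      by (rule poly_mapping_eqI) (simp add: lookup_add lookup_minus lookup_single when_def divide_simps, simp add: algebra_simps)
    also have "eG * pt 1 - smul (1 / Q^2) eG = smul (1 / Q^2) (gG * (pt 1 + 1))"
      unfolding gG_def eG_def one_pt
      by (rule poly_mapping_eqI) (simp add: algebra_simps smul_add smul_diff mult_single lookup_add lookup_minus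
          lookup_single when_def del: single_one; (simp add: field_simps)?)
    finally show ?thesis by (simp add: algebra_simps smul_add del: smul_single)
  qed
  have k': "(pt (m + 1) - 1 - smul (cc (m + 1)) eG) - (pt m - 1 - smul (cc m) eG) * pt 1 \<in> RG" for m
    unfolding k RG_iff by blast
  have up: "pt (m + 1) - 1 - smul (cc (m + 1)) eG \<in> RG" if "pt m - 1 - smul (cc m) eG \<in> RG" for m
    using csub_add[OF RG_csub k'[of m] RG_mult[OF that, of "pt 1"]] by simp
  have down: "pt m - 1 - smul (cc m) eG \<in> RG" if "pt (m + 1) - 1 - smul (cc (m + 1)) eG \<in> RG" for m
  proof -
    have "(pt m - 1 - smul (cc m) eG) * pt 1 \<in> RG"
      using csub_diff[OF RG_csub that k'[of m]] by simp
    from RG_mult[OF this, of "pt (-1)"] show ?thesis by (simp add: mult.assoc)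
  qed
  show ?thesis
  proof (induction m rule: int_induct[of _ 0])
    case base
    then show ?case using csub_zero[OF RG_csub] by simp
  next
    case (step1 i)
    show ?case by (rule up[OF step1(2)])
  next
    case (step2 i)
    then show ?case using down[of "i - 1"] by simp
  qed
qed

text \<open>The product of \<open>eG\<close> with z^m is a difference of two powers of z, so
  \<open>RG_pt\<close> applies twice and the values of \<open>cc\<close> at neighbours of m combine
  to the twist.\<close>

lemma RG_eG: "eG * pt m - smul (zf (2 * m)) eG \<in> RG"
proof -
  have 1: "cc 1 - cc (- 1) = 1" by (simp add: divide_simps)
  have "cc (1 + m) - cc (- 1 + m) = (cc 1 - cc (- 1)) * zf (2 * m)"
    by (simp only: cc_add) (simp add: left_diff_distrib del: cc_simps)
  then have z: "zf (2 * m) = cc (m + 1) - cc (m - 1)" unfolding 1 by (simp add: add.commute)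
  have "eG * pt m = pt (m + 1) - pt (m - 1)"
    by (simp add: eG_def left_diff_distrib add.commute)
  then have "eG * pt m - smul (zf (2 * m)) eG
      = (pt (m + 1) - 1 - smul (cc (m + 1)) eG) - (pt (m - 1) - 1 - smul (cc (m - 1)) eG)"
    unfolding z smul.scale_left_diff_distrib by simp
  then show ?thesis using csub_diff[OF RG_csub RG_pt RG_pt] by simp
qed

text \<open>The functional \<open>cc\<close> descends to germs and has value 1 at \<open>eG\<close>.
  Hence the basic germ is nonzero and scalar multiples of it are determined.\<close>

lemma cc_RG: "x \<in> RG \<Longrightarrow> fl cc x = 0"
proof -
  have "fl cc (gG * b) = 0" for b
  proof (rule fl_eqI[of "\<lambda>b. fl cc (gG * b)" "\<lambda>_. 0"])
    fix m
    have "fl cc (gG * pt m) = Q^2 * cc (1 + m) + cc (- 1 + m) - (1 + Q^2) * cc m"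
      unfolding gG_def one_pt by (simp add: left_diff_distrib distrib_right mult_single del: single_one)
    also have "\<dots> = (Q^2 * cc 1 + cc (- 1)) * zf (2 * m)"
      unfolding cc_add by (simp add: algebra_simps del: cc_simps)
    also have "Q^2 * cc 1 + cc (- 1) = 0" by (simp add: divide_simps)
    finally show "fl cc (gG * pt m) = 0" by simp
  qed (simp_all add: distrib_left)
  then show "x \<in> RG \<Longrightarrow> fl cc x = 0" by (auto simp: RG_iff)
qed

end

text \<open>Tensors whose first leg has degree 0; \<open>S2\<close> is the analogue for the second
  leg. They describe where the graded tensor product has no signs.\<close>

definition S1 :: "('a lt wd \<times> 'b lt wd \<Rightarrow>\<^sub>0 complex) set" where
  "S1 = {x. \<forall>k\<in>Poly_Mapping.keys x. wdeg (fst k) = 0}"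

definition S2 :: "('a lt wd \<times> 'b lt wd \<Rightarrow>\<^sub>0 complex) set" where
  "S2 = {x. \<forall>k\<in>Poly_Mapping.keys x. wdeg (snd k) = 0}"

lemma keys_smul_subset: "Poly_Mapping.keys (smul c x) \<subseteq> Poly_Mapping.keys x"
  by (auto simp: in_keys_iff)

lemma S1_csub: "csub S1" and S2_csub: "csub S2"
  by (auto simp: csub_def S1_def S2_def dest!: subsetD[OF Poly_Mapping.keys_add] subsetD[OF keys_smul_subset])

lemma wdeg_plus: "wdeg (u + v) = wdeg u + wdeg v"
  by (simp add: wdeg_def)

lemma S1_mult: "x \<in> S1 \<Longrightarrow> y \<in> S1 \<Longrightarrow> x * y \<in> S1"
  using keys_mult[of x y] unfolding S1_def by (fastforce simp: wdeg_plus)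

text \<open>The Koszul sign only sees the second leg of the left factor and the first leg of the
  right factor. With one of them in degree 0 the convolution product can be used.\<close>

lemma gmul_eq_mult: "x \<in> S2 \<or> y \<in> S1 \<Longrightarrow> gmul x y = x * y"
proof -
  assume *: "x \<in> S2 \<or> y \<in> S1"
  have "gmul x y = lin (\<lambda>k. lin (\<lambda>k'. pt k * pt k') y) x"
    unfolding gmul_def
  proof (rule lin_cong, clarify, rule lin_cong, clarify)
    fix u v u' v' assume "(u, v) \<in> Poly_Mapping.keys x" "(u', v') \<in> Poly_Mapping.keys y"
    then have "wdeg v = 0 \<or> wdeg u' = 0" using * by (auto simp: S1_def S2_def)
    then have z: "wdeg v * wdeg u' = 0" by auto
    then show "Poly_Mapping.single (u + u', v + v') ((- 1) ^ (wdeg v * wdeg u')) = pt (u, v) * pt (u', v')"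
      unfolding z by simp
  qed
  also have "\<dots> = x * y" by (simp only: lin_mult_left lin_mult_right lin_id)
  finally show ?thesis .
qed

context suq
begin

text \<open>The twist for the single basic form on G; as for \<open>\<eta>3\<close> its weight is
  2.\<close>

definition sG :: "(int \<Rightarrow>\<^sub>0 complex) \<Rightarrow> (int \<Rightarrow>\<^sub>0 complex)" where
  "sG = lin (\<lambda>m. Poly_Mapping.single m (zf (2 * m)))"

abbreviation cG :: "(int \<times> int \<Rightarrow>\<^sub>0 complex) \<Rightarrow> (int \<Rightarrow>\<^sub>0 complex)" where
  "cG \<equiv> slice cc"

lemma clin_sG: "clin sG"
  by (simp add: sG_def)

lemma sG_model: "env_model sG"
proof
  show "sG (x * y) = sG x * sG y" for x y
    by (rule clin2_eqI[of "\<lambda>x y. sG (x * y)" "\<lambda>x y. sG x * sG y"])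
      (simp_all add: clin_def algebra_simps sG_def lin_add lin_smul mult_single zf_add)
  show "sG 1 = 1" unfolding one_pt sG_def lin_pt by simp
qed (rule clin_sG)

abbreviation DG :: "int env \<Rightarrow> (int \<Rightarrow>\<^sub>0 complex)" where
  "DG \<equiv> D1 cG sG"

lemmas DG_mult = env_model.D1_mult[OF sG_model]
lemmas DG_fn [simp] = env_model.D1_fn[OF sG_model]
lemmas DG_fm [simp] = env_model.D1_fm[OF sG_model]

lemma clin_germG: "clin (germ (calcG q))"
  by (simp add: germ_def clin_def counitG_fl smul_add_left smul_diff)

lemma clin_comultG: "clin comultG"
  by (simp add: comultG_def)

lemma cG_null: "\<omega> \<in> null1 (calcG q) \<Longrightarrow> cG \<omega> = 0"
proof -
  assume "\<omega> \<in> null1 (calcG q)"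
  then have 1: "tmap id (germ (calcG q)) \<omega> \<in> tnull {0} RG" by (simp add: null1_def Rid_G)
  have 2: "cG (tmap id (germ (calcG q)) \<omega>) = cG \<omega>"
    by (rule clin_eqI[of "\<lambda>\<omega>. cG (tmap id (germ (calcG q)) \<omega>)" cG, OF clin_comp[OF clin_slice clin_tmap] clin_slice])
      (auto simp: tmap_pt germ_def counitG_fl fl_one)
  have "cG (tmap id (germ (calcG q)) \<omega>) \<in> {0}"
    by (rule tnull_into[OF clin_slice _ _ 1]) (auto simp: csub_def cc_RG)
  then show ?thesis by (simp add: 2)
qed

lemma cG_ract: "cG (ract (calcG q) \<omega> p) = cG \<omega> * sG p"
proof (rule clin2_eqI[of "\<lambda>\<omega> p. cG (ract (calcG q) \<omega> p)" "\<lambda>\<omega> p. cG \<omega> * sG p"])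
  show "cG (ract (calcG q) (pt j) (pt m)) = cG (pt j) * sG (pt m)" for j m
  proof (cases j)
    case (Pair a b)
    have "ract (calcG q) (pt j) (pt m) = pt (a + m, b + m) - pt (a + m, m)"
      unfolding Pair ract_def tmap_pt by (simp add: germ_def counitG_fl one_pt tens_diff_right left_diff_distrib del: single_one)
    then show ?thesis
      by (simp add: Pair slice_lin cc_add sG_def mult_single single_diff[symmetric])
  qed
qed (simp_all add: clin_def ract_def clin_add[OF clin_tmap] clin_smul[OF clin_tmap] clin_add[OF clin_comultG]
    clin_smul[OF clin_comultG] slice_lin algebra_simps clin_add[OF clin_sG] clin_smul[OF clin_sG])

lemma cG_lact: "cG (lact p \<omega>) = p * cG \<omega>"
proof -
  have "tens p (pt (0 :: int)) * \<omega> = lact p \<omega>"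
    unfolding lact_def by simp
  then show ?thesis using slice_tens_mult[of cc p 0 \<omega>] by simp
qed

lemma zero_cideal: "cideal {0}"
  by (simp add: cideal_def csub_def)

lemma D0_G: "x \<in> env_ideal (calcG q) \<Longrightarrow> D0 x = 0"
  using D0_env_ideal[of "calcG q" x] zero_cideal by simp

lemma DG_null: "x \<in> env_ideal (calcG q) \<Longrightarrow> DG x = 0"
  using env_model.D1_env_ideal[OF sG_model, of "calcG q" x cG] zero_cideal
  by (simp add: cG_lact cG_ract cG_null clin_zero[OF clin_sG])

abbreviation V where "V \<equiv> md (env_ideal (calcG q))"

lemmas V_refl [simp] = md_refl[OF env_csub[of "calcG q"]]
  and V_trans [trans] = md_trans[OF env_csub[of "calcG q"]]
  and V_smul = md_smul[OF env_csub[of "calcG q"]]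
  and V_sym = md_sym[OF env_csub[of "calcG q"]]
  and V_mult = md_mult[OF env_cideal[of "calcG q"]]

definition vs :: "int env" where
  "vs = fm (tens 1 eG)"

lemma counit_eG: "counitG eG = 0"
  by (simp add: counitG_fl eG_def)

text \<open>The differential of z^m in the calculus on G. By \<open>RG_pt\<close> the coproduct of
  z^m and the multiple of the basic form differ by a null form.\<close>

lemma V_comult: "V (fm (comultG (zpow m))) (smul (cc m) (fn (zpow m) * vs))"
proof -
  let ?\<omega> = "lact (smul (cc m) (zpow m)) (tens 1 eG)"
  have l: "?\<omega> = smul (cc m) (tens (zpow m) eG)"
    unfolding lact_def by (simp only: tens_mult mult_1_left mult_1_right tens_smul_left smul_mult_left)
  have "tmap id (germ (calcG q)) (comultG (zpow m) - ?\<omega>)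
     = tens (zpow m) (pt m - 1 - smul (cc m) eG)"
    unfolding l clin_diff[OF clin_tmap] clin_smul[OF clin_tmap] tmap_tens[OF clin_id' clin_germG]
    by (simp add: zpow_def tmap_pt germ_def counitG_fl counit_eG[unfolded counitG_fl] tens_diff_right)
  also have "\<dots> \<in> tnull {0} RG" by (intro tnullI disjI2 RG_pt)
  finally have "comultG (zpow m) - ?\<omega> \<in> null1 (calcG q)" by (simp add: null1_def Rid_G)
  then have "V (fm (comultG (zpow m))) (fm ?\<omega>)" by (rule fm_cong)
  also have "V \<dots> (fn (smul (cc m) (zpow m)) * vs)" unfolding vs_def by (rule fm_lact)
  also have "V \<dots> (smul (cc m) (fn (zpow m)) * vs)" by (intro V_mult fn_smul V_refl)
  finally show ?thesis by simp
qed

lemma V_commute: "V (vs * fn (zpow m)) (smul (zf (2 * m)) (fn (zpow m) * vs))"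
proof -
  let ?\<omega> = "lact (smul (zf (2 * m)) (zpow m)) (tens 1 eG)"
  have l: "?\<omega> = smul (zf (2 * m)) (tens (zpow m) eG)"
    unfolding lact_def by (simp only: tens_mult mult_1_left mult_1_right tens_smul_left smul_mult_left)
  have r: "ract (calcG q) (tens 1 eG) (zpow m) = tens (zpow m) (eG * pt m)"
    unfolding ract_def tmap_tens[OF clin_id' clin_germG]
    by (simp add: germ_def counit_eG zpow_def flip: tens_pt) (simp add: tens_mult del: tens_pt)
  have c: "counitG (eG * pt m) = 0"
    unfolding counitG_fl eG_def by (simp add: left_diff_distrib)
  have "tmap id (germ (calcG q)) (ract (calcG q) (tens 1 eG) (zpow m) - ?\<omega>)
     = tens (zpow m) (eG * pt m - smul (zf (2 * m)) eG)"
    unfolding l r clin_diff[OF clin_tmap] clin_smul[OF clin_tmap] tmap_tens[OF clin_id' clin_germG]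
    by (simp add: germ_def c counit_eG tens_diff_right)
  also have "\<dots> \<in> tnull {0} RG" by (intro tnullI disjI2 RG_eG)
  finally have n: "ract (calcG q) (tens 1 eG) (zpow m) - ?\<omega> \<in> null1 (calcG q)" by (simp add: null1_def Rid_G)
  have "V (vs * fn (zpow m)) (fm (ract (calcG q) (tens 1 eG) (zpow m)))"
    unfolding vs_def by (rule V_sym[OF fm_ract])
  also have "V \<dots> (fm ?\<omega>)" by (rule fm_cong[OF n])
  also have "V \<dots> (fn (smul (zf (2 * m)) (zpow m)) * vs)" unfolding vs_def by (rule fm_lact)
  also have "V \<dots> (smul (zf (2 * m)) (fn (zpow m)) * vs)" by (intro V_mult fn_smul V_refl)
  finally show ?thesis by simp
qed

lemma zpow_add: "zpow (a + b) = zpow a * zpow b"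
  by (simp add: zpow_def)

lemma V_fn_add: "V (fn (zpow (a + b))) (fn (zpow a) * fn (zpow b))"
  unfolding zpow_add by (rule fn_mult)

lemma V_fn_zero: "V (fn (zpow 0)) 1"
  using fn_one[of "calcG q"] by (simp add: zpow_def)

subsection \<open>The coaction in degrees 0 and 1\<close>

abbreviation H where "H \<equiv> md (PGnull q)"

lemma PG_cideal: "cideal (PGnull q)"
  unfolding PGnull_def by (intro cideal_tnull env_cideal)

lemmas PG_csub = cideal_csub[OF PG_cideal]

lemmas H_refl [simp] = md_refl[OF PG_csub]
  and H_sym = md_sym[OF PG_csub]
  and H_trans [trans] = md_trans[OF PG_csub]
  and H_add = md_add[OF PG_csub]
  and H_diff = md_diff[OF PG_csub]
  and H_smul = md_smul[OF PG_csub]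
  and H_sum = md_sum[OF PG_csub]
  and H_mult = md_mult[OF PG_cideal]

lemma H_tens: "W x x' \<Longrightarrow> V y y' \<Longrightarrow> H (tens x y) (tens x' y')"
  unfolding PGnull_def by (rule tnull_md[OF _ _ env_csub env_csub])

lemma coact0_lin: "coact0 q p = lin (\<lambda>w. tens (fn (pt w)) (fn (zpow (wdg w)))) p"
  unfolding coact0_def coactP_lin tmap_def clin_lin_comm[OF clin_lin]
  by (simp add: zpow_def)

lemma clin_coact0 [simp, intro]: "clin (coact0 q)"
  unfolding coact0_lin[abs_def] by simp

lemma coact0_pt: "coact0 q (pt w) = tens (fn (pt w)) (fn (zpow (wdg w)))"
  unfolding coact0_lin by simp

lemma tens_fn_S: "tens (fn a) (fn b) \<in> S1" "tens (fn a) (fn b) \<in> S2"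
  by (simp_all add: fn_def var_def S1_def S2_def wdeg_def)

lemma coact0_S: "coact0 q p \<in> S1" "coact0 q p \<in> S2"
  unfolding coact0_lin by (intro csub_lin S1_csub S2_csub tens_fn_S)+

lemma coact0_hdeg:
  assumes "hdeg n p"
  shows "H (coact0 q p) (tens (fn p) (fn (zpow n)))"
proof -
  have "coact0 q p = lin (\<lambda>w. tens (fn (pt w)) (fn (zpow n))) p"
    unfolding coact0_lin by (rule lin_cong) (use assms in \<open>auto simp: hdeg_iff\<close>)
  also have "\<dots> = tens (lin (\<lambda>w. fn (pt w)) p) (fn (zpow n))"
    by (rule clin_lin_comm[OF clin_tens_left[OF clin_id], symmetric])
  also have "H \<dots> (tens (fn (lin pt p)) (fn (zpow n)))"
    by (intro H_tens V_refl W_sym[OF fn_lin])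
  finally show ?thesis by (simp add: lin_id)
qed

lemma coact0_mult: "H (coact0 q (x * y)) (coact0 q x * coact0 q y)"
proof -
  have 1: "H (coact0 q (pt v * pt w)) (coact0 q (pt v) * coact0 q (pt w))" for v w
  proof -
    have "coact0 q (pt v * pt w) = tens (fn (pt v * pt w)) (fn (zpow (wdg v + wdg w)))"
      by (simp add: coact0_pt)
    also have "H \<dots> (tens (fn (pt v) * fn (pt w)) (fn (zpow (wdg v)) * fn (zpow (wdg w))))"
      by (intro H_tens fn_mult V_fn_add)
    finally show ?thesis by (simp only: coact0_pt tens_mult)
  qed
  have 2: "H (coact0 q (pt v * y)) (coact0 q (pt v) * coact0 q y)" for v y
    by (rule md_clin[of "PGnull q" "\<lambda>y. coact0 q (pt v * y)" "\<lambda>y. coact0 q (pt v) * coact0 q y", OF PG_csub _ _ 1])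
      (simp_all add: clin_def clin_add[OF clin_coact0] clin_smul[OF clin_coact0] distrib_left)
  show ?thesis
    by (rule md_clin[of "PGnull q" "\<lambda>x. coact0 q (x * y)" "\<lambda>x. coact0 q x * coact0 q y", OF PG_csub _ _ 2])
      (simp_all add: clin_def clin_add[OF clin_coact0] clin_smul[OF clin_coact0] distrib_right)
qed

lemma coact0_PI: "p \<in> PI q \<Longrightarrow> coact0 q p \<in> PGnull q"
proof -
  assume p: "p \<in> PI q"
  let ?R = "wdg ` Poly_Mapping.keys p"
  have "p = (\<Sum>r\<in>?R. comp r p)"
    by (rule poly_mapping_eqI) (auto simp: lookup_sum lookup_comp in_keys_iff if_distrib cong: if_cong)
  then have "coact0 q p = (\<Sum>r\<in>?R. coact0 q (comp r p))"
    using clin_sum[OF clin_coact0, of "\<lambda>r. comp r p" ?R] by simp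
  also have "\<dots> \<in> PGnull q"
  proof (rule csub_sum[OF PG_csub])
    fix r
    have "tens (fn (comp r p)) (fn (zpow r)) \<in> PGnull q"
      unfolding PGnull_def using fn_Rel[of "comp r p" "calcP q"] comp_PI[OF p] by (intro tnullI) simp
    then show "coact0 q (comp r p) \<in> PGnull q"
      using md_in[OF PG_csub coact0_hdeg[OF hdeg_comp]] by blast
  qed
  finally show ?thesis .
qed

lemma coact0_E: "E x y \<Longrightarrow> H (coact0 q x) (coact0 q y)"
  by (rule md_map[OF clin_coact0 coact0_PI])

text \<open>With \<open>Z\<close> this describes the coaction on basic forms: the form of index i
  goes to \<open>T i\<close>, and \<open>\<eta>3\<close> gets the additional summand
  \<open>Z\<close>.\<close>

definition T :: "ix \<Rightarrow> envPG" where
  "T i = tens (et i) (fn (zpow (- dgi i)))"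

definition Z :: envPG where
  "Z = tens 1 vs"

end

lemma homog_csub: "csub (homog k)"
  by (auto simp: csub_def homog_def dest!: subsetD[OF Poly_Mapping.keys_add] subsetD[OF keys_smul_subset])

lemma pt_homog: "pt w \<in> homog k \<longleftrightarrow> wdeg w = k"
  by (simp add: homog_def)

lemma homog_mult: "x \<in> homog a \<Longrightarrow> y \<in> homog b \<Longrightarrow> x * y \<in> homog (a + b)"
  using keys_mult[of x y] unfolding homog_def by (fastforce simp: wdeg_plus)

lemma fn_homog: "fn p \<in> homog 0" and fm_homog: "fm \<omega> \<in> homog 1"
  by (simp_all add: fn_def fm_def var_def homog_def wdeg_def)

lemma d_env_fn: "d_env X (fn a) = fm (dif X a)"
proof -
  have 1: "fn a = pt (Wd [Fn a])" "pt (Wd []) = (1 :: 'a env)"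
    unfolding fn_def one_pt by (simp_all add: var_def wd_zero)
  show ?thesis unfolding 1(1) d_env_def lin_pt by (simp add: 1(2) del: single_one)
qed

context suq
begin

lemma et_homog: "et i \<in> homog 1"
  using fm_homog csub_smul[OF homog_csub] by (cases i) (auto simp: \<eta>3_def \<eta>p_def \<eta>m_def)

lemma clin_d_tens: "clin (d_tens q)"
  by (simp add: d_tens_def)

lemma d_tens_fn: "d_tens q (tens (fn a) (fn b)) = tens (fm (comult q a)) (fn b) + tens (fn a) (fm (comultG b))"
proof -
  have 1: "fn a = pt (Wd [Fn a])" "fn b = pt (Wd [Fn b])"
    unfolding fn_def by (simp_all add: var_def)
  have "d_tens q (tens (fn a) (fn b)) = tens (dP q (fn a)) (fn b) + tens (fn a) (d_env (calcG q) (fn b))"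
    unfolding 1 tens_pt d_tens_def lin_pt by simp
  then show ?thesis by (simp only: d_env_fn Cop_P G_simps)
qed

lemma coact0_single: "coact0 q (Poly_Mapping.single w c) = smul c (tens (fn (pt w)) (fn (zpow (wdg w))))"
  unfolding coact0_lin by (rule lin_single)

text \<open>The differential of a coacted function has a part along P, which is graded by the shifts
  \<open>dgi\<close>, and a part along G. The latter is governed by \<open>cc\<close>, hence by
  \<open>dd I3\<close>, and attaches to \<open>Z\<close>.\<close>

lemma d_tens_coact0: "H (d_tens q (coact0 q h)) ((\<Sum>i\<in>IX. coact0 q (dd i h) * T i) + coact0 q (dd I3 h) * Z)"
proof (rule md_clin[of "PGnull q" "\<lambda>h. d_tens q (coact0 q h)" "\<lambda>h. (\<Sum>i\<in>IX. coact0 q (dd i h) * T i) + coact0 q (dd I3 h) * Z", OF PG_csub])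
  fix w :: "gen wd"
  let ?b = "wdg w"
  have 1: "H (tens (fn (dd i (pt w)) * et i) (fn (zpow ?b))) (coact0 q (dd i (pt w)) * T i)" for i
  proof -
    have h: "hdeg (?b + dgi i) (dd i (pt w))"
      by (rule hdeg_dd[OF _ refl]) (simp add: hdeg_def)
    have "H (tens (fn (dd i (pt w)) * et i) (fn (zpow ((?b + dgi i) + (- dgi i)))))
        (tens (fn (dd i (pt w)) * et i) (fn (zpow (?b + dgi i)) * fn (zpow (- dgi i))))"
      by (intro H_tens V_fn_add W_refl)
    also have "\<dots> = tens (fn (dd i (pt w))) (fn (zpow (?b + dgi i))) * T i"
      by (simp add: T_def tens_mult)
    also have "H \<dots> (coact0 q (dd i (pt w)) * T i)"
      by (rule H_mult[OF H_sym[OF coact0_hdeg[OF h]] H_refl])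
    finally show ?thesis by simp
  qed
  have 2: "H (tens (fn (pt w)) (fm (comultG (zpow ?b)))) (coact0 q (dd I3 (pt w)) * Z)"
  proof -
    have "H (tens (fn (pt w)) (fm (comultG (zpow ?b)))) (tens (fn (pt w)) (smul (cc ?b) (fn (zpow ?b) * vs)))"
      by (intro H_tens V_comult W_refl)
    also have "\<dots> = smul (cc ?b) (tens (fn (pt w)) (fn (zpow ?b)) * Z)"
      by (simp add: Z_def tens_mult)
    also have "\<dots> = coact0 q (dd I3 (pt w)) * Z"
      by (simp add: dd3_pt coact0_pt coact0_single)
    finally show ?thesis .
  qed
  have "d_tens q (coact0 q (pt w)) = tens (fm (comult q (pt w))) (fn (zpow ?b)) + tens (fn (pt w)) (fm (comultG (zpow ?b)))"
    by (simp only: coact0_pt d_tens_fn)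
  also have "H \<dots> (tens (\<Sum>i\<in>IX. fn (dd i (pt w)) * et i) (fn (zpow ?b)) + coact0 q (dd I3 (pt w)) * Z)"
    using fm_expand[of "comult q (pt w)"] by (intro H_add 2 H_tens V_refl) (simp add: cf_comult)
  also have "\<dots> = (\<Sum>i\<in>IX. tens (fn (dd i (pt w)) * et i) (fn (zpow ?b))) + coact0 q (dd I3 (pt w)) * Z"
    by (simp add: tens_sum_left)
  also have "H \<dots> ((\<Sum>i\<in>IX. coact0 q (dd i (pt w)) * T i) + coact0 q (dd I3 (pt w)) * Z)"
    by (intro H_add H_sum 1 H_refl)
  finally show "H (d_tens q (coact0 q (pt w))) ((\<Sum>i\<in>IX. coact0 q (dd i (pt w)) * T i) + coact0 q (dd I3 (pt w)) * Z)" .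
qed (auto simp: clin_def clin_add[OF clin_d_tens] clin_smul[OF clin_d_tens] clin_add[OF clin_coact0]
    clin_smul[OF clin_coact0] sum.distrib distrib_right smul_sum smul_add)

lemma coact0_sum_list: "coact0 q (sum_list (map f xs)) = (\<Sum>a\<leftarrow>xs. coact0 q (f a))"
  by (rule clin_sum_list) simp

text \<open>The sum over the chosen presentation collapses to coefficients of the form, because
  \<open>coact0\<close> is multiplicative modulo null tensors. This removes the dependence on the
  choice.\<close>

lemma coact_letter_Fm: "H (coact_letter q (Fm \<omega>)) ((\<Sum>i\<in>IX. coact0 q (cf i \<omega>) * T i) + coact0 q (cf I3 \<omega>) * Z)"
proof -
  let ?xs = "presentation (calcP q) \<omega>"
  have e: "H (\<Sum>(g, h)\<leftarrow>?xs. coact0 q g * coact0 q (dd i h)) (coact0 q (cf i \<omega>))" for i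
  proof -
    have "H (\<Sum>(g, h)\<leftarrow>?xs. coact0 q g * coact0 q (dd i h)) (\<Sum>(g, h)\<leftarrow>?xs. coact0 q (g * dd i h))"
      unfolding case_prod_unfold by (intro md_sum_list PG_csub H_sym[OF coact0_mult])
    also have "\<dots> = coact0 q (\<Sum>(g, h)\<leftarrow>?xs. g * dd i h)" by (simp add: coact0_sum_list case_prod_unfold)
    also have "H \<dots> (coact0 q (cf i \<omega>))"
      using is_pres_presentation[of \<omega>] by (intro coact0_E) (simp add: is_pres_def)
    finally show ?thesis .
  qed
  have sums: "(\<Sum>(g, h)\<leftarrow>ys. coact0 q g * ((\<Sum>i\<in>IX. coact0 q (dd i h) * T i) + coact0 q (dd I3 h) * Z))
     = (\<Sum>i\<in>IX. (\<Sum>(g, h)\<leftarrow>ys. coact0 q g * coact0 q (dd i h)) * T i)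
     + (\<Sum>(g, h)\<leftarrow>ys. coact0 q g * coact0 q (dd I3 h)) * Z" for ys
    by (induction ys) (auto simp: sum.distrib distrib_left distrib_right sum_distrib_left mult.assoc)
  have "coact_letter q (Fm \<omega>) = (\<Sum>(g, h)\<leftarrow>?xs. coact0 q g * d_tens q (coact0 q h))"
    by (simp add: gmul_eq_mult coact0_S)
  also have "H \<dots> (\<Sum>(g, h)\<leftarrow>?xs. coact0 q g * ((\<Sum>i\<in>IX. coact0 q (dd i h) * T i) + coact0 q (dd I3 h) * Z))"
    unfolding case_prod_unfold by (intro md_sum_list PG_csub H_mult H_refl d_tens_coact0)
  also have "\<dots> = (\<Sum>i\<in>IX. (\<Sum>(g, h)\<leftarrow>?xs. coact0 q g * coact0 q (dd i h)) * T i)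
     + (\<Sum>(g, h)\<leftarrow>?xs. coact0 q g * coact0 q (dd I3 h)) * Z"
    by (rule sums)
  also have "H \<dots> ((\<Sum>i\<in>IX. coact0 q (cf i \<omega>) * T i) + coact0 q (cf I3 \<omega>) * Z)"
    by (intro H_add H_sum H_mult H_refl e)
  finally show ?thesis .
qed

lemma T_coact0: "H (T i * coact0 q p) (coact0 q (sg (mw i) p) * T i)"
proof (rule md_clin[of "PGnull q" "\<lambda>p. T i * coact0 q p" "\<lambda>p. coact0 q (sg (mw i) p) * T i", OF PG_csub])
  fix w :: "gen wd"
  let ?z = "zf (mw i * wdg w)"
  have V: "V (fn (zpow (- dgi i)) * fn (zpow (wdg w))) (fn (zpow (wdg w)) * fn (zpow (- dgi i)))"
    using V_trans[OF V_sym[OF V_fn_add[of "- dgi i" "wdg w"]]] V_fn_add[of "wdg w" "- dgi i"] by (simp add: add.commute)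
  have W': "W (et i * fn (pt w)) (smul ?z (fn (pt w)) * et i)"
  proof -
    have "W (et i * fn (pt w)) (fn (smul ?z (pt w)) * et i)" using et_fn[of i "pt w"] by simp
    also have "W \<dots> (smul ?z (fn (pt w)) * et i)" by (intro W_mult fn_smul W_refl)
    finally show ?thesis .
  qed
  have "T i * coact0 q (pt w) = tens (et i * fn (pt w)) (fn (zpow (- dgi i)) * fn (zpow (wdg w)))"
    by (simp add: T_def coact0_pt tens_mult)
  also have "H \<dots> (tens (smul ?z (fn (pt w)) * et i) (fn (zpow (wdg w)) * fn (zpow (- dgi i))))"
    by (rule H_tens[OF W' V])
  also have "\<dots> = coact0 q (sg (mw i) (pt w)) * T i"
    by (simp add: T_def coact0_pt tens_mult coact0_single)
  finally show "H (T i * coact0 q (pt w)) (coact0 q (sg (mw i) (pt w)) * T i)" .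
qed (auto simp: clin_def clin_add[OF clin_coact0] clin_smul[OF clin_coact0] distrib_left distrib_right)

lemma Z_coact0: "H (Z * coact0 q p) (coact0 q (sg 2 p) * Z)"
proof (rule md_clin[of "PGnull q" "\<lambda>p. Z * coact0 q p" "\<lambda>p. coact0 q (sg 2 p) * Z", OF PG_csub])
  fix w :: "gen wd"
  have "Z * coact0 q (pt w) = tens (fn (pt w)) (vs * fn (zpow (wdg w)))"
    by (simp add: Z_def coact0_pt tens_mult)
  also have "H \<dots> (tens (fn (pt w)) (smul (zf (2 * wdg w)) (fn (zpow (wdg w)) * vs)))"
    by (intro H_tens W_refl V_commute)
  also have "\<dots> = coact0 q (sg 2 (pt w)) * Z"
    by (simp add: Z_def coact0_pt tens_mult coact0_single)
  finally show "H (Z * coact0 q (pt w)) (coact0 q (sg 2 (pt w)) * Z)" .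
qed (auto simp: clin_def clin_add[OF clin_coact0] clin_smul[OF clin_coact0] distrib_left distrib_right)

text \<open>The ungraded multiplicative extension. On words of degree at most 1 it agrees with the
  iterated graded product, since a letter of degree 0 lies in \<open>S2\<close> and what follows the
  only one-form lies in \<open>S1\<close>.\<close>

abbreviation K :: "gen wd env \<Rightarrow> envPG" where
  "K \<equiv> hom_ext (coact_letter q)"

lemma K_word0: "wdeg (Wd w) = 0 \<Longrightarrow> H (K (pt (Wd w))) (coact0 q (D0 (pt (Wd w)))) \<and> K (pt (Wd w)) \<in> S1
    \<and> foldr (\<lambda>l x. gmul (coact_letter q l) x) w (tens 1 1) = K (pt (Wd w))"
proof (induction w)
  case Nil
  have 1: "pt (Wd []) = (1 :: gen wd env)" by (simp only: one_pt wd_zero)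
  have 2: "(1 :: gen wd lt wd \<times> int lt wd \<Rightarrow>\<^sub>0 complex) \<in> S1"
    unfolding one_pt S1_def by (simp add: zero_prod_def wdeg_def del: single_one)
  have "H (tens (fn 1) (fn (zpow 0))) (tens 1 1)" by (intro H_tens fn_one V_fn_zero)
  then have "H 1 (coact0 q 1)"
    using H_sym H_trans[OF coact0_hdeg[OF hdeg_one]] by (simp del: H_refl)
  then show ?case unfolding 1 by (simp add: 2)
next
  case (Cons l w)
  then obtain p where l: "l = Fn p" by (cases l) auto
  have IH: "H (K (pt (Wd w))) (coact0 q (D0 (pt (Wd w))))" "K (pt (Wd w)) \<in> S1"
    "foldr (\<lambda>l x. gmul (coact_letter q l) x) w (tens 1 1) = K (pt (Wd w))"
    using Cons l by auto
  have k: "K (pt (Wd (l # w))) = coact0 q p * K (pt (Wd w))" by (simp add: l)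
  have "H (coact0 q p * K (pt (Wd w))) (coact0 q p * coact0 q (D0 (pt (Wd w))))" by (intro H_mult H_refl IH)
  also have "H \<dots> (coact0 q (p * D0 (pt (Wd w))))" by (rule H_sym[OF coact0_mult])
  also have "p * D0 (pt (Wd w)) = D0 (pt (Wd (l # w)))" by (simp only: pt_Cons l var_lt D0_simps)
  finally show ?case unfolding k using IH(3) by (simp add: l S1_mult coact0_S IH(2) gmul_eq_mult del: hom_ext_pt)
qed

abbreviation KG :: "gen wd env \<Rightarrow> envPG" where
  "KG \<phi> \<equiv> (\<Sum>i\<in>IX. coact0 q (DD i \<phi>) * T i) + coact0 q (DD I3 \<phi>) * Z"

lemma K_word1: "wdeg (Wd w) = 1 \<Longrightarrow> H (K (pt (Wd w))) (KG (pt (Wd w)))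
    \<and> foldr (\<lambda>l x. gmul (coact_letter q l) x) w (tens 1 1) = K (pt (Wd w))"
proof (induction w)
  case (Cons l w)
  show ?case
  proof (cases l)
    case (Fn p)
    have IH: "H (K (pt (Wd w))) (KG (pt (Wd w)))"
      "foldr (\<lambda>l x. gmul (coact_letter q l) x) w (tens 1 1) = K (pt (Wd w))"
      using Cons Fn by auto
    have k: "K (pt (Wd (l # w))) = coact0 q p * K (pt (Wd w))" by (simp add: Fn)
    have d: "DD i (pt (Wd (l # w))) = p * DD i (pt (Wd w))" for i by (simp add: pt_Cons Fn var_lt DD_mult)
    have "H (coact0 q p * K (pt (Wd w))) (coact0 q p * KG (pt (Wd w)))" by (intro H_mult H_refl IH)
    also have "\<dots> = (\<Sum>i\<in>IX. (coact0 q p * coact0 q (DD i (pt (Wd w)))) * T i) + (coact0 q p * coact0 q (DD I3 (pt (Wd w)))) * Z"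
      by (simp add: distrib_left sum_distrib_left mult.assoc)
    also have "H \<dots> (KG (pt (Wd (l # w))))"
      unfolding d by (intro H_add H_sum H_mult H_refl H_sym[OF coact0_mult])
    finally show ?thesis unfolding k using IH(2) by (simp add: Fn coact0_S gmul_eq_mult del: hom_ext_pt)
  next
    case (Fm \<omega>)
    let ?p = "D0 (pt (Wd w))"
    have "wdeg (Wd w) = 0" using Cons(2) Fm by simp
    note w0 = K_word0[OF this]
    have k: "K (pt (Wd (l # w))) = coact_letter q (Fm \<omega>) * K (pt (Wd w))" by (simp add: Fm)
    have d: "DD i (pt (Wd (l # w))) = cf i \<omega> * sg (mw i) ?p" for i by (simp add: pt_Cons Fm var_lt DD_mult)
    have "H (coact_letter q (Fm \<omega>) * K (pt (Wd w))) (((\<Sum>i\<in>IX. coact0 q (cf i \<omega>) * T i) + coact0 q (cf I3 \<omega>) * Z) * coact0 q ?p)"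
      using w0 by (intro H_mult coact_letter_Fm) simp
    also have "\<dots> = (\<Sum>i\<in>IX. coact0 q (cf i \<omega>) * (T i * coact0 q ?p)) + coact0 q (cf I3 \<omega>) * (Z * coact0 q ?p)"
      by (simp add: distrib_right sum_distrib_right mult.assoc)
    also have "H \<dots> ((\<Sum>i\<in>IX. coact0 q (cf i \<omega>) * (coact0 q (sg (mw i) ?p) * T i)) + coact0 q (cf I3 \<omega>) * (coact0 q (sg 2 ?p) * Z))"
      by (intro H_add H_sum H_mult H_refl T_coact0 Z_coact0)
    also have "\<dots> = (\<Sum>i\<in>IX. (coact0 q (cf i \<omega>) * coact0 q (sg (mw i) ?p)) * T i) + (coact0 q (cf I3 \<omega>) * coact0 q (sg (mw I3) ?p)) * Z"
      by (simp add: mult.assoc)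
    also have "H \<dots> (KG (pt (Wd (l # w))))"
      unfolding d by (intro H_add H_sum H_mult H_refl H_sym[OF coact0_mult])
    finally show ?thesis unfolding k using w0 by (simp add: Fm gmul_eq_mult del: hom_ext_pt coact_letter.simps)
  qed
qed simp

lemma coact\<Omega>_0: "\<phi> \<in> homog 0 \<Longrightarrow> H (coact\<Omega> q \<phi>) (coact0 q (D0 \<phi>))"
proof -
  assume h: "\<phi> \<in> homog 0"
  have w: "H (foldr (\<lambda>l x. gmul (coact_letter q l) x) (letters w) (tens 1 1)) (coact0 q (D0 (pt w)))"
    if "w \<in> Poly_Mapping.keys \<phi>" for w
    using that h K_word0[of "letters w"] by (cases w) (auto simp: homog_def)
  have "H (coact\<Omega> q \<phi>) (lin (\<lambda>w. coact0 q (D0 (pt w))) \<phi>)"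
    unfolding coact\<Omega>_def by (rule md_lin[OF PG_csub w])
  also have "\<dots> = coact0 q (D0 \<phi>)"
    by (rule clin_lin_pt[of "\<lambda>\<phi>. coact0 q (D0 \<phi>)", OF clin_comp[OF clin_coact0 clin_D0], symmetric])
  finally show ?thesis .
qed

lemma coact\<Omega>_1: "\<phi> \<in> homog 1 \<Longrightarrow> H (coact\<Omega> q \<phi>) (KG \<phi>)"
proof -
  assume h: "\<phi> \<in> homog 1"
  have w: "H (foldr (\<lambda>l x. gmul (coact_letter q l) x) (letters w) (tens 1 1)) (KG (pt w))"
    if "w \<in> Poly_Mapping.keys \<phi>" for w
    using that h K_word1[of "letters w"] by (cases w) (auto simp: homog_def)
  have c: "clin KG"
    by (auto simp: clin_def clin_add[OF clin_coact0] clin_smul[OF clin_coact0] sum.distrib distrib_right smul_sum smul_add)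
  have "H (coact\<Omega> q \<phi>) (lin (\<lambda>w. KG (pt w)) \<phi>)"
    unfolding coact\<Omega>_def by (rule md_lin[OF PG_csub w])
  also have "\<dots> = KG \<phi>"
    by (rule clin_lin_pt[OF c, symmetric])
  finally show ?thesis .
qed

lemma DD_et [simp]: "DD j (et i) = (if i = j then 1 else 0)"
proof (cases i)
  case I3
  then show ?thesis using chw_eg[of j I3] by (auto simp: \<eta>3_def)
next
  case Ip
  then show ?thesis using chw_eg[of j Ip] by (auto simp: \<eta>p_def)
next
  case Im
  then show ?thesis using chw_eg[of j Im] by (auto simp: \<eta>m_def)
qed

lemma DD_eta [simp]: "DD j \<eta>3 = (if j = I3 then 1 else 0)" "DD j \<eta>p = (if j = Ip then 1 else 0)"
  "DD j (\<eta>m q) = (if j = Im then 1 else 0)"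
  using DD_et[of j I3] DD_et[of j Ip] DD_et[of j Im] by auto

lemmas DD_eta_weight [simp] = DD_eta[of I3, unfolded mw.simps] DD_eta[of Ip, unfolded mw.simps] DD_eta[of Im, unfolded mw.simps]

lemma D0_eta [simp]: "D0 \<eta>3 = 0" "D0 \<eta>p = 0" "D0 (\<eta>m q) = 0" "D0 (et i) = 0"
  by (simp_all add: \<eta>3_def \<eta>p_def \<eta>m_def) (cases i; simp add: \<eta>3_def \<eta>p_def \<eta>m_def)

lemma D2_eta [simp]: "D2 \<eta>p = 0" "D2 (\<eta>m q) = 0"
  by (simp_all add: \<eta>p_def \<eta>m_def)

lemma D2_dvol [simp]: "D2 (fn p * dvol q) = p"
  by (simp add: dvol_def D2_mult DD_mult)

text \<open>Three functionals on the second leg: \<open>bet r\<close> reads the coefficient of z^r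
  in degree 0, \<open>gam r\<close> the coefficient of z^r times the basic form of G, and
  \<open>kap\<close> the value that the connection attaches to a function on G.\<close>

definition bet :: "int \<Rightarrow> int lt wd \<Rightarrow> complex" where
  "bet r v = Poly_Mapping.lookup (D0 (pt v)) r"

definition gam :: "int \<Rightarrow> int lt wd \<Rightarrow> complex" where
  "gam r v = Poly_Mapping.lookup (DG (pt v)) r"

definition kap :: "int lt wd \<Rightarrow> complex" where
  "kap v = fl cc (D0 (pt v))"

lemma fl_bet: "fl (bet r) y = Poly_Mapping.lookup (D0 y) r"
  by (rule fl_eqI[of "fl (bet r)" "\<lambda>y. Poly_Mapping.lookup (D0 y) r"]) (simp_all add: lookup_add bet_def)

lemma fl_gam: "fl (gam r) y = Poly_Mapping.lookup (DG y) r"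
  by (rule fl_eqI[of "fl (gam r)" "\<lambda>y. Poly_Mapping.lookup (DG y) r"]) (simp_all add: lookup_add gam_def)

lemma fl_kap: "fl kap y = fl cc (D0 y)"
  by (rule fl_eqI[of "fl kap" "\<lambda>y. fl cc (D0 y)"]) (simp_all add: kap_def)

text \<open>A functional which kills the envelope ideal of G turns congruences of tensors into
  congruences of forms on P.\<close>

lemma H_slice:
  assumes h: "H x y" and f: "\<And>z. z \<in> env_ideal (calcG q) \<Longrightarrow> fl f z = 0"
  shows "W (slice f x) (slice f y)"
proof (rule md_map[OF clin_slice _ h])
  fix z assume "z \<in> PGnull q"
  then show "slice f z \<in> \<Omega>null q"
    unfolding PGnull_def
    by (rule tnull_into[OF clin_slice env_csub, rotated]) (auto simp: f csub_zero[OF env_csub] intro: csub_smul[OF env_csub])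
qed

lemma H_bet: "H x y \<Longrightarrow> W (slice (bet r) x) (slice (bet r) y)"
  and H_gam: "H x y \<Longrightarrow> W (slice (gam r) x) (slice (gam r) y)"
  and H_kap: "H x y \<Longrightarrow> W (slice kap x) (slice kap y)"
  by (erule H_slice; simp add: fl_bet fl_gam fl_kap D0_G DG_null)+

lemma bet_coact0: "D0 (slice (bet r) (coact0 q p)) = comp r p"
  by (rule clin_eqI[of "\<lambda>p. D0 (slice (bet r) (coact0 q p))" "comp r"])
    (auto simp: clin_def clin_add[OF clin_coact0] clin_smul[OF clin_coact0] slice_lin coact0_pt fl_bet zpow_def lookup_single)

lemma bet_T: "DD j (slice (bet 0) (coact0 q p * T i)) = (if i = j then comp (dgi i) p else 0)"
proof (rule clin_eqI[of "\<lambda>p. DD j (slice (bet 0) (coact0 q p * T i))" "\<lambda>p. if i = j then comp (dgi i) p else 0"])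
  show "DD j (slice (bet 0) (coact0 q (pt w) * T i)) = (if i = j then comp (dgi i) (pt w) else 0)" for w
    by (auto simp: coact0_pt T_def tens_mult fl_bet zpow_def lookup_single when_def DD_mult)
qed (auto simp: clin_def clin_add[OF clin_coact0] clin_smul[OF clin_coact0] slice_lin distrib_right)

lemma bet_Z: "slice (bet r) (coact0 q p * Z) = 0"
  by (rule clin_eqI[of "\<lambda>p. slice (bet r) (coact0 q p * Z)" "\<lambda>p. 0"])
    (auto simp: clin_def clin_add[OF clin_coact0] clin_smul[OF clin_coact0] slice_lin distrib_right coact0_pt Z_def
      tens_mult fl_bet vs_def)

lemma gam_T: "slice (gam r) (coact0 q p * T i) = 0"
  by (rule clin_eqI[of "\<lambda>p. slice (gam r) (coact0 q p * T i)" "\<lambda>p. 0"])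
    (auto simp: clin_def clin_add[OF clin_coact0] clin_smul[OF clin_coact0] slice_lin distrib_right coact0_pt T_def
      tens_mult fl_gam DG_mult clin_zero[OF clin_sG])

lemma fl_cc_eG: "fl cc eG = 1"
  by (simp add: eG_def divide_simps)

lemma gam_Z: "D0 (slice (gam r) (coact0 q p * Z)) = comp r p"
proof (rule clin_eqI[of "\<lambda>p. D0 (slice (gam r) (coact0 q p * Z))" "comp r"])
  show "D0 (slice (gam r) (coact0 q (pt w) * Z)) = comp r (pt w)" for w
    by (simp add: coact0_pt Z_def tens_mult fl_gam DG_mult vs_def fl_cc_eG zpow_def lookup_single when_def)
qed (auto simp: clin_def clin_add[OF clin_coact0] clin_smul[OF clin_coact0] slice_lin distrib_right)

subsection \<open>Base forms\<close>

lemma base0_D: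
  assumes "\<mu> \<in> BaseForms q 0"
  shows "W \<mu> (fn (D0 \<mu>))" "D0 \<mu> \<in> Mor q 0"
proof -
  have h: "\<mu> \<in> homog 0" and c: "H (coact\<Omega> q \<mu>) (tens \<mu> 1)"
    using assms by (auto simp: BaseForms_def md_def)
  show "W \<mu> (fn (D0 \<mu>))" by (rule homog0_fn[OF h])
  have "H (coact0 q (D0 \<mu>)) (tens \<mu> 1)" by (rule H_trans[OF H_sym[OF coact\<Omega>_0[OF h]] c])
  from W_D0[OF H_bet[OF this, of 0]] have "E (comp 0 (D0 \<mu>)) (D0 \<mu>)"
    by (simp add: bet_coact0 fl_bet lookup_one)
  then show "D0 \<mu> \<in> Mor q 0" unfolding Mor_iff by (rule E_sym)
qed

lemma base0_fn:
  assumes "b \<in> Mor q 0"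
  shows "fn b \<in> BaseForms q 0"
proof -
  obtain x where x: "hdeg 0 x" "E b x" using assms by (rule MorE)
  have "H (coact\<Omega> q (fn b)) (coact0 q (D0 (fn b)))" by (rule coact\<Omega>_0[OF fn_homog])
  also have "H \<dots> (coact0 q x)" using x by (intro coact0_E) simp
  also have "H \<dots> (tens (fn x) (fn (zpow 0)))" by (rule coact0_hdeg[OF x(1)])
  also have "H \<dots> (tens (fn b) 1)" by (intro H_tens W_fn V_fn_zero E_sym[OF x(2)])
  finally show ?thesis by (simp add: BaseForms_def fn_homog md_def)
qed

text \<open>Comparing coefficients of z^0 fixes the degrees of the three coefficients. The basic
  form of G must not occur in the coaction, which forces the coefficient of \<open>\<eta>3\<close>
  to vanish.\<close>

lemma base1_D:
  assumes "\<mu> \<in> BaseForms q 1"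
  shows "\<mu> \<in> homog 1" "DD Im \<mu> \<in> Mor q 2" "DD Ip \<mu> \<in> Mor q (- 2)" "DD I3 \<mu> \<in> PI q"
proof -
  show h: "\<mu> \<in> homog 1" using assms by (auto simp: BaseForms_def)
  have c: "H (coact\<Omega> q \<mu>) (tens \<mu> 1)"
    using assms by (auto simp: BaseForms_def md_def)
  have k: "H (KG \<mu>) (tens \<mu> 1)" by (rule H_trans[OF H_sym[OF coact\<Omega>_1[OF h]] c])
  have e: "E (comp (dgi j) (DD j \<mu>)) (DD j \<mu>)" for j
  proof -
    have "DD j (slice (bet 0) (KG \<mu>)) = (\<Sum>i\<in>IX. if i = j then comp (dgi i) (DD i \<mu>) else 0)"
      by (simp only: slice_lin clin_sum[OF clin_slice] D1_lin clin_sum[OF clin_D1] bet_T bet_Z) simp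
    also have "\<dots> = comp (dgi j) (DD j \<mu>)" by (rule sum_delta_IX)
    finally show ?thesis using W_DD[OF H_bet[OF k, of 0], of j] by (simp add: fl_bet lookup_one)
  qed
  show "DD Im \<mu> \<in> Mor q 2" "DD Ip \<mu> \<in> Mor q (- 2)"
    using E_sym[OF e[of Im]] E_sym[OF e[of Ip]] by (simp_all add: Mor_iff)
  \<comment> \<open>This only sees the component of degree 0 of the \<open>\<eta>3\<close>
    coefficient; by \<open>e\<close> with \<open>I3\<close> there is no other component.\<close>
  have "D0 (slice (gam 0) (KG \<mu>)) = comp 0 (DD I3 \<mu>)"
    by (simp add: slice_lin clin_sum[OF clin_slice] gam_T gam_Z)
  then have "E (comp 0 (DD I3 \<mu>)) 0"
    using W_D0[OF H_gam[OF k, of 0]] by (simp add: fl_gam)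
  then have "E (DD I3 \<mu>) 0" using E_trans[OF E_sym[OF e[of I3]]] by simp
  then show "DD I3 \<mu> \<in> PI q" by (simp add: md_zero)
qed

lemma homog1_base:
  assumes "\<mu> \<in> homog 1" "DD I3 \<mu> \<in> PI q"
  shows "W \<mu> (fn (DD Im \<mu>) * \<eta>m q + fn (DD Ip \<mu>) * \<eta>p)"
proof -
  have "W \<mu> (\<Sum>i\<in>IX. fn (DD i \<mu>) * et i)" by (rule homog1_et[OF assms(1)])
  also have "\<dots> = fn (DD I3 \<mu>) * \<eta>3 + (fn (DD Im \<mu>) * \<eta>m q + fn (DD Ip \<mu>) * \<eta>p)"
    by (simp add: sum_IX algebra_simps)
  also have "W \<dots> (0 + (fn (DD Im \<mu>) * \<eta>m q + fn (DD Ip \<mu>) * \<eta>p))"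
    using assms(2) by (intro W_add W_refl W_fn_zero) (simp add: md_zero)
  finally show ?thesis by simp
qed

lemma base1_I:
  assumes x: "x \<in> Mor q 2" and y: "y \<in> Mor q (- 2)"
  shows "fn x * \<eta>m q + fn y * \<eta>p \<in> BaseForms q 1"
proof -
  let ?\<mu> = "fn x * \<eta>m q + fn y * \<eta>p"
  have h: "?\<mu> \<in> homog 1"
    using homog_mult[OF fn_homog et_homog[of Im], of x] homog_mult[OF fn_homog et_homog[of Ip], of y]
    by (intro csub_add[OF homog_csub]) simp_all
  have d: "DD Im ?\<mu> = x" "DD Ip ?\<mu> = y" "DD I3 ?\<mu> = 0" by (simp_all add: DD_mult)
  have t: "H (coact0 q z * T i) (tens (fn z * et i) 1)" if z: "z \<in> Mor q (dgi i)" for z i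
  proof -
    obtain u where u: "hdeg (dgi i) u" "E z u" using z by (rule MorE)
    have "H (coact0 q z * T i) (coact0 q u * T i)" by (intro H_mult H_refl coact0_E u)
    also have "H \<dots> (tens (fn u) (fn (zpow (dgi i))) * T i)" by (intro H_mult H_refl coact0_hdeg u)
    also have "\<dots> = tens (fn u * et i) (fn (zpow (dgi i)) * fn (zpow (- dgi i)))" by (simp add: T_def tens_mult)
    also have "H \<dots> (tens (fn z * et i) (fn (zpow (dgi i + - dgi i))))"
      by (intro H_tens W_mult W_fn W_refl E_sym[OF u(2)] V_sym[OF V_fn_add])
    also have "H \<dots> (tens (fn z * et i) 1)"
      using V_fn_zero by (intro H_tens W_refl) simp
    finally show ?thesis .
  qed
  have "H (coact\<Omega> q ?\<mu>) (KG ?\<mu>)" by (rule coact\<Omega>_1[OF h])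
  also have "KG ?\<mu> = coact0 q x * T Im + coact0 q y * T Ip"
    unfolding sum_IX d by (simp add: clin_zero[OF clin_coact0] add.commute)
  also have "H \<dots> (tens (fn x * et Im) 1 + tens (fn y * et Ip) 1)"
    using x y by (intro H_add t) simp_all
  finally show ?thesis using h by (simp add: BaseForms_def md_def tens_add_left)
qed

lemma zero_base1: "0 \<in> BaseForms q 1"
  using csub_zero[OF homog_csub] csub_zero[OF PG_csub] by (simp add: BaseForms_def coact\<Omega>_def)

subsection \<open>The covariant derivative\<close>

text \<open>Existence of the scalar is \<open>RG_pt\<close>; its uniqueness comes from the
  functional \<open>cc\<close>.\<close>

lemma conn_germ_zpow: "conn_germ q (zpow m) = smul (cc m) \<eta>3"
proof -
  have g: "germ (calcG q) (zpow m) = pt m - 1" "germ (calcG q) (zpow 1 - zpow (-1)) = eG"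
    using counit_eG by (simp_all add: germ_def counitG_fl zpow_def eG_def)
  have "(SOME c. germ (calcG q) (zpow m) - smul c (germ (calcG q) (zpow 1 - zpow (-1))) \<in> Rid (calcG q)) = cc m"
    unfolding g Rid_G
  proof (rule some_equality)
    show "pt m - 1 - smul (cc m) eG \<in> RG" by (rule RG_pt)
    show "c = cc m" if "pt m - 1 - smul c eG \<in> RG" for c
      using cc_RG[OF that] by (simp add: fl_cc_eG fl_one)
  qed
  then show ?thesis by (simp add: conn_germ_def)
qed

text \<open>In degree n the \<open>\<eta>3\<close> part of dp is \<open>cc n\<close> times p, which
  is precisely the connection term. The other two parts are horizontal and remain.\<close>

lemma covD_fn:
  assumes p: "p \<in> Mor q n"
  shows "W (covD q 0 (fn p)) (fn (dd Im p) * \<eta>m q + fn (dd Ip p) * \<eta>p)"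
proof -
  obtain x where x: "hdeg n x" "E p x" using p by (rule MorE)
  let ?\<psi> = "coactHor q (fn p)"
  have incl: "inclG (tens (fn p) (zpow n)) = tens (fn p) (fn (zpow n))"
    unfolding inclG_def fn_def var_def zpow_def tens_pt tmap_pt by simp
  have "H (coact\<Omega> q (fn p)) (coact0 q (D0 (fn p)))" by (rule coact\<Omega>_0[OF fn_homog])
  also have "H \<dots> (coact0 q x)" using x by (intro coact0_E) simp
  also have "H \<dots> (tens (fn x) (fn (zpow n)))" by (rule coact0_hdeg[OF x(1)])
  also have "H \<dots> (tens (fn p) (fn (zpow n)))" by (intro H_tens W_fn V_refl E_sym[OF x(2)])
  finally have 1: "H (coact\<Omega> q (fn p)) (tens (fn p) (fn (zpow n)))" .
  then have "\<exists>\<psi>. coact\<Omega> q (fn p) - inclG \<psi> \<in> PGnull q"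
    by (intro exI[of _ "tens (fn p) (zpow n)"]) (simp add: incl md_def)
  then have "H (coact\<Omega> q (fn p)) (inclG ?\<psi>)"
    unfolding coactHor_def md_def by (rule someI_ex)
  then have 2: "H (inclG ?\<psi>) (tens (fn p) (fn (zpow n)))" using H_trans[OF H_sym 1] by blast
  \<comment> \<open>The connection term depends on the chosen \<open>?\<psi>\<close> only through
    its inclusion, sliced by \<open>kap\<close>; congruent inclusions give congruent
    results.\<close>
  have k: "lin (\<lambda>(u, m). pt u * conn_germ q (zpow m)) \<psi> = slice kap (inclG \<psi>) * \<eta>3" for \<psi>
    by (rule clin_eqI[of "\<lambda>\<psi>. lin (\<lambda>(u, m). pt u * conn_germ q (zpow m)) \<psi>" "\<lambda>\<psi>. slice kap (inclG \<psi>) * \<eta>3"])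
      (auto simp: clin_def lin_add lin_smul inclG_def clin_add[OF clin_tmap] clin_smul[OF clin_tmap] slice_lin
        distrib_right conn_germ_zpow[unfolded zpow_def] tmap_pt fl_kap zpow_def single_smul_pt[of _ "cc _"]
        simp del: smul_single)
  have 3: "W (slice kap (inclG ?\<psi>) * \<eta>3) (smul (cc n) (fn p) * \<eta>3)"
    using H_kap[OF 2] by (intro W_mult W_refl) (simp add: fl_kap zpow_def)
  have "covD q 0 (fn p) = fm (comult q p) - slice kap (inclG ?\<psi>) * \<eta>3"
    unfolding covD_def k by (simp add: dP_fn)
  also have "W \<dots> ((\<Sum>i\<in>IX. fn (dd i p) * et i) - smul (cc n) (fn p) * \<eta>3)"
    using fm_expand[of "comult q p"] by (intro W_diff 3) (simp add: cf_comult)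
  also have "\<dots> = (fn (dd Im p) * \<eta>m q + fn (dd Ip p) * \<eta>p) + fn (dd I3 p) * \<eta>3 - smul (cc n) (fn p) * \<eta>3"
    by (simp add: sum_IX)
  also have "W \<dots> ((fn (dd Im p) * \<eta>m q + fn (dd Ip p) * \<eta>p) + smul (cc n) (fn p) * \<eta>3 - smul (cc n) (fn p) * \<eta>3)"
    by (intro W_diff W_add W_mult W_refl W_fn_smul Mor_dd3 p)
  finally show ?thesis by simp
qed

section \<open>The involution and the Hodge operators\<close>

text \<open>The involution exchanges \<open>\<eta>p\<close> and \<open>\<eta>m\<close> and sends
  \<open>\<eta>3\<close> to its negative; \<open>isn\<close> records the sign.\<close>

fun ist :: "ix \<Rightarrow> ix" where "ist I3 = I3" | "ist Ip = Im" | "ist Im = Ip"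
fun isn :: "ix \<Rightarrow> complex" where "isn I3 = -1" | "isn Ip = 1" | "isn Im = 1"

lemma mw_ist [simp]: "mw (ist i) = mw i"
  by (cases i) auto

lemma cnj_zf [simp]: "cnj (zf m) = zf m"
proof -
  have "zf m = complex_of_real (q powi (- m))" by (simp add: zf_def)
  then show ?thesis by (metis complex_cnj_complex_of_real)
qed

abbreviation sst :: "gen wd \<Rightarrow> gen free" where
  "sst v \<equiv> pstar (antipode q (pt v))"

lemma sst_simps: "sst (Wd []) = 1" "sst (Wd (a # v)) = pstar (gen_antipode q a) * sst (Wd v)"
  by (simp_all add: antipode_def)

lemma fl_fw_mult: "fl (fw m) (x * y) = fl (fw m) x * fl (fw m) y"
  using fl_tensor_eqI[of "fw m" "[(fw m, fw m)]"] by simp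

lemma fw_sst: "fl (fw m) (sst (Wd v)) = cnj (fw m (Wd v))"
proof (induction v)
  case (Cons a v)
  then show ?case by (cases a) (simp_all add: sst_simps fl_fw_mult fl_var)
qed (simp add: sst_simps fl_one wd_zero)

text \<open>The map v to the adjoint of S(v) is multiplicative on words, so the rule for tangent
  functionals on products applies letter by letter on both sides.\<close>

lemma chw_sst: "fl (chw i) (sst (Wd v)) = - isn i * cnj (chw (ist i) (Wd v))"
proof (induction v)
  case (Cons a v)
  then show ?case
    by (subst chw_Cons, cases a; cases i)
      (simp_all add: sst_simps fl_chw_mult fl_var fw_sst algebra_simps inverse_eq_divide)
qed (simp add: sst_simps chw_one)

text \<open>The adjoint of x \<eta> is the adjoint form times the adjoint of x from the right;
  moving the function to the left produces the twist.\<close>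

lemma cf_form_star: "cf i (form_star q \<omega>) = smul (isn i) (sg (mw i) (pstar (cf (ist i) \<omega>)))"
proof (rule alin_eqI[of "\<lambda>\<omega>. cf i (form_star q \<omega>)" "\<lambda>\<omega>. smul (isn i) (sg (mw i) (pstar (cf (ist i) \<omega>)))"])
  fix k :: "gen wd \<times> gen wd"
  obtain u v where k: "k = (u, Wd v)" by (cases k, cases "snd k") auto
  have "cf i (form_star q (pt k)) = - (smul (fl (chw i) (sst (Wd v))) 1 * sg (mw i) (pstar (pt u)))"
    by (simp add: k form_star_def clin_minus[OF clin_slice] cf_ract)
  also have "\<dots> = smul (isn i) (sg (mw i) (pstar (cf (ist i) (pt k))))"
    by (simp add: k chw_sst single_smul_pt[of u "chw _ _"] smul_minus del: smul_single)
  finally show "cf i (form_star q (pt k)) = smul (isn i) (sg (mw i) (pstar (cf (ist i) (pt k))))" .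
qed (auto simp: alin_def form_star_def alin_add[OF alin_antilin] alin_smul[OF alin_antilin] slice_lin smul_add mult.commute)

text \<open>The involution reverses degrees, so the inner and the outer twist cancel.\<close>

lemma sg_pstar_sg: "sg m (pstar (sg m x)) = pstar x"
  by (rule alin_eqI[of "\<lambda>x. sg m (pstar (sg m x))" pstar])
    (auto simp: alin_def single_smul_pt[of _ "zf _"] pstar_pt wdg_star zf_minus simp del: smul_single,
     simp add: field_simps)

lemma star_word0: "wdeg (Wd w) = 0 \<Longrightarrow> D0 (star_word q w) = pstar (D0 (pt (Wd w))) \<and> star_word q w \<in> homog 0"
proof (induction w)
  case Nil
  have "(1 :: gen wd env) = pt (Wd [])" by (simp only: one_pt wd_zero)
  moreover have "(pt (Wd []) :: gen wd env) \<in> homog 0" unfolding pt_homog by simp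
  ultimately have "(1 :: gen wd env) \<in> homog 0" by (simp only:)
  then show ?case by (simp only: star_word.simps D0_simps \<open>1 = pt (Wd [])\<close>[symmetric] pstar_one)
next
  case (Cons l w)
  then obtain p where l: "l = Fn p" by (cases l) auto
  have IH: "D0 (star_word q w) = pstar (D0 (pt (Wd w)))" "star_word q w \<in> homog 0"
    using Cons l by auto
  have s: "star_word q (l # w) = star_word q w * fn (pstar p)" by (simp add: l)
  have d: "D0 (pt (Wd (l # w))) = p * D0 (pt (Wd w))" by (simp only: pt_Cons l var_lt D0_simps)
  show ?case unfolding s d using homog_mult[OF IH(2) fn_homog, of "pstar p"] by (simp add: IH(1))
qed

lemma star_word1: "wdeg (Wd w) = 1 \<Longrightarrow>
    DD i (star_word q w) = smul (isn i) (sg (mw i) (pstar (DD (ist i) (pt (Wd w))))) \<and> star_word q w \<in> homog 1"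
proof (induction w)
  case (Cons l w)
  show ?case
  proof (cases l)
    case (Fn p)
    have IH: "DD i (star_word q w) = smul (isn i) (sg (mw i) (pstar (DD (ist i) (pt (Wd w)))))" "star_word q w \<in> homog 1"
      using Cons Fn by auto
    have s: "star_word q (l # w) = star_word q w * fn (pstar p)" by (simp add: Fn)
    have d: "DD (ist i) (pt (Wd (l # w))) = p * DD (ist i) (pt (Wd w))" by (simp add: pt_Cons Fn var_lt DD_mult)
    show ?thesis
      unfolding s d using homog_mult[OF IH(2) fn_homog, of "pstar p"] by (simp add: IH(1) DD_mult)
  next
    case (Fm \<omega>)
    have 0: "wdeg (Wd w) = 0" using Cons(2) Fm by simp
    note w0 = star_word0[OF 0]
    have s: "star_word q (l # w) = star_word q w * fm (form_star q \<omega>)" by (simp add: Fm 0)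
    have d: "DD (ist i) (pt (Wd (l # w))) = cf (ist i) \<omega> * sg (mw i) (D0 (pt (Wd w)))" by (simp add: pt_Cons Fm var_lt DD_mult)
    show ?thesis
      unfolding s d using homog_mult[OF conjunct2[OF w0] fm_homog, of "form_star q \<omega>"] conjunct1[OF w0]
      by (simp add: DD_mult cf_form_star sg_pstar_sg)
  qed
qed simp

lemma star_homog:
  assumes h: "\<phi> \<in> homog k" and w: "\<And>w. wdeg (Wd w) = k \<Longrightarrow> F (star_word q w) = G (pt (Wd w)) \<and> star_word q w \<in> homog k"
    and F: "clin F" and G: "alin G"
  shows "F (env_star q \<phi>) = G \<phi> \<and> env_star q \<phi> \<in> homog k"
proof
  have w': "F (star_word q (letters w)) = G (pt w) \<and> star_word q (letters w) \<in> homog k" if "w \<in> Poly_Mapping.keys \<phi>" for w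
    using that h w[of "letters w"] by (cases w) (auto simp: homog_def)
  have "F (env_star q \<phi>) = lin (\<lambda>w. F (star_word q (letters w))) (cjm \<phi>)"
    unfolding env_star_def antilin_conv by (rule clin_lin_comm[OF F])
  also have "\<dots> = lin (\<lambda>w. G (pt w)) (cjm \<phi>)"
    by (rule lin_cong) (use w' in simp)
  also have "\<dots> = G \<phi>"
    using clin_lin_pt[OF alin_cjm[OF G], of "cjm \<phi>"] by simp
  finally show "F (env_star q \<phi>) = G \<phi>" .
  show "env_star q \<phi> \<in> homog k"
    unfolding env_star_def antilin_conv by (intro csub_lin homog_csub) (use w' in simp)
qed

lemma env_star0:
  assumes "\<phi> \<in> homog 0"
  shows "D0 (env_star q \<phi>) = pstar (D0 \<phi>)" "env_star q \<phi> \<in> homog 0"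
  using star_homog[OF assms star_word0 clin_D0 clin_alin[OF clin_D0 alin_pstar]] by auto

lemma env_star1:
  assumes "\<phi> \<in> homog 1"
  shows "DD i (env_star q \<phi>) = smul (isn i) (sg (mw i) (pstar (DD (ist i) \<phi>)))" "env_star q \<phi> \<in> homog 1"
proof -
  have "alin (\<lambda>\<phi>. smul (isn i) (sg (mw i) (pstar (DD (ist i) \<phi>))))"
    by (simp add: alin_def smul_add mult.commute)
  from star_homog[OF assms star_word1 clin_D1 this]
  show "DD i (env_star q \<phi>) = smul (isn i) (sg (mw i) (pstar (DD (ist i) \<phi>)))" "env_star q \<phi> \<in> homog 1" by auto
qed

text \<open>The factors Q^2 and 1 / Q^2 are the twists of adjoint coefficients in degrees -2 and 2,
  which appear when the involution brings functions back to the left. The second involution, inside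
  \<open>starL\<close>, restores the coefficients themselves.\<close>

lemma starR_1:
  assumes \<mu>: "\<mu> \<in> BaseForms q 1"
  obtains x y where "starR q 1 \<mu> = - (fn x * \<eta>m q) + fn y * \<eta>p"
    "E x (smul (Q^2) (DD Im \<mu>))" "E y (smul (1 / Q^2) (DD Ip \<mu>))"
proof -
  let ?s = "env_star q \<mu>"
  note b = base1_D[OF \<mu>]
  have dm: "DD Im ?s = sg 1 (pstar (DD Ip \<mu>))" and dp: "DD Ip ?s = sg 1 (pstar (DD Im \<mu>))"
    and d3: "DD I3 ?s = smul (- 1) (sg 2 (pstar (DD I3 \<mu>)))"
    using env_star1(1)[OF b(1), of Im] env_star1(1)[OF b(1), of Ip] env_star1(1)[OF b(1), of I3] by simp_all
  have Em: "E (sg 1 (pstar (DD Ip \<mu>))) (smul (1 / Q^2) (pstar (DD Ip \<mu>)))"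
    using Mor_sg[OF Mor_pstar[OF b(3), of 2], of 1] by simp
  have Ep: "E (sg 1 (pstar (DD Im \<mu>))) (smul (Q^2) (pstar (DD Im \<mu>)))"
    using Mor_sg[OF Mor_pstar[OF b(2), of "-2"], of 1] by simp
  let ?P = "\<lambda>(x, y). x \<in> Mor q 2 \<and> y \<in> Mor q (-2) \<and> ?s - (fn x * \<eta>m q + fn y * \<eta>p) \<in> \<Omega>null q"
  have "W ?s (fn (DD Im ?s) * \<eta>m q + fn (DD Ip ?s) * \<eta>p)"
    by (rule homog1_base[OF env_star1(2)[OF b(1)]])
      (unfold d3, intro csub_smul[OF PI_csub] sg_PI pstar_PI b(4))
  moreover have "DD Im ?s \<in> Mor q 2"
    unfolding dm by (rule Mor_E[OF _ Em]) (intro csub_smul[OF Mor_csub] Mor_pstar[OF b(3)], simp)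
  moreover have "DD Ip ?s \<in> Mor q (- 2)"
    unfolding dp by (rule Mor_E[OF _ Ep]) (intro csub_smul[OF Mor_csub] Mor_pstar[OF b(2)], simp)
  ultimately have "?P (DD Im ?s, DD Ip ?s)" by (simp add: md_def)
  then have P: "?P (SOME p. ?P p)" by (rule someI)
  \<comment> \<open>The selected pair need not be the exhibited one, but \<open>DD Im\<close> and
    \<open>DD Ip\<close> of the adjoint form determine it modulo \<open>PI q\<close>.\<close>
  obtain x y where xy: "(SOME p. ?P p) = (x, y)" by (cases "SOME p. ?P p") auto
  have r: "starR q 1 \<mu> = - (fn (pstar y) * \<eta>m q) + fn (pstar x) * \<eta>p"
    unfolding starR_def starL_def by (simp add: xy[simplified])
  have "W ?s (fn x * \<eta>m q + fn y * \<eta>p)" using P unfolding xy by (simp add: md_def)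
  from W_DD[OF this, of Im] W_DD[OF this, of Ip]
  have "E (sg 1 (pstar (DD Ip \<mu>))) x" "E (sg 1 (pstar (DD Im \<mu>))) y"
    unfolding dm dp by (simp_all add: DD_mult)
  then have "E x (smul (1 / Q^2) (pstar (DD Ip \<mu>)))" "E y (smul (Q^2) (pstar (DD Im \<mu>)))"
    using Em Ep E_sym E_trans by blast+
  from E_pstar[OF this(1)] E_pstar[OF this(2)] show ?thesis
    by (intro that[OF r]) simp_all
qed

lemma starR_0:
  assumes \<mu>: "\<mu> \<in> BaseForms q 0"
  shows "W (starR q 0 \<mu>) (fn (D0 \<mu>) * dvol q)"
proof -
  have h: "\<mu> \<in> homog 0" using \<mu> by (simp add: BaseForms_def)
  let ?s = "env_star q \<mu>"
  let ?P = "\<lambda>b. b \<in> Hyp q \<and> ?s - fn b \<in> \<Omega>null q"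
  have "W ?s (fn (pstar (D0 \<mu>)))" using homog0_fn[OF env_star0(2)[OF h]] env_star0(1)[OF h] by simp
  moreover have "pstar (D0 \<mu>) \<in> Hyp q" by (rule Mor_pstar[OF base0_D(2)[OF \<mu>]]) simp
  ultimately have "?P (pstar (D0 \<mu>))" by (simp add: md_def)
  then have P: "?P (SOME b. ?P b)" by (rule someI)
  have r: "starR q 0 \<mu> = fn (pstar (SOME b. ?P b)) * dvol q"
    unfolding starR_def starL_def by simp
  have "W ?s (fn (SOME b. ?P b))" using P by (simp add: md_def)
  from W_D0[OF this] have "E (pstar (D0 \<mu>)) (SOME b. ?P b)" using env_star0(1)[OF h] by simp
  from E_pstar[OF E_sym[OF this]] have "E (pstar (SOME b. ?P b)) (D0 \<mu>)" by simp
  then show ?thesis unfolding r by (intro W_mult W_refl W_fn)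
qed

text \<open>The selected preimage is known through the coefficient of \<open>dvol\<close>: the Hodge
  operator in degree 0 multiplies by \<open>dvol\<close>, and \<open>D2\<close> reads this factor
  off.\<close>

lemma starR_inv_2:
  assumes b: "b \<in> Hyp q" and \<nu>: "W \<nu> (fn b * dvol q)"
  shows "starR_inv q 2 \<nu> \<in> BaseForms q 0" "E (D0 (starR_inv q 2 \<nu>)) (D2 \<nu>)"
proof -
  let ?P = "\<lambda>\<mu>. \<mu> \<in> BaseForms q (2 - 2) \<and> starR q (2 - 2) \<mu> - \<nu> \<in> \<Omega>null q"
  have "W (starR q 0 (fn b)) (fn b * dvol q)" using starR_0[OF base0_fn[OF b]] by simp
  then have "W (starR q 0 (fn b)) \<nu>" by (rule W_trans[OF _ W_sym[OF \<nu>]])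
  then have "?P (fn b)" using base0_fn[OF b] by (simp add: md_def)
  then have P: "?P (starR_inv q 2 \<nu>)" unfolding starR_inv_def by (rule someI)
  then show m: "starR_inv q 2 \<nu> \<in> BaseForms q 0" by simp
  have "W (starR q 0 (starR_inv q 2 \<nu>)) \<nu>" using P by (simp add: md_def)
  then have "W (fn (D0 (starR_inv q 2 \<nu>)) * dvol q) \<nu>" by (rule W_trans[OF W_sym[OF starR_0[OF m]]])
  from W_D2[OF this] show "E (D0 (starR_inv q 2 \<nu>)) (D2 \<nu>)" by simp
qed

section \<open>The right gauge Laplacian\<close>

lemma clin_coact\<Omega>: "clin (coact\<Omega> q)"
  by (simp add: coact\<Omega>_def)

lemma base_csub: "csub (BaseForms q k)"
proof -
  have "csub {\<mu>. coact\<Omega> q \<mu> - tens \<mu> 1 \<in> PGnull q}"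
    by (rule csub_vimage[of "\<lambda>\<mu>. coact\<Omega> q \<mu> - tens \<mu> 1", OF clin_sub[OF clin_coact\<Omega> clin_tens_left[OF clin_id]] PG_csub])
  then show ?thesis using homog_csub[of k] by (auto simp: BaseForms_def csub_def)
qed

lemma one_base0: "1 \<in> BaseForms q 0"
proof -
  have 1: "(1 :: gen wd env) = pt (Wd [])" by (simp only: one_pt wd_zero)
  have "coact\<Omega> q 1 = tens 1 1" unfolding coact\<Omega>_def one_pt lin_pt by simp
  then show ?thesis using csub_zero[OF PG_csub] by (simp add: BaseForms_def) (simp only: 1 pt_homog wdeg_simps)
qed

lemma ERep_csub: "csub (ERep q n k)"
  by (auto simp: csub_def ERep_def dest!: subsetD[OF Poly_Mapping.keys_add] subsetD[OF keys_smul_subset])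

lemma ERep_pt: "a \<in> Mor q n \<Longrightarrow> \<mu> \<in> BaseForms q k \<Longrightarrow> pt (a, \<mu>) \<in> ERep q n k"
  by (simp add: ERep_def)

lemma clin_Upsilon [simp, intro]: "clin \<Upsilon>"
  by (simp add: \<Upsilon>_def)

lemmas Upsilon_lin = clin_add[OF clin_Upsilon] clin_diff[OF clin_Upsilon] clin_smul[OF clin_Upsilon] clin_zero[OF clin_Upsilon]

lemma Upsilon_pt [simp]: "\<Upsilon> (pt (a, \<mu>)) = fn a * \<mu>"
  by (simp add: \<Upsilon>_def)

text \<open>Writing x as the sum of s (t x) over the splitting of 1 from \<open>Mor_unit\<close>
  leaves coefficients t x of the degrees that base forms demand.\<close>

lemma Upsilon_ex:
  assumes a: "a \<in> Mor q (n + 2)" and c: "c \<in> Mor q (n - 2)"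
  shows "\<exists>u. u \<in> ERep q n 1 \<and> W (\<Upsilon> u) (fn a * \<eta>m q + fn c * \<eta>p)"
proof -
  obtain xs where xs: "\<And>s t. (s, t) \<in> set xs \<Longrightarrow> s \<in> Mor q n \<and> t \<in> Mor q (- n)"
    and one: "E (\<Sum>(s, t)\<leftarrow>xs. s * t) 1"
    using Mor_unit[of n] by blast
  let ?m = "\<lambda>t. fn (t * a) * \<eta>m q + fn (t * c) * \<eta>p"
  let ?u = "\<Sum>(s, t)\<leftarrow>xs. pt (s, ?m t)"
  have "?u \<in> ERep q n 1"
  proof (rule csub_sum_list[OF ERep_csub], clarify)
    fix s t assume "(s, t) \<in> set xs"
    then have st: "s \<in> Mor q n" "t \<in> Mor q (- n)" using xs by auto
    have "t * a \<in> Mor q 2" "t * c \<in> Mor q (- 2)"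
      using Mor_mult[OF st(2) a] Mor_mult[OF st(2) c] by simp_all
    then show "pt (s, ?m t) \<in> ERep q n 1" by (intro ERep_pt st base1_I)
  qed
  moreover have "W (\<Upsilon> ?u) (fn a * \<eta>m q + fn c * \<eta>p)"
  proof -
    have r: "fn (s * (t * x)) = fn ((s * t) * x)" for s t x :: "gen free" by (simp add: mult.assoc)
    have g: "W (\<Sum>(s, t)\<leftarrow>xs. fn s * fn (t * x)) (fn x)" for x
    proof -
      have "W (\<Sum>(s, t)\<leftarrow>xs. fn s * fn (t * x)) (\<Sum>(s, t)\<leftarrow>xs. fn ((s * t) * x))"
        unfolding case_prod_unfold r[symmetric] by (intro md_sum_list env_csub W_sym[OF fn_mult])
      also have "W \<dots> (fn (\<Sum>(s, t)\<leftarrow>xs. (s * t) * x))"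
        unfolding case_prod_unfold by (rule W_sym[OF fn_sum_list])
      also have "(\<Sum>(s, t)\<leftarrow>xs. (s * t) * x) = (\<Sum>(s, t)\<leftarrow>xs. s * t) * x"
        by (induction xs) (auto simp: algebra_simps)
      also have "W (fn \<dots>) (fn (1 * x))" by (intro W_fn E_mult one E_refl)
      finally show ?thesis by simp
    qed
    have "\<Upsilon> ?u = (\<Sum>(s, t)\<leftarrow>xs. fn s * fn (t * a)) * \<eta>m q + (\<Sum>(s, t)\<leftarrow>xs. fn s * fn (t * c)) * \<eta>p"
      by (induction xs) (auto simp: Upsilon_lin algebra_simps)
    also have "W \<dots> (fn a * \<eta>m q + fn c * \<eta>p)" by (intro W_add W_mult W_refl g)
    finally show ?thesis .
  qed
  ultimately show ?thesis by blast
qed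

lemma nabla_spec:
  assumes p: "p \<in> Mor q n"
  shows "nabla q n p \<in> ERep q n 1" "W (\<Upsilon> (nabla q n p)) (fn (dd Im p) * \<eta>m q + fn (dd Ip p) * \<eta>p)"
proof -
  have "dd Im p \<in> Mor q (n + 2)" "dd Ip p \<in> Mor q (n - 2)" by (rule Mor_dd[OF p], simp)+
  then obtain u where "u \<in> ERep q n 1" "W (\<Upsilon> u) (fn (dd Im p) * \<eta>m q + fn (dd Ip p) * \<eta>p)"
    using Upsilon_ex by blast
  then have "u \<in> ERep q n 1 \<and> \<Upsilon> u - covD q 0 (fn p) \<in> \<Omega>null q"
    using W_trans[OF _ W_sym[OF covD_fn[OF p]]] by (simp add: md_def)
  then have s: "nabla q n p \<in> ERep q n 1 \<and> \<Upsilon> (nabla q n p) - covD q 0 (fn p) \<in> \<Omega>null q"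
    unfolding nabla_def \<Upsilon>hat_def by (rule someI)
  then show "nabla q n p \<in> ERep q n 1" by simp
  have "W (\<Upsilon> (nabla q n p)) (covD q 0 (fn p))" using s by (simp add: md_def)
  then show "W (\<Upsilon> (nabla q n p)) (fn (dd Im p) * \<eta>m q + fn (dd Ip p) * \<eta>p)"
    by (rule W_trans[OF _ covD_fn[OF p]])
qed

text \<open>Two-forms for which the value of \<open>starR_inv\<close> is controlled by
  \<open>starR_inv_2\<close>.\<close>

definition top_form :: "gen wd env \<Rightarrow> bool" where
  "top_form \<nu> \<longleftrightarrow> (\<exists>b\<in>Hyp q. W \<nu> (fn b * dvol q))"

text \<open>The squares of \<open>\<eta>m\<close> and \<open>\<eta>p\<close> vanish and the mixed
  products are multiples of \<open>dvol\<close>; the shifts 2 and -2 of the coefficients cancel, so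
  the result is a base form.\<close>

lemma top_form_mult:
  assumes \<nu>: "W \<nu> (fn x' * \<eta>m q + fn y' * \<eta>p)" "x' \<in> Mor q 2" "y' \<in> Mor q (- 2)"
    and x: "x \<in> Mor q 2" and y: "y \<in> Mor q (- 2)"
  shows "top_form (\<nu> * (- (fn x * \<eta>m q) + fn y * \<eta>p))"
proof -
  let ?b = "x' * sg 1 y + smul (Q^2) (y' * sg 1 x)"
  have s: "sg 1 u \<in> Mor q m" if "u \<in> Mor q m" for u m
    by (rule Mor_E[OF csub_smul[OF Mor_csub that] Mor_sg[OF that]])
  have b: "?b \<in> Hyp q"
    using Mor_mult[OF \<nu>(2) s[OF y]] Mor_mult[OF \<nu>(3) s[OF x]]
    by (intro csub_add[OF Mor_csub] csub_smul[OF Mor_csub]) simp_all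
  have c: "W (fn u * et i * (fn v * et j)) (fn (u * sg (mw i) v) * (et i * et j))" for u v i j
  proof -
    have "fn u * et i * (fn v * et j) = fn u * ((et i * fn v) * et j)" by (simp add: mult.assoc)
    also have "W \<dots> (fn u * ((fn (sg (mw i) v) * et i) * et j))" by (intro W_mult W_refl et_fn)
    also have "\<dots> = (fn u * fn (sg (mw i) v)) * (et i * et j)" by (simp add: mult.assoc)
    also have "W \<dots> (fn (u * sg (mw i) v) * (et i * et j))" by (intro W_mult W_refl W_sym[OF fn_mult])
    finally show ?thesis .
  qed
  have "W (\<nu> * (- (fn x * \<eta>m q) + fn y * \<eta>p)) ((fn x' * \<eta>m q + fn y' * \<eta>p) * (- (fn x * \<eta>m q) + fn y * \<eta>p))"
    by (intro W_mult \<nu> W_refl)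
  also have "\<dots> = - (fn x' * et Im * (fn x * et Im)) + fn x' * et Im * (fn y * et Ip)
      - fn y' * et Ip * (fn x * et Im) + fn y' * et Ip * (fn y * et Ip)"
    by (simp add: algebra_simps)
  also have "W \<dots> (- (fn (x' * sg (mw Im) x) * (et Im * et Im)) + fn (x' * sg (mw Im) y) * (et Im * et Ip)
      - fn (y' * sg (mw Ip) x) * (et Ip * et Im) + fn (y' * sg (mw Ip) y) * (et Ip * et Ip))"
    by (intro W_add W_diff W_minus c)
  also have "\<dots> = - (fn (x' * sg 1 x) * (\<eta>m q * \<eta>m q)) + fn (x' * sg 1 y) * dvol q
      - fn (y' * sg 1 x) * (\<eta>p * \<eta>m q) + fn (y' * sg 1 y) * (\<eta>p * \<eta>p)"
    by (simp add: dvol_def)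
  also have "W \<dots> (- (fn (x' * sg 1 x) * 0) + fn (x' * sg 1 y) * dvol q
      - fn (y' * sg 1 x) * smul (- (Q^2)) (dvol q) + fn (y' * sg 1 y) * 0)"
    by (intro W_add W_diff W_minus W_mult W_refl et_mm et_pp et_pm)
  also have "\<dots> = (fn (x' * sg 1 y) + smul (Q^2) (fn (y' * sg 1 x))) * dvol q"
    by (simp add: distrib_right smul_minus)
  also have "W \<dots> (fn ?b * dvol q)"
    by (intro W_mult W_refl W_sym[OF W_trans[OF fn_add W_add[OF W_refl fn_smul]]])
  finally show ?thesis using b unfolding top_form_def by blast
qed

lemma dP_starR:
  assumes x: "x \<in> Mor q 2" and y: "y \<in> Mor q (- 2)"
  shows "top_form (dP q (- (fn x * \<eta>m q) + fn y * \<eta>p))"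
    "E (D2 (dP q (- (fn x * \<eta>m q) + fn y * \<eta>p))) (smul (Q^2) (dd Ip x) + dd Im y)"
proof -
  let ?b = "smul (Q^2) (dd Ip x) + dd Im y"
  have b: "?b \<in> Hyp q"
    using Mor_dd[OF x, of 0 Ip] Mor_dd[OF y, of 0 Im] by (intro csub_add[OF Mor_csub] csub_smul[OF Mor_csub]) simp_all
  have "dP q (- (fn x * \<eta>m q) + fn y * \<eta>p) = - dP q (fn x * \<eta>m q) + dP q (fn y * \<eta>p)"
    by (simp only: clin_add[OF clin_dP] clin_minus[OF clin_dP])
  also have "W \<dots> (- (fn (smul (- (Q^2)) (dd Ip x)) * dvol q) + fn (dd Im y) * dvol q)"
    using Mor_dd3[OF x] Mor_dd3[OF y] by (intro W_add W_minus dP_etm dP_etp) simp_all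
  also have "\<dots> = (- fn (smul (- (Q^2)) (dd Ip x)) + fn (dd Im y)) * dvol q" by (simp add: distrib_right left_diff_distrib)
  also have "W \<dots> ((fn (- smul (- (Q^2)) (dd Ip x)) + fn (dd Im y)) * dvol q)"
    by (intro W_mult W_add W_refl W_sym[OF fn_minus])
  also have "W \<dots> (fn (- smul (- (Q^2)) (dd Ip x) + dd Im y) * dvol q)"
    by (intro W_mult W_refl W_sym[OF fn_add])
  finally have w: "W (dP q (- (fn x * \<eta>m q) + fn y * \<eta>p)) (fn ?b * dvol q)" by (simp add: smul_minus)
  show "top_form (dP q (- (fn x * \<eta>m q) + fn y * \<eta>p))" using w b unfolding top_form_def by blast
  show "E (D2 (dP q (- (fn x * \<eta>m q) + fn y * \<eta>p))) ?b" using W_D2[OF w] by simp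
qed

text \<open>The operator \<open>on_form\<close> is applied to each formal pair separately and
  \<open>starR_inv\<close> is not known to be additive. So every key, and not just the total, has to
  carry a top form.\<close>

definition TopRep :: "int \<Rightarrow> etens set" where
  "TopRep n = {w. \<forall>(a, \<nu>)\<in>Poly_Mapping.keys w. a \<in> Mor q n \<and> top_form \<nu>}"

lemma TopRep_csub: "csub (TopRep n)"
  by (auto simp: csub_def TopRep_def dest!: subsetD[OF Poly_Mapping.keys_add] subsetD[OF keys_smul_subset])

lemma TopRep_pt: "a \<in> Mor q n \<Longrightarrow> top_form \<nu> \<Longrightarrow> pt (a, \<nu>) \<in> TopRep n"
  by (simp add: TopRep_def)

lemma on_form_starR_inv:
  assumes w: "w \<in> TopRep n"
  shows "on_form (starR_inv q 2) w \<in> ERep q n 0" "E (D0 (\<Upsilon> (on_form (starR_inv q 2) w))) (D2 (\<Upsilon> w))"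
proof -
  have k: "a \<in> Mor q n \<and> starR_inv q 2 \<nu> \<in> BaseForms q 0 \<and> E (D0 (starR_inv q 2 \<nu>)) (D2 \<nu>)"
    if "(a, \<nu>) \<in> Poly_Mapping.keys w" for a \<nu>
  proof -
    have "a \<in> Mor q n" "top_form \<nu>" using that w by (auto simp: TopRep_def)
    then show ?thesis using starR_inv_2 unfolding top_form_def by blast
  qed
  show "on_form (starR_inv q 2) w \<in> ERep q n 0"
    unfolding on_form_def by (rule csub_lin[OF ERep_csub]) (auto dest!: k intro: ERep_pt)
  have "D0 (\<Upsilon> (on_form (starR_inv q 2) w)) = lin (\<lambda>k. D0 (\<Upsilon> (case k of (a, \<nu>) \<Rightarrow> pt (a, starR_inv q 2 \<nu>)))) w"
    unfolding on_form_def by (rule clin_lin_comm[OF clin_comp[OF clin_D0 clin_Upsilon]])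
  also have "E \<dots> (lin (\<lambda>k. D2 (\<Upsilon> (pt k))) w)"
  proof (rule md_lin[OF PI_csub], clarify)
    fix a \<nu> assume "(a, \<nu>) \<in> Poly_Mapping.keys w"
    from k[OF this] show "E (D0 (\<Upsilon> (pt (a, starR_inv q 2 \<nu>)))) (D2 (\<Upsilon> (pt (a, \<nu>))))"
      by (simp add: D2_mult E_mult)
  qed
  also have "\<dots> = D2 (\<Upsilon> w)"
    by (rule clin_lin_pt[of "\<lambda>w. D2 (\<Upsilon> w)", OF clin_comp[OF clin_D2 clin_Upsilon], symmetric])
  finally show "E (D0 (\<Upsilon> (on_form (starR_inv q 2) w))) (D2 (\<Upsilon> w))" .
qed

text \<open>The factors combine those of \<open>starR_1\<close> with the constants Q^2 and 1 of
  \<open>dP_starR\<close>; the minus sign is that of the adjoint differential in degree 1.\<close>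

definition Lap :: "gen free \<Rightarrow> gen free" where
  "Lap p = smul (- (Q^4)) (dd Ip (dd Im p)) + smul (- (1 / Q^2)) (dd Im (dd Ip p))"

lemma clin_on_form: "clin (on_form f)"
  by (simp add: on_form_def)

lemma Upsilon_on_form_mult: "\<Upsilon> (on_form (\<lambda>\<nu>. \<nu> * m) u) = \<Upsilon> u * m"
  by (rule clin_eqI[of "\<lambda>u. \<Upsilon> (on_form (\<lambda>\<nu>. \<nu> * m) u)" "\<lambda>u. \<Upsilon> u * m", OF clin_comp[OF clin_Upsilon clin_on_form]])
    (auto intro: clin_mult_right simp: on_form_def mult.assoc)

text \<open>The result depends on the pair only through the product a \<mu>. This allows the sum
  over the formal pairs to be evaluated after \<open>\<Upsilon>\<close>, without knowing the tensor
  chosen by \<open>nabla\<close>.\<close>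

lemma d_nabla_term:
  assumes a: "a \<in> Mor q n" and \<mu>: "\<mu> \<in> BaseForms q 1"
  defines "g \<equiv> on_form (\<lambda>\<nu>. \<nu> * starR q 1 \<mu>) (nabla q n a) + pt (a, dP q (starR q 1 \<mu>))"
  shows "g \<in> TopRep n"
    "E (D2 (\<Upsilon> g)) (smul (Q^4) (dd Ip (DD Im (fn a * \<mu>))) + smul (1 / Q^2) (dd Im (DD Ip (fn a * \<mu>))))"
proof -
  obtain x y where r: "starR q 1 \<mu> = - (fn x * \<eta>m q) + fn y * \<eta>p"
    and x: "E x (smul (Q^2) (DD Im \<mu>))" and y: "E y (smul (1 / Q^2) (DD Ip \<mu>))"
    using starR_1[OF \<mu>] .
  note b = base1_D[OF \<mu>]
  have xM: "x \<in> Mor q 2" and yM: "y \<in> Mor q (- 2)"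
    using Mor_E[OF csub_smul[OF Mor_csub b(2)] x] Mor_E[OF csub_smul[OF Mor_csub b(3)] y] by auto
  have "on_form (\<lambda>\<nu>. \<nu> * starR q 1 \<mu>) (nabla q n a) \<in> TopRep n"
    unfolding on_form_def
  proof (rule csub_lin[OF TopRep_csub], clarify)
    fix c \<nu> assume "(c, \<nu>) \<in> Poly_Mapping.keys (nabla q n a)"
    then have c: "c \<in> Mor q n" and \<nu>: "\<nu> \<in> BaseForms q 1"
      using nabla_spec(1)[OF a] by (auto simp: ERep_def)
    note d = base1_D[OF \<nu>]
    show "pt (c, \<nu> * starR q 1 \<mu>) \<in> TopRep n"
      unfolding r by (rule TopRep_pt[OF c top_form_mult[OF homog1_base[OF d(1,4)] d(2,3) xM yM]])
  qed
  moreover have "pt (a, dP q (starR q 1 \<mu>)) \<in> TopRep n"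
    unfolding r by (rule TopRep_pt[OF a dP_starR(1)[OF xM yM]])
  ultimately show "g \<in> TopRep n" unfolding g_def by (rule csub_add[OF TopRep_csub])
  have dp: "E (D2 (dP q (starR q 1 \<mu>))) (smul (Q^2) (dd Ip x) + dd Im y)"
    unfolding r by (rule dP_starR(2)[OF xM yM])
  have "D2 (\<Upsilon> g) = D2 (\<Upsilon> (nabla q n a) * starR q 1 \<mu>) + a * D2 (dP q (starR q 1 \<mu>))"
    unfolding g_def Upsilon_lin Upsilon_on_form_mult Upsilon_pt D2_lin by (simp add: D2_mult[of "fn a"])
  also have "E \<dots> (D2 ((fn (dd Im a) * \<eta>m q + fn (dd Ip a) * \<eta>p) * starR q 1 \<mu>) + a * (smul (Q^2) (dd Ip x) + dd Im y))"
    by (intro E_add W_D2 W_mult W_refl E_mult E_refl nabla_spec(2)[OF a] dp)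
  \<comment> \<open>The product with the covariant derivative of a and the differential of the Hodge
    image are the two halves of the twisted Leibniz rule.\<close>
  also have "\<dots> = smul (Q^2) (dd Ip (a * x)) + dd Im (a * y)"
    unfolding r by (simp add: D2_mult DD_mult dd_mult smul_add algebra_simps)
  also have "E \<dots> (smul (Q^2) (dd Ip (a * smul (Q^2) (DD Im \<mu>))) + dd Im (a * smul (1 / Q^2) (DD Ip \<mu>)))"
    by (intro E_add E_smul E_dd E_mult E_refl x y)
  also have "\<dots> = smul (Q^4) (dd Ip (DD Im (fn a * \<mu>))) + smul (1 / Q^2) (dd Im (DD Ip (fn a * \<mu>)))"
    by (simp add: DD_mult power4_eq_xxxx power2_eq_square mult.assoc)
  finally show "E (D2 (\<Upsilon> g)) (smul (Q^4) (dd Ip (DD Im (fn a * \<mu>))) + smul (1 / Q^2) (dd Im (DD Ip (fn a * \<mu>))))" .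
qed

lemma box_0:
  assumes p: "p \<in> Mor q n"
  shows "box q n 0 (pt (p, 1)) \<in> ERep q n 0" "E (D0 (\<Upsilon> (box q n 0 (pt (p, 1))))) (Lap p)"
proof -
  \<comment> \<open>The summand \<open>pt (p, 0)\<close> comes from the differential of 1. It is a
    nonzero formal generator and has to be carried along until \<open>\<Upsilon>\<close> kills
    it.\<close>
  let ?u = "nabla q n p + pt (p, 0)"
  let ?w = "d_nabla q n (on_form (starR q 1) ?u)"
  have "on_form (\<lambda>\<nu>. \<nu> * 1) u = u" for u :: etens
    by (rule clin_eqI[of "on_form (\<lambda>\<nu>. \<nu> * 1)" "\<lambda>u. u", OF clin_on_form clin_id]) (auto simp: on_form_def)
  then have dn: "d_nabla q n (pt (p, 1)) = ?u" by (simp add: d_nabla_def)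
  have z: "d_nabla q n 0 = 0" by (simp add: d_nabla_def)
  have box: "box q n 0 (pt (p, 1)) = smul (- 1) (on_form (starR_inv q 2) ?w)"
    by (simp add: box_def dn z del: smul_single)
  have u: "?u \<in> ERep q n 1"
    by (intro csub_add[OF ERep_csub] nabla_spec p ERep_pt zero_base1)
  let ?g = "\<lambda>k. case k of (a, \<mu>) \<Rightarrow> on_form (\<lambda>\<nu>. \<nu> * starR q 1 \<mu>) (nabla q n a) + pt (a, dP q (starR q 1 \<mu>))"
  have w: "?w = lin ?g ?u"
    unfolding on_form_def d_nabla_def by (subst clin_lin_comm[OF clin_lin]) (rule lin_cong, auto)
  have uk: "a \<in> Mor q n" "\<mu> \<in> BaseForms q 1" if "(a, \<mu>) \<in> Poly_Mapping.keys ?u" for a \<mu>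
    using u that by (auto simp: ERep_def)
  have wt: "?w \<in> TopRep n"
    unfolding w
  proof (rule csub_lin[OF TopRep_csub])
    fix k assume k: "k \<in> Poly_Mapping.keys ?u"
    obtain a \<mu> where a: "k = (a, \<mu>)" by (cases k)
    show "?g k \<in> TopRep n"
      using d_nabla_term(1)[OF uk[OF k[unfolded a]]] by (simp only: a case_prod_conv)
  qed
  note s = on_form_starR_inv[OF wt]
  show "box q n 0 (pt (p, 1)) \<in> ERep q n 0"
    unfolding box by (intro csub_smul[OF ERep_csub] s)
  let ?F = "\<lambda>x. smul (Q^4) (dd Ip (DD Im x)) + smul (1 / Q^2) (dd Im (DD Ip x))"
  have "D2 (\<Upsilon> ?w) = lin (\<lambda>k. D2 (\<Upsilon> (?g k))) ?u"
    unfolding w by (rule clin_lin_comm[OF clin_comp[OF clin_D2 clin_Upsilon]])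
  also have "E \<dots> (lin (\<lambda>k. ?F (\<Upsilon> (pt k))) ?u)"
  proof (rule md_lin[OF PI_csub])
    fix k assume k: "k \<in> Poly_Mapping.keys ?u"
    obtain a \<mu> where [simp]: "k = (a, \<mu>)" by (cases k)
    show "E (D2 (\<Upsilon> (?g k))) (?F (\<Upsilon> (pt k)))"
      using d_nabla_term(2)[OF uk[of a \<mu>]] k by simp
  qed
  also have "\<dots> = ?F (\<Upsilon> ?u)"
    by (rule clin_lin_pt[of "\<lambda>u. ?F (\<Upsilon> u)", symmetric]) (simp add: clin_def Upsilon_lin smul_add mult.commute add_ac)
  also have "E \<dots> (?F (fn (dd Im p) * \<eta>m q + fn (dd Ip p) * \<eta>p))"
    using nabla_spec(2)[OF p] by (intro E_add E_smul E_dd W_DD) (simp_all add: Upsilon_lin)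
  also have "\<dots> = - Lap p" by (simp add: DD_mult Lap_def smul_minus)
  finally have "E (D0 (\<Upsilon> (on_form (starR_inv q 2) ?w))) (- Lap p)" by (rule E_trans[OF s(2)])
  from E_smul[OF this, of "- 1"] show "E (D0 (\<Upsilon> (box q n 0 (pt (p, 1))))) (Lap p)"
    unfolding box Upsilon_lin by (simp add: smul_minus)
qed

lemma Enull_csub: "csub (Enull q n k)"
  unfolding Enull_def Let_def by (rule csub_span)

lemma Enull_gens:
  assumes "a \<in> Mor q n" "\<mu> \<in> BaseForms q k"
  shows "a' \<in> Mor q n \<Longrightarrow> pt (a + a', \<mu>) - pt (a, \<mu>) - pt (a', \<mu>) \<in> Enull q n k"
    "\<mu>' \<in> BaseForms q k \<Longrightarrow> pt (a, \<mu> + \<mu>') - pt (a, \<mu>) - pt (a, \<mu>') \<in> Enull q n k"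
    "pt (smul c a, \<mu>) - smul c (pt (a, \<mu>)) \<in> Enull q n k"
    "b \<in> Hyp q \<Longrightarrow> pt (a * b, \<mu>) - pt (a, fn b * \<mu>) \<in> Enull q n k"
    "a \<in> PI q \<or> \<mu> \<in> \<Omega>null q \<Longrightarrow> pt (a, \<mu>) \<in> Enull q n k"
  unfolding Enull_def Let_def by (rule smul.span_base; use assms in blast)+

text \<open>This direction gives uniqueness of the value of the Laplacian modulo
  \<open>PI q\<close>; \<open>Enull_reduce\<close> gives existence.\<close>

lemma Upsilon_Enull: "x \<in> Enull q n k \<Longrightarrow> \<Upsilon> x \<in> \<Omega>null q"
proof -
  have S: "csub {x. \<Upsilon> x \<in> \<Omega>null q}" by (rule csub_vimage[OF clin_Upsilon env_csub])
  note csub = env_csub[of "calcP q"] and ideal = env_cideal[of "calcP q"]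
  have 1: "fn (a + a') * \<mu> - fn a * \<mu> - fn a' * \<mu> \<in> \<Omega>null q" for a a' \<mu>
    using W_mult[OF fn_add[of "calcP q" a a'] W_refl[of \<mu>]] by (simp add: md_def algebra_simps)
  have 2: "fn (smul c a) * \<mu> - smul c (fn a * \<mu>) \<in> \<Omega>null q" for a c \<mu>
    using W_mult[OF fn_smul[of "calcP q" c a] W_refl[of \<mu>]] by (simp add: md_def)
  have 3: "fn (a * b) * \<mu> - fn a * (fn b * \<mu>) \<in> \<Omega>null q" for a b \<mu>
    using W_mult[OF fn_mult[of "calcP q" a b] W_refl[of \<mu>]] by (simp add: md_def mult.assoc)
  have 4: "fn a * \<mu> \<in> \<Omega>null q" if "a \<in> PI q \<or> \<mu> \<in> \<Omega>null q" for a \<mu>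
    using that cideal_left[OF ideal] cideal_right[OF ideal] fn_Rel[of a "calcP q"] by auto
  show "x \<in> Enull q n k \<Longrightarrow> \<Upsilon> x \<in> \<Omega>null q"
    unfolding Enull_def Let_def
    by (drule span_into[OF S, rotated]) (auto simp: Upsilon_lin 1 2 3 4 distrib_left csub_zero[OF csub] simp del: smul_single)
qed

text \<open>In degree 0 each base form is a function up to null forms, so balancing moves it to the
  left factor and only 1 remains on the right.\<close>

lemma Enull_reduce:
  assumes z: "z \<in> ERep q n 0"
  shows "D0 (\<Upsilon> z) \<in> Mor q n" "z - pt (D0 (\<Upsilon> z), 1) \<in> Enull q n 0"
proof -
  let ?N = "md (Enull q n 0)"
  note tr = md_trans[OF Enull_csub[of n 0]]
  have k: "a \<in> Mor q n" "\<mu> \<in> BaseForms q 0" if "(a, \<mu>) \<in> Poly_Mapping.keys z" for a \<mu>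
    using z that by (auto simp: ERep_def)
  let ?f = "\<lambda>(a, \<mu>). a * D0 \<mu>"
  have one: "?N (pt (a, \<mu>)) (pt (a * D0 \<mu>, 1))" if a: "a \<in> Mor q n" and \<mu>: "\<mu> \<in> BaseForms q 0" for a \<mu>
  proof -
    note b = base0_D[OF \<mu>]
    have m: "\<mu> - fn (D0 \<mu>) \<in> BaseForms q 0" by (intro csub_diff[OF base_csub] \<mu> base0_fn b)
    have "?N (pt (a, \<mu>)) (pt (a, fn (D0 \<mu>)) + pt (a, \<mu> - fn (D0 \<mu>)))"
      using Enull_gens(2)[OF a base0_fn[OF b(2)] m] by (simp add: md_def diff_diff_add)
    moreover have "?N (pt (a, fn (D0 \<mu>)) + pt (a, \<mu> - fn (D0 \<mu>))) (pt (a, fn (D0 \<mu>)) + 0)"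
      using Enull_gens(5)[OF a m] b(1) by (intro md_add[OF Enull_csub] md_refl[OF Enull_csub]) (simp add: md_def)
    moreover have "?N (pt (a, fn (D0 \<mu>) * 1)) (pt (a * D0 \<mu>, 1))"
      by (rule md_sym[OF Enull_csub]) (use Enull_gens(4)[OF a one_base0 b(2)] in \<open>simp add: md_def\<close>)
    ultimately show ?thesis using tr by (metis add.right_neutral mult_1_right)
  qed
  have f: "?f j \<in> Mor q n" if "j \<in> Poly_Mapping.keys z" for j
    using that k base0_D(2) Mor_mult[of _ n _ 0] by (cases j) auto
  have D: "D0 (\<Upsilon> z) = lin ?f z"
    using clin_lin_pt[OF clin_comp[OF clin_D0 clin_Upsilon], of z] by (simp add: split_def) (metis (no_types, lifting) D0_simps(1,2) Upsilon_pt lin_cong prod.collapse)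
  show "D0 (\<Upsilon> z) \<in> Mor q n" unfolding D by (rule csub_lin[OF Mor_csub f])
  \<comment> \<open>The relations are binary and \<open>pt\<close> is not additive in its entries.
    Hence the keys are absorbed one by one, with arbitrary coefficients to keep the induction
    going.\<close>
  have sums: "(\<Sum>j\<in>A. smul (c j) (?f j)) \<in> Mor q n \<and> ?N (\<Sum>j\<in>A. smul (c j) (pt (?f j, 1))) (pt (\<Sum>j\<in>A. smul (c j) (?f j), 1))"
    if "finite A" "A \<subseteq> Poly_Mapping.keys z" for A c
    using that
  proof (induction A rule: finite_induct)
    case empty
    have "pt (0, 1) \<in> Enull q n 0"
      using Enull_gens(5)[OF csub_zero[OF Mor_csub] one_base0] csub_zero[OF PI_csub] by simp
    from csub_minus[OF Enull_csub this] show ?case using csub_zero[OF Mor_csub] by (simp add: md_def)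
  next
    case (insert j A)
    let ?x = "smul (c j) (?f j)" and ?S = "\<Sum>j\<in>A. smul (c j) (?f j)"
    have j: "?f j \<in> Mor q n" using insert f by simp
    have x: "?x \<in> Mor q n" by (rule csub_smul[OF Mor_csub j])
    have IH: "?S \<in> Mor q n" "?N (\<Sum>j\<in>A. smul (c j) (pt (?f j, 1))) (pt (?S, 1))" using insert by auto
    have "?N (smul (c j) (pt (?f j, 1))) (pt (?x, 1))"
      by (rule md_sym[OF Enull_csub]) (use Enull_gens(3)[OF j one_base0] in \<open>simp add: md_def del: smul_single\<close>)
    from md_add[OF Enull_csub this IH(2)]
    have 1: "?N (smul (c j) (pt (?f j, 1)) + (\<Sum>j\<in>A. smul (c j) (pt (?f j, 1)))) (pt (?x, 1) + pt (?S, 1))" .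
    have 2: "?N (pt (?x, 1) + pt (?S, 1)) (pt (?x + ?S, 1))"
      by (rule md_sym[OF Enull_csub]) (use Enull_gens(1)[OF x one_base0 IH(1)] in \<open>simp add: md_def algebra_simps\<close>)
    show ?case
      unfolding sum.insert[OF insert(1,2)] by (rule conjI[OF csub_add[OF Mor_csub x IH(1)] tr[OF 1 2]])
  qed
  have "?N z (lin (\<lambda>j. pt (?f j, 1)) z)"
  proof -
    have "?N (lin pt z) (lin (\<lambda>j. pt (?f j, 1)) z)"
      by (rule md_lin[OF Enull_csub]) (use one k in auto)
    then show ?thesis by (simp add: lin_id)
  qed
  also have "?N \<dots> (pt (D0 (\<Upsilon> z), 1))"
    unfolding D unfolding lin_def using sums[OF finite_keys order_refl] by blast
  finally (tr) show "z - pt (D0 (\<Upsilon> z), 1) \<in> Enull q n 0" by (simp add: md_def)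
qed

text \<open>Existence of the representative makes the choice meaningful. Applying
  \<open>\<Upsilon>\<close> and \<open>D0\<close> then identifies whatever was chosen.\<close>

lemma laplacian_Lap:
  assumes p: "p \<in> Mor q n"
  shows "laplacian q n p \<in> Mor q n" "E (laplacian q n p) (Lap p)"
proof -
  let ?b = "box q n 0 (pt (p, 1))"
  let ?P = "\<lambda>p'. p' \<in> Mor q n \<and> ?b - pt (p', 1) \<in> Enull q n 0"
  have "?P (D0 (\<Upsilon> ?b))" using Enull_reduce[OF box_0(1)[OF p]] by simp
  then have P: "?P (laplacian q n p)" unfolding laplacian_def by (rule someI)
  then show "laplacian q n p \<in> Mor q n" by simp
  have "W (\<Upsilon> ?b) (\<Upsilon> (pt (laplacian q n p, 1)))"
    using Upsilon_Enull[OF conjunct2[OF P]] by (simp only: Upsilon_lin md_def)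
  from W_D0[OF this] have "E (D0 (\<Upsilon> ?b)) (laplacian q n p)" by simp
  then show "E (laplacian q n p) (Lap p)" using E_trans[OF E_sym box_0(2)[OF p]] by blast
qed

section \<open>The Laplacian on the monomial basis\<close>

lemma zf_nat: "zf (int k) = 1 / Q ^ k" "zf (- int k) = Q ^ k"
  by (simp_all add: zf_def power_int_minus divide_inverse)

text \<open>The derivations in normal form. The first term comes from differentiating the power of
  \<open>\<gamma>\<close> or \<open>\<gamma>s\<close>. The second one occurs when \<open>t\<close>
  has the sign for which the power of \<open>\<alpha>\<close> or \<open>\<alpha>s\<close>
  contributes or reordering leaves a remainder. Truncated subtraction is harmless, since the
  coefficient vanishes at k = 0 or l = 0. The value at \<open>I3\<close> is a dummy.\<close>

fun dVb :: "ix \<Rightarrow> int \<times> nat \<times> nat \<Rightarrow> (int \<times> nat \<times> nat \<Rightarrow>\<^sub>0 complex)" where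
  "dVb Ip (t, k, l) = Poly_Mapping.single (t - 1, k - 1, l) (Q * Q ^ l / Q ^ k * (((Q ^ k)^2 - 1) / (Q^2 - 1)))
     + (if t > 0 then Poly_Mapping.single (t - 1, k, l + 1) (Q^3 * Q ^ l / Q ^ k * (((Q ^ k)^2 - zf t ^ 2) / (Q^2 - 1))) else 0)"
| "dVb Im (t, k, l) = Poly_Mapping.single (t + 1, k, l - 1) (1 / (Q ^ l * Q ^ k) * (((Q ^ l)^2 - 1) / (Q^2 - 1)))
     + (if t < 0 then Poly_Mapping.single (t + 1, k + 1, l) (1 / (Q ^ l * Q ^ k) * (((Q ^ l)^2 * zf t ^ 2 - 1) / (Q^2 - 1))) else 0)"
| "dVb I3 (t, k, l) = 0"

definition dV :: "ix \<Rightarrow> (int \<times> nat \<times> nat \<Rightarrow>\<^sub>0 complex) \<Rightarrow> (int \<times> nat \<times> nat \<Rightarrow>\<^sub>0 complex)" where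
  "dV i = lin (dVb i)"

lemma clin_dV [simp, intro]: "clin (dV i)"
  by (simp add: dV_def)

lemmas dV_lin [simp] = clin_add[OF clin_dV] clin_diff[OF clin_dV] clin_smul[OF clin_dV] clin_zero[OF clin_dV]

lemma dV_pt [simp]: "dV i (pt j) = dVb i j" and dV_single [simp]: "dV i (Poly_Mapping.single j c) = smul c (dVb i j)"
  by (simp_all add: dV_def lin_single)

lemma zf_vdg: "zf (vdg (t, k, l)) = zf t * Q ^ l / Q ^ k"
  using zf_add[of t "int k - int l"] zf_add[of "int k" "- int l"] zf_nat(1)[of k] zf_nat(2)[of l]
  by (simp add: vdg_def algebra_simps)

text \<open>The guessed matrices satisfy the Leibniz rule with respect to left multiplication by
  letters, which together with the value at 1 characterizes the derivation.\<close>

lemma dV_ag: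
  assumes "i \<noteq> I3"
  shows "dV i (ag a v) = ag a (dV i v) + act (dl i a) (vsg 1 v)"
proof (rule clin_eqI[of "\<lambda>v. dV i (ag a v)" "\<lambda>v. ag a (dV i v) + act (dl i a) (vsg 1 v)"])
  fix j :: "int \<times> nat \<times> nat"
  obtain t k l where j: "j = (t, k, l)" by (cases j)
  \<comment> \<open>A letter shifts \<open>t\<close> by at most one and the formulas switch at 0, so
    the values -1, 0 and 1 need separate treatment.\<close>
  consider "t < -1" | "t = -1" | "t = 0" | "t = 1" | "t > 1" by linarith
  then show "dV i (ag a (pt j)) = ag a (dV i (pt j)) + act (dl i a) (vsg 1 (pt j))"
    using assms
    by cases
      (rule poly_mapping_eqI, cases i; cases a; cases k; cases l;
        simp add: j zf_vdg lookup_add lookup_single when_def smul_add;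
        (simp add: divide_simps)?; (simp add: algebra_simps eval_nat_numeral)?)+
qed (simp_all add: clin_def act_lin_right clin_add[OF clin_vsg] clin_smul[OF clin_vsg] smul_add add_ac)

lemma nf_dd: "i \<noteq> I3 \<Longrightarrow> nf (dd i x) = dV i (nf x)"
proof (induction x rule: free_induct)
  case one
  then show ?case by (cases i) simp_all
next
  case (var a x)
  have "mw i = 1" using var by (cases i) auto
  moreover have "nf (y * z) = act y (nf z)" for y z by (simp add: nf_def)
  ultimately show ?case using var by (simp add: dd_mult nf_sg dV_ag)
qed simp_all

lemma act_power: "act (x ^ m) v = (act x ^^ m) v"
  by (induction m arbitrary: v) simp_all

text \<open>Linear independence of the monomials: they are sent to distinct basis symbols.\<close>

lemma nf_Mf [simp]: "nf (Mf j) = pt j"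
proof -
  obtain t k l where j: "j = (t, k, l)" by (cases j)
  have 1: "(act \<gamma>s ^^ m) (pt (0, 0, 0)) = pt (0, 0, m)" for m by (induction m) simp_all
  have 2: "(act \<gamma> ^^ m) (pt (0, 0, l)) = pt (0, m, l)" for m by (induction m) simp_all
  have 3: "(act \<alpha> ^^ m) (pt (0, k, l)) = pt (int m, k, l)" for m by (induction m) (simp_all add: add.commute)
  have 4: "(act \<alpha>s ^^ m) (pt (0, k, l)) = pt (- int m, k, l)" for m
  proof (induction m)
    case (Suc m)
    have 1: "- int (Suc m) = - int m - 1" by simp
    show ?case unfolding 1 using Suc by simp
  qed simp
  show ?thesis
    unfolding j Mf_Apow nf_def act_mult act_power 1 2 by (simp add: Apow_def act_power 3 4)
qed

definition LV :: "(int \<times> nat \<times> nat \<Rightarrow>\<^sub>0 complex) \<Rightarrow> (int \<times> nat \<times> nat \<Rightarrow>\<^sub>0 complex)" where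
  "LV v = smul (- (Q^4)) (dV Ip (dV Im v)) + smul (- (1 / Q^2)) (dV Im (dV Ip v))"

lemma nf_Lap: "nf (Lap p) = LV (nf p)"
  by (simp add: Lap_def LV_def nf_dd)

lemma clin_LV: "clin LV"
  by (simp add: clin_def LV_def smul_add smul_diff smul_minus mult.commute add_ac)

lemma qbr_c: "complex_of_real (qbr q m) = (Q ^ (2 * m) - 1) / (Q^2 - 1)"
  by (simp add: qbr_def)

lemma Q_powi: "Q powi (- (2 * int k)) = 1 / (Q ^ k)^2" "Q powi (4 - 2 * int k) = Q^4 / (Q ^ k)^2"
proof -
  have 1: "Q powi (2 * int k) = (Q ^ k)^2"
    using power_int_of_nat[of Q "2 * k"] by (simp add: power_mult power2_eq_square flip: power_mult_distrib)
  show "Q powi (- (2 * int k)) = 1 / (Q ^ k)^2" by (simp add: power_int_minus 1 divide_inverse)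
  show "Q powi (4 - 2 * int k) = Q^4 / (Q ^ k)^2" by (simp add: power_int_diff 1)
qed

lemma Q_double: "Q ^ (2 * k) = (Q ^ k)^2"
  by (simp add: power_mult[symmetric] mult.commute)

lemma chat_c: "complex_of_real (chat q t k l) =
    - (1 / (Q ^ k)^2) * (1 + Q^4) * (((Q ^ k)^2 - 1) / (Q^2 - 1)) * (((Q ^ l)^2 - 1) / (Q^2 - 1))"
  by (simp add: chat_def qbr_c Q_powi Q_double)

lemma ehat_c0: "complex_of_real (ehat q 0 k l) =
    - (1 / (Q ^ k)^2 * (1 + Q^2 * (((Q ^ l)^2 - 1) / (Q^2 - 1))) * (((Q ^ k)^2 - 1) / (Q^2 - 1))
      + Q^4 * (1 + 1 / (Q ^ k)^2 * (((Q ^ k)^2 - 1) / (Q^2 - 1))) * (((Q ^ l)^2 - 1) / (Q^2 - 1)))"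
  by (simp add: ehat_def qbr_c Q_powi Q_double)

text \<open>Powers of q with exponent \<open>t\<close> are expressed by \<open>zf t\<close>, so that
  the comparison in \<open>LV_pt\<close> becomes an identity of rational functions in Q, its powers
  and \<open>zf t\<close>.\<close>

lemma ehat_c1:
  assumes "t \<ge> 1"
  shows "complex_of_real (ehat q t k l) =
    - (zf t ^ 2) * ((1 / zf t ^ 2 - 1) / (Q^2 - 1) * ((Q^2 * (Q ^ l)^2 - 1) / (Q^2 - 1))
      + 1 / (Q ^ k)^2 * (((Q ^ k)^2 - 1) / (Q^2 - 1)) * ((Q^2 * (Q ^ l)^2 - 1) / (Q^2 - 1))
      + Q^4 * (((Q ^ l)^2 - 1) / (Q^2 - 1)) * ((Q^2 / zf t ^ 2 - 1) / (Q^2 - 1))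
      + Q^4 / (Q ^ k)^2 * (((Q ^ l)^2 - 1) / (Q^2 - 1)) * (((Q ^ k)^2 - 1) / (Q^2 - 1)))"
proof -
  obtain m where m: "t = int m" using assms zero_le_imp_eq_int[of t] by auto
  have z: "zf t = 1 / Q ^ m" unfolding m by (rule zf_nat)
  have e: "ehat q t k l = - (q powi (- (2 * int m))) *
         (qbr q m * qbr q (Suc l) + q powi (- (2 * int k)) * qbr q k * qbr q (Suc l)
          + q^4 * qbr q l * qbr q (Suc m) + q powi (4 - 2 * int k) * qbr q l * qbr q k)"
    using assms unfolding ehat_def by (simp add: m)
  have s: "(Q ^ Suc j)^2 = Q^2 * (Q ^ j)^2" for j
    by (simp add: power_mult_distrib)
  have y: "(1 / Q ^ m)^2 = 1 / (Q ^ m)^2" "1 / (1 / (Q ^ m)^2) = (Q ^ m)^2" "Q^2 / (1 / (Q ^ m)^2) = Q^2 * (Q ^ m)^2"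
    by (simp_all add: power_divide)
  have c: "complex_of_real (q powi (- (2 * int k))) = 1 / (Q ^ k)^2" "complex_of_real (q powi (4 - 2 * int k)) = Q^4 / (Q ^ k)^2" for k
    by (simp_all add: Q_powi)
  show ?thesis
    unfolding e z of_real_mult of_real_add of_real_minus c qbr_c Q_double of_real_power y s ..
qed

lemma ehat_c2:
  assumes "t < 0"
  shows "complex_of_real (ehat q t k l) =
    - (1 / (Q ^ k)^2) * (((Q ^ k)^2 - 1) / (Q^2 - 1) * ((Q^2 * zf t ^ 2 - 1) / (Q^2 - 1))
      + Q^2 * zf t ^ 2 * (((Q ^ k)^2 - 1) / (Q^2 - 1)) * (((Q ^ l)^2 - 1) / (Q^2 - 1))
      + Q^4 * ((zf t ^ 2 - 1) / (Q^2 - 1)) * ((Q^2 * (Q ^ k)^2 - 1) / (Q^2 - 1))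
      + Q^4 * zf t ^ 2 * (((Q ^ l)^2 - 1) / (Q^2 - 1)) * ((Q^2 * (Q ^ k)^2 - 1) / (Q^2 - 1)))"
proof -
  obtain m where m: "t = - int m" using assms by (metis minus_minus nat_0_le neg_0_le_iff_le order_less_imp_le)
  have z: "zf t = Q ^ m" unfolding m by (rule zf_nat)
  show ?thesis using assms
    by (simp add: ehat_def qbr_c Q_powi Let_def z) (simp add: m power_divide Q_double power_add power_mult_distrib power2_eq_square[of Q] mult.assoc)
qed

text \<open>The composites first raise and then lower \<open>t\<close>, or conversely, so
  \<open>t\<close> is unchanged and at most the symbol with k and l lowered by one appears besides
  the diagonal. The case split is that of \<open>dV_ag\<close>.\<close>

lemma LV_pt: "LV (pt (t, k, l)) = smul (of_real (ehat q t k l)) (pt (t, k, l)) +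
    (if k = 0 \<or> l = 0 then 0 else smul (of_real (chat q t k l)) (pt (t, k - 1, l - 1)))"
proof -
  consider "t < -1" | "t = -1" | "t = 0" | "t = 1" | "t > 1" by linarith
  then show ?thesis
    by cases
      (rule poly_mapping_eqI, cases k; cases l;
        simp add: LV_def lookup_add lookup_single when_def smul_add ehat_c0 ehat_c1 ehat_c2 chat_c;
        (simp add: divide_simps)?; (simp add: algebra_simps eval_nat_numeral)?)+
qed

section \<open>Eigenvalues and eigenvectors\<close>

subsection \<open>Growth of the eigenvalues\<close>

abbreviation rq :: real where "rq \<equiv> 1 / q^2"

lemma q2: "0 < q^2" "q^2 < 1" "rq > 1"
proof -
  show "0 < q^2" by simp
  have "\<bar>q\<bar> < 1" using q1 by auto
  then show "q^2 < 1" by (simp add: abs_square_less_1)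
  then show "rq > 1" by (simp add: field_simps)
qed

lemma qbr_Suc: "qbr q (Suc m) = qbr q m + (q^2)^m"
  using q2 by (simp add: qbr_def power_mult divide_simps) (simp add: algebra_simps power2_eq_square)

lemma qbr_0 [simp]: "qbr q 0 = 0"
  by (simp add: qbr_def)

lemma qbr_strict_mono: "m < m' \<Longrightarrow> qbr q m < qbr q m'"
  by (rule lift_Suc_mono_less[of "qbr q"]) (simp_all add: qbr_Suc)

lemma qbr_mono: "m \<le> m' \<Longrightarrow> qbr q m \<le> qbr q m'"
  using qbr_strict_mono[of m m'] by (cases "m = m'") auto

lemma qbr_nonneg [simp]: "qbr q m \<ge> 0"
  using qbr_mono[of 0 m] by simp

lemma qbr_ge_1: "m \<ge> 1 \<Longrightarrow> qbr q m \<ge> 1"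
  using qbr_mono[of 1 m] qbr_Suc[of 0] by simp

lemma rq_powi: "q powi (- (2 * int k)) = rq ^ k" "q powi (4 - 2 * int k) = q^4 * rq ^ k"
proof -
  have 1: "q powi (2 * int k) = (q^2) ^ k"
    using power_int_of_nat[of q "2 * k"] by (simp add: power_mult)
  show "q powi (- (2 * int k)) = rq ^ k" by (simp add: power_int_minus 1 power_divide divide_inverse power_inverse)
  show "q powi (4 - 2 * int k) = q^4 * rq ^ k" by (simp add: power_int_diff 1 power_divide)
qed

text \<open>The negatives of the eigenvalues as sums of products of nonnegative factors that are
  monotone in k and l. Monotonicity and growth are read off from this shape.\<close>

lemma neg_ehat:
  "- ehat q 0 k l = rq ^ k * qbr q k * (1 + q^2 * qbr q l) + q^4 * (qbr q l * (1 + rq ^ k * qbr q k))"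
  "- ehat q (int (Suc m)) k l = rq ^ Suc m * (qbr q (Suc m) * qbr q (Suc l) + rq ^ k * qbr q k * qbr q (Suc l)
      + q^4 * (qbr q l * qbr q (Suc (Suc m))) + q^4 * (qbr q l * (rq ^ k * qbr q k)))"
  "- ehat q (- int (Suc m)) k l = rq ^ k * qbr q k * qbr q (Suc (Suc m)) + q ^ (2 * m + 4) * (rq ^ k * qbr q k * qbr q l)
      + q^4 * (qbr q (Suc m) * (rq ^ k * qbr q (Suc k))) + q ^ (6 + 2 * m) * (rq ^ k * qbr q (Suc k) * qbr q l)"
proof -
  show "- ehat q 0 k l = rq ^ k * qbr q k * (1 + q^2 * qbr q l) + q^4 * (qbr q l * (1 + rq ^ k * qbr q k))"
    by (simp add: ehat_def rq_powi)
  have p: "q powi (- (2 * int (Suc m))) = rq ^ Suc m" by (rule rq_powi)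
  have n: "nat (int (Suc m)) = Suc m" by simp
  show "- ehat q (int (Suc m)) k l = rq ^ Suc m * (qbr q (Suc m) * qbr q (Suc l) + rq ^ k * qbr q k * qbr q (Suc l)
      + q^4 * (qbr q l * qbr q (Suc (Suc m))) + q^4 * (qbr q l * (rq ^ k * qbr q k)))"
    using p n unfolding ehat_def by (simp add: rq_powi del: of_nat_Suc power_Suc; (simp add: algebra_simps del: of_nat_Suc power_Suc)?)
  have n': "nat (- (- int (Suc m))) = Suc m" by simp
  show "- ehat q (- int (Suc m)) k l = rq ^ k * qbr q k * qbr q (Suc (Suc m)) + q ^ (2 * m + 4) * (rq ^ k * qbr q k * qbr q l)
      + q^4 * (qbr q (Suc m) * (rq ^ k * qbr q (Suc k))) + q ^ (6 + 2 * m) * (rq ^ k * qbr q (Suc k) * qbr q l)"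
  proof -
    have e: "4 + 2 * Suc m = 6 + 2 * m" "2 * Suc m + 2 = 2 * m + 4" by simp_all
    show ?thesis
      using n' unfolding ehat_def Let_def n' e by (simp add: rq_powi del: of_nat_Suc power_Suc; (simp add: algebra_simps del: of_nat_Suc power_Suc)?)
  qed
qed

lemma rq_pos [simp]: "rq ^ k > 0" "rq ^ k \<ge> 0"
  by simp_all

lemma even_pow_pos: "q ^ (2 * m + 4) > 0" "q ^ (6 + 2 * m) > 0" "q^4 > 0"
  by (simp_all add: zero_less_power_eq)

lemma rq_mono: "k \<le> k' \<Longrightarrow> rq ^ k \<le> rq ^ k'"
  using q2 by (intro power_increasing) auto

lemma rq_qbr_strict: "k < k' \<Longrightarrow> rq ^ k * qbr q k < rq ^ k' * qbr q k'"
proof -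
  assume "k < k'"
  then have "rq ^ k * qbr q k \<le> rq ^ k' * qbr q k" "rq ^ k' * qbr q k < rq ^ k' * qbr q k'"
    using rq_mono[of k k'] qbr_strict_mono[of k k'] by (auto intro!: mult_right_mono mult_strict_left_mono simp del: power_divide)
  then show ?thesis by linarith
qed

lemma int_cases3: obtains "t = 0" | m where "t = int (Suc m)" | m where "t = - int (Suc m)"
  by (metis int_cases not0_implies_Suc of_nat_0)

text \<open>Each summand is weakly monotone in k and l, and one is strict: for t positive it is the
  one with \<open>qbr q (Suc l)\<close>, otherwise the one with
  \<open>rq ^ k * qbr q k\<close>.\<close>

lemma ehat_strict:
  assumes k: "k < k'" and l: "l < l'"
  shows "ehat q t k' l' < ehat q t k l"
proof -
  have a: "rq ^ k * qbr q k < rq ^ k' * qbr q k'" by (rule rq_qbr_strict[OF k])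
  have b: "qbr q l < qbr q l'" "qbr q (Suc l) < qbr q (Suc l')" using l by (simp_all add: qbr_strict_mono)
  have c: "rq ^ k * qbr q (Suc k) \<le> rq ^ k' * qbr q (Suc k')"
    using rq_mono[of k k'] qbr_mono[of "Suc k" "Suc k'"] k by (intro mult_mono) auto
  have nn: "rq ^ k * qbr q k \<ge> 0" "rq ^ k * qbr q (Suc k) \<ge> 0" "rq ^ k' * qbr q k' \<ge> 0" "rq ^ k' * qbr q (Suc k') \<ge> 0"
    by (simp_all add: mult_nonneg_nonneg)
  have a': "rq ^ k * qbr q k \<le> rq ^ k' * qbr q k'" and b': "qbr q l \<le> qbr q l'" "qbr q (Suc l) \<le> qbr q (Suc l')"
    using a b by simp_all
  define A A' B B' C C' where "A = rq ^ k * qbr q k" and "A' = rq ^ k' * qbr q k'" and "B = qbr q l" and "B' = qbr q l'"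
    and "C = rq ^ k * qbr q (Suc k)" and "C' = rq ^ k' * qbr q (Suc k')"
  have ABC: "A < A'" "A \<le> A'" "B \<le> B'" "C \<le> C'" "0 \<le> A" "0 \<le> A'" "0 \<le> B" "0 \<le> B'" "0 \<le> C" "0 \<le> C'"
    using a a' b' c nn by (simp_all add: A_def A'_def B_def B'_def C_def C'_def)
  have "- ehat q t k l < - ehat q t k' l'"
  proof (cases t rule: int_cases3)
    case 1
    have "A * (1 + q^2 * B) < A' * (1 + q^2 * B')"
      using ABC by (intro mult_less_le_imp_less) (auto intro!: mult_left_mono add_pos_nonneg)
    moreover have "q^4 * (B * (1 + A)) \<le> q^4 * (B' * (1 + A'))"
      using ABC even_pow_pos(3) by (intro mult_left_mono mult_mono) auto
    ultimately show ?thesis unfolding 1 neg_ehat A_def[symmetric] A'_def[symmetric] B_def[symmetric] B'_def[symmetric] by linarith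
  next
    case (2 m)
    define D D' F G where "D = qbr q (Suc l)" and "D' = qbr q (Suc l')" and "F = qbr q (Suc m)" and "G = qbr q (Suc (Suc m))"
    have D: "D < D'" "0 \<le> D" "0 \<le> D'" "F \<ge> 1" "G \<ge> 0" using b qbr_ge_1[of "Suc m"] by (simp_all add: D_def D'_def F_def G_def)
    have "F * D < F * D'" using D by (intro mult_strict_left_mono) auto
    moreover have "A * D \<le> A' * D'" using D ABC by (intro mult_mono) auto
    moreover have "q^4 * (B * G) \<le> q^4 * (B' * G)"
      using ABC D even_pow_pos(3) by (intro mult_left_mono mult_right_mono) auto
    moreover have "q^4 * (B * A) \<le> q^4 * (B' * A')"
      using ABC even_pow_pos(3) by (intro mult_left_mono mult_mono) auto
    ultimately have "F * D + A * D + q^4 * (B * G) + q^4 * (B * A) < F * D' + A' * D' + q^4 * (B' * G) + q^4 * (B' * A')"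
      by linarith
    from mult_strict_left_mono[OF this rq_pos(1)[of "Suc m"]] show ?thesis
      unfolding 2 neg_ehat A_def[symmetric] A'_def[symmetric] B_def[symmetric] B'_def[symmetric] D_def[symmetric] D'_def[symmetric]
        F_def[symmetric] G_def[symmetric] .
  next
    case (3 m)
    define F G where "F = qbr q (Suc m)" and "G = qbr q (Suc (Suc m))"
    have D: "F \<ge> 0" "G \<ge> 1" using qbr_ge_1[of "Suc (Suc m)"] by (simp_all add: F_def G_def)
    have "A * G < A' * G" using D ABC by (intro mult_strict_right_mono) auto
    moreover have "q ^ (2 * m + 4) * (A * B) \<le> q ^ (2 * m + 4) * (A' * B')"
      using ABC even_pow_pos(1)[of m] by (intro mult_left_mono mult_mono) auto
    moreover have "q^4 * (F * C) \<le> q^4 * (F * C')"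
      using ABC D even_pow_pos(3) by (intro mult_left_mono) auto
    moreover have "q ^ (6 + 2 * m) * (C * B) \<le> q ^ (6 + 2 * m) * (C' * B')"
      using ABC even_pow_pos(2)[of m] by (intro mult_left_mono mult_mono) auto
    ultimately show ?thesis
      unfolding 3 neg_ehat A_def[symmetric] A'_def[symmetric] B_def[symmetric] B'_def[symmetric] C_def[symmetric] C'_def[symmetric]
        F_def[symmetric] G_def[symmetric] by linarith
  qed
  then show ?thesis by simp
qed

text \<open>Exponential lower bounds, as \<open>rq\<close> exceeds 1. They control k always and t
  when it is positive, which is enough on a set with t + k - l fixed.\<close>

lemma ehat_growth: "rq ^ k \<le> 1 - ehat q t k l" "t \<ge> 1 \<Longrightarrow> rq ^ nat t \<le> - ehat q t k l"
proof -
  \<comment> \<open>The added 1 covers k = 0, where the product vanishes but the power is 1.\<close>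
  have k1: "rq ^ k \<le> 1 + rq ^ k * qbr q k"
    using qbr_ge_1[of k] by (cases "k = 0") (auto intro!: add_increasing mult_le_cancel_left1[THEN iffD2])
  define A C where "A = rq ^ k * qbr q k" and "C = rq ^ k * qbr q (Suc k)"
  have A: "0 \<le> A" "0 \<le> C" by (simp_all add: A_def C_def mult_nonneg_nonneg)
  have B: "0 \<le> qbr q l" by simp
  note e = even_pow_pos
  have "A \<le> - ehat q t k l \<and> (t \<ge> 1 \<longrightarrow> rq ^ nat t \<le> - ehat q t k l)"
  proof (cases t rule: int_cases3)
    case 1
    have "A * 1 \<le> A * (1 + q^2 * qbr q l)" using A by (intro mult_left_mono) auto
    moreover have "0 \<le> q^4 * (qbr q l * (1 + A))" using A by (intro mult_nonneg_nonneg) auto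
    ultimately show ?thesis unfolding 1 neg_ehat A_def[symmetric] by simp
  next
    case (2 m)
    define F where "F = rq ^ Suc m"
    have F: "F \<ge> 1" unfolding F_def using q2 by (intro one_le_power) auto
    have g: "qbr q (Suc m) \<ge> 1" "qbr q (Suc l) \<ge> 1" by (simp_all add: qbr_ge_1)
    let ?X = "qbr q (Suc m) * qbr q (Suc l) + A * qbr q (Suc l) + q^4 * (qbr q l * qbr q (Suc (Suc m))) + q^4 * (qbr q l * A)"
    have p: "1 * 1 \<le> qbr q (Suc m) * qbr q (Suc l)" using g by (intro mult_mono) auto
    have r: "A * 1 \<le> A * qbr q (Suc l)" using g A by (intro mult_left_mono) auto
    have s: "0 \<le> q^4 * (qbr q l * qbr q (Suc (Suc m)))" "0 \<le> q^4 * (qbr q l * A)"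
      using A by (simp_all add: mult_nonneg_nonneg)
    have X: "1 + A \<le> ?X" using p r s by linarith
    have "F * 1 \<le> F * ?X" using F X A by (intro mult_left_mono) linarith+
    moreover have "1 * A \<le> F * ?X" using F X A by (intro mult_mono) linarith+
    moreover have "rq ^ nat t = F" unfolding 2 F_def nat_int ..
    ultimately show ?thesis unfolding 2 neg_ehat A_def[symmetric] F_def[symmetric] by simp
  next
    case (3 m)
    have g: "qbr q (Suc (Suc m)) \<ge> 1" by (simp add: qbr_ge_1)
    have r: "A * 1 \<le> A * qbr q (Suc (Suc m))" using g A by (intro mult_left_mono) auto
    have s: "0 \<le> q ^ (2 * m + 4) * (A * qbr q l)" "0 \<le> q^4 * (qbr q (Suc m) * C)" "0 \<le> q ^ (6 + 2 * m) * (C * qbr q l)"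
      using A e(1,2)[of m] e(3) by (intro mult_nonneg_nonneg; simp)+
    show ?thesis unfolding 3 neg_ehat A_def[symmetric] C_def[symmetric] using r s by simp
  qed
  then show "rq ^ k \<le> 1 - ehat q t k l" "t \<ge> 1 \<Longrightarrow> rq ^ nat t \<le> - ehat q t k l"
    using k1 by (auto simp: A_def)
qed

lemma finite_ehat_bounded: "finite {j \<in> J n. - (case j of (t, k, l) \<Rightarrow> ehat q t k l) \<le> B}"
proof -
  obtain N where N: "rq ^ N > 1 + B" using real_arch_pow[OF q2(3)] by blast
  \<comment> \<open>The third index is determined by the first two, and t = n - k + l is bounded
    below because k is bounded.\<close>
  have "{j \<in> J n. - (case j of (t, k, l) \<Rightarrow> ehat q t k l) \<le> B}
     \<subseteq> (\<lambda>(t, k). (t, k, nat (t + int k - n))) ` ({n - int N..int N} \<times> {..N})"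
  proof
    fix j assume j: "j \<in> {j \<in> J n. - (case j of (t, k, l) \<Rightarrow> ehat q t k l) \<le> B}"
    obtain t k l where [simp]: "j = (t, k, l)" by (cases j)
    have e: "t + int k - int l = n" "- ehat q t k l \<le> B" using j by (auto simp: J_def)
    have "rq ^ k < rq ^ N" using ehat_growth(1)[of k t l] e(2) N by linarith
    then have k: "k < N" using q2(3) power_less_imp_less_exp by blast
    have t: "t \<le> int N"
    proof (rule ccontr)
      assume t: "\<not> t \<le> int N"
      then have "rq ^ nat t < rq ^ N" using ehat_growth(2)[of t k l] e(2) N by linarith
      then have "nat t < N" using q2(3) power_less_imp_less_exp by blast
      then show False using t by simp
    qed
    have "l = nat (t + int k - n)" "n - int N \<le> t" using e(1) k by linarith+
    then show "j \<in> (\<lambda>(t, k). (t, k, nat (t + int k - n))) ` ({n - int N..int N} \<times> {..N})"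
      using k t by (intro image_eqI[of _ _ "(t, k)"]) auto
  qed
  then show ?thesis by (rule finite_subset) simp
qed

subsection \<open>The eigenbasis\<close>

lemma J_vdg: "j \<in> J n \<longleftrightarrow> vdg j = n"
  by (cases j) (simp add: J_def vdg_def)

lemma lookup_vcomp: "Poly_Mapping.lookup (vcomp n v) j = (if vdg j = n then Poly_Mapping.lookup v j else 0)"
proof -
  have "Poly_Mapping.lookup (vcomp n v) j = fl (\<lambda>i. if i = j \<and> vdg i = n then 1 else 0) v"
    by (rule fl_eqI[of "\<lambda>v. Poly_Mapping.lookup (vcomp n v) j"])
      (auto simp: clin_add[OF clin_vcomp] clin_smul[OF clin_vcomp] lookup_add lookup_single when_def)
  also have "\<dots> = (if vdg j = n then Poly_Mapping.lookup v j else 0)"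
    by (rule fl_eqI[of "fl _" "\<lambda>v. if vdg j = n then Poly_Mapping.lookup v j else 0"]) (auto simp: lookup_add lookup_single when_def)
  finally show ?thesis .
qed

lemma Mor_iff_keys: "p \<in> Mor q n \<longleftrightarrow> Poly_Mapping.keys (nf p) \<subseteq> J n"
proof -
  have "p \<in> Mor q n \<longleftrightarrow> nf p = vcomp n (nf p)" by (simp add: Mor_iff E_iff_nf nf_comp)
  also have "\<dots> \<longleftrightarrow> Poly_Mapping.keys (nf p) \<subseteq> J n"
    unfolding poly_mapping_eq_iff fun_eq_iff lookup_vcomp subset_iff in_keys_iff J_vdg by auto
  finally show ?thesis .
qed

lemma M_Mf: "M t k l = Mf (t, k, l)"
  by (simp add: Mf_def)

lemma nf_M [simp]: "nf (M t k l) = pt (t, k, l)"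
  by (simp add: M_Mf)

text \<open>Solution of the recursion that the eigenvector equation imposes along the diagonal: the
  i-th coefficient times the spectral gap equals the previous coefficient times the off-diagonal
  entry.\<close>

definition acoef :: "int \<Rightarrow> nat \<Rightarrow> nat \<Rightarrow> nat \<Rightarrow> real" where
  "acoef t k l i = (\<Prod>j<i. chat q t (k - j) (l - j) / (ehat q t k l - ehat q t (k - j - 1) (l - j - 1)))"

definition ph :: "int \<times> nat \<times> nat \<Rightarrow> (int \<times> nat \<times> nat \<Rightarrow>\<^sub>0 complex)" where
  "ph = (\<lambda>(t, k, l). \<Sum>i\<le>min k l. smul (of_real (acoef t k l i)) (pt (t, k - i, l - i)))"

lemma sum_atMost_head: "(\<Sum>i\<le>m. f i) = f 0 + (\<Sum>i=1..m. f i)" for f :: "nat \<Rightarrow> 'z::comm_monoid_add"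
  by (induction m) (simp_all add: add.assoc)

lemma nf_phat: "nf (phat q t k l) = ph (t, k, l)"
  unfolding phat_def ph_def acoef_def case_prod_conv sum_atMost_head clin_add[OF clin_nf] clin_sum[OF clin_nf]
    clin_smul[OF clin_nf] nf_M by simp

lemma ehat_distinct: "j < min k l \<Longrightarrow> ehat q t k l \<noteq> ehat q t (k - j - 1) (l - j - 1)"
  using ehat_strict[of "k - j - 1" k "l - j - 1" l t] by auto

text \<open>A telescoping sum: the off-diagonal contribution of each term turns the next diagonal
  value into the leading one, by the recursion for the coefficients.\<close>

lemma LV_ph: "LV (ph (t, k, l)) = smul (of_real (ehat q t k l)) (ph (t, k, l))"
proof -
  define m where "m = min k l"
  define a e c p where "a i = complex_of_real (acoef t k l i)" and "e i = complex_of_real (ehat q t (k - i) (l - i))"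
    and "c i = complex_of_real (chat q t (k - i) (l - i))" and "p i = pt (t, k - i, l - i)" for i
  have ph: "ph (t, k, l) = (\<Sum>i\<le>m. smul (a i) (p i))"
    by (simp add: ph_def a_def p_def m_def)
  have L: "LV (p i) = smul (e i) (p i) + smul (c i) (p (Suc i))" if "i < m" for i
    using that unfolding p_def LV_pt e_def c_def m_def by (simp add: diff_diff_left)
  \<comment> \<open>At the end of the chain k or l has reached 0, so no off-diagonal term is left
    over.\<close>
  have Lm: "LV (p m) = smul (e m) (p m)"
    unfolding p_def LV_pt e_def m_def by (auto simp: min_def)
  have a: "a (Suc i) * (e 0 - e (Suc i)) = a i * c i" if "i < m" for i
  proof -
    have "ehat q t k l - ehat q t (k - i - 1) (l - i - 1) \<noteq> 0"
      using ehat_distinct[of i k l t] that by (simp add: m_def)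
    then have "acoef t k l (Suc i) * (ehat q t k l - ehat q t (k - i - 1) (l - i - 1)) = acoef t k l i * chat q t (k - i) (l - i)"
      by (simp add: acoef_def)
    then have "complex_of_real (acoef t k l (Suc i) * (ehat q t k l - ehat q t (k - i - 1) (l - i - 1))) =
      complex_of_real (acoef t k l i * chat q t (k - i) (l - i))" by (rule arg_cong)
    then show ?thesis by (simp add: a_def e_def c_def diff_diff_left)
  qed
  \<comment> \<open>The partial sum satisfies the eigenvalue equation up to one remainder term at
    the next symbol.\<close>
  have s: "(\<Sum>i\<le>M. smul (a i) (LV (p i))) = smul (e 0) (\<Sum>i\<le>M. smul (a i) (p i)) + smul (a M * c M) (p (Suc M))"
    if "M < m" for M
    using that
  proof (induction M)
    case 0
    then show ?case using L[of 0] by (simp add: smul_add mult.commute)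
  next
    case (Suc M)
    have "smul (a M * c M) (p (Suc M)) + smul (a (Suc M)) (LV (p (Suc M)))
      = smul (e 0 * a (Suc M)) (p (Suc M)) + smul (a (Suc M) * c (Suc M)) (p (Suc (Suc M)))"
      using L[of "Suc M"] a[of M, symmetric] Suc(2)
      by (simp add: smul_add algebra_simps flip: smul_add_left)
    then show ?case using Suc by (simp add: smul_add add.assoc)
  qed
  have "LV (ph (t, k, l)) = (\<Sum>i\<le>m. smul (a i) (LV (p i)))"
    unfolding ph by (simp add: clin_sum[OF clin_LV] clin_smul[OF clin_LV])
  also have "\<dots> = smul (e 0) (\<Sum>i\<le>m. smul (a i) (p i))"
  proof (cases m)
    case 0
    then show ?thesis using Lm by (simp add: mult.commute)
  next
    case (Suc M)
    have "smul (a M * c M) (p (Suc M)) + smul (a (Suc M)) (LV (p (Suc M))) = smul (e 0 * a (Suc M)) (p (Suc M))"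
      using Lm a[of M, symmetric] Suc by (simp add: algebra_simps flip: smul_add_left)
    then show ?thesis using s[of M] Suc by (simp add: smul_add add.assoc)
  qed
  finally show ?thesis by (simp add: ph e_def)
qed

text \<open>Unitriangularity with respect to the exponent k, which together with
  \<open>lookup_ph_self\<close> makes the eigenvectors a basis.\<close>

lemma keys_ph: "j' \<in> Poly_Mapping.keys (ph j) \<Longrightarrow> vdg j' = vdg j \<and> (j' = j \<or> fst (snd j') < fst (snd j))"
proof -
  obtain t k l where j: "j = (t, k, l)" by (cases j)
  assume "j' \<in> Poly_Mapping.keys (ph j)"
  then have "j' \<in> (\<Union>i\<in>{..min k l}. Poly_Mapping.keys (smul (of_real (acoef t k l i)) (pt (t, k - i, l - i))))"
    by (intro subsetD[OF keys_sum]) (simp only: ph_def j case_prod_conv)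
  then obtain i where i: "i \<le> min k l" "j' \<in> Poly_Mapping.keys (smul (of_real (acoef t k l i)) (pt (t, k - i, l - i)))"
    by auto
  then have "j' = (t, k - i, l - i)" using keys_smul_subset by fastforce
  then show ?thesis using i(1) by (cases "i = 0") (auto simp: vdg_def j)
qed

lemma lookup_ph_self: "Poly_Mapping.lookup (ph j) j = 1"
proof -
  obtain t k l where j: "j = (t, k, l)" by (cases j)
  have "Poly_Mapping.lookup (ph j) j = (\<Sum>i\<le>min k l. if i = 0 then 1 else 0)"
    unfolding ph_def j case_prod_conv lookup_sum
    by (rule sum.cong) (auto simp: lookup_single when_def acoef_def)
  then show ?thesis by simp
qed

lemma ph_J:
  assumes "j \<in> J n"
  shows "Poly_Mapping.keys (ph j) \<subseteq> J n"
proof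
  show "j' \<in> J n" if "j' \<in> Poly_Mapping.keys (ph j)" for j'
    using keys_ph[OF that] assms by (simp add: J_vdg)
qed

lemma phat_Mor: "(t, k, l) \<in> J n \<Longrightarrow> phat q t k l \<in> Mor q n"
  unfolding Mor_iff_keys nf_phat by (rule ph_J)

text \<open>Take a key of maximal exponent k. By triangularity no other eigenvector of the
  combination reaches this symbol.\<close>

lemma lin_ph_inj:
  assumes "lin ph c = 0"
  shows "c = 0"
proof (rule ccontr)
  assume "c \<noteq> 0"
  let ?F = "(\<lambda>j. fst (snd j)) ` Poly_Mapping.keys c"
  have F: "finite ?F" "?F \<noteq> {}" using \<open>c \<noteq> 0\<close> by simp_all
  from Max_in[OF F] obtain j where j: "j \<in> Poly_Mapping.keys c" "fst (snd j) = Max ?F" by auto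
  have jm: "fst (snd j') \<le> fst (snd j)" if "j' \<in> Poly_Mapping.keys c" for j'
    unfolding j(2) using F that by (intro Max_ge) auto
  have "Poly_Mapping.lookup (lin ph c) j = (\<Sum>j'\<in>Poly_Mapping.keys c. Poly_Mapping.lookup c j' * Poly_Mapping.lookup (ph j') j)"
    by (simp add: lin_def lookup_sum)
  also have "\<dots> = (\<Sum>j'\<in>Poly_Mapping.keys c. if j' = j then Poly_Mapping.lookup c j else 0)"
  proof (rule sum.cong[OF refl])
    fix j' assume j': "j' \<in> Poly_Mapping.keys c"
    have "Poly_Mapping.lookup (ph j') j = 0" if "j' \<noteq> j"
      using keys_ph[of j j'] jm[OF j'] that by (force simp: in_keys_iff)
    then show "Poly_Mapping.lookup c j' * Poly_Mapping.lookup (ph j') j = (if j' = j then Poly_Mapping.lookup c j else 0)"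
      by (simp add: lookup_ph_self)
  qed
  also have "\<dots> = Poly_Mapping.lookup c j" using j(1) by simp
  finally show False using assms j(1) by (simp add: in_keys_iff)
qed

lemma keys_csub: "csub {c. Poly_Mapping.keys c \<subseteq> I}"
  by (auto simp: csub_def dest!: subsetD[OF Poly_Mapping.keys_add] subsetD[OF keys_smul_subset])

text \<open>Induction on the exponent k: a symbol differs from its eigenvector by symbols of smaller
  k in the same degree.\<close>

lemma lin_ph_surj:
  assumes "Poly_Mapping.keys v \<subseteq> J n"
  shows "\<exists>c. Poly_Mapping.keys c \<subseteq> J n \<and> lin ph c = v"
proof -
  let ?R = "{v. \<exists>c. Poly_Mapping.keys c \<subseteq> J n \<and> lin ph c = v}"
  have R: "csub ?R"
  proof -
    have "x + y \<in> ?R" if xy: "x \<in> ?R" "y \<in> ?R" for x y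
    proof -
      obtain c d where "Poly_Mapping.keys c \<subseteq> J n" "lin ph c = x" "Poly_Mapping.keys d \<subseteq> J n" "lin ph d = y"
        using xy by blast
      then show ?thesis using csub_add[OF keys_csub[of "J n"], of c d] by (auto intro!: exI[of _ "c + d"] simp: lin_add)
    qed
    moreover have "smul a x \<in> ?R" if x: "x \<in> ?R" for a x
    proof -
      obtain c where "Poly_Mapping.keys c \<subseteq> J n" "lin ph c = x" using x by blast
      then show ?thesis using csub_smul[OF keys_csub[of "J n"], of c a] by (auto intro!: exI[of _ "smul a c"] simp: lin_smul)
    qed
    moreover have "0 \<in> ?R" by (auto intro!: exI[of _ 0])
    ultimately show ?thesis by (simp add: csub_def)
  qed
  have pt: "pt j \<in> ?R" if "j \<in> J n" for j
    using that
  proof (induction "fst (snd j)" arbitrary: j rule: less_induct)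
    case less
    have "ph j \<in> ?R" using less(2) by (auto intro!: exI[of _ "pt j"])
    moreover have "ph j - pt j \<in> ?R"
    proof -
      have "lin pt (ph j - pt j) \<in> ?R"
      proof (rule csub_lin[OF R])
        fix j' assume j': "j' \<in> Poly_Mapping.keys (ph j - pt j)"
        then have "j' \<noteq> j" by (auto simp: in_keys_iff lookup_minus lookup_ph_self)
        then have kp: "j' \<in> Poly_Mapping.keys (ph j)" using j' by (auto simp: in_keys_iff lookup_minus lookup_single when_def)
        have k: "fst (snd j') < fst (snd j)" "j' \<in> J n"
          using keys_ph[OF kp] \<open>j' \<noteq> j\<close> less(2) by (simp_all add: J_vdg)
        show "pt j' \<in> ?R" by (rule less(1)[OF k])
      qed
      then show ?thesis by (simp only: lin_id)
    qed
    ultimately have "ph j - (ph j - pt j) \<in> ?R" by (rule csub_diff[OF R])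
    then show ?case by simp
  qed
  have "lin pt v \<in> ?R" by (rule csub_lin[OF R]) (use assms pt in blast)
  then show ?thesis by (simp add: lin_id)
qed

lemma phat_basis: "basis_of q (Mor q n) (J n) (\<lambda>(t, k, l). phat q t k l)"
  unfolding basis_of_def
proof (intro conjI ballI)
  let ?b = "\<lambda>(t, k, l). phat q t k l"
  fix j assume "j \<in> J n"
  then show "?b j \<in> Mor q n" using phat_Mor by (cases j) auto
next
  let ?b = "\<lambda>(t, k, l). phat q t k l"
  fix p assume p: "p \<in> Mor q n"
  have e: "eqP q p (lin ?b c) \<longleftrightarrow> nf p = lin ph c" for c
  proof -
    have "(\<lambda>j. nf (?b j)) = ph" by (rule ext) (auto simp: nf_phat)
    then have "nf (lin ?b c) = lin ph c" using clin_lin_comm[OF clin_nf, of ?b c] by simp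
    then show ?thesis by (simp add: eqP_E E_iff_nf)
  qed
  obtain c where c: "Poly_Mapping.keys c \<subseteq> J n" "lin ph c = nf p"
    using lin_ph_surj p[unfolded Mor_iff_keys] by blast
  show "\<exists>!c. Poly_Mapping.keys c \<subseteq> J n \<and> eqP q p (lin ?b c)"
  proof (rule ex1I[of _ c])
    show "Poly_Mapping.keys c \<subseteq> J n \<and> eqP q p (lin ?b c)" using c by (simp add: e)
    show "d = c" if "Poly_Mapping.keys d \<subseteq> J n \<and> eqP q p (lin ?b d)" for d
    proof -
      have "lin ph (d - c) = 0" using that c(2) by (simp add: e lin_diff)
      then have "d - c = 0" by (rule lin_ph_inj)
      then show ?thesis by simp
    qed
  qed
qed

lemma nf_laplacian: "p \<in> Mor q n \<Longrightarrow> nf (laplacian q n p) = LV (nf p)"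
  using laplacian_Lap(2)[of p n] by (simp add: E_iff_nf nf_Lap)

lemma laplacian_M:
  assumes "(t, k, l) \<in> J n"
  shows "eqP q (laplacian q n (M t k l)) (smul (of_real (ehat q t k l)) (M t k l) +
            (if k = 0 \<or> l = 0 then 0 else smul (of_real (chat q t k l)) (M t (k - 1) (l - 1))))"
proof -
  have "M t k l \<in> Mor q n" using assms by (simp add: Mor_iff_keys)
  then show ?thesis by (auto simp: eqP_E E_iff_nf nf_laplacian LV_pt simp del: smul_single)
qed

lemma laplacian_phat:
  "(t, k, l) \<in> J n \<Longrightarrow> eqP q (laplacian q n (phat q t k l)) (smul (of_real (ehat q t k l)) (phat q t k l))"
  by (simp add: eqP_E E_iff_nf nf_laplacian[OF phat_Mor] nf_phat LV_ph)

lemma laplacian_linear: "linear_op q (Mor q n) (laplacian q n)"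
  using laplacian_Lap(1) csub_add[OF Mor_csub[of n]] csub_smul[OF Mor_csub[of n]]
  by (simp add: linear_op_def eqP_E E_iff_nf nf_laplacian clin_add[OF clin_LV] clin_smul[OF clin_LV])

text \<open>In the eigenbasis the operator is diagonal, so any nonzero coordinate of an eigenvector
  identifies its eigenvalue.\<close>

lemma eigenvalues_eq: "eigenvalues q (Mor q n) (laplacian q n) = (\<lambda>(t, k, l). of_real (ehat q t k l)) ` J n"
proof (intro equalityI subsetI)
  fix ev assume "ev \<in> eigenvalues q (Mor q n) (laplacian q n)"
  then obtain p where p: "p \<in> Mor q n" and p0: "nf p \<noteq> 0" and L: "LV (nf p) = smul ev (nf p)"
    by (auto simp: eigenvalues_def eqP_E E_iff_nf nf_laplacian)
  obtain c where c: "Poly_Mapping.keys c \<subseteq> J n" "lin ph c = nf p"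
    using lin_ph_surj p[unfolded Mor_iff_keys] by blast
  let ?e = "\<lambda>(t, k, l). complex_of_real (ehat q t k l)"
  let ?d = "lin (\<lambda>j. Poly_Mapping.single j (?e j)) c"
  have "LV (lin ph c) = lin (\<lambda>j. smul (?e j) (ph j)) c"
    unfolding clin_lin_comm[OF clin_LV] by (rule lin_cong) (auto simp: LV_ph)
  also have "\<dots> = lin ph ?d" unfolding clin_lin_comm[OF clin_lin] by (simp add: lin_single)
  finally have "lin ph (?d - smul ev c) = 0" using L c(2) by (simp add: lin_diff lin_smul)
  then have d: "?d = smul ev c" using lin_ph_inj by fastforce
  have "c \<noteq> 0" using c(2) p0 by auto
  then obtain j where j: "j \<in> Poly_Mapping.keys c" by (metis all_not_in_conv keys_eq_empty)
  have "Poly_Mapping.lookup ?d j = ?e j * Poly_Mapping.lookup c j"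
    by (rule fl_eqI[of "\<lambda>c. Poly_Mapping.lookup (lin (\<lambda>j. Poly_Mapping.single j (?e j)) c) j" "\<lambda>c. ?e j * Poly_Mapping.lookup c j"])
      (auto simp: lin_add lin_smul lookup_add lookup_single when_def distrib_left)
  then have "ev = ?e j" using d j by (simp add: in_keys_iff)
  then show "ev \<in> ?e ` J n" using c(1) j by blast
next
  fix ev assume "ev \<in> (\<lambda>(t, k, l). complex_of_real (ehat q t k l)) ` J n"
  then obtain t k l where j: "(t, k, l) \<in> J n" and ev: "ev = of_real (ehat q t k l)" by auto
  have "ph (t, k, l) \<noteq> 0" using lookup_ph_self[of "(t, k, l)"] by auto
  then have "\<not> eqP q (phat q t k l) 0" by (simp add: eqP_E E_iff_nf nf_phat)
  then show "ev \<in> eigenvalues q (Mor q n) (laplacian q n)"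
    unfolding eigenvalues_def ev using phat_Mor[OF j] laplacian_phat[OF j] by blast
qed

text \<open>Finitely many values would be bounded, and then \<open>finite_ehat_bounded\<close> would
  make the infinite index set finite. This bypasses possible coincidences between
  eigenvalues.\<close>

lemma eigenvalues_infinite: "infinite (eigenvalues q (Mor q n) (laplacian q n))"
proof
  let ?e = "\<lambda>(t, k, l). ehat q t k l"
  assume "finite (eigenvalues q (Mor q n) (laplacian q n))"
  moreover have "eigenvalues q (Mor q n) (laplacian q n) = complex_of_real ` ?e ` J n"
    unfolding eigenvalues_eq by (auto simp: image_image split_def)
  ultimately have "finite (?e ` J n)" by (simp add: finite_image_iff inj_on_def)
  then have "finite ((\<lambda>j. - ?e j) ` J n)"
    using finite_imageI[of "?e ` J n" uminus] by (simp add: image_image)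
  then obtain B where "\<And>j. j \<in> J n \<Longrightarrow> - ?e j \<le> B"
    by (metis (no_types, lifting) Max_ge imageI)
  then have "J n \<subseteq> {j \<in> J n. - ?e j \<le> B}" by blast
  then have fin: "finite (J n)" by (rule finite_subset[OF _ finite_ehat_bounded])
  have "(\<lambda>m. (n, m, m)) ` (UNIV :: nat set) \<subseteq> J n" by (auto simp: J_def)
  then have "finite ((\<lambda>m. (n, m, m)) ` (UNIV :: nat set))" by (rule finite_subset[OF _ fin])
  then have "finite (UNIV :: nat set)" by (rule finite_imageD) (simp add: inj_on_def)
  then show False by simp
qed

text \<open>Eigenvalues in a unit ball have bounded modulus, hence only finitely many indices can
  produce them and no point of the set is a limit point.\<close>

lemma eigenvalues_discrete: "discrete (eigenvalues q (Mor q n) (laplacian q n))"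
proof (rule discreteI)
  let ?S = "eigenvalues q (Mor q n) (laplacian q n)"
  fix x assume x: "x \<in> ?S"
  have "?S \<inter> ball x 1 \<subseteq> (\<lambda>(t, k, l). complex_of_real (ehat q t k l)) ` {j \<in> J n. - (case j of (t, k, l) \<Rightarrow> ehat q t k l) \<le> cmod x + 1}"
  proof
    fix y assume "y \<in> ?S \<inter> ball x 1"
    then obtain t k l where j: "(t, k, l) \<in> J n" "y = of_real (ehat q t k l)" and d: "dist x y < 1"
      unfolding eigenvalues_eq by auto
    have "cmod y \<le> cmod x + 1" using d norm_triangle_ineq2[of y x] by (simp add: dist_norm norm_minus_commute)
    then have "- ehat q t k l \<le> cmod x + 1" unfolding j(2) by (simp add: norm_of_real)
    then show "y \<in> (\<lambda>(t, k, l). complex_of_real (ehat q t k l)) ` {j \<in> J n. - (case j of (t, k, l) \<Rightarrow> ehat q t k l) \<le> cmod x + 1}"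
      using j by (intro image_eqI[of _ _ "(t, k, l)"]) auto
  qed
  then have "finite (?S \<inter> ball x 1)" by (rule finite_subset) (intro finite_imageI finite_ehat_bounded)
  then have "\<not> x islimpt ?S" unfolding islimpt_eq_infinite_ball by (metis Int_commute zero_less_one)
  then show "x isolated_in ?S" using x by (simp add: isolated_in_islimpt_iff)
qed

end

theorem mainTheorem4:
  fixes q :: real and n :: int
  assumes "-1 < q" and "q < 1" and "q \<noteq> 0" and "n \<noteq> 0"
  shows "linear_op q (Mor q n) (laplacian q n)
    \<and> (\<forall>(t, k, l)\<in>J n. eqP q (laplacian q n (M t k l))
           (smul (of_real (ehat q t k l)) (M t k l) +
            (if k = 0 \<or> l = 0 then 0 else smul (of_real (chat q t k l)) (M t (k - 1) (l - 1)))))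
    \<and> (\<forall>(t, k, l)\<in>J n. \<forall>j<min k l. ehat q t k l \<noteq> ehat q t (k - j - 1) (l - j - 1))
    \<and> (\<forall>(t, k, l)\<in>J n. eqP q (laplacian q n (phat q t k l))
           (smul (of_real (ehat q t k l)) (phat q t k l)))
    \<and> basis_of q (Mor q n) (J n) (\<lambda>(t, k, l). phat q t k l)
    \<and> infinite (eigenvalues q (Mor q n) (laplacian q n))
    \<and> discrete (eigenvalues q (Mor q n) (laplacian q n))"
proof -
  interpret suq q by unfold_locales (use assms in auto)
  show ?thesis
  proof (intro conjI)
    show "linear_op q (Mor q n) (laplacian q n)" by (rule laplacian_linear)
    show "\<forall>(t, k, l)\<in>J n. eqP q (laplacian q n (M t k l))
           (smul (of_real (ehat q t k l)) (M t k l) +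
            (if k = 0 \<or> l = 0 then 0 else smul (of_real (chat q t k l)) (M t (k - 1) (l - 1))))"
      using laplacian_M by blast
    show "\<forall>(t, k, l)\<in>J n. \<forall>j<min k l. ehat q t k l \<noteq> ehat q t (k - j - 1) (l - j - 1)"
      using ehat_distinct by blast
    show "\<forall>(t, k, l)\<in>J n. eqP q (laplacian q n (phat q t k l)) (smul (of_real (ehat q t k l)) (phat q t k l))"
      using laplacian_phat by blast
    show "basis_of q (Mor q n) (J n) (\<lambda>(t, k, l). phat q t k l)" by (rule phat_basis)
    show "infinite (eigenvalues q (Mor q n) (laplacian q n))" by (rule eigenvalues_infinite)
    show "discrete (eigenvalues q (Mor q n) (laplacian q n))" by (rule eigenvalues_discrete)
  qed
qed

end
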